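(* Let $\alpha\ge1$. The mapping $\tilde\iota:(G^\alpha_\alpha(\mathbb{R}^d_+))'\to(\mathfrak{s}^\alpha)'$, $\tilde\iota(T)=\{\langle T,\mathcal{L}_n\rangle\}_{n\in\mathbb{N}_0^d}$, is a topological isomorphism. Moreover, for each $T\in(G^\alpha_\alpha(\mathbb{R}^d_+))'$, $\sum_{n\in\mathbb{N}_0^d}\langle T,\mathcal{L}_n\rangle\mathcal{L}_n$ is summable to $T$ in $(G^\alpha_\alpha(\mathbb{R}^d_+))'$.
   Context: $\mathbb{R}^d_+=(0,\infty)^d$, $\mathbb{N}_0=\{0,1,2,\dots\}$. Multi-index notation: $|n|=n_1+\dots+n_d$, $x^t=\prod_lx_l^{t_l}$, $p^{\beta p}=\prod_lp_l^{\beta p_l}$, with $0^0=1$. $\|\cdot\|_2$ is the norm of $L^2(\mathbb{R}^d_+)$. Laguerre functions: $L_j(t)=\frac{e^t}{j!}\frac{d^j}{dt^j}(e^{-t}t^j)$ and $\mathcal{L}_n(t)=\prod_{l=1}^dL_{n_l}(t_l)e^{-t_l/2}$ for $n\in\mathbb{N}_0^d$. They belong to $G^\alpha_\alpha(\mathbb{R}^d_+)$ for $\alpha\geq 1$, and are also regarded as elements of the dual via $\langle\mathcal{L}_n,f\rangle=\int_{\mathbb{R}^d_+}\mathcal{L}_nf\,dt$. $\mathcal{S}(\mathbb{R}^d_+)$ is the Fréchet space of all $f\in C^\infty(\mathbb{R}^d_+)$ all of whose derivatives extend continuously to $[0,\infty)^d$ and with $\sup_{x\in\mathbb{R}^d_+}x^k|D^pf(x)|<\infty$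 for all $k,p\in\mathbb{N}_0^d$. For $A>0$, $G^{\alpha,A}_{\alpha,A}(\mathbb{R}^d_+)$ is the Fréchet space of all $f\in\mathcal{S}(\mathbb{R}^d_+)$ with $\sup_{p,k}\frac{\|t^{(p+k)/2}D^pf\|_2}{A^{|p+k|}k^{(\alpha/2)k}p^{(\alpha/2)p}}<\infty$, with seminorms $\sigma_{A,j}(f)=\sup_{p,k}\frac{\|t^{(p+k)/2}D^pf\|_2}{A^{|p+k|}k^{(\alpha/2)k}p^{(\alpha/2)p}}+\sup_{|p|\le j,|k|\le j}\sup_{t\in\mathbb{R}^d_+}|t^kD^pf(t)|$, $j\in\mathbb{N}_0$; $G^\alpha_\alpha(\mathbb{R}^d_+)=\varinjlim_{A\to\infty}G^{\alpha,A}_{\alpha,A}(\mathbb{R}^d_+)$ (locally convex inductive limit), and $(G^\alpha_\alpha(\mathbb{R}^d_+))'$ is its strong dual. For $a>1$, $\mathfrak{s}^{\alpha,a}$ is the Banach space of complex sequences $\{a_n\}_{n\in\mathbb{N}_0^d}$ with norm $\sup_n|a_n|a^{|n|^{1/\alpha}}<\infty$, and $\mathfrak{s}^\alpha=\varinjlim_{a\to1^+}\mathfrak{s}^{\alpha,a}$. Its strong dual $(\mathfrak{s}^\alpha)'$ is identified, via $\langle\{b_n\},\{a_n\}\rangle=\sum_na_nb_n$, with the Fréchet space of all complex sequences $\{b_n\}_{n\in\mathbb{N}_0^d}$ with $\sum_n|b_n|a^{-|n|^{1/\alpha}}<\infty$ for every $a>1$, topologized by these seminorms. A family is summable to $T$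 if the net of its finite partial sums, indexed by finite subsets of $\mathbb{N}_0^d$ ordered by inclusion, converges to $T$. *)

theory Defs
  imports "HOL-Analysis.Analysis"
begin

section \<open>Locally convex spaces of complex-valued functions\<close>

text \<open>
  All spaces below (test functions, sequences, functionals) are linear subspaces of
  \<open>'i \<Rightarrow> complex\<close> for a suitable index type, with the pointwise operations. A locally
  convex space is given by its topology \<open>X\<close>; the underlying vector space is
  \<open>topspace X\<close>.
\<close>

definition seminorm_on :: "('i \<Rightarrow> complex) set \<Rightarrow> (('i \<Rightarrow> complex) \<Rightarrow> real) \<Rightarrow> bool" where
  "seminorm_on V p \<longleftrightarrow>
     (\<forall>f\<in>V. 0 \<le> p f) \<and>
     (\<forall>f\<in>V. \<forall>g\<in>V. p (\<lambda>x. f x + g x) \<le> p f + p g) \<and>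
     (\<forall>c. \<forall>f\<in>V. p (\<lambda>x. c * f x) = cmod c * p f)"

definition seminorm_topology ::
    "('i \<Rightarrow> complex) set \<Rightarrow> (('i \<Rightarrow> complex) \<Rightarrow> real) set \<Rightarrow> ('i \<Rightarrow> complex) topology" where
  "seminorm_topology V P =
     topology_generated_by {{g\<in>V. p (\<lambda>x. g x - f x) < r} | f p r. f \<in> V \<and> p \<in> P \<and> 0 < r}"

lemma topspace_seminorm_topology:
  assumes "P \<noteq> {}"
  shows "topspace (seminorm_topology V P) = V"
proof -
  obtain p where p: "p \<in> P" using assms by blast
  have "f \<in> \<Union> {{g\<in>V. p (\<lambda>x. g x - f x) < r} | f p r. f \<in> V \<and> p \<in> P \<and> 0 < r}" if "f \<in> V" for f
  proof -
    let ?r = "max 0 (p (\<lambda>x. f x - f x)) + 1"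
    have "f \<in> {g\<in>V. p (\<lambda>x. g x - f x) < ?r}" using that by auto
    moreover have "0 < ?r" by auto
    ultimately show ?thesis using p that by blast
  qed
  then show ?thesis
    unfolding seminorm_topology_def topology_generated_by_topspace by blast
qed

text \<open>
  Locally convex inductive limit of an increasing family of locally convex spaces: the
  finest locally convex topology on the union for which all inclusions are continuous.
  Its continuous seminorms are the seminorms whose restriction to each step is continuous.
\<close>

definition lc_inductive_limit ::
    "'a set \<Rightarrow> ('a \<Rightarrow> ('i \<Rightarrow> complex) topology) \<Rightarrow> ('i \<Rightarrow> complex) topology" where
  "lc_inductive_limit I X =
     (let V = (\<Union>a\<in>I. topspace (X a))
      in seminorm_topology V {p. seminorm_on V p \<and> (\<forall>a\<in>I. continuous_map (X a) euclideanreal p)})"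

definition bounded_in :: "('i \<Rightarrow> complex) topology \<Rightarrow> ('i \<Rightarrow> complex) set \<Rightarrow> bool" where
  "bounded_in X B \<longleftrightarrow> B \<subseteq> topspace X \<and>
     (\<forall>U. openin X U \<and> (\<lambda>_. 0) \<in> U \<longrightarrow>
        (\<exists>r>0. \<forall>c. r \<le> cmod c \<longrightarrow> B \<subseteq> (\<lambda>f x. c * f x) ` U))"

text \<open>
  Functionals are extended by 0 outside of the space on which they live, so that equality of
  functionals is equality of HOL functions.
\<close>

definition dual_space :: "('i \<Rightarrow> complex) topology \<Rightarrow> (('i \<Rightarrow> complex) \<Rightarrow> complex) set" where
  "dual_space X = {T.
     (\<forall>f\<in>topspace X. \<forall>g\<in>topspace X. T (\<lambda>x. f x + g x) = T f + T g) \<and>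
     (\<forall>c. \<forall>f\<in>topspace X. T (\<lambda>x. c * f x) = c * T f) \<and>
     continuous_map X euclidean T \<and>
     (\<forall>f. f \<notin> topspace X \<longrightarrow> T f = 0)}"

definition strong_dual ::
    "('i \<Rightarrow> complex) topology \<Rightarrow> (('i \<Rightarrow> complex) \<Rightarrow> complex) topology" where
  "strong_dual X =
     seminorm_topology (dual_space X)
       {(\<lambda>T. SUP f\<in>B. cmod (T f)) | B. bounded_in X B \<and> B \<noteq> {}}"

definition topological_isomorphism ::
    "('i \<Rightarrow> complex) topology \<Rightarrow> ('j \<Rightarrow> complex) topology \<Rightarrow>
     (('i \<Rightarrow> complex) \<Rightarrow> ('j \<Rightarrow> complex)) \<Rightarrow> bool" where
  "topological_isomorphism X Y h \<longleftrightarrow>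
     (\<forall>f\<in>topspace X. \<forall>g\<in>topspace X. h (\<lambda>x. f x + g x) = (\<lambda>y. h f y + h g y)) \<and>
     (\<forall>c. \<forall>f\<in>topspace X. h (\<lambda>x. c * f x) = (\<lambda>y. c * h f y)) \<and>
     homeomorphic_map X Y h"


section \<open>Multi-indices and partial derivatives\<close>

definition orthant :: "(real ^ 'd::finite) set" where
  "orthant = {x. \<forall>l. 0 < x $ l}"

definition closed_orthant :: "(real ^ 'd::finite) set" where
  "closed_orthant = {x. \<forall>l. 0 \<le> x $ l}"

definition mi_abs :: "nat ^ 'd::finite \<Rightarrow> nat" where
  "mi_abs n = (\<Sum>l\<in>UNIV. n $ l)"

definition mi_pow :: "real ^ 'd::finite \<Rightarrow> nat ^ 'd \<Rightarrow> real" where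
  "mi_pow x k = (\<Prod>l\<in>UNIV. (x $ l) ^ (k $ l))"

definition mi_powr :: "real ^ 'd::finite \<Rightarrow> real ^ 'd \<Rightarrow> real" where
  "mi_powr x t = (\<Prod>l\<in>UNIV. (x $ l) powr (t $ l))"

text \<open>
  \<open>p\<close> to the power \<open>\<beta> p\<close>. In HOL \<open>0 powr 0 = 0\<close>, so the convention that 0 to the power 0
  is 1 has to be made explicit.
\<close>

definition mi_self_powr :: "real \<Rightarrow> nat ^ 'd::finite \<Rightarrow> real" where
  "mi_self_powr \<beta> p =
     (\<Prod>l\<in>UNIV. if p $ l = 0 then 1 else real (p $ l) powr (\<beta> * real (p $ l)))"

definition has_partial_at :: "(real ^ 'd::finite \<Rightarrow> complex) \<Rightarrow> 'd \<Rightarrow> real ^ 'd \<Rightarrow> bool" where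
  "has_partial_at f l x \<longleftrightarrow> (\<lambda>s. f (x + s *\<^sub>R axis l 1)) differentiable (at 0)"

definition partial :: "'d::finite \<Rightarrow> (real ^ 'd \<Rightarrow> complex) \<Rightarrow> real ^ 'd \<Rightarrow> complex" where
  "partial l f x = vector_derivative (\<lambda>s. f (x + s *\<^sub>R axis l 1)) (at 0)"

definition partials :: "'d::finite list \<Rightarrow> (real ^ 'd \<Rightarrow> complex) \<Rightarrow> real ^ 'd \<Rightarrow> complex" where
  "partials ls f = foldr partial ls f"

definition smooth_on :: "(real ^ 'd::finite) set \<Rightarrow> (real ^ 'd \<Rightarrow> complex) \<Rightarrow> bool" where
  "smooth_on S f \<longleftrightarrow>
     (\<forall>ls. continuous_on S (partials ls f) \<and> (\<forall>l. \<forall>x\<in>S. has_partial_at (partials ls f) l x))"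

text \<open>
  The index type carries no order, so some order of differentiation is chosen. For smooth
  functions the result does not depend on it.
\<close>

definition mi_deriv :: "nat ^ 'd::finite \<Rightarrow> (real ^ 'd \<Rightarrow> complex) \<Rightarrow> real ^ 'd \<Rightarrow> complex" where
  "mi_deriv p f = partials (SOME ls. \<forall>l. count_list ls l = p $ l) f"


section \<open>Test function spaces on the orthant\<close>

text \<open>Functions on the orthant are represented by their extension by 0 to the whole space.\<close>

definition schwartz_orthant :: "(real ^ 'd::finite \<Rightarrow> complex) set" where
  "schwartz_orthant = {f.
     (\<forall>x. x \<notin> orthant \<longrightarrow> f x = 0) \<and>
     smooth_on orthant f \<and>
     (\<forall>p. \<exists>g. continuous_on closed_orthant g \<and> (\<forall>x\<in>orthant. g x = mi_deriv p f x)) \<and>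
     (\<forall>k p. bdd_above ((\<lambda>x. mi_pow x k * cmod (mi_deriv p f x)) ` orthant))}"

text \<open>
  Only applied to functions that are square integrable on the orthant. (All
  weighted derivatives of a function in \<^const>\<open>schwartz_orthant\<close> are.)
\<close>

definition L2_norm_orthant :: "(real ^ 'd::finite \<Rightarrow> complex) \<Rightarrow> real" where
  "L2_norm_orthant g = sqrt (LINT t:orthant|lborel. (cmod (g t))\<^sup>2)"

definition G_quotient ::
    "real \<Rightarrow> real \<Rightarrow> (real ^ 'd::finite \<Rightarrow> complex) \<Rightarrow> nat ^ 'd \<Rightarrow> nat ^ 'd \<Rightarrow> real" where
  "G_quotient \<alpha> A f p k =
     L2_norm_orthant
       (\<lambda>t. complex_of_real (mi_powr t (\<chi> l. real ((p + k) $ l) / 2)) * mi_deriv p f t) /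
     (A ^ mi_abs (p + k) * mi_self_powr (\<alpha> / 2) k * mi_self_powr (\<alpha> / 2) p)"

definition G_step_space :: "real \<Rightarrow> real \<Rightarrow> (real ^ 'd::finite \<Rightarrow> complex) set" where
  "G_step_space \<alpha> A =
     {f \<in> schwartz_orthant. bdd_above (range (\<lambda>(p, k). G_quotient \<alpha> A f p k))}"

definition G_seminorm ::
    "real \<Rightarrow> real \<Rightarrow> nat \<Rightarrow> (real ^ 'd::finite \<Rightarrow> complex) \<Rightarrow> real" where
  "G_seminorm \<alpha> A j f =
     (SUP (p, k). G_quotient \<alpha> A f p k) +
     (SUP (p, k)\<in>{(p, k). mi_abs p \<le> j \<and> mi_abs k \<le> j}.
        SUP t\<in>orthant. cmod (complex_of_real (mi_pow t k) * mi_deriv p f t))"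

definition G_step :: "real \<Rightarrow> real \<Rightarrow> (real ^ 'd::finite \<Rightarrow> complex) topology" where
  "G_step \<alpha> A = seminorm_topology (G_step_space \<alpha> A) (range (G_seminorm \<alpha> A))"

definition G_space :: "real \<Rightarrow> (real ^ 'd::finite \<Rightarrow> complex) topology" where
  "G_space \<alpha> = lc_inductive_limit {0<..} (G_step \<alpha>)"


section \<open>Laguerre functions\<close>

definition laguerre_poly :: "nat \<Rightarrow> real \<Rightarrow> real" where
  "laguerre_poly j t = exp t / fact j * (deriv ^^ j) (\<lambda>s. exp (- s) * s ^ j) t"

definition laguerre_fun :: "nat ^ 'd::finite \<Rightarrow> real ^ 'd \<Rightarrow> complex" where
  "laguerre_fun n t =
     (if t \<in> orthant
      then complex_of_real (\<Prod>l\<in>UNIV. laguerre_poly (n $ l) (t $ l) * exp (- (t $ l) / 2))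
      else 0)"

definition laguerre_functional ::
    "real \<Rightarrow> nat ^ 'd::finite \<Rightarrow> (real ^ 'd \<Rightarrow> complex) \<Rightarrow> complex" where
  "laguerre_functional \<alpha> n f =
     (if f \<in> topspace (G_space \<alpha>) then (LINT t:orthant|lborel. laguerre_fun n t * f t) else 0)"

definition laguerre_coeffs ::
    "((real ^ 'd::finite \<Rightarrow> complex) \<Rightarrow> complex) \<Rightarrow> nat ^ 'd \<Rightarrow> complex" where
  "laguerre_coeffs T n = T (laguerre_fun n)"


section \<open>Sequence spaces\<close>

definition s_weight :: "real \<Rightarrow> real \<Rightarrow> nat ^ 'd::finite \<Rightarrow> real" where
  "s_weight \<alpha> a n = a powr (real (mi_abs n) powr (1 / \<alpha>))"

definition s_step :: "real \<Rightarrow> real \<Rightarrow> (nat ^ 'd::finite \<Rightarrow> complex) topology" where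
  "s_step \<alpha> a =
     seminorm_topology
       {u. bdd_above (range (\<lambda>n. cmod (u n) * s_weight \<alpha> a n))}
       {(\<lambda>u. SUP n. cmod (u n) * s_weight \<alpha> a n)}"

definition s_space :: "real \<Rightarrow> (nat ^ 'd::finite \<Rightarrow> complex) topology" where
  "s_space \<alpha> = lc_inductive_limit {1<..} (s_step \<alpha>)"

text \<open>The strong dual of \<^const>\<open>s_space\<close>, realised as a Frechet space of sequences.\<close>

definition s_dual :: "real \<Rightarrow> (nat ^ 'd::finite \<Rightarrow> complex) topology" where
  "s_dual \<alpha> =
     seminorm_topology
       {b. \<forall>a>1. (\<lambda>n. cmod (b n) / s_weight \<alpha> a n) summable_on UNIV}
       {(\<lambda>b. \<Sum>\<^sub>\<infinity>n. cmod (b n) / s_weight \<alpha> a n) | a. 1 < a}"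

text \<open>The identification of sequences with functionals on \<^const>\<open>s_space\<close>.\<close>

definition s_pairing ::
    "real \<Rightarrow> (nat ^ 'd::finite \<Rightarrow> complex) \<Rightarrow> (nat ^ 'd \<Rightarrow> complex) \<Rightarrow> complex" where
  "s_pairing \<alpha> b u = (if u \<in> topspace (s_space \<alpha>) then (\<Sum>\<^sub>\<infinity>n. u n * b n) else 0)"

end

theory Submission
  imports Defs "HOL-Probability.Distributions"
begin

text \<open>
  Everything reduces to test functions: taking Laguerre coefficients is an isomorphism of
  \<open>G_space\<close> onto \<open>s_space\<close> with the summation of Laguerre series as inverse, and transposing it
  gives the isomorphism of the strong duals. The seminorms of an inductive limit only have to be
  estimated on each step.

  For the decay of the coefficients of \<open>f\<close>, integrate by parts \<open>m\<close> times in a coordinate \<open>l\<close> with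
  \<open>n\<^sub>l = max n =: N\<close>. The functions \<open>t^i e^{-t/2} L^{(i)}_j\<close> with associated Laguerre polynomials are
  turned into one another, and the weight \<open>t^m\<close> is shared between \<open>f\<close> and the Laguerre function, so
  that the Cauchy-Schwarz inequality gives
  \<open>\<bar>\<langle>f, L_n\<rangle>\<bar> \<le> ((N - m)! / N!)^{1/2} \<parallel>t_l^{m/2} (\<partial>_l + 1/2)^m f\<parallel>\<close>. Optimising over \<open>m\<close> yields the
  factor \<open>exp (- c N^{1/\<alpha>})\<close>. Conversely, the weighted \<open>L\<^sup>2\<close> norms of derivatives of Laguerre functions
  grow polynomially in \<open>n\<close> with explicit exponents, and summation against \<open>a^{- \<bar>n\<bar>^{1/\<alpha>}}\<close> produces
  the factorial powers in the definition of \<open>G_step\<close>.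

  A test function all of whose coefficients vanish is zero: by the generating function of the
  Laguerre polynomials it is orthogonal to all products of exponentials \<open>e^{- k t_l}\<close>, \<open>k \<ge> 1\<close>,
  and these are polynomials in \<open>e^{- t_l}\<close>, to which the Stone-Weierstrass theorem applies.

  Finally, truncations of a sequence in \<open>s_dual\<close> converge to it, and the inverse isomorphism maps
  them to the partial sums of the Laguerre series of a functional.
\<close>

section \<open>Seminorm topologies and strong duals\<close>

text \<open>The obstacle is that strong duals are topologised by bounded sets, which are not visible
  from the definition of an inductive limit. They are determined for \<open>s_space\<close>, where
  each of them lies in one step and is bounded there; the strong dual of \<open>G_space\<close>
  inherits the result through the linear homeomorphism.

  The isomorphism exists only in the limit: a step of one side goes into some step of the other,
  with constants that deteriorate. Passing between \<open>mi_abs n\<close> and single indices costs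
  factors depending on the dimension.

  The weights of \<open>G_step\<close> suit Laguerre functions because \<open>p\<close> derivatives
  of \<open>exp (- t / 2) * L_j\<close> are combinations of functions with parameter
  \<open>p\<close>, orthogonal for the weight \<open>t ^ p\<close>; the further \<open>k\<close>
  powers of \<open>t\<close> are reached by raising the parameter. In the other direction, the shift
  1/2 appears since \<open>exp (- t / 2)\<close> is the square root of the weight
  \<open>exp (- t)\<close> in Rodrigues' formula. The expansion of
  \<open>(\<partial> + 1/2)^m\<close> keeps the weight \<open>t^(m/2)\<close> while the order of the
  derivative varies, which is the mixture \<open>p + k = m\<close> that \<open>G_step\<close>
  controls.\<close>

definition function_subspace :: "('i \<Rightarrow> complex) set \<Rightarrow> bool" where
  "function_subspace V \<longleftrightarrow> (\<lambda>_. 0) \<in> V \<and>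
     (\<forall>f\<in>V. \<forall>g\<in>V. (\<lambda>x. f x + g x) \<in> V) \<and> (\<forall>c. \<forall>f\<in>V. (\<lambda>x. c * f x) \<in> V)"

lemma function_subspaceD:
  assumes "function_subspace V"
  shows "(\<lambda>_. 0) \<in> V" "f \<in> V \<Longrightarrow> g \<in> V \<Longrightarrow> (\<lambda>x. f x + g x) \<in> V" "f \<in> V \<Longrightarrow> (\<lambda>x. c * f x) \<in> V"
  using assms unfolding function_subspace_def by blast+

lemma function_subspace_diff:
  assumes "function_subspace V" "f \<in> V" "g \<in> V"
  shows "(\<lambda>x. f x - g x) \<in> V"
  using function_subspaceD(2)[OF assms(1,2) function_subspaceD(3)[OF assms(1,3), of "-1"]] by simp

lemma function_subspace_sum:
  assumes "function_subspace V" "\<And>i. i \<in> I \<Longrightarrow> f i \<in> V"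
  shows "(\<lambda>x. \<Sum>i\<in>I. f i x) \<in> V"
  using assms(2)
proof (induction I rule: infinite_finite_induct)
  case (insert i I)
  then show ?case using function_subspaceD(2)[OF assms(1), of "f i" "\<lambda>x. \<Sum>i\<in>I. f i x"] by simp
qed (use function_subspaceD(1)[OF assms(1)] in auto)

lemma seminorm_onD:
  assumes "seminorm_on V p"
  shows "f \<in> V \<Longrightarrow> 0 \<le> p f"
    "f \<in> V \<Longrightarrow> g \<in> V \<Longrightarrow> p (\<lambda>x. f x + g x) \<le> p f + p g"
    "f \<in> V \<Longrightarrow> p (\<lambda>x. c * f x) = cmod c * p f"
  using assms unfolding seminorm_on_def by blast+

lemma seminorm_on_zero:
  assumes "function_subspace V" "seminorm_on V p"
  shows "p (\<lambda>_. 0) = 0"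
  using seminorm_onD(3)[OF assms(2) function_subspaceD(1)[OF assms(1)], of 0] by simp

lemma seminorm_on_diff_commute:
  assumes "function_subspace V" "seminorm_on V p" "f \<in> V" "g \<in> V"
  shows "p (\<lambda>x. f x - g x) = p (\<lambda>x. g x - f x)"
  using seminorm_onD(3)[OF assms(2) function_subspace_diff[OF assms(1,3,4)], of "-1"] by simp

lemma seminorm_on_diff_triangle:
  assumes "function_subspace V" "seminorm_on V p" "f \<in> V" "g \<in> V" "h \<in> V"
  shows "p (\<lambda>x. f x - h x) \<le> p (\<lambda>x. f x - g x) + p (\<lambda>x. g x - h x)"
  using seminorm_onD(2)[OF assms(2) function_subspace_diff[OF assms(1,3,4)]
      function_subspace_diff[OF assms(1,4,5)]] by simp

lemma seminorm_on_abs_diff: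
  assumes "function_subspace V" "seminorm_on V p" "f \<in> V" "g \<in> V"
  shows "\<bar>p f - p g\<bar> \<le> p (\<lambda>x. f x - g x)"
  using seminorm_on_diff_triangle[OF assms, of "\<lambda>_. 0"] seminorm_on_diff_triangle[OF assms(1,2,4,3), of "\<lambda>_. 0"]
    function_subspaceD(1)[OF assms(1)] seminorm_on_diff_commute[OF assms] by auto

section \<open>Topologies generated by families of seminorms\<close>

definition seminorm_family :: "('i \<Rightarrow> complex) set \<Rightarrow> (('i \<Rightarrow> complex) \<Rightarrow> real) set \<Rightarrow> bool" where
  "seminorm_family V P \<longleftrightarrow> function_subspace V \<and> P \<noteq> {} \<and> (\<forall>p\<in>P. seminorm_on V p)"

lemma seminorm_familyD:
  assumes "seminorm_family V P"
  shows "function_subspace V" "p \<in> P \<Longrightarrow> seminorm_on V p" "P \<noteq> {}"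
    "topspace (seminorm_topology V P) = V"
  using assms topspace_seminorm_topology[of P V] unfolding seminorm_family_def by auto

lemma openin_sublevel:
  assumes "continuous_map X euclideanreal q"
  shows "openin X {f \<in> topspace X. q f < r}"
proof -
  have "openin X {f \<in> topspace X. q f \<in> {..<r}}"
    using assms unfolding continuous_map_def by (metis open_lessThan open_openin)
  then show ?thesis by simp
qed

text \<open>The subbasis contains balls around all centres, so an induction over the generated
  topology works: intersections unite the finite families and take the smaller radius, and by the
  triangle inequality a ball around \<open>f0\<close> contains a ball around each of its
  points.\<close>

lemma openin_seminorm_topology_iff:
  assumes P: "seminorm_family V P"
  shows "openin (seminorm_topology V P) U \<longleftrightarrow> U \<subseteq> V \<and>
    (\<forall>f\<in>U. \<exists>F e. finite F \<and> F \<subseteq> P \<and> 0 < e \<and> (\<forall>g\<in>V. (\<forall>p\<in>F. p (\<lambda>x. g x - f x) < e) \<longrightarrow> g \<in> U))"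
    (is "_ \<longleftrightarrow> _ \<and> (\<forall>f\<in>U. ?N f U)")
proof (intro iffI conjI)
  assume "openin (seminorm_topology V P) U"
  then show "U \<subseteq> V" using openin_subset seminorm_familyD(4)[OF P] by metis
next
  assume "openin (seminorm_topology V P) U"
  then have "generate_topology_on {{g\<in>V. p (\<lambda>x. g x - f x) < r} | f p r. f \<in> V \<and> p \<in> P \<and> 0 < r} U"
    unfolding seminorm_topology_def by (rule openin_topology_generated_by)
  then show "\<forall>f\<in>U. ?N f U"
  proof induction
    case Empty
    then show ?case by simp
  next
    case (Int A B)
    show ?case
    proof
      fix f assume f: "f \<in> A \<inter> B"
      obtain F1 e1 where
        1: "finite F1" "F1 \<subseteq> P" "0 < e1" "\<forall>g\<in>V. (\<forall>p\<in>F1. p (\<lambda>x. g x - f x) < e1) \<longrightarrow> g \<in> A"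
        using bspec[OF Int.IH(1) IntD1[OF f]] by (elim exE conjE)
      obtain F2 e2 where
        2: "finite F2" "F2 \<subseteq> P" "0 < e2" "\<forall>g\<in>V. (\<forall>p\<in>F2. p (\<lambda>x. g x - f x) < e2) \<longrightarrow> g \<in> B"
        using bspec[OF Int.IH(2) IntD2[OF f]] by (elim exE conjE)
      show "?N f (A \<inter> B)"
        using 1 2 by (intro exI[of _ "F1 \<union> F2"] exI[of _ "min e1 e2"]) auto
    qed
  next
    case (UN K)
    show ?case
    proof
      fix f assume "f \<in> \<Union>K"
      then obtain k where k: "k \<in> K" "f \<in> k" by blast
      obtain F e where "finite F" "F \<subseteq> P" "0 < e" "\<forall>g\<in>V. (\<forall>p\<in>F. p (\<lambda>x. g x - f x) < e) \<longrightarrow> g \<in> k"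
        using bspec[OF UN.IH[OF k(1)] k(2)] by (elim exE conjE)
      then show "?N f (\<Union>K)" using k(1) by (intro exI[of _ F] exI[of _ e]) auto
    qed
  next
    case (Basis S)
    then obtain f0 p r where S: "S = {g\<in>V. p (\<lambda>x. g x - f0 x) < r}" and *: "f0 \<in> V" "p \<in> P" "0 < r" by blast
    show ?case
    proof
      fix f assume f: "f \<in> S"
      show "?N f S"
      proof (intro exI[of _ "{p}"] exI[of _ "r - p (\<lambda>x. f x - f0 x)"] conjI ballI impI)
        fix g assume g: "g \<in> V" "\<forall>q\<in>{p}. q (\<lambda>x. g x - f x) < r - p (\<lambda>x. f x - f0 x)"
        then have "p (\<lambda>x. g x - f0 x) < r"
          using seminorm_on_diff_triangle[OF seminorm_familyD(1)[OF P] seminorm_familyD(2)[OF P *(2)], of g f f0] f * S by force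
        then show "g \<in> S" using S g by blast
      qed (use * f S in auto)
    qed
  qed
next
  assume R: "U \<subseteq> V \<and> (\<forall>f\<in>U. ?N f U)"
  show "openin (seminorm_topology V P) U"
  proof (subst openin_subopen, intro ballI)
    fix f assume f: "f \<in> U"
    then obtain F e where F: "finite F" "F \<subseteq> P" "0 < e" "\<forall>g\<in>V. (\<forall>p\<in>F. p (\<lambda>x. g x - f x) < e) \<longrightarrow> g \<in> U"
      using R by blast
    have fV: "f \<in> V" using f R by blast
    \<comment> \<open>The factor \<open>topspace\<close> keeps the intersection inside
      \<open>V\<close> when \<open>F\<close> is empty.\<close>
    let ?T = "(\<Inter>p\<in>F. {g\<in>V. p (\<lambda>x. g x - f x) < e}) \<inter> topspace (seminorm_topology V P)"
    have "openin (seminorm_topology V P) ?T"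
    proof (rule openin_INT[OF F(1)])
      fix p assume "p \<in> F"
      then show "openin (seminorm_topology V P) {g\<in>V. p (\<lambda>x. g x - f x) < e}"
        unfolding seminorm_topology_def
        by (intro topology_generated_by_Basis) (use fV F in blast)
    qed
    moreover have "p (\<lambda>x. f x - f x) < e" if "p \<in> F" for p
      using seminorm_on_zero[OF seminorm_familyD(1)[OF P] seminorm_familyD(2)[OF P subsetD[OF F(2) that]]] F(3)
      by simp
    then have "f \<in> ?T"
      using fV seminorm_familyD(4)[OF P] by blast
    moreover have "?T \<subseteq> U" using F(4) seminorm_familyD(4)[OF P] by auto
    ultimately show "\<exists>T. openin (seminorm_topology V P) T \<and> f \<in> T \<and> T \<subseteq> U" by blast
  qed
qed

lemma openin_seminorm_topology_nbhd:
  assumes P: "seminorm_family V P" and U: "openin (seminorm_topology V P) U" "f \<in> U"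
  obtains F e where "finite F" "F \<subseteq> P" "0 < e"
    "\<And>g. g \<in> V \<Longrightarrow> (\<forall>p\<in>F. p (\<lambda>x. g x - f x) < e) \<Longrightarrow> g \<in> U"
proof -
  have "\<forall>f\<in>U. \<exists>F e. finite F \<and> F \<subseteq> P \<and> 0 < e \<and> (\<forall>g\<in>V. (\<forall>p\<in>F. p (\<lambda>x. g x - f x) < e) \<longrightarrow> g \<in> U)"
    using U(1) openin_seminorm_topology_iff[OF P] by blast
  from bspec[OF this U(2)] show thesis using that by (elim exE conjE) blast
qed

lemma openin_seminorm_topology_zero_nbhd:
  assumes P: "seminorm_family V P" and U: "openin (seminorm_topology V P) U" "(\<lambda>_. 0) \<in> U"
  obtains F e where "finite F" "F \<subseteq> P" "0 < e" "\<And>g. g \<in> V \<Longrightarrow> (\<forall>p\<in>F. p g < e) \<Longrightarrow> g \<in> U"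
proof -
  show thesis
  proof (rule openin_seminorm_topology_nbhd[OF P U, unfolded diff_zero])
    fix F e
    assume "finite F" "F \<subseteq> P" "0 < e" "\<And>g. g \<in> V \<Longrightarrow> (\<forall>p\<in>F. p g < e) \<Longrightarrow> g \<in> U"
    then show thesis by (rule that)
  qed
qed

section \<open>Continuity as domination by finitely many seminorms\<close>

definition dominated_on ::
    "('i \<Rightarrow> complex) set \<Rightarrow> (('i \<Rightarrow> complex) \<Rightarrow> real) set \<Rightarrow> (('i \<Rightarrow> complex) \<Rightarrow> real) \<Rightarrow> bool" where
  "dominated_on V P q \<longleftrightarrow> (\<exists>F C. finite F \<and> F \<subseteq> P \<and> 0 \<le> C \<and> (\<forall>f\<in>V. q f \<le> C * (\<Sum>p\<in>F. p f)))"

lemma dominated_onI: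
  assumes "p \<in> P" "0 \<le> C" "\<And>f. f \<in> V \<Longrightarrow> q f \<le> C * p f"
  shows "dominated_on V P q"
  unfolding dominated_on_def using assms by (intro exI[of _ "{p}"] exI[of _ C]) auto

lemma dominated_on_nbhd:
  assumes P: "seminorm_family V P" and q: "dominated_on V P q" and "0 < r"
  obtains F e where "finite F" "F \<subseteq> P" "0 < e" "\<And>g. g \<in> V \<Longrightarrow> (\<forall>p\<in>F. p g < e) \<Longrightarrow> q g < r"
proof -
  obtain F C where F: "finite F" "F \<subseteq> P" "0 \<le> C" "\<And>f. f\<in>V \<Longrightarrow> q f \<le> C * (\<Sum>p\<in>F. p f)"
    using q unfolding dominated_on_def by blast
  \<comment> \<open>The radius will be \<open>r / (1 + D)\<close>; the summand 1 covers
    \<open>D = 0\<close> and makes the final estimate strict.\<close>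
  define D where "D = C * real (card F)"
  have D: "0 \<le> D" using F(3) by (simp add: D_def)
  have "q g < r" if g: "g \<in> V" "\<forall>p\<in>F. p g < r / (1 + D)" for g
  proof -
    have "(\<Sum>p\<in>F. p g) \<le> real (card F) * (r / (1 + D))"
      using sum_bounded_above[of F "\<lambda>p. p g" "r / (1 + D)"] g(2) by force
    then have "q g \<le> C * (real (card F) * (r / (1 + D)))"
      using F(3) F(4)[OF g(1)] by (meson mult_left_mono order_trans)
    also have "\<dots> = r * (D / (1 + D))" by (simp add: D_def)
    also have "\<dots> < r * 1" using D \<open>0 < r\<close> by (intro mult_strict_left_mono) (auto simp: divide_simps)
    finally show ?thesis by simp
  qed
  moreover have "0 < r / (1 + D)" using D \<open>0 < r\<close> by auto
  ultimately show thesis using that F(1,2) by blast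
qed

text \<open>The target is any metric space and increments are bounded by a dominated
  \<open>q\<close>, because the lemma is applied to seminorms, to functionals and to the functions
  \<open>f \<mapsto> q (h f - w)\<close> for a linear map \<open>h\<close>.\<close>

lemma continuous_map_seminorm_topology:
  fixes \<phi> :: "('i \<Rightarrow> complex) \<Rightarrow> 'b::metric_space"
  assumes P: "seminorm_family V P"
    and q: "dominated_on V P q"
    and \<phi>: "\<And>f g. f \<in> V \<Longrightarrow> g \<in> V \<Longrightarrow> dist (\<phi> g) (\<phi> f) \<le> q (\<lambda>x. g x - f x)"
  shows "continuous_map (seminorm_topology V P) euclidean \<phi>"
  unfolding continuous_map_def seminorm_familyD(4)[OF P]
proof (intro conjI allI impI)
  fix U :: "'b set" assume "openin euclidean U"
  then have U: "open U" by simp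
  show "openin (seminorm_topology V P) {f \<in> V. \<phi> f \<in> U}"
    unfolding openin_seminorm_topology_iff[OF P]
  proof (intro conjI ballI)
    fix f assume "f \<in> {f \<in> V. \<phi> f \<in> U}"
    then have f: "f \<in> V" "\<phi> f \<in> U" by auto
    then obtain r where r: "0 < r" "\<And>y. dist y (\<phi> f) < r \<Longrightarrow> y \<in> U"
      using U unfolding open_dist by blast
    obtain F e where F: "finite F" "F \<subseteq> P" "0 < e" "\<And>g. g \<in> V \<Longrightarrow> (\<forall>p\<in>F. p g < e) \<Longrightarrow> q g < r"
      using dominated_on_nbhd[OF P q r(1)] by blast
    show "\<exists>F e. finite F \<and> F \<subseteq> P \<and> 0 < e \<and>
        (\<forall>g\<in>V. (\<forall>p\<in>F. p (\<lambda>x. g x - f x) < e) \<longrightarrow> g \<in> {f \<in> V. \<phi> f \<in> U})"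
    proof (intro exI[of _ F] exI[of _ e] conjI ballI impI CollectI)
      fix g assume g: "g \<in> V" "\<forall>p\<in>F. p (\<lambda>x. g x - f x) < e"
      show "\<phi> g \<in> U"
        using F(4)[OF function_subspace_diff[OF seminorm_familyD(1)[OF P] g(1) f(1)] g(2)] \<phi>[OF f(1) g(1)] by (intro r(2)) simp
    qed (use F in auto)
  qed auto
qed auto

text \<open>The open unit ball of \<open>q\<close> contains a basic neighbourhood of 0; scaling an
  arbitrary \<open>f\<close> into that neighbourhood gives the estimate.\<close>

lemma seminorm_dominated_if_ball_open:
  assumes P: "seminorm_family V P"
    and q: "seminorm_on V q" and o: "openin (seminorm_topology V P) {f\<in>V. q f < 1}"
  shows "dominated_on V P q"
proof -
  have z: "(\<lambda>_. 0) \<in> {f\<in>V. q f < 1}"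
    using function_subspaceD(1)[OF seminorm_familyD(1)[OF P]] seminorm_on_zero[OF seminorm_familyD(1)[OF P] q]
    by simp
  obtain F e where F: "finite F" "F \<subseteq> P" "0 < e"
      "\<And>g. g\<in>V \<Longrightarrow> (\<forall>p\<in>F. p g < e) \<Longrightarrow> g \<in> {f\<in>V. q f < 1}"
    by (rule openin_seminorm_topology_zero_nbhd[OF P o z]) blast
  have nn: "0 \<le> p f" if "p \<in> F" "f \<in> V" for p f using seminorm_onD(1)[OF seminorm_familyD(2)[OF P]] that F(2) by blast
  have "q f \<le> 1 / e * (\<Sum>p\<in>F. p f)" if f: "f \<in> V" for f
  proof (rule field_le_epsilon)
    fix d :: real assume d: "0 < d"
    define s where "s = (\<Sum>p\<in>F. p f)"
    have s: "0 \<le> s" unfolding s_def by (intro sum_nonneg nn f)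
    \<comment> \<open>The summand \<open>e * d\<close> keeps the scaling factor finite when all
      seminorms in \<open>F\<close> vanish at \<open>f\<close>; \<open>d > 0\<close> is arbitrary
      and disappears at the end.\<close>
    define c where "c = e / (s + e * d)"
    have ed: "0 < e * d" using d F(3) by simp
    then have c: "0 < c" unfolding c_def using F(3) s by (intro divide_pos_pos) auto
    have "p (\<lambda>x. complex_of_real c * f x) < e" if p: "p \<in> F" for p
    proof -
      have "p f \<le> s" unfolding s_def using p nn f F(1) by (intro member_le_sum) auto
      then have "c * p f \<le> c * s" using c by simp
      also have "\<dots> < c * (s + e * d)" using c ed by simp
      also have "\<dots> = e" using s ed by (simp add: c_def)
      finally show ?thesis using seminorm_onD(3)[OF seminorm_familyD(2)[OF P] f, of p "complex_of_real c"] p F(2) c by auto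
    qed
    then have "q (\<lambda>x. complex_of_real c * f x) < 1"
      using F(4)[of "\<lambda>x. complex_of_real c * f x"] function_subspaceD(3)[OF seminorm_familyD(1)[OF P] f] by blast
    then have "c * q f < 1" using seminorm_onD(3)[OF q f, of "complex_of_real c"] c by simp
    then have "q f < 1 / c" using c by (simp add: field_simps)
    also have "\<dots> = 1 / e * s + d" using F(3) by (simp add: c_def field_simps)
    finally show "q f \<le> 1 / e * (\<Sum>p\<in>F. p f) + d" unfolding s_def by simp
  qed
  then show ?thesis unfolding dominated_on_def using F by (intro exI[of _ F] exI[of _ "1/e"]) auto
qed

lemma continuous_map_seminorm_iff:
  assumes P: "seminorm_family V P"
    and q: "seminorm_on V q"
  shows "continuous_map (seminorm_topology V P) euclideanreal q \<longleftrightarrow> dominated_on V P q"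
proof
  assume "continuous_map (seminorm_topology V P) euclideanreal q"
  then show "dominated_on V P q"
    using seminorm_dominated_if_ball_open[OF P q] openin_sublevel[of _ q 1] seminorm_familyD(4)[OF P] by force
next
  assume d: "dominated_on V P q"
  show "continuous_map (seminorm_topology V P) euclideanreal q"
    by (rule continuous_map_seminorm_topology[OF P d])
       (use seminorm_on_abs_diff[OF seminorm_familyD(1)[OF P] q] in \<open>auto simp: dist_real_def\<close>)
qed

section \<open>Linear maps and isomorphisms\<close>

definition linear_map_on :: "('i \<Rightarrow> complex) set \<Rightarrow> (('i \<Rightarrow> complex) \<Rightarrow> 'j \<Rightarrow> complex) \<Rightarrow> bool" where
  "linear_map_on V h \<longleftrightarrow> (\<forall>f\<in>V. \<forall>g\<in>V. h (\<lambda>x. f x + g x) = (\<lambda>y. h f y + h g y)) \<and>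
     (\<forall>c. \<forall>f\<in>V. h (\<lambda>x. c * f x) = (\<lambda>y. c * h f y))"

lemma linear_map_onD:
  assumes "linear_map_on V h"
  shows "f \<in> V \<Longrightarrow> g \<in> V \<Longrightarrow> h (\<lambda>x. f x + g x) = (\<lambda>y. h f y + h g y)"
    "f \<in> V \<Longrightarrow> h (\<lambda>x. c * f x) = (\<lambda>y. c * h f y)"
  using assms unfolding linear_map_on_def by blast+

lemma linear_map_on_diff:
  assumes "function_subspace V" "linear_map_on V h" "f \<in> V" "g \<in> V"
  shows "h (\<lambda>x. f x - g x) = (\<lambda>y. h f y - h g y)"
  using linear_map_onD(1)[OF assms(2,3) function_subspaceD(3)[OF assms(1,4), of "-1"]]
    linear_map_onD(2)[OF assms(2,4), of "-1"] by simp

lemma seminorm_on_compose: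
  assumes "linear_map_on V h" "seminorm_on W q" "h \<in> V \<rightarrow> W"
  shows "seminorm_on V (\<lambda>f. q (h f))"
  using assms unfolding seminorm_on_def linear_map_on_def by (auto simp: Pi_iff)

text \<open>Only preimages of subbasic balls have to be open. They are sublevel sets of
  \<open>f \<mapsto> q (h f - w)\<close>, a function whose increments are bounded by
  \<open>q\<close> composed with \<open>h\<close>, also when the centre \<open>w\<close> is outside
  the range of \<open>h\<close>.\<close>

lemma continuous_map_linear:
  assumes P: "seminorm_family V P"
    and Q: "seminorm_family W Q"
    and h: "linear_map_on V h" "h \<in> V \<rightarrow> W"
    and d: "\<And>q. q \<in> Q \<Longrightarrow> dominated_on V P (\<lambda>f. q (h f))"
  shows "continuous_map (seminorm_topology V P) (seminorm_topology W Q) h"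
proof -
  have "openin (seminorm_topology V P) (h -` U \<inter> V)"
    if U: "U \<in> {{g\<in>W. q (\<lambda>x. g x - f x) < r} | f q r. f \<in> W \<and> q \<in> Q \<and> 0 < r}" for U
  proof -
    obtain w q r where U: "U = {g\<in>W. q (\<lambda>x. g x - w x) < r}" and w: "w \<in> W" "q \<in> Q" using U by blast
    have "continuous_map (seminorm_topology V P) euclideanreal (\<lambda>f. q (\<lambda>x. h f x - w x))"
    proof (rule continuous_map_seminorm_topology[OF P d[OF w(2)]])
      fix f g assume fg: "f \<in> V" "g \<in> V"
      then have hW: "h f \<in> W" "h g \<in> W" using h(2) by auto
      show "dist (q (\<lambda>x. h g x - w x)) (q (\<lambda>x. h f x - w x)) \<le> q (h (\<lambda>x. g x - f x))"
        using seminorm_on_abs_diff[OF seminorm_familyD(1)[OF Q] seminorm_familyD(2)[OF Q w(2)] function_subspace_diff[OF seminorm_familyD(1)[OF Q] hW(2) w(1)]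
            function_subspace_diff[OF seminorm_familyD(1)[OF Q] hW(1) w(1)]] linear_map_on_diff[OF seminorm_familyD(1)[OF P] h(1) fg(2,1)]
        by (simp add: dist_real_def)
    qed
    from openin_sublevel[OF this, of r]
    have "openin (seminorm_topology V P) {f \<in> V. q (\<lambda>x. h f x - w x) < r}"
      unfolding seminorm_familyD(4)[OF P] .
    moreover have "{f \<in> V. q (\<lambda>x. h f x - w x) < r} = h -` U \<inter> V"
      using h(2) U by auto
    ultimately show ?thesis by simp
  qed
  moreover have "h ` V \<subseteq> \<Union> {{g\<in>W. q (\<lambda>x. g x - f x) < r} | f q r. f \<in> W \<and> q \<in> Q \<and> 0 < r}"
    using h(2) seminorm_familyD(4)[OF Q, unfolded seminorm_topology_def topology_generated_by_topspace]
    by (metis image_subset_iff_funcset)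
  ultimately show ?thesis
    by (subst seminorm_topology_def[of W Q])
       (simp only: continuous_on_generated_topo_iff seminorm_familyD(4)[OF P], blast intro: allI)
qed

text \<open>The inverse \<open>k\<close> is given merely as a map; its linearity follows from that
  of \<open>h\<close>, by applying \<open>k\<close> to the equations for \<open>h\<close>.\<close>

lemma topological_isomorphism_seminormI:
  assumes P: "seminorm_family V P"
    and Q: "seminorm_family W Q"
    and h: "linear_map_on V h" "h \<in> V \<rightarrow> W"
    and k: "k \<in> W \<rightarrow> V" "\<And>f. f \<in> V \<Longrightarrow> k (h f) = f" "\<And>g. g \<in> W \<Longrightarrow> h (k g) = g"
    and d: "\<And>q. q \<in> Q \<Longrightarrow> dominated_on V P (\<lambda>f. q (h f))"
    and d': "\<And>p. p \<in> P \<Longrightarrow> dominated_on W Q (\<lambda>f. p (k f))"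
  shows "topological_isomorphism (seminorm_topology V P) (seminorm_topology W Q) h"
proof -
  have "linear_map_on W k"
    unfolding linear_map_on_def
  proof (intro conjI ballI allI)
    fix f g assume "f \<in> W" "g \<in> W"
    then show "k (\<lambda>x. f x + g x) = (\<lambda>y. k f y + k g y)"
      using linear_map_onD(1)[OF h(1), of "k f" "k g"] k(3) k(2)[of "\<lambda>x. k f x + k g x"] funcset_mem[OF k(1)]
        function_subspaceD(2)[OF seminorm_familyD(1)[OF P], of "k f" "k g"] by simp
  next
    fix c f assume "f \<in> W"
    then show "k (\<lambda>x. c * f x) = (\<lambda>y. c * k f y)"
      using linear_map_onD(2)[OF h(1), of "k f" c] k(3) k(2)[of "\<lambda>x. c * k f x"] funcset_mem[OF k(1)]
        function_subspaceD(3)[OF seminorm_familyD(1)[OF P], of "k f" c] by simp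
  qed
  then have "continuous_map (seminorm_topology W Q) (seminorm_topology V P) k"
    using continuous_map_linear[OF Q P _ k(1) d'] by blast
  moreover have "continuous_map (seminorm_topology V P) (seminorm_topology W Q) h"
    using continuous_map_linear[OF P Q h d] by blast
  ultimately have "homeomorphic_maps (seminorm_topology V P) (seminorm_topology W Q) h k"
    unfolding homeomorphic_maps_def seminorm_familyD(4)[OF P] seminorm_familyD(4)[OF Q]
    using k by auto
  then show ?thesis
    using h(1) homeomorphic_map_maps
    unfolding topological_isomorphism_def linear_map_on_def seminorm_familyD(4)[OF P] by blast
qed

section \<open>Bounded sets and limits\<close>

lemma bounded_in_absorb:
  assumes "bounded_in X B" "openin X U" "(\<lambda>_. 0) \<in> U"
  obtains r where "0 < r" "\<And>f. f \<in> B \<Longrightarrow> \<exists>u\<in>U. f = (\<lambda>x. complex_of_real r * u x)"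
proof -
  obtain r where r: "r > 0" "\<And>c. r \<le> cmod c \<Longrightarrow> B \<subseteq> (\<lambda>f x. c * f x) ` U"
    using assms unfolding bounded_in_def by blast
  show thesis using that[OF r(1)] r(2)[of "complex_of_real r"] r(1) by auto
qed

text \<open>A bounded set is absorbed by the unit ball of each \<open>p\<close>, and the absorbing
  factor bounds \<open>p\<close> on it. Conversely a neighbourhood of 0 involves finitely many
  seminorms, whose bounds on \<open>B\<close> have a common majorant.\<close>

lemma bounded_in_seminorm_topology_iff:
  assumes P: "seminorm_family V P"
  shows "bounded_in (seminorm_topology V P) B \<longleftrightarrow> B \<subseteq> V \<and> (\<forall>p\<in>P. bdd_above (p ` B))"
proof (intro iffI conjI ballI)
  assume b: "bounded_in (seminorm_topology V P) B"
  then show "B \<subseteq> V" unfolding bounded_in_def seminorm_familyD(4)[OF P] by blast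
  fix p assume p: "p \<in> P"
  have "continuous_map (seminorm_topology V P) euclideanreal p"
    unfolding continuous_map_seminorm_iff[OF P seminorm_familyD(2)[OF P p]]
    by (rule dominated_onI[OF p, of 1]) auto
  from openin_sublevel[OF this, of 1] have o: "openin (seminorm_topology V P) {f \<in> V. p f < 1}"
    unfolding seminorm_familyD(4)[OF P] .
  have z: "(\<lambda>_. 0) \<in> {f \<in> V. p f < 1}"
    using function_subspaceD(1)[OF seminorm_familyD(1)[OF P]] seminorm_on_zero[OF seminorm_familyD(1)[OF P] seminorm_familyD(2)[OF P p]] by simp
  obtain r where r: "0 < r" "\<And>f. f \<in> B \<Longrightarrow> \<exists>u\<in>{f \<in> V. p f < 1}. f = (\<lambda>x. complex_of_real r * u x)"
    by (rule bounded_in_absorb[OF b o z]) blast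
  have "p f \<le> r" if f: "f \<in> B" for f
  proof -
    obtain u where u: "u \<in> V" "p u < 1" "f = (\<lambda>x. complex_of_real r * u x)" using r(2)[OF f] by auto
    have "p f = r * p u" using seminorm_onD(3)[OF seminorm_familyD(2)[OF P p] u(1), of "complex_of_real r"] r(1) u(3) by simp
    then show ?thesis using r(1) u(2) by simp
  qed
  then show "bdd_above (p ` B)" by (intro bdd_aboveI[of _ r]) auto
next
  assume b: "B \<subseteq> V \<and> (\<forall>p\<in>P. bdd_above (p ` B))"
  show "bounded_in (seminorm_topology V P) B"
    unfolding bounded_in_def seminorm_familyD(4)[OF P]
  proof (intro conjI allI impI)
    fix U assume U: "openin (seminorm_topology V P) U \<and> (\<lambda>_. 0) \<in> U"
    obtain F e where F: "finite F" "F \<subseteq> P" "0 < e" "\<And>g. g\<in>V \<Longrightarrow> (\<forall>p\<in>F. p g < e) \<Longrightarrow> g \<in> U"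
      by (rule openin_seminorm_topology_zero_nbhd[OF P conjunct1[OF U] conjunct2[OF U]]) blast
    have "\<exists>M. \<forall>f\<in>B. p f \<le> M" if "p \<in> F" for p
      using b that F(2) unfolding bdd_above_def by (meson imageI subsetD)
    then obtain M where M: "\<And>p f. p \<in> F \<Longrightarrow> f \<in> B \<Longrightarrow> p f \<le> M p" by metis
    \<comment> \<open>A strict bound for all \<open>p\<close> in \<open>F\<close> at once, positive
      even for empty \<open>F\<close>.\<close>
    define N where "N = (\<Sum>p\<in>F. \<bar>M p\<bar>) + 1"
    have N: "0 < N" unfolding N_def by (simp add: add_nonneg_pos sum_nonneg)
    have MN: "p f < N" if "p \<in> F" "f \<in> B" for p f
      using M[OF that] member_le_sum[OF that(1), of "\<lambda>p. \<bar>M p\<bar>"] F(1) unfolding N_def by force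
    show "\<exists>r>0. \<forall>c. r \<le> cmod c \<longrightarrow> B \<subseteq> (\<lambda>f x. c * f x) ` U"
    proof (intro exI[of _ "N / e"] conjI allI impI subsetI)
      fix c f assume c: "N / e \<le> cmod c" and f: "f \<in> B"
      have c0: "0 < cmod c" using c N F(3) by (meson divide_pos_pos less_le_trans)
      have "(\<lambda>x. inverse c * f x) \<in> U"
      proof (intro F(4) ballI)
        show "(\<lambda>x. inverse c * f x) \<in> V" using function_subspaceD(3)[OF seminorm_familyD(1)[OF P]] f b by blast
        fix p assume p: "p \<in> F"
        have "p (\<lambda>x. inverse c * f x) = p f / cmod c"
          using seminorm_onD(3)[OF seminorm_familyD(2)[OF P subsetD[OF F(2) p]] subsetD[OF conjunct1[OF b] f], of "inverse c"]
          by (simp add: norm_inverse divide_inverse mult.commute)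
        also have "\<dots> < N / cmod c" using MN[OF p f] c0 by (simp add: divide_strict_right_mono)
        also have "\<dots> \<le> e" using c c0 F(3) by (simp add: field_simps)
        finally show "p (\<lambda>x. inverse c * f x) < e" .
      qed
      moreover have "f = (\<lambda>x. c * (inverse c * f x))" using c0 by auto
      ultimately show "f \<in> (\<lambda>f x. c * f x) ` U" by (intro image_eqI[of _ _ "\<lambda>x. inverse c * f x"])
    qed (use N F in auto)
  qed (use b in auto)
qed

lemma limitin_seminorm_topology:
  assumes P: "seminorm_family V P"
    and l: "l \<in> V" and f: "eventually (\<lambda>i. f i \<in> V) F"
    and lim: "\<And>p. p \<in> P \<Longrightarrow> ((\<lambda>i. p (\<lambda>x. f i x - l x)) \<longlongrightarrow> 0) F"
  shows "limitin (seminorm_topology V P) f l F"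
  unfolding limitin_def seminorm_familyD(4)[OF P]
proof (intro conjI allI impI)
  fix U assume "openin (seminorm_topology V P) U \<and> l \<in> U"
  then have U: "openin (seminorm_topology V P) U" "l \<in> U" by auto
  obtain G e where G: "finite G" "G \<subseteq> P" "0 < e" "\<And>g. g\<in>V \<Longrightarrow> (\<forall>p\<in>G. p (\<lambda>x. g x - l x) < e) \<Longrightarrow> g \<in> U"
    by (rule openin_seminorm_topology_nbhd[OF P U]) blast
  have "\<forall>p\<in>G. eventually (\<lambda>i. p (\<lambda>x. f i x - l x) < e) F"
    using order_tendstoD(2)[OF lim G(3)] G(2) by blast
  then have "eventually (\<lambda>i. \<forall>p\<in>G. p (\<lambda>x. f i x - l x) < e) F"
    using G(1) by (simp add: eventually_ball_finite)
  then show "eventually (\<lambda>i. f i \<in> U) F" using f by eventually_elim (rule G(4))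
qed (use l in auto)

section \<open>Inductive limits\<close>

lemma seminorm_on_subset: "seminorm_on V p \<Longrightarrow> U \<subseteq> V \<Longrightarrow> seminorm_on U p"
  unfolding seminorm_on_def by blast

definition lc_seminorms ::
  "'a set \<Rightarrow> ('a \<Rightarrow> ('i \<Rightarrow> complex) set) \<Rightarrow> ('a \<Rightarrow> (('i \<Rightarrow> complex) \<Rightarrow> real) set) \<Rightarrow> (('i \<Rightarrow> complex) \<Rightarrow> real) set"
  where "lc_seminorms I V Q =
    {p. seminorm_on (\<Union>a\<in>I. V a) p \<and> (\<forall>a\<in>I. dominated_on (V a) (Q a) p)}"

lemma lc_inductive_limit_seminorm_topology:
  assumes Q: "\<And>a. a \<in> I \<Longrightarrow> seminorm_family (V a) (Q a)"
  shows "lc_inductive_limit I (\<lambda>a. seminorm_topology (V a) (Q a)) =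
    seminorm_topology (\<Union>a\<in>I. V a) (lc_seminorms I V Q)"
proof -
  have U: "(\<Union>a\<in>I. topspace (seminorm_topology (V a) (Q a))) = (\<Union>a\<in>I. V a)"
    using seminorm_familyD(4)[OF Q] by simp
  have "(\<forall>a\<in>I. continuous_map (seminorm_topology (V a) (Q a)) euclideanreal p) \<longleftrightarrow>
      (\<forall>a\<in>I. dominated_on (V a) (Q a) p)" if p: "seminorm_on (\<Union>a\<in>I. V a) p" for p
    by (intro ball_cong refl continuous_map_seminorm_iff[OF Q] seminorm_on_subset[OF p]) auto
  then have "{p. seminorm_on (\<Union>a\<in>I. V a) p \<and>
        (\<forall>a\<in>I. continuous_map (seminorm_topology (V a) (Q a)) euclideanreal p)} = lc_seminorms I V Q"
    unfolding lc_seminorms_def by blast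
  then show ?thesis unfolding lc_inductive_limit_def Let_def U by simp
qed

lemma seminorm_family_lc_seminorms:
  assumes "function_subspace (\<Union>a\<in>I. V a)"
  shows "seminorm_family (\<Union>a\<in>I. V a) (lc_seminorms I V Q)"
proof -
  \<comment> \<open>The zero seminorm makes the family nonempty, so that the carrier of the topology
    is the whole union.\<close>
  have "(\<lambda>_. 0) \<in> lc_seminorms I V Q"
    unfolding lc_seminorms_def dominated_on_def seminorm_on_def by (auto intro!: exI[of _ "{}"] exI[of _ 0])
  then show ?thesis using assms unfolding seminorm_family_def lc_seminorms_def by blast
qed

section \<open>Continuous functionals and the strong dual\<close>

definition linear_functional_on :: "('i \<Rightarrow> complex) set \<Rightarrow> (('i \<Rightarrow> complex) \<Rightarrow> complex) \<Rightarrow> bool" where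
  "linear_functional_on V T \<longleftrightarrow> (\<forall>f\<in>V. \<forall>g\<in>V. T (\<lambda>x. f x + g x) = T f + T g) \<and>
     (\<forall>c. \<forall>f\<in>V. T (\<lambda>x. c * f x) = c * T f)"

lemma linear_functional_onD:
  assumes "linear_functional_on V T"
  shows "f \<in> V \<Longrightarrow> g \<in> V \<Longrightarrow> T (\<lambda>x. f x + g x) = T f + T g" "f \<in> V \<Longrightarrow> T (\<lambda>x. c * f x) = c * T f"
  using assms unfolding linear_functional_on_def by blast+

lemma linear_functional_on_diff:
  assumes "function_subspace V" "linear_functional_on V T" "f \<in> V" "g \<in> V"
  shows "T (\<lambda>x. f x - g x) = T f - T g"
  using linear_functional_onD(1)[OF assms(2,3) function_subspaceD(3)[OF assms(1,4), of "-1"]]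
    linear_functional_onD(2)[OF assms(2,4), of "-1"] by simp

lemma linear_functional_on_sum:
  assumes "function_subspace V" "linear_functional_on V T" "\<And>i. i \<in> I \<Longrightarrow> f i \<in> V"
  shows "T (\<lambda>x. \<Sum>i\<in>I. c i * f i x) = (\<Sum>i\<in>I. c i * T (f i))"
proof -
  have T0: "T (\<lambda>_. 0) = 0"
    using linear_functional_onD(2)[OF assms(2) function_subspaceD(1)[OF assms(1)], of 0] by simp
  show ?thesis
    using assms(3)
  proof (induction I rule: infinite_finite_induct)
    case (insert i I)
    have "(\<lambda>x. c i * f i x) \<in> V" "(\<lambda>x. \<Sum>i\<in>I. c i * f i x) \<in> V"
      using insert.prems by (intro function_subspaceD(3)[OF assms(1)] function_subspace_sum[OF assms(1)]; simp)+
    from linear_functional_onD(1)[OF assms(2) this] show ?case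
      using insert linear_functional_onD(2)[OF assms(2), of "f i" "c i"] by simp
  qed (use T0 in auto)
qed

lemma seminorm_on_cmod_functional: "linear_functional_on V T \<Longrightarrow> seminorm_on V (\<lambda>f. cmod (T f))"
  unfolding linear_functional_on_def seminorm_on_def by (auto simp: norm_mult norm_triangle_ineq)

lemma dual_space_iff:
  "T \<in> dual_space X \<longleftrightarrow> linear_functional_on (topspace X) T \<and> continuous_map X euclidean T \<and>
     (\<forall>f. f \<notin> topspace X \<longrightarrow> T f = 0)"
  unfolding dual_space_def linear_functional_on_def by blast

lemma dual_space_openin_ball:
  assumes "T \<in> dual_space X"
  shows "openin X {f \<in> topspace X. cmod (T f) < 1}"
proof -
  have "continuous_map X euclideanreal (\<lambda>f. cmod (T f))"
    using continuous_map_norm[of X T] assms unfolding dual_space_iff by blast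
  then show ?thesis by (rule openin_sublevel)
qed

lemma dual_space_seminorm_topology_iff:
  assumes P: "seminorm_family V P"
  shows "T \<in> dual_space (seminorm_topology V P) \<longleftrightarrow> linear_functional_on V T \<and>
    dominated_on V P (\<lambda>f. cmod (T f)) \<and> (\<forall>f. f \<notin> V \<longrightarrow> T f = 0)"
proof -
  have "dominated_on V P (\<lambda>f. cmod (T f))" if T: "T \<in> dual_space (seminorm_topology V P)"
  proof (rule seminorm_dominated_if_ball_open[OF P])
    show "seminorm_on V (\<lambda>f. cmod (T f))"
      using T unfolding dual_space_iff seminorm_familyD(4)[OF P] by (blast intro: seminorm_on_cmod_functional)
    show "openin (seminorm_topology V P) {f \<in> V. cmod (T f) < 1}"
      using dual_space_openin_ball[OF T] unfolding seminorm_familyD(4)[OF P] .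
  qed
  moreover have "continuous_map (seminorm_topology V P) euclidean T"
    if T: "linear_functional_on V T" and d: "dominated_on V P (\<lambda>f. cmod (T f))"
    by (rule continuous_map_seminorm_topology[OF P d])
       (simp add: linear_functional_on_diff[OF seminorm_familyD(1)[OF P] T] dist_norm)
  ultimately show ?thesis unfolding dual_space_iff seminorm_familyD(4)[OF P] by blast
qed

lemma function_subspace_dual_space: "function_subspace (dual_space X)"
  unfolding function_subspace_def
proof (intro conjI ballI allI)
  show "(\<lambda>_. 0) \<in> dual_space X"
    unfolding dual_space_iff linear_functional_on_def by simp
  fix S assume S: "S \<in> dual_space X"
  show "(\<lambda>x. S x + T x) \<in> dual_space X" if T: "T \<in> dual_space X" for T
    using S T continuous_map_add[of X S T]
    unfolding dual_space_iff linear_functional_on_def by (auto simp: algebra_simps)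
  fix c :: complex
  have "continuous_map euclidean euclidean ((*) c)"
    using continuous_on_mult_left[OF continuous_on_id, of UNIV c] by simp
  then have "continuous_map X euclidean (\<lambda>x. c * S x)"
    using S continuous_map_compose[of X euclidean S euclidean "(*) c"]
    unfolding dual_space_iff comp_def by blast
  then show "(\<lambda>x. c * S x) \<in> dual_space X"
    using S unfolding dual_space_iff linear_functional_on_def by (auto simp: algebra_simps)
qed

text \<open>The suprema in the strong dual topology are thus suprema of bounded sets of reals, where
  \<open>SUP\<close> has its usual meaning. The unit ball of \<open>T\<close> is an open
  neighbourhood of 0 and absorbs \<open>B\<close>.\<close>

lemma dual_space_bounded:
  assumes T: "T \<in> dual_space X" and B: "bounded_in X B" and X: "function_subspace (topspace X)"
  shows "bdd_above ((\<lambda>f. cmod (T f)) ` B)"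
proof -
  have lin: "linear_functional_on (topspace X) T" using T unfolding dual_space_iff by blast
  have z: "(\<lambda>_. 0) \<in> {f \<in> topspace X. cmod (T f) < 1}"
    using function_subspaceD(1)[OF X] linear_functional_onD(2)[OF lin, of "\<lambda>_. 0" 0] by simp
  obtain r where r: "0 < r"
      "\<And>f. f \<in> B \<Longrightarrow> \<exists>u\<in>{f \<in> topspace X. cmod (T f) < 1}. f = (\<lambda>x. complex_of_real r * u x)"
    by (rule bounded_in_absorb[OF B dual_space_openin_ball[OF T] z]) blast
  have "cmod (T f) \<le> r" if f: "f \<in> B" for f
  proof -
    obtain u where u: "u \<in> topspace X" "cmod (T u) < 1" "f = (\<lambda>x. complex_of_real r * u x)"
      using r(2)[OF f] by blast
    have "cmod (T f) = r * cmod (T u)"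
      unfolding u(3) linear_functional_onD(2)[OF lin u(1)] using r(1) by (simp add: norm_mult)
    then show ?thesis using r(1) u(2) by simp
  qed
  then show ?thesis by (intro bdd_aboveI[of _ r]) auto
qed

definition polar_seminorms :: "('i \<Rightarrow> complex) topology \<Rightarrow> ((('i \<Rightarrow> complex) \<Rightarrow> complex) \<Rightarrow> real) set" where
  "polar_seminorms X = {(\<lambda>T. SUP f\<in>B. cmod (T f)) | B. bounded_in X B \<and> B \<noteq> {}}"

lemma strong_dual_eq: "strong_dual X = seminorm_topology (dual_space X) (polar_seminorms X)"
  unfolding strong_dual_def polar_seminorms_def by simp

text \<open>Since \<open>SUP\<close> in \<open>real\<close> is conditional, homogeneity is split:
  one inequality holds termwise, the other follows after division by \<open>cmod c\<close>, and
  \<open>c = 0\<close> is treated apart.\<close>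

lemma seminorm_on_SUP:
  assumes "B \<noteq> {}" and bdd: "\<And>T. T \<in> V \<Longrightarrow> bdd_above ((\<lambda>f. cmod (T f)) ` B)"
  shows "seminorm_on V (\<lambda>T. SUP f\<in>B. cmod (T f))"
  unfolding seminorm_on_def
proof (intro conjI ballI allI)
  fix S assume S: "S \<in> V"
  obtain b where b: "b \<in> B" using assms by blast
  show "0 \<le> (SUP f\<in>B. cmod (S f))"
    using cSUP_upper[OF b bdd[OF S]] by (meson norm_ge_zero order_trans)
  show "(SUP f\<in>B. cmod (S f + T f)) \<le> (SUP f\<in>B. cmod (S f)) + (SUP f\<in>B. cmod (T f))" if T: "T \<in> V" for T
    using assms(1) cSUP_upper[OF _ bdd[OF S]] cSUP_upper[OF _ bdd[OF T]]
    by (intro cSUP_least) (auto intro!: norm_triangle_le add_mono)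
  fix c
  show "(SUP f\<in>B. cmod (c * S f)) = cmod c * (SUP f\<in>B. cmod (S f))"
  proof (cases "c = 0")
    case True
    then show ?thesis using assms(1) by simp
  next
    case False
    show ?thesis
    proof (rule antisym)
      show "(SUP f\<in>B. cmod (c * S f)) \<le> cmod c * (SUP f\<in>B. cmod (S f))"
        using assms(1) cSUP_upper[OF _ bdd[OF S]]
        by (intro cSUP_least) (auto simp: norm_mult intro!: mult_left_mono)
      obtain M where M: "\<And>f. f \<in> B \<Longrightarrow> cmod (S f) \<le> M" using bdd[OF S] unfolding bdd_above_def by auto
      have bc: "bdd_above ((\<lambda>f. cmod (c * S f)) ` B)"
        using M by (intro bdd_aboveI[of _ "cmod c * M"]) (auto simp: norm_mult intro!: mult_left_mono)
      have "(SUP f\<in>B. cmod (S f)) \<le> (SUP f\<in>B. cmod (c * S f)) / cmod c"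
      proof (rule cSUP_least[OF assms(1)])
        fix f assume "f \<in> B"
        from cSUP_upper[OF this bc] show "cmod (S f) \<le> (SUP f\<in>B. cmod (c * S f)) / cmod c"
          using False by (simp add: field_simps norm_mult)
      qed
      then show "cmod c * (SUP f\<in>B. cmod (S f)) \<le> (SUP f\<in>B. cmod (c * S f))"
        using False by (simp add: field_simps)
    qed
  qed
qed

lemma bounded_in_zero: "function_subspace (topspace X) \<Longrightarrow> bounded_in X {\<lambda>_. 0}"
  unfolding bounded_in_def
  by (auto simp: function_subspaceD(1) intro!: exI[of _ 1] image_eqI[of _ _ "\<lambda>_. 0"])

lemma seminorm_family_strong_dual:
  assumes X: "function_subspace (topspace X)"
  shows "seminorm_family (dual_space X) (polar_seminorms X)"
  unfolding seminorm_family_def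
proof (intro conjI ballI)
  show "polar_seminorms X \<noteq> {}"
    unfolding polar_seminorms_def using bounded_in_zero[OF X] by blast
  fix p assume "p \<in> polar_seminorms X"
  then obtain B where "p = (\<lambda>T. SUP f\<in>B. cmod (T f))" "bounded_in X B" "B \<noteq> {}"
    unfolding polar_seminorms_def by blast
  then show "seminorm_on (dual_space X) p"
    by (simp only:) (rule seminorm_on_SUP, simp, rule dual_space_bounded[OF _ _ X])
qed (rule function_subspace_dual_space)

section \<open>Transposed maps\<close>

lemma bounded_in_image:
  assumes B: "bounded_in Y B" and k: "continuous_map Y X k" and X: "function_subspace (topspace X)"
    and lin: "linear_map_on (topspace Y) k" and Y: "function_subspace (topspace Y)"
  shows "bounded_in X (k ` B)"
  unfolding bounded_in_def
proof (intro conjI allI impI)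
  show "k ` B \<subseteq> topspace X"
    using B k unfolding bounded_in_def continuous_map_def by auto
  fix U assume U: "openin X U \<and> (\<lambda>_. 0) \<in> U"
  have k0: "k (\<lambda>_. 0) = (\<lambda>_. 0)"
    using linear_map_onD(2)[OF lin function_subspaceD(1)[OF Y], of 0] by simp
  have "openin Y {u \<in> topspace Y. k u \<in> U}" using k U unfolding continuous_map_def by blast
  moreover have "(\<lambda>_. 0) \<in> {u \<in> topspace Y. k u \<in> U}" using U k0 function_subspaceD(1)[OF Y] by simp
  ultimately obtain r where r: "0 < r" "\<And>c. r \<le> cmod c \<Longrightarrow> B \<subseteq> (\<lambda>f x. c * f x) ` {u \<in> topspace Y. k u \<in> U}"
    using B unfolding bounded_in_def by blast
  show "\<exists>r>0. \<forall>c. r \<le> cmod c \<longrightarrow> k ` B \<subseteq> (\<lambda>f x. c * f x) ` U"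
  proof (intro exI[of _ r] conjI allI impI r(1) image_subsetI)
    fix c f assume "r \<le> cmod c" "f \<in> B"
    then obtain u where u: "u \<in> topspace Y" "k u \<in> U" "f = (\<lambda>x. c * u x)" using r(2) by blast
    then have "k f = (\<lambda>x. c * k u x)" using linear_map_onD(2)[OF lin] by simp
    then show "k f \<in> (\<lambda>f x. c * f x) ` U" using u(2) by blast
  qed
qed

text \<open>Composition of \<open>T\<close> with \<open>k\<close>, cut off to 0 outside of the
  carrier of \<open>Y\<close> as the representation of functionals demands.\<close>

definition transpose_map ::
  "('j \<Rightarrow> complex) topology \<Rightarrow> (('j \<Rightarrow> complex) \<Rightarrow> ('i \<Rightarrow> complex)) \<Rightarrow>
    (('i \<Rightarrow> complex) \<Rightarrow> complex) \<Rightarrow> ('j \<Rightarrow> complex) \<Rightarrow> complex" where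
  "transpose_map Y k T u = (if u \<in> topspace Y then T (k u) else 0)"

lemma transpose_map_in_dual_space:
  assumes T: "T \<in> dual_space X" and k: "continuous_map Y X k" and lin: "linear_map_on (topspace Y) k"
    and Y: "function_subspace (topspace Y)"
  shows "transpose_map Y k T \<in> dual_space Y"
  unfolding dual_space_iff
proof (intro conjI)
  have kX: "k u \<in> topspace X" if "u \<in> topspace Y" for u
    using k that unfolding continuous_map_def by blast
  have lT: "linear_functional_on (topspace X) T" using T unfolding dual_space_iff by blast
  show "linear_functional_on (topspace Y) (transpose_map Y k T)"
    unfolding linear_functional_on_def transpose_map_def
    using linear_map_onD[OF lin] linear_functional_onD[OF lT] kX function_subspaceD[OF Y] by simp
  have "continuous_map Y euclidean (T \<circ> k)"
    using continuous_map_compose[OF k] T unfolding dual_space_iff by blast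
  then show "continuous_map Y euclidean (transpose_map Y k T)"
    by (rule continuous_map_eq) (simp add: transpose_map_def)
qed (simp add: transpose_map_def)

lemma topological_isomorphism_transpose:
  assumes X: "function_subspace (topspace X)" and Y: "function_subspace (topspace Y)"
    and hk: "homeomorphic_maps X Y h k"
    and lh: "linear_map_on (topspace X) h" and lk: "linear_map_on (topspace Y) k"
  shows "topological_isomorphism (strong_dual X) (strong_dual Y) (transpose_map Y k)"
proof -
  have h: "continuous_map X Y h" and k: "continuous_map Y X k"
    and hkid: "\<And>f. f \<in> topspace X \<Longrightarrow> k (h f) = f" "\<And>u. u \<in> topspace Y \<Longrightarrow> h (k u) = u"
    using hk unfolding homeomorphic_maps_def by auto
  have hY: "f \<in> topspace X \<Longrightarrow> h f \<in> topspace Y" and kX: "u \<in> topspace Y \<Longrightarrow> k u \<in> topspace X" for f u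
    using h k unfolding continuous_map_def by auto
  \<comment> \<open>Stated for arbitrary spaces and maps, because it is used for \<open>k\<close>
    and for its inverse \<open>h\<close>, with \<open>X\<close> and \<open>Y\<close>
    exchanged.\<close>
  have dom: "dominated_on (dual_space X) (polar_seminorms X) (\<lambda>T. q (transpose_map Y k T))"
    if q: "q \<in> polar_seminorms Y" and X: "function_subspace (topspace X)"
      and Y: "function_subspace (topspace Y)" and k: "continuous_map Y X k" and lk: "linear_map_on (topspace Y) k"
    for X :: "('m \<Rightarrow> complex) topology" and Y :: "('n \<Rightarrow> complex) topology" and k q
  proof -
    obtain B where B: "q = (\<lambda>T. SUP f\<in>B. cmod (T f))" "bounded_in Y B" "B \<noteq> {}"
      using q unfolding polar_seminorms_def by blast
    have BY: "B \<subseteq> topspace Y" using B unfolding bounded_in_def by blast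
    have "(\<lambda>T. SUP f\<in>k ` B. cmod (T f)) \<in> polar_seminorms X"
      unfolding polar_seminorms_def using bounded_in_image[OF B(2) k X lk Y] B(3) by blast
    moreover have "q (transpose_map Y k T) = (SUP f\<in>k ` B. cmod (T f))" for T
      unfolding B(1) image_image by (intro SUP_cong refl) (use BY in \<open>auto simp: transpose_map_def\<close>)
    ultimately show ?thesis by (intro dominated_onI[where C = 1]) auto
  qed
  show ?thesis
    unfolding strong_dual_eq
  proof (rule topological_isomorphism_seminormI[OF seminorm_family_strong_dual[OF X] seminorm_family_strong_dual[OF Y],
        where k = "transpose_map X h"])
    show "linear_map_on (dual_space X) (transpose_map Y k)"
      unfolding linear_map_on_def transpose_map_def by auto
    show "transpose_map Y k \<in> dual_space X \<rightarrow> dual_space Y"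
      using transpose_map_in_dual_space[OF _ k lk Y] by blast
    show "transpose_map X h \<in> dual_space Y \<rightarrow> dual_space X"
      using transpose_map_in_dual_space[OF _ h lh X] by blast
    show "transpose_map X h (transpose_map Y k T) = T" if "T \<in> dual_space X" for T
      using that hkid(1) hY unfolding transpose_map_def dual_space_iff by auto
    show "transpose_map Y k (transpose_map X h S) = S" if "S \<in> dual_space Y" for S
      using that hkid(2) kX unfolding transpose_map_def dual_space_iff by auto
  qed (use dom X Y h k lh lk in auto)
qed

section \<open>The sequence spaces and their duality\<close>

lemma finite_mi_abs_le: "finite {n :: nat ^ 'd::finite. mi_abs n \<le> N}"
proof (rule finite_subset)
  show "{n :: nat ^ 'd. mi_abs n \<le> N} \<subseteq> vec_lambda ` (UNIV \<rightarrow>\<^sub>E {..N})"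
  proof
    fix n :: "nat ^ 'd" assume n: "n \<in> {n. mi_abs n \<le> N}"
    have "n $ l \<le> N" for l
      using member_le_sum[of l UNIV "($) n"] n unfolding mi_abs_def by simp
    then show "n \<in> vec_lambda ` (UNIV \<rightarrow>\<^sub>E {..N})"
      by (intro image_eqI[of _ _ "($) n"]) (auto simp: vec_nth_inverse)
  qed
qed (auto intro!: finite_PiE)

lemma s_weight_pos: "0 < a \<Longrightarrow> 0 < s_weight \<alpha> a n"
  unfolding s_weight_def by simp

lemma s_weight_nonneg: "0 \<le> s_weight \<alpha> a n"
  unfolding s_weight_def by simp

lemma s_weight_ge_1: "1 < a \<Longrightarrow> 1 \<le> s_weight \<alpha> a n"
  unfolding s_weight_def by (intro ge_one_powr_ge_zero) auto

lemma s_weight_mono: "0 < a \<Longrightarrow> a \<le> b \<Longrightarrow> s_weight \<alpha> a n \<le> s_weight \<alpha> b n"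
  unfolding s_weight_def by (intro powr_mono2) auto

definition s_norm :: "real \<Rightarrow> real \<Rightarrow> (nat ^ 'd::finite \<Rightarrow> complex) \<Rightarrow> real" where
  "s_norm \<alpha> a u = (SUP n. cmod (u n) * s_weight \<alpha> a n)"

definition s_carrier :: "real \<Rightarrow> real \<Rightarrow> (nat ^ 'd::finite \<Rightarrow> complex) set" where
  "s_carrier \<alpha> a = {u. bdd_above (range (\<lambda>n. cmod (u n) * s_weight \<alpha> a n))}"

lemma s_step_eq: "s_step \<alpha> a = seminorm_topology (s_carrier \<alpha> a) {s_norm \<alpha> a}"
  unfolding s_step_def s_carrier_def s_norm_def[abs_def] by simp

lemma s_carrierI: "(\<And>n. cmod (u n) * s_weight \<alpha> a n \<le> M) \<Longrightarrow> u \<in> s_carrier \<alpha> a"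
  unfolding s_carrier_def by (auto intro!: bdd_aboveI[of _ M])

lemma s_norm_upper: "u \<in> s_carrier \<alpha> a \<Longrightarrow> cmod (u n) * s_weight \<alpha> a n \<le> s_norm \<alpha> a u"
  unfolding s_carrier_def s_norm_def by (auto intro!: cSUP_upper)

lemma s_norm_bound:
  assumes "u \<in> s_carrier \<alpha> a" "1 < a"
  shows "cmod (u n) \<le> s_norm \<alpha> a u / s_weight \<alpha> a n"
  using s_norm_upper[OF assms(1), of n] s_weight_pos[of a \<alpha> n] assms(2) by (simp add: field_simps)

lemma s_norm_least: "(\<And>n. cmod (u n) * s_weight \<alpha> a n \<le> M) \<Longrightarrow> s_norm \<alpha> a u \<le> M"
  unfolding s_norm_def by (auto intro!: cSUP_least)

lemma s_norm_nonneg: "1 < a \<Longrightarrow> u \<in> s_carrier \<alpha> a \<Longrightarrow> 0 \<le> s_norm \<alpha> a u"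
  using s_norm_upper[of u \<alpha> a undefined] s_weight_pos[of a \<alpha> undefined]
  by (meson mult_nonneg_nonneg norm_ge_zero order_trans less_imp_le zero_less_one less_trans)

lemma function_subspace_s_carrier:
  assumes "1 < a"
  shows "function_subspace (s_carrier \<alpha> a)"
  unfolding function_subspace_def
proof (intro conjI ballI allI)
  show "(\<lambda>_. 0) \<in> s_carrier \<alpha> a" by (rule s_carrierI[of _ _ _ 0]) simp
  fix u v :: "nat ^ 'd \<Rightarrow> complex" assume uv: "u \<in> s_carrier \<alpha> a" "v \<in> s_carrier \<alpha> a"
  show "(\<lambda>n. u n + v n) \<in> s_carrier \<alpha> a"
  proof (rule s_carrierI[of _ _ _ "s_norm \<alpha> a u + s_norm \<alpha> a v"])
    fix n
    have "cmod (u n + v n) * s_weight \<alpha> a n \<le> (cmod (u n) + cmod (v n)) * s_weight \<alpha> a n"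
      using s_weight_pos[of a \<alpha> n] assms by (intro mult_right_mono norm_triangle_ineq) auto
    then show "cmod (u n + v n) * s_weight \<alpha> a n \<le> s_norm \<alpha> a u + s_norm \<alpha> a v"
      using s_norm_upper[OF uv(1), of n] s_norm_upper[OF uv(2), of n] by (simp add: distrib_right)
  qed
next
  fix c and u :: "nat ^ 'd \<Rightarrow> complex" assume u: "u \<in> s_carrier \<alpha> a"
  show "(\<lambda>n. c * u n) \<in> s_carrier \<alpha> a"
    using s_norm_upper[OF u] by (intro s_carrierI[of _ _ _ "cmod c * s_norm \<alpha> a u"])
      (auto simp: norm_mult mult.assoc intro!: mult_left_mono)
qed

text \<open>The weight is absorbed into the sequence \<open>u n * r n\<close>, which reduces the
  claim to a supremum of moduli.\<close>

lemma SUP_cmod_weight: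
  fixes r :: "'n \<Rightarrow> real"
  assumes r: "\<And>n. 0 \<le> r n" and bdd: "\<And>u. u \<in> V \<Longrightarrow> bdd_above (range (\<lambda>n. cmod (u n) * r n))"
  shows "seminorm_on V (\<lambda>u. SUP n. cmod (u n) * r n)"
proof -
  have "seminorm_on V (\<lambda>u. SUP T\<in>range (\<lambda>n u. u n * complex_of_real (r n)). cmod (T u))"
    unfolding seminorm_on_def
  proof -
    let ?B = "range (\<lambda>n (u :: 'n \<Rightarrow> complex). u n * complex_of_real (r n))"
    define ev where "ev u = (\<lambda>T. T u)" for u :: "'n \<Rightarrow> complex" and T :: "('n \<Rightarrow> complex) \<Rightarrow> complex"
    show "(\<forall>f\<in>V. 0 \<le> (SUP T\<in>?B. cmod (T f))) \<and>
      (\<forall>f\<in>V. \<forall>g\<in>V. (SUP T\<in>?B. cmod (T (\<lambda>x. f x + g x))) \<le> (SUP T\<in>?B. cmod (T f)) + (SUP T\<in>?B. cmod (T g))) \<and>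
      (\<forall>c. \<forall>f\<in>V. (SUP T\<in>?B. cmod (T (\<lambda>x. c * f x))) = cmod c * (SUP T\<in>?B. cmod (T f)))"
    proof -
      have "seminorm_on ((\<lambda>f n. f n * complex_of_real (r n)) ` V) (\<lambda>T. SUP n\<in>UNIV. cmod (T n))"
        by (rule seminorm_on_SUP) (use bdd r in \<open>auto simp: norm_mult\<close>)
      then show ?thesis
        unfolding seminorm_on_def image_image by (auto simp: algebra_simps)
    qed
  qed
  then show ?thesis using r by (simp add: image_image norm_mult)
qed

lemma seminorm_family_s_step:
  assumes "1 < a"
  shows "seminorm_family (s_carrier \<alpha> a) {s_norm \<alpha> a}"
proof -
  have "seminorm_on (s_carrier \<alpha> a) (s_norm \<alpha> a)"
    unfolding s_norm_def[abs_def]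
    by (rule SUP_cmod_weight) (auto simp: s_carrier_def s_weight_nonneg)
  then show ?thesis
    unfolding seminorm_family_def by (simp add: function_subspace_s_carrier[OF assms])
qed

lemma s_carrier_antimono:
  assumes "1 < a" "a \<le> b"
  shows "s_carrier \<alpha> b \<subseteq> s_carrier \<alpha> a"
proof
  fix u :: "nat ^ 'd \<Rightarrow> complex" assume u: "u \<in> s_carrier \<alpha> b"
  show "u \<in> s_carrier \<alpha> a"
    using order_trans[OF mult_left_mono[OF s_weight_mono[OF _ assms(2)] norm_ge_zero] s_norm_upper[OF u]] assms(1)
    by (intro s_carrierI[of _ _ _ "s_norm \<alpha> b u"]) simp
qed

abbreviation s_union :: "real \<Rightarrow> (nat ^ 'd::finite \<Rightarrow> complex) set" where
  "s_union \<alpha> \<equiv> (\<Union>a\<in>{1<..}. s_carrier \<alpha> a)"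

text \<open>Formulated with directedness, since the steps of \<open>s_space\<close> shrink and those
  of \<open>G_space\<close> grow with the parameter.\<close>

lemma function_subspace_UN_antimono:
  fixes V :: "real \<Rightarrow> ('i \<Rightarrow> complex) set"
  assumes V: "\<And>a. a \<in> I \<Longrightarrow> function_subspace (V a)" and "I \<noteq> {}"
    and directed: "\<And>a b. a \<in> I \<Longrightarrow> b \<in> I \<Longrightarrow> \<exists>c\<in>I. V a \<union> V b \<subseteq> V c"
  shows "function_subspace (\<Union>a\<in>I. V a)"
  unfolding function_subspace_def
proof (intro conjI ballI allI)
  show "(\<lambda>_. 0) \<in> (\<Union>a\<in>I. V a)" using function_subspaceD(1)[OF V] \<open>I \<noteq> {}\<close> by blast
  fix f assume f: "f \<in> (\<Union>a\<in>I. V a)"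
  show "(\<lambda>x. c * f x) \<in> (\<Union>a\<in>I. V a)" for c using function_subspaceD(3)[OF V] f by blast
  fix g assume g: "g \<in> (\<Union>a\<in>I. V a)"
  obtain a b where "a \<in> I" "b \<in> I" "f \<in> V a" "g \<in> V b" using f g by blast
  moreover from this obtain c where "c \<in> I" "V a \<union> V b \<subseteq> V c" using directed by metis
  ultimately have "c \<in> I" "f \<in> V c" "g \<in> V c" by auto
  then show "(\<lambda>x. f x + g x) \<in> (\<Union>a\<in>I. V a)" using function_subspaceD(2)[OF V] by blast
qed

lemma function_subspace_s_union: "function_subspace (s_union \<alpha>)"
proof (rule function_subspace_UN_antimono)
  fix a b :: real assume "a \<in> {1<..}" "b \<in> {1<..}"
  then have "s_carrier \<alpha> a \<union> s_carrier \<alpha> b \<subseteq> s_carrier \<alpha> (min a b)" "min a b \<in> {1<..}"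
    using s_carrier_antimono[of "min a b" a \<alpha>] s_carrier_antimono[of "min a b" b \<alpha>] by auto
  then show "\<exists>c\<in>{1<..}. s_carrier \<alpha> a \<union> s_carrier \<alpha> b \<subseteq> s_carrier \<alpha> c" by blast
qed (auto simp: function_subspace_s_carrier)

definition s_seminorms :: "real \<Rightarrow> ((nat ^ 'd::finite \<Rightarrow> complex) \<Rightarrow> real) set" where
  "s_seminorms \<alpha> = lc_seminorms {1<..} (s_carrier \<alpha>) (\<lambda>a. {s_norm \<alpha> a})"

lemma s_space_eq: "s_space \<alpha> = seminorm_topology (s_union \<alpha>) (s_seminorms \<alpha>)"
  unfolding s_space_def s_seminorms_def
  by (subst lc_inductive_limit_seminorm_topology[symmetric])
     (simp_all add: seminorm_family_s_step s_step_eq[abs_def])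

lemma seminorm_family_s_space: "seminorm_family (s_union \<alpha>) (s_seminorms \<alpha>)"
  unfolding s_seminorms_def by (rule seminorm_family_lc_seminorms[OF function_subspace_s_union])

lemma topspace_s_space: "topspace (s_space \<alpha>) = s_union \<alpha>"
  unfolding s_space_eq by (rule seminorm_familyD(4)[OF seminorm_family_s_space])

lemma dominated_on_singleton:
  "dominated_on V {p} q \<longleftrightarrow> (\<exists>C\<ge>0. \<forall>f\<in>V. q f \<le> C * p f)"
    if "\<And>f. f \<in> V \<Longrightarrow> 0 \<le> p f"
proof
  assume "dominated_on V {p} q"
  then obtain F C where F: "F \<subseteq> {p}" "0 \<le> C" "\<And>f. f \<in> V \<Longrightarrow> q f \<le> C * (\<Sum>p\<in>F. p f)"
    unfolding dominated_on_def by blast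
  have "F = {} \<or> F = {p}" using F(1) by blast
  then have "q f \<le> C * p f" if f: "f \<in> V" for f
    using F(3)[OF f] mult_nonneg_nonneg[OF F(2) \<open>\<And>f. f \<in> V \<Longrightarrow> 0 \<le> p f\<close>[OF f]] by auto
  then show "\<exists>C\<ge>0. \<forall>f\<in>V. q f \<le> C * p f" using F(2) by blast
qed (auto intro!: dominated_onI)

lemma s_dominatedI:
  assumes "0 \<le> C" "\<And>u. u \<in> s_carrier \<alpha> a \<Longrightarrow> q u \<le> C * s_norm \<alpha> a u"
  shows "dominated_on (s_carrier \<alpha> a) {s_norm \<alpha> a} q"
  using assms by (intro dominated_onI[where p = "s_norm \<alpha> a"]) auto

lemma s_dominatedD:
  assumes "dominated_on (s_carrier \<alpha> a) {s_norm \<alpha> a} q" "1 < a"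
  obtains C where "0 \<le> C" "\<And>u. u \<in> s_carrier \<alpha> a \<Longrightarrow> q u \<le> C * s_norm \<alpha> a u"
  using assms dominated_on_singleton[of "s_carrier \<alpha> a" "s_norm \<alpha> a" q] s_norm_nonneg by blast

text \<open>Regularity of the inductive limit. If \<open>B\<close> were unbounded in every step,
  there would be entries, at indices tending to infinity, that witness this for parameters
  decreasing to 1. A weight \<open>r\<close> supported at these indices can be chosen below a
  multiple of every \<open>s_weight \<alpha> a\<close> and yet so large that the weighted entries
  are unbounded. Its supremum is a continuous seminorm, which must be bounded on \<open>B\<close>: a
  contradiction.\<close>

lemma s_bounded_step:
  fixes B :: "(nat ^ 'd::finite \<Rightarrow> complex) set"
  assumes B: "bounded_in (s_space \<alpha>) B"
  obtains a M where "1 < a" "0 \<le> M" "\<And>u n. u \<in> B \<Longrightarrow> cmod (u n) * s_weight \<alpha> a n \<le> M"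
proof (rule ccontr)
  assume "\<not> thesis"
  then have neg: "\<exists>u\<in>B. \<exists>n. M < cmod (u n) * s_weight \<alpha> a n" if "1 < a" "0 \<le> M" for a M
    using that \<open>\<And>M a. \<lbrakk>1 < a; 0 \<le> M; \<And>u n. u \<in> B \<Longrightarrow> cmod (u n) * s_weight \<alpha> a n \<le> M\<rbrakk> \<Longrightarrow> thesis\<close>
    by (meson not_le)
  have BW: "B \<subseteq> s_union \<alpha>" using B unfolding bounded_in_def topspace_s_space by blast
  have "B \<subseteq> s_union \<alpha> \<and> (\<forall>p\<in>s_seminorms \<alpha>. bdd_above (p ` B))"
    using B unfolding s_space_eq bounded_in_seminorm_topology_iff[OF seminorm_family_s_space] .
  from bspec[OF conjunct2[OF this]]
  have bdd: "bdd_above (p ` B)" if "p \<in> s_seminorms \<alpha>" for p using that by this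
  \<comment> \<open>The constant \<open>C\<close> may depend on \<open>a\<close>, because domination
    is required on each step separately.\<close>
  have semi: "(\<lambda>u. SUP n. cmod (u n) * r n) \<in> s_seminorms \<alpha> \<and>
      (\<forall>u\<in>s_union \<alpha>. \<forall>n. cmod (u n) * r n \<le> (SUP n. cmod (u n) * r n))"
    if r0: "\<And>n. 0 \<le> r n" and r: "\<And>a. 1 < a \<Longrightarrow> \<exists>C\<ge>0. \<forall>n. r n \<le> C * s_weight \<alpha> a n"
    for r :: "nat ^ 'd \<Rightarrow> real"
  proof -
    have bd: "\<exists>C\<ge>0. \<forall>u\<in>s_carrier \<alpha> a. \<forall>n. cmod (u n) * r n \<le> C * s_norm \<alpha> a u" if a: "1 < a" for a
    proof -
      obtain C where C: "0 \<le> C" "\<And>n. r n \<le> C * s_weight \<alpha> a n" using r[OF a] by blast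
      have "cmod (u n) * r n \<le> C * s_norm \<alpha> a u" if u: "u \<in> s_carrier \<alpha> a" for u n
        using mult_left_mono[OF C(2)[of n] norm_ge_zero[of "u n"]] mult_left_mono[OF s_norm_upper[OF u, of n] C(1)]
        by (simp add: algebra_simps)
      then show ?thesis using C(1) by blast
    qed
    have bdu: "bdd_above (range (\<lambda>n. cmod (u n) * r n))" if u: "u \<in> s_union \<alpha>" for u
    proof -
      obtain a where "1 < a" "u \<in> s_carrier \<alpha> a" using u by auto
      with bd obtain C where "\<And>n. cmod (u n) * r n \<le> C * s_norm \<alpha> a u" by blast
      then show ?thesis by (intro bdd_aboveI[of _ "C * s_norm \<alpha> a u"]) auto
    qed
    have "dominated_on (s_carrier \<alpha> a) {s_norm \<alpha> a} (\<lambda>u. SUP n. cmod (u n) * r n)" if a: "1 < a" for a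
    proof -
      obtain C where C: "0 \<le> C" "\<And>u n. u \<in> s_carrier \<alpha> a \<Longrightarrow> cmod (u n) * r n \<le> C * s_norm \<alpha> a u"
        using bd[OF a] by blast
      show ?thesis using C by (intro s_dominatedI[OF C(1)] cSUP_least) auto
    qed
    then have "(\<lambda>u. SUP n. cmod (u n) * r n) \<in> s_seminorms \<alpha>"
      unfolding s_seminorms_def lc_seminorms_def using SUP_cmod_weight[of r "s_union \<alpha>", OF r0 bdu] by auto
    then show ?thesis using cSUP_upper[OF UNIV_I bdu] by blast
  qed
  \<comment> \<open>With the indicator of one index as weight, \<open>B\<close> is seen to be
    bounded entrywise. Hence finitely many indices cannot be responsible for unboundedness.\<close>
  have point: "\<exists>M\<ge>0. \<forall>u\<in>B. cmod (u n) \<le> M" for n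
  proof -
    define r where "r m = (if m = n then 1 else 0 :: real)" for m
    have r0: "0 \<le> r m" for m by (simp add: r_def)
    have r1: "\<exists>C\<ge>0. \<forall>m. r m \<le> C * s_weight \<alpha> a m" if "1 < a" for a
      using that by (intro exI[of _ 1]) (auto simp: r_def s_weight_ge_1 s_weight_nonneg)
    have s: "(\<lambda>u. SUP m. cmod (u m) * r m) \<in> s_seminorms \<alpha>"
        "\<And>u. u \<in> s_union \<alpha> \<Longrightarrow> cmod (u n) * r n \<le> (SUP m. cmod (u m) * r m)"
      using semi[of r, OF r0 r1] by blast+
    obtain M where "\<And>u. u \<in> B \<Longrightarrow> (SUP m. cmod (u m) * r m) \<le> M"
      using bdd[OF s(1)] unfolding bdd_above_def by auto
    then have "\<forall>u\<in>B. cmod (u n) \<le> \<bar>M\<bar>" using s(2) BW by (fastforce simp: r_def)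
    then show ?thesis by (intro exI[of _ "\<bar>M\<bar>"]) simp
  qed
  \<comment> \<open>Parameters tending to 1; the common bound 2 gives the estimate \<open>L\<close>
    on the finitely many indices with \<open>mi_abs n \<le> k\<close>.\<close>
  define ak where "ak k = 1 + 1 / real (Suc k)" for k
  have ak: "1 < ak k" "ak k \<le> 2" for k unfolding ak_def by auto
  have "\<exists>n u. u \<in> B \<and> k < mi_abs n \<and> real k < cmod (u n) * s_weight \<alpha> (ak k) n" for k
  proof -
    obtain M where M: "\<And>n. 0 \<le> M n" "\<And>n u. u \<in> B \<Longrightarrow> cmod (u n) \<le> M n" using point by metis
    define L where "L = (\<Sum>n\<in>{n :: nat ^ 'd. mi_abs n \<le> k}. M n * s_weight \<alpha> 2 n)"
    have L: "cmod (u n) * s_weight \<alpha> (ak k) n \<le> L" if n: "mi_abs n \<le> k" and u: "u \<in> B" for n u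
    proof -
      have "cmod (u n) * s_weight \<alpha> (ak k) n \<le> M n * s_weight \<alpha> 2 n"
        using M(1) M(2)[OF u] s_weight_mono[of "ak k" 2 \<alpha> n] ak[of k] s_weight_pos[of "ak k" \<alpha> n]
        by (intro mult_mono) auto
      also have "\<dots> \<le> L"
        unfolding L_def using M(1)
        by (intro member_le_sum finite_mi_abs_le) (use n in \<open>auto simp: s_weight_nonneg\<close>)
      finally show ?thesis .
    qed
    obtain u n where un: "u \<in> B" "max (real k) L < cmod (u n) * s_weight \<alpha> (ak k) n"
      using neg[OF ak(1), of "max (real k) L" k] by (auto simp: max.coboundedI1)
    then have "k < mi_abs n" using L[of n u] by (cases "mi_abs n \<le> k") auto
    then show ?thesis using un by auto
  qed
  then obtain nk uk where nk: "\<And>k. uk k \<in> B" "\<And>k. k < mi_abs (nk k)"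
      "\<And>k. real k < cmod (uk k (nk k)) * s_weight \<alpha> (ak k) (nk k)"
    by metis
  \<comment> \<open>An index may occur as \<open>nk k\<close> for several \<open>k\<close>, but only
    for \<open>k < mi_abs n\<close>. The largest of them is used for the weight, so that
    \<open>K (nk j)\<close> tends to infinity with \<open>j\<close>.\<close>
  have finK: "finite {k. nk k = n}" for n
    by (rule finite_subset[of _ "{..mi_abs n}"]) (use nk(2) in \<open>auto simp: less_imp_le\<close>)
  define K where "K n = Max {k. nk k = n}" for n
  have K: "nk (K (nk j)) = nk j" "j \<le> K (nk j)" for j
    unfolding K_def using Max_in[OF finK[of "nk j"]] Max_ge[OF finK[of "nk j"], of j] by auto
  define r where "r n = (if n \<in> range nk then s_weight \<alpha> (ak (K n)) n else 0)" for n
  have r0: "0 \<le> r n" for n using s_weight_pos[of "ak (K n)" \<alpha> n] ak(1)[of "K n"] by (simp add: r_def)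
  have r1: "\<exists>C\<ge>0. \<forall>n. r n \<le> C * s_weight \<alpha> a n" if a: "1 < a" for a
  proof -
    obtain N where N: "1 / real (Suc N) < a - 1" using a by (metis diff_gt_0_iff_gt nat_approx_posE)
    \<comment> \<open>Indices with \<open>K n \<ge> N\<close> have \<open>ak (K n) \<le> a\<close>;
      the finitely many others are paid for by the sum.\<close>
    define C where "C = 1 + (\<Sum>k\<le>N. s_weight \<alpha> 2 (nk k))"
    have wpos: "0 \<le> s_weight \<alpha> 2 n" for n :: "nat ^ 'd" using s_weight_pos[of 2 \<alpha> n] by simp
    have C: "1 \<le> C" unfolding C_def using wpos by (simp add: sum_nonneg)
    have "r n \<le> C * s_weight \<alpha> a n" for n
    proof (cases "n \<in> range nk")
      case False
      then show ?thesis using C s_weight_pos[of a \<alpha> n] a by (simp add: r_def)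
    next
      case True
      then obtain j where j: "n = nk j" by blast
      show ?thesis
      proof (cases "N \<le> K n")
        case True
        then have "1 / real (Suc (K n)) \<le> 1 / real (Suc N)" by (intro divide_left_mono) auto
        then have "ak (K n) \<le> a" using N by (simp add: ak_def)
        then have "r n \<le> 1 * s_weight \<alpha> a n"
          using s_weight_mono[of "ak (K n)" a \<alpha> n] ak(1)[of "K n"] j by (simp add: r_def)
        also have "\<dots> \<le> C * s_weight \<alpha> a n" using C s_weight_pos[of a \<alpha> n] a by (intro mult_right_mono) auto
        finally show ?thesis .
      next
        case False
        have "r n \<le> s_weight \<alpha> 2 (nk (K n))"
          using s_weight_mono[of "ak (K n)" 2 \<alpha> n] ak[of "K n"] j K(1)[of j] by (simp add: r_def)
        also have "\<dots> \<le> (\<Sum>k\<le>N. s_weight \<alpha> 2 (nk k))"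
          using False wpos by (intro member_le_sum) auto
        also have "\<dots> \<le> C * 1" by (simp add: C_def)
        also have "\<dots> \<le> C * s_weight \<alpha> a n" using C s_weight_ge_1[OF a, of \<alpha> n] by (intro mult_left_mono) auto
        finally show ?thesis .
      qed
    qed
    then show ?thesis using C by (intro exI[of _ C]) auto
  qed
  have s: "(\<lambda>u. SUP n. cmod (u n) * r n) \<in> s_seminorms \<alpha>"
      "\<And>u n. u \<in> s_union \<alpha> \<Longrightarrow> cmod (u n) * r n \<le> (SUP n. cmod (u n) * r n)"
    using semi[of r, OF r0 r1] by blast+
  obtain M where M: "\<And>u. u \<in> B \<Longrightarrow> (SUP n. cmod (u n) * r n) \<le> M"
    using bdd[OF s(1)] unfolding bdd_above_def by auto
  obtain j where j: "M < real j" using reals_Archimedean2 by blast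
  let ?k = "K (nk j)"
  have "real ?k < cmod (uk ?k (nk j)) * r (nk j)"
    using nk(3)[of ?k] K(1)[of j] by (simp add: r_def)
  also have "\<dots> \<le> M" using s(2)[of "uk ?k" "nk j"] M[OF nk(1)[of ?k]] BW nk(1)[of ?k] by force
  finally show False using j K(2)[of j] by simp
qed

section \<open>Functionals on inductive limits\<close>

lemma dominated_on_trans:
  assumes q: "dominated_on V P q" and U: "U \<subseteq> V" and Q: "seminorm_family U Q"
    and d: "\<And>p. p \<in> P \<Longrightarrow> dominated_on U Q p"
  shows "dominated_on U Q q"
proof -
  obtain F C where F: "finite F" "F \<subseteq> P" "0 \<le> C" "\<And>f. f \<in> V \<Longrightarrow> q f \<le> C * (\<Sum>p\<in>F. p f)"
    using q unfolding dominated_on_def by blast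
  have "\<forall>p\<in>F. \<exists>G D. finite G \<and> G \<subseteq> Q \<and> 0 \<le> D \<and> (\<forall>f\<in>U. p f \<le> D * (\<Sum>p\<in>G. p f))"
    using d F(2) unfolding dominated_on_def by blast
  then obtain G D where G: "\<And>p. p \<in> F \<Longrightarrow> finite (G p) \<and> G p \<subseteq> Q \<and> 0 \<le> D p \<and> (\<forall>f\<in>U. p f \<le> D p * (\<Sum>p\<in>G p. p f))"
    unfolding bchoice_iff by blast
  let ?G = "\<Union>p\<in>F. G p"
  have fin: "finite ?G" and sub: "?G \<subseteq> Q" using F(1) G by auto
  have nn: "0 \<le> p f" if "p \<in> Q" "f \<in> U" for p f
    using seminorm_onD(1)[OF seminorm_familyD(2)[OF Q]] that by blast
  have "q f \<le> (C * (\<Sum>p\<in>F. D p)) * (\<Sum>p\<in>?G. p f)" if f: "f \<in> U" for f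
  proof -
    have "p f \<le> D p * (\<Sum>p\<in>?G. p f)" if p: "p \<in> F" for p
    proof -
      have "(\<Sum>p\<in>G p. p f) \<le> (\<Sum>p\<in>?G. p f)"
        using p sub nn f by (intro sum_mono2[OF fin]) auto
      then show ?thesis using G[OF p] f by (meson mult_left_mono order_trans)
    qed
    then have "(\<Sum>p\<in>F. p f) \<le> (\<Sum>p\<in>F. D p) * (\<Sum>p\<in>?G. p f)"
      unfolding sum_distrib_right by (rule sum_mono)
    then show ?thesis
      using F(3) order_trans[OF F(4) mult_left_mono] U f by (auto simp: mult.assoc)
  qed
  moreover have "0 \<le> C * (\<Sum>p\<in>F. D p)" using F(3) G by (simp add: sum_nonneg)
  ultimately show ?thesis unfolding dominated_on_def using fin sub by blast
qed

text \<open>If \<open>T\<close> is continuous on each step, then \<open>cmod (T f)\<close> is itself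
  one of the seminorms that define the limit topology.\<close>

lemma dual_space_lc_iff:
  assumes V: "function_subspace (\<Union>a\<in>I. V a)" and Q: "\<And>a. a \<in> I \<Longrightarrow> seminorm_family (V a) (Q a)"
  shows "T \<in> dual_space (seminorm_topology (\<Union>a\<in>I. V a) (lc_seminorms I V Q)) \<longleftrightarrow>
    linear_functional_on (\<Union>a\<in>I. V a) T \<and> (\<forall>a\<in>I. dominated_on (V a) (Q a) (\<lambda>f. cmod (T f))) \<and>
    (\<forall>f. f \<notin> (\<Union>a\<in>I. V a) \<longrightarrow> T f = 0)"
proof -
  have "dominated_on (\<Union>a\<in>I. V a) (lc_seminorms I V Q) (\<lambda>f. cmod (T f)) \<longleftrightarrow>
      (\<forall>a\<in>I. dominated_on (V a) (Q a) (\<lambda>f. cmod (T f)))" if T: "linear_functional_on (\<Union>a\<in>I. V a) T"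
  proof
    assume d: "dominated_on (\<Union>a\<in>I. V a) (lc_seminorms I V Q) (\<lambda>f. cmod (T f))"
    show "\<forall>a\<in>I. dominated_on (V a) (Q a) (\<lambda>f. cmod (T f))"
      using dominated_on_trans[OF d _ Q] unfolding lc_seminorms_def by blast
  next
    assume "\<forall>a\<in>I. dominated_on (V a) (Q a) (\<lambda>f. cmod (T f))"
    then have "(\<lambda>f. cmod (T f)) \<in> lc_seminorms I V Q"
      unfolding lc_seminorms_def using seminorm_on_cmod_functional[OF T] by blast
    then show "dominated_on (\<Union>a\<in>I. V a) (lc_seminorms I V Q) (\<lambda>f. cmod (T f))"
      by (intro dominated_onI[where C = 1]) auto
  qed
  then show ?thesis
    unfolding dual_space_seminorm_topology_iff[OF seminorm_family_lc_seminorms[OF V]] by blast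
qed

section \<open>Functionals on the sequence space as sequences\<close>

definition unit_seq :: "'i \<Rightarrow> 'i \<Rightarrow> complex" where
  "unit_seq n m = (if m = n then 1 else 0)"

lemma finite_support_in_s_carrier:
  assumes "finite F" "\<And>n. n \<notin> F \<Longrightarrow> u n = 0"
  shows "u \<in> s_carrier \<alpha> a"
proof (rule s_carrierI[of _ _ _ "\<Sum>n\<in>F. cmod (u n) * s_weight \<alpha> a n"])
  fix n
  show "cmod (u n) * s_weight \<alpha> a n \<le> (\<Sum>n\<in>F. cmod (u n) * s_weight \<alpha> a n)"
    using assms member_le_sum[of n F "\<lambda>n. cmod (u n) * s_weight \<alpha> a n"]
    by (cases "n \<in> F") (auto simp: s_weight_nonneg sum_nonneg)
qed

lemma unit_seq_in_s_carrier: "unit_seq n \<in> s_carrier \<alpha> a"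
  by (rule finite_support_in_s_carrier[of "{n}"]) (auto simp: unit_seq_def)

definition s_dual_carrier :: "real \<Rightarrow> (nat ^ 'd::finite \<Rightarrow> complex) set" where
  "s_dual_carrier \<alpha> = {b. \<forall>a>1. (\<lambda>n. cmod (b n) / s_weight \<alpha> a n) summable_on UNIV}"

definition s_dual_norm :: "real \<Rightarrow> real \<Rightarrow> (nat ^ 'd::finite \<Rightarrow> complex) \<Rightarrow> real" where
  "s_dual_norm \<alpha> a b = (\<Sum>\<^sub>\<infinity>n. cmod (b n) / s_weight \<alpha> a n)"

definition s_dual_seminorms :: "real \<Rightarrow> ((nat ^ 'd::finite \<Rightarrow> complex) \<Rightarrow> real) set" where
  "s_dual_seminorms \<alpha> = {s_dual_norm \<alpha> a | a. 1 < a}"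

lemma s_dual_eq: "s_dual \<alpha> = seminorm_topology (s_dual_carrier \<alpha>) (s_dual_seminorms \<alpha>)"
  unfolding s_dual_def s_dual_carrier_def s_dual_seminorms_def s_dual_norm_def[abs_def] by simp

lemma s_dual_summable: "b \<in> s_dual_carrier \<alpha> \<Longrightarrow> 1 < a \<Longrightarrow> (\<lambda>n. cmod (b n) / s_weight \<alpha> a n) summable_on UNIV"
  unfolding s_dual_carrier_def by blast

lemma seminorm_family_s_dual: "seminorm_family (s_dual_carrier \<alpha>) (s_dual_seminorms \<alpha>)"
proof -
  have add: "(\<lambda>n. cmod (b n + c n) / s_weight \<alpha> a n) summable_on UNIV \<and>
      s_dual_norm \<alpha> a (\<lambda>n. b n + c n) \<le> s_dual_norm \<alpha> a b + s_dual_norm \<alpha> a c"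
    if bc: "b \<in> s_dual_carrier \<alpha>" "c \<in> s_dual_carrier \<alpha>" and a: "1 < a" for a b and c :: "nat ^ 'd \<Rightarrow> complex"
  proof -
    have s: "(\<lambda>n. cmod (b n) / s_weight \<alpha> a n + cmod (c n) / s_weight \<alpha> a n) summable_on UNIV"
      by (intro summable_on_add s_dual_summable bc a)
    have le: "cmod (b n + c n) / s_weight \<alpha> a n \<le> cmod (b n) / s_weight \<alpha> a n + cmod (c n) / s_weight \<alpha> a n" for n
      unfolding add_divide_distrib[symmetric]
      by (intro divide_right_mono norm_triangle_ineq s_weight_nonneg)
    have s': "(\<lambda>n. cmod (b n + c n) / s_weight \<alpha> a n) summable_on UNIV"
      by (rule summable_on_comparison_test[OF s]) (use le in \<open>auto simp: s_weight_nonneg\<close>)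
    moreover have "s_dual_norm \<alpha> a (\<lambda>n. b n + c n) \<le> s_dual_norm \<alpha> a b + s_dual_norm \<alpha> a c"
      unfolding s_dual_norm_def infsum_add[OF s_dual_summable[OF bc(1) a] s_dual_summable[OF bc(2) a], symmetric]
      by (rule infsum_mono[OF s' s le])
    ultimately show ?thesis by blast
  qed
  have scale: "(\<lambda>n. cmod (c * b n) / s_weight \<alpha> a n) summable_on UNIV \<and>
      s_dual_norm \<alpha> a (\<lambda>n. c * b n) = cmod c * s_dual_norm \<alpha> a b"
    if b: "b \<in> s_dual_carrier \<alpha>" and a: "1 < a" for a c and b :: "nat ^ 'd \<Rightarrow> complex"
    using summable_on_cmult_right[OF s_dual_summable[OF b a], of "cmod c"]
      infsum_cmult_right[OF s_dual_summable[OF b a], of "cmod c"]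
    by (simp add: norm_mult s_dual_norm_def)
  have "function_subspace (s_dual_carrier \<alpha> :: (nat ^ 'd \<Rightarrow> complex) set)"
    using add scale unfolding function_subspace_def s_dual_carrier_def by (intro conjI) (simp, blast, blast)
  moreover have "seminorm_on (s_dual_carrier \<alpha>) (s_dual_norm \<alpha> a :: (nat ^ 'd \<Rightarrow> complex) \<Rightarrow> real)" if "1 < a" for a
    using add[OF _ _ that] scale[OF _ that] unfolding seminorm_on_def
    by (auto simp: s_dual_norm_def s_weight_nonneg intro!: infsum_nonneg)
  ultimately show ?thesis
    unfolding seminorm_family_def s_dual_seminorms_def using gt_ex[of "1::real"] by auto
qed

lemma s_pairing_bound:
  fixes b u :: "nat ^ 'd::finite \<Rightarrow> complex"
  assumes b: "b \<in> s_dual_carrier \<alpha>" and a: "1 < a" and u: "\<And>n. cmod (u n) * s_weight \<alpha> a n \<le> M"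
  shows "(\<lambda>n. u n * b n) summable_on UNIV" "cmod (\<Sum>\<^sub>\<infinity>n. u n * b n) \<le> M * s_dual_norm \<alpha> a b"
proof -
  have le: "cmod (u n * b n) \<le> M * (cmod (b n) / s_weight \<alpha> a n)" for n
    using mult_right_mono[OF u[of n], of "cmod (b n) / s_weight \<alpha> a n"] s_weight_pos[of a \<alpha> n] a
    by (simp add: norm_mult)
  have s: "(\<lambda>n. M * (cmod (b n) / s_weight \<alpha> a n)) summable_on UNIV"
    by (intro summable_on_cmult_right s_dual_summable b a)
  have s': "(\<lambda>n. cmod (u n * b n)) summable_on UNIV"
    by (rule summable_on_comparison_test[OF s]) (use le in auto)
  show "(\<lambda>n. u n * b n) summable_on UNIV" by (rule abs_summable_summable[OF s'])
  have "cmod (\<Sum>\<^sub>\<infinity>n. u n * b n) \<le> (\<Sum>\<^sub>\<infinity>n. cmod (u n * b n))" by (rule norm_infsum_bound[OF s'])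
  also have "\<dots> \<le> (\<Sum>\<^sub>\<infinity>n. M * (cmod (b n) / s_weight \<alpha> a n))" by (rule infsum_mono[OF s' s le])
  also have "\<dots> = M * s_dual_norm \<alpha> a b" unfolding s_dual_norm_def by (rule infsum_cmult_right')
  finally show "cmod (\<Sum>\<^sub>\<infinity>n. u n * b n) \<le> M * s_dual_norm \<alpha> a b" .
qed

lemma dual_space_s_space_iff:
  "T \<in> dual_space (s_space \<alpha>) \<longleftrightarrow> linear_functional_on (s_union \<alpha>) T \<and>
     (\<forall>a>1. dominated_on (s_carrier \<alpha> a) {s_norm \<alpha> a} (\<lambda>f. cmod (T f))) \<and> (\<forall>f. f \<notin> s_union \<alpha> \<longrightarrow> T f = 0)"
  unfolding s_space_eq s_seminorms_def
  by (subst dual_space_lc_iff[OF function_subspace_s_union]) (auto simp: seminorm_family_s_step)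

lemma s_pairing_eq: "s_pairing \<alpha> b u = (if u \<in> s_union \<alpha> then (\<Sum>\<^sub>\<infinity>n. u n * b n) else 0)"
  unfolding s_pairing_def topspace_s_space by simp

lemma s_pairing_in_dual_space:
  fixes b :: "nat ^ 'd::finite \<Rightarrow> complex"
  assumes b: "b \<in> s_dual_carrier \<alpha>"
  shows "s_pairing \<alpha> b \<in> dual_space (s_space \<alpha>)"
  unfolding dual_space_s_space_iff
proof (intro conjI allI impI)
  have sum: "(\<lambda>n. u n * b n) summable_on UNIV" if "u \<in> s_union \<alpha>" for u
    using that s_pairing_bound(1)[OF b] s_norm_upper by blast
  show "linear_functional_on (s_union \<alpha>) (s_pairing \<alpha> b)"
    unfolding linear_functional_on_def
  proof (intro conjI ballI allI)
    fix u v :: "nat ^ 'd \<Rightarrow> complex" assume uv: "u \<in> s_union \<alpha>" "v \<in> s_union \<alpha>"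
    show "s_pairing \<alpha> b (\<lambda>x. u x + v x) = s_pairing \<alpha> b u + s_pairing \<alpha> b v"
      using infsum_add[OF sum[OF uv(1)] sum[OF uv(2)]] function_subspaceD(2)[OF function_subspace_s_union uv] uv
      unfolding s_pairing_eq by (simp add: distrib_right)
  next
    fix c and u :: "nat ^ 'd \<Rightarrow> complex" assume u: "u \<in> s_union \<alpha>"
    show "s_pairing \<alpha> b (\<lambda>x. c * u x) = c * s_pairing \<alpha> b u"
      using infsum_cmult_right[OF sum[OF u], of c] function_subspaceD(3)[OF function_subspace_s_union u, of c] u
      unfolding s_pairing_eq by (simp add: mult.assoc)
  qed
  fix a :: real assume a: "1 < a"
  show "dominated_on (s_carrier \<alpha> a) {s_norm \<alpha> a} (\<lambda>f. cmod (s_pairing \<alpha> b f))"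
  proof (rule s_dominatedI)
    show "0 \<le> s_dual_norm \<alpha> a b" unfolding s_dual_norm_def by (intro infsum_nonneg) (simp add: s_weight_nonneg)
    fix u :: "nat ^ 'd \<Rightarrow> complex" assume u: "u \<in> s_carrier \<alpha> a"
    then have "u \<in> s_union \<alpha>" using a by auto
    then show "cmod (s_pairing \<alpha> b u) \<le> s_dual_norm \<alpha> a b * s_norm \<alpha> a u"
      using s_pairing_bound(2)[OF b a s_norm_upper[OF u]] unfolding s_pairing_eq by (simp add: mult.commute)
  qed
qed (simp add: s_pairing_eq)

lemma dual_s_space_finite_support:
  fixes T :: "(nat ^ 'd::finite \<Rightarrow> complex) \<Rightarrow> complex"
  assumes T: "linear_functional_on (s_union \<alpha>) T" and F: "finite F"
  shows "T (\<lambda>m. if m \<in> F then u m else 0) = (\<Sum>n\<in>F. u n * T (unit_seq n))"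
proof -
  have "unit_seq n \<in> s_union \<alpha>" for n :: "nat ^ 'd"
    using unit_seq_in_s_carrier[of n \<alpha> 2] by (auto intro!: bexI[of _ 2])
  then have "T (\<lambda>m. \<Sum>n\<in>F. u n * unit_seq n m) = (\<Sum>n\<in>F. u n * T (unit_seq n))"
    by (intro linear_functional_on_sum[OF function_subspace_s_union T])
  moreover have "(\<lambda>m. \<Sum>n\<in>F. u n * unit_seq n m) = (\<lambda>m. if m \<in> F then u m else 0)"
    using F by (auto simp: unit_seq_def if_distrib fun_eq_iff sum.delta cong: if_cong)
  ultimately show ?thesis by simp
qed

text \<open>On \<open>F\<close> the sequence carries the conjugate phases of
  \<open>T (unit_seq n)\<close> and modulus at most \<open>1 / s_weight \<alpha> a n\<close>, which
  makes all terms nonnegative. Partial sums of the dual norm are therefore values of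
  \<open>T\<close> on the unit ball of a step.\<close>

lemma unit_ball_sum_le:
  fixes T :: "(nat ^ 'd::finite \<Rightarrow> complex) \<Rightarrow> complex"
  assumes T: "linear_functional_on (s_union \<alpha>) T" and F: "finite F" and a: "1 < a"
  obtains u where "\<And>n. cmod (u n) * s_weight \<alpha> a n \<le> 1"
    "T u = complex_of_real (\<Sum>n\<in>F. cmod (T (unit_seq n)) / s_weight \<alpha> a n)"
proof -
  define v where "v n = cnj (sgn (T (unit_seq n))) / complex_of_real (s_weight \<alpha> a n)" for n
  have w: "0 < s_weight \<alpha> a n" for n :: "nat ^ 'd" using s_weight_pos[of a \<alpha> n] a by simp
  show thesis
  proof (rule that[of "\<lambda>m. if m \<in> F then v m else 0"])
    show "cmod (if n \<in> F then v n else 0) * s_weight \<alpha> a n \<le> 1" for n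
      using w[of n] by (simp add: v_def norm_divide norm_sgn)
    have "v n * T (unit_seq n) = complex_of_real (cmod (T (unit_seq n)) / s_weight \<alpha> a n)" for n
    proof -
      have "cnj (sgn z) * z = complex_of_real (cmod z)" for z
        by (simp add: sgn_div_norm scaleR_conv_of_real complex_norm_square[symmetric] power2_eq_square divide_simps
            mult.commute[of "cnj z"] flip: of_real_mult)
      then show ?thesis by (simp add: v_def)
    qed
    then show "T (\<lambda>m. if m \<in> F then v m else 0) =
        complex_of_real (\<Sum>n\<in>F. cmod (T (unit_seq n)) / s_weight \<alpha> a n)"
      unfolding dual_s_space_finite_support[OF T F] by simp
  qed
qed

lemma dual_s_space_coeffs:
  fixes T :: "(nat ^ 'd::finite \<Rightarrow> complex) \<Rightarrow> complex"
  assumes T: "T \<in> dual_space (s_space \<alpha>)"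
  shows "(\<lambda>n. T (unit_seq n)) \<in> s_dual_carrier \<alpha>"
  unfolding s_dual_carrier_def
proof (intro CollectI allI impI nonneg_bdd_above_summable_on)
  have lin: "linear_functional_on (s_union \<alpha>) T" using T unfolding dual_space_s_space_iff by blast
  fix a :: real assume a: "1 < a"
  then have "dominated_on (s_carrier \<alpha> a) {s_norm \<alpha> a} (\<lambda>f. cmod (T f))"
    using T unfolding dual_space_s_space_iff by blast
  then obtain C where C: "0 \<le> C" "\<And>u. u \<in> s_carrier \<alpha> a \<Longrightarrow> cmod (T u) \<le> C * s_norm \<alpha> a u"
    using s_dominatedD a by blast
  show "bdd_above (sum (\<lambda>n. cmod (T (unit_seq n)) / s_weight \<alpha> a n) ` {F. F \<subseteq> UNIV \<and> finite F})"
  proof (intro bdd_aboveI2[where M = C])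
    fix F :: "(nat ^ 'd) set" assume "F \<in> {F. F \<subseteq> UNIV \<and> finite F}"
    then have F: "finite F" by simp
    obtain u where u: "\<And>n. cmod (u n) * s_weight \<alpha> a n \<le> 1"
        "T u = complex_of_real (\<Sum>n\<in>F. cmod (T (unit_seq n)) / s_weight \<alpha> a n)"
      by (rule unit_ball_sum_le[OF lin F a]) blast
    have "(\<Sum>n\<in>F. cmod (T (unit_seq n)) / s_weight \<alpha> a n) \<le> cmod (T u)"
      unfolding u(2) norm_of_real by simp
    also have "\<dots> \<le> C * s_norm \<alpha> a u" by (rule C(2)[OF s_carrierI[OF u(1)]])
    also have "\<dots> \<le> C * 1" by (intro mult_left_mono s_norm_least u(1) C(1))
    finally show "(\<Sum>n\<in>F. cmod (T (unit_seq n)) / s_weight \<alpha> a n) \<le> C" by simp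
  qed
qed (simp add: s_weight_nonneg)

lemma s_weight_ratio_small:
  assumes \<alpha>: "0 < \<alpha>" and ab: "1 < a" "a < b" and "0 < e"
  shows "\<exists>F. finite F \<and> (\<forall>n. n \<notin> F \<longrightarrow> s_weight \<alpha> a n \<le> e * s_weight \<alpha> b (n :: nat ^ 'd::finite))"
proof -
  \<comment> \<open>The exponent with \<open>(a / b) powr x = e\<close>; as \<open>a < b\<close>,
    larger exponents give smaller values.\<close>
  define x where "x = ln e / ln (a / b)"
  have lnneg: "ln (a / b) < 0" using ab by simp
  obtain N where N: "\<bar>x\<bar> powr \<alpha> < real N" using reals_Archimedean2 by blast
  have "s_weight \<alpha> a n \<le> e * s_weight \<alpha> b n" if n: "n \<notin> {n :: nat ^ 'd. mi_abs n \<le> N}" for n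
  proof -
    let ?y = "real (mi_abs n) powr (1 / \<alpha>)"
    have "\<bar>x\<bar> = (\<bar>x\<bar> powr \<alpha>) powr (1 / \<alpha>)" using \<alpha> by (simp add: powr_powr)
    also have "\<dots> \<le> ?y" using N n \<alpha> by (intro powr_mono2) auto
    finally have "x \<le> ?y" by simp
    then have "?y * ln (a / b) \<le> ln e" using lnneg unfolding x_def by (simp add: field_simps)
    then have "exp (?y * ln (a / b)) \<le> e" by (rule iffD1[OF ln_ge_iff[OF \<open>0 < e\<close>]])
    then have "(a / b) powr ?y \<le> e" using ab by (simp add: powr_def)
    then have "a powr ?y / b powr ?y \<le> e" using ab by (simp add: powr_divide)
    then show ?thesis using ab unfolding s_weight_def by (simp add: field_simps)
  qed
  then show ?thesis using finite_mi_abs_le by blast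
qed

text \<open>In the supremum norm of its own step a sequence need not be the limit of its
  truncations. They do converge in every larger step, whence the passage from \<open>b\<close> to
  the midpoint \<open>a\<close> of 1 and \<open>b\<close>.\<close>

lemma dual_s_space_eq_s_pairing:
  fixes T :: "(nat ^ 'd::finite \<Rightarrow> complex) \<Rightarrow> complex"
  assumes \<alpha>: "0 < \<alpha>" and T: "T \<in> dual_space (s_space \<alpha>)"
  shows "s_pairing \<alpha> (\<lambda>n. T (unit_seq n)) = T"
proof
  fix u :: "nat ^ 'd \<Rightarrow> complex"
  have lin: "linear_functional_on (s_union \<alpha>) T" using T unfolding dual_space_s_space_iff by blast
  show "s_pairing \<alpha> (\<lambda>n. T (unit_seq n)) u = T u"
  proof (cases "u \<in> s_union \<alpha>")
    case False
    then show ?thesis using T unfolding dual_space_s_space_iff s_pairing_eq by auto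
  next
    case True
    then obtain b where b: "1 < b" "u \<in> s_carrier \<alpha> b" by auto
    define a where "a = (1 + b) / 2"
    have a: "1 < a" "a < b" using b unfolding a_def by auto
    have "dominated_on (s_carrier \<alpha> a) {s_norm \<alpha> a} (\<lambda>f. cmod (T f))"
      using T a unfolding dual_space_s_space_iff by blast
    then obtain C where C: "0 \<le> C" "\<And>u. u \<in> s_carrier \<alpha> a \<Longrightarrow> cmod (T u) \<le> C * s_norm \<alpha> a u"
      using s_dominatedD a(1) by blast
    have N: "0 \<le> s_norm \<alpha> b u" using s_norm_nonneg b by blast
    have "((\<lambda>n. u n * T (unit_seq n)) has_sum T u) UNIV"
      unfolding has_sum_def tendsto_iff
    proof (intro allI impI)
      fix e :: real assume e: "0 < e"
      define d where "d = e / (C * s_norm \<alpha> b u + 1)"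
      have K: "0 < C * s_norm \<alpha> b u + 1" using C(1) N by (simp add: add_nonneg_pos)
      have d: "0 < d" "C * s_norm \<alpha> b u * d < e"
        using e K unfolding d_def by (simp_all add: pos_divide_less_eq distrib_left)
      obtain F where F: "finite F" "\<And>n. n \<notin> F \<Longrightarrow> s_weight \<alpha> a n \<le> d * s_weight \<alpha> b (n :: nat ^ 'd)"
        using s_weight_ratio_small[OF \<alpha> a d(1), where 'd = 'd] by blast
      show "eventually (\<lambda>G. dist (\<Sum>n\<in>G. u n * T (unit_seq n)) (T u) < e) (finite_subsets_at_top UNIV)"
        unfolding eventually_finite_subsets_at_top
      proof (intro exI[of _ F] conjI allI impI F(1))
        fix G assume "finite G \<and> F \<subseteq> G \<and> G \<subseteq> (UNIV :: (nat ^ 'd) set)"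
        then have G: "finite G" "F \<subseteq> G" by auto
        let ?v = "\<lambda>m. if m \<in> G then u m else 0"
        let ?w = "\<lambda>m. u m - ?v m"
        have bd: "cmod (?w n) * s_weight \<alpha> a n \<le> s_norm \<alpha> b u * d" for n
        proof (cases "n \<in> G")
          case False
          then have "cmod (?w n) * s_weight \<alpha> a n \<le> cmod (u n) * (d * s_weight \<alpha> b n)"
            using F(2)[of n] G(2) by (auto intro!: mult_left_mono)
          also have "\<dots> = (cmod (u n) * s_weight \<alpha> b n) * d" by simp
          also have "\<dots> \<le> s_norm \<alpha> b u * d" using d(1) by (intro mult_right_mono s_norm_upper b) auto
          finally show ?thesis .
        qed (use N d in simp)
        have v: "?v \<in> s_union \<alpha>" using finite_support_in_s_carrier[OF G(1), of ?v \<alpha> 2] by (auto intro!: bexI[of _ 2])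
        have "cmod (T u - T ?v) = cmod (T ?w)"
          using linear_functional_on_diff[OF function_subspace_s_union lin True v] by simp
        also have "\<dots> \<le> C * s_norm \<alpha> a ?w" by (rule C(2)[OF s_carrierI[OF bd]])
        also have "\<dots> \<le> C * (s_norm \<alpha> b u * d)" by (intro mult_left_mono C(1) s_norm_least bd)
        also have "\<dots> < e" using d(2) by (simp add: mult.assoc)
        finally show "dist (\<Sum>n\<in>G. u n * T (unit_seq n)) (T u) < e"
          unfolding dual_s_space_finite_support[OF lin G(1), symmetric] by (simp add: dist_norm norm_minus_commute)
      qed simp
    qed
    then show ?thesis using True infsumI unfolding s_pairing_eq by auto
  qed
qed

lemma s_pairing_unit_seq: "s_pairing \<alpha> b (unit_seq n) = b n"
proof -
  have "unit_seq n \<in> s_union \<alpha>" using unit_seq_in_s_carrier[of n \<alpha> 2] by (auto intro!: bexI[of _ 2])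
  moreover have "(\<Sum>\<^sub>\<infinity>m. unit_seq n m * b m) = (\<Sum>\<^sub>\<infinity>m\<in>{n}. unit_seq n m * b m)"
    by (rule infsum_cong_neutral) (auto simp: unit_seq_def)
  ultimately show ?thesis unfolding s_pairing_eq by (simp add: unit_seq_def)
qed

text \<open>Polar seminorms are compared with weighted \<open>l^1\<close> norms. A bounded set lies
  in a multiple of the unit ball of a step by \<open>s_bounded_step\<close>, which bounds its polar
  seminorm by one norm. Conversely the unit ball of each step is bounded in the limit, and the norm
  is recovered from it by the extremal sequences of \<open>unit_ball_sum_le\<close>.\<close>

lemma topological_isomorphism_s_pairing:
  assumes \<alpha>: "0 < \<alpha>"
  shows "topological_isomorphism (s_dual \<alpha> :: (nat ^ 'd::finite \<Rightarrow> complex) topology)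
    (strong_dual (s_space \<alpha>)) (s_pairing \<alpha>)"
  unfolding s_dual_eq strong_dual_eq
proof (rule topological_isomorphism_seminormI[where k = "\<lambda>T n. T (unit_seq n)"])
  show "seminorm_family (s_dual_carrier \<alpha>) (s_dual_seminorms \<alpha> :: ((nat ^ 'd \<Rightarrow> complex) \<Rightarrow> real) set)"
    by (rule seminorm_family_s_dual)
  show "seminorm_family (dual_space (s_space \<alpha>)) (polar_seminorms (s_space \<alpha> :: (nat ^ 'd \<Rightarrow> complex) topology))"
    by (rule seminorm_family_strong_dual) (simp only: topspace_s_space function_subspace_s_union)
  have sum: "(\<lambda>n. u n * b n) summable_on UNIV" if "u \<in> s_union \<alpha>" "b \<in> s_dual_carrier \<alpha>"
    for u b :: "nat ^ 'd \<Rightarrow> complex"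
    using that s_pairing_bound(1) s_norm_upper by blast
  show "linear_map_on (s_dual_carrier \<alpha>) (s_pairing \<alpha> :: _ \<Rightarrow> (nat ^ 'd \<Rightarrow> complex) \<Rightarrow> complex)"
    unfolding linear_map_on_def
  proof (intro conjI ballI allI ext)
    fix b c u :: "nat ^ 'd \<Rightarrow> complex"
    assume bc: "b \<in> s_dual_carrier \<alpha>" "c \<in> s_dual_carrier \<alpha>"
    show "s_pairing \<alpha> (\<lambda>x. b x + c x) u = s_pairing \<alpha> b u + s_pairing \<alpha> c u"
      using infsum_add[OF sum[OF _ bc(1), of u] sum[OF _ bc(2), of u]]
      unfolding s_pairing_eq by (auto simp: distrib_left)
  next
    fix z and b u :: "nat ^ 'd \<Rightarrow> complex"
    show "s_pairing \<alpha> (\<lambda>x. z * b x) u = z * s_pairing \<alpha> b u"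
      using infsum_cmult_right'[of z "\<lambda>n. u n * b n" UNIV] unfolding s_pairing_eq by (simp add: mult.left_commute)
  qed
  show "s_pairing \<alpha> \<in> s_dual_carrier \<alpha> \<rightarrow> dual_space (s_space \<alpha> :: (nat ^ 'd \<Rightarrow> complex) topology)"
    using s_pairing_in_dual_space by blast
  show "(\<lambda>T n. T (unit_seq n)) \<in> dual_space (s_space \<alpha> :: (nat ^ 'd \<Rightarrow> complex) topology) \<rightarrow> s_dual_carrier \<alpha>"
    using dual_s_space_coeffs by blast
  show "(\<lambda>n. s_pairing \<alpha> b (unit_seq n)) = b" for b :: "nat ^ 'd \<Rightarrow> complex"
    using s_pairing_unit_seq by blast
  show "s_pairing \<alpha> (\<lambda>n. T (unit_seq n)) = T" if "T \<in> dual_space (s_space \<alpha>)"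
    for T :: "(nat ^ 'd \<Rightarrow> complex) \<Rightarrow> complex"
    by (rule dual_s_space_eq_s_pairing[OF \<alpha> that])
next
  fix q assume "q \<in> polar_seminorms (s_space \<alpha> :: (nat ^ 'd \<Rightarrow> complex) topology)"
  then obtain B where B: "q = (\<lambda>T. SUP f\<in>B. cmod (T f))" "bounded_in (s_space \<alpha>) B" "B \<noteq> {}"
    unfolding polar_seminorms_def by blast
  obtain a M where a: "1 < a" "0 \<le> M" "\<And>u n. u \<in> B \<Longrightarrow> cmod (u n) * s_weight \<alpha> a n \<le> M"
    by (rule s_bounded_step[OF B(2)]) blast
  show "dominated_on (s_dual_carrier \<alpha>) (s_dual_seminorms \<alpha>) (\<lambda>b. q (s_pairing \<alpha> b))"
  proof (rule dominated_onI[where p = "s_dual_norm \<alpha> a"])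
    fix b :: "nat ^ 'd \<Rightarrow> complex" assume b: "b \<in> s_dual_carrier \<alpha>"
    have "cmod (s_pairing \<alpha> b u) \<le> M * s_dual_norm \<alpha> a b" if u: "u \<in> B" for u
    proof -
      have "u \<in> s_carrier \<alpha> a" using a(3)[OF u] by (rule s_carrierI)
      then show ?thesis using s_pairing_bound(2)[OF b a(1) a(3)[OF u]] a(1) unfolding s_pairing_eq by auto
    qed
    then show "q (s_pairing \<alpha> b) \<le> M * s_dual_norm \<alpha> a b"
      unfolding B(1) by (intro cSUP_least B(3))
  qed (use a in \<open>auto simp: s_dual_seminorms_def\<close>)
next
  fix p assume "p \<in> (s_dual_seminorms \<alpha> :: ((nat ^ 'd \<Rightarrow> complex) \<Rightarrow> real) set)"
  then obtain a where a: "1 < a" and p: "p = s_dual_norm \<alpha> a" unfolding s_dual_seminorms_def by blast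
  define B where "B = {u :: nat ^ 'd \<Rightarrow> complex. \<forall>n. cmod (u n) * s_weight \<alpha> a n \<le> 1}"
  have Bc: "B \<subseteq> s_carrier \<alpha> a" unfolding B_def using s_carrierI by blast
  have "bounded_in (s_space \<alpha>) B"
    unfolding s_space_eq bounded_in_seminorm_topology_iff[OF seminorm_family_s_space]
  proof (intro conjI ballI)
    show "B \<subseteq> s_union \<alpha>" using Bc a by auto
    fix q :: "(nat ^ 'd \<Rightarrow> complex) \<Rightarrow> real" assume "q \<in> s_seminorms \<alpha>"
    then have "dominated_on (s_carrier \<alpha> a) {s_norm \<alpha> a} q" using a unfolding s_seminorms_def lc_seminorms_def by auto
    then obtain C where C: "0 \<le> C" "\<And>u. u \<in> s_carrier \<alpha> a \<Longrightarrow> q u \<le> C * s_norm \<alpha> a u" using s_dominatedD a by blast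
    have "q u \<le> C * 1" if u: "u \<in> B" for u
    proof -
      have "q u \<le> C * s_norm \<alpha> a u" using C(2) Bc u by blast
      also have "\<dots> \<le> C * 1" using u unfolding B_def by (intro mult_left_mono C(1) s_norm_least) auto
      finally show ?thesis .
    qed
    then show "bdd_above (q ` B)" by (intro bdd_aboveI[of _ "C * 1"]) auto
  qed
  moreover have "(\<lambda>_. 0) \<in> B" unfolding B_def by simp
  ultimately have mem: "(\<lambda>T. SUP f\<in>B. cmod (T f)) \<in> polar_seminorms (s_space \<alpha>)" and bB: "bounded_in (s_space \<alpha>) B"
    unfolding polar_seminorms_def by auto
  show "dominated_on (dual_space (s_space \<alpha>)) (polar_seminorms (s_space \<alpha>)) (\<lambda>T. p (\<lambda>n. T (unit_seq n)))"
  proof (rule dominated_onI[OF mem, of 1])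
    fix T :: "(nat ^ 'd \<Rightarrow> complex) \<Rightarrow> complex" assume T: "T \<in> dual_space (s_space \<alpha>)"
    have lin: "linear_functional_on (s_union \<alpha>) T" using T unfolding dual_space_s_space_iff by blast
    have bdd: "bdd_above ((\<lambda>f. cmod (T f)) ` B)"
      by (rule dual_space_bounded[OF T bB]) (simp only: topspace_s_space function_subspace_s_union)
    have "s_dual_norm \<alpha> a (\<lambda>n. T (unit_seq n)) \<le> (SUP f\<in>B. cmod (T f))"
      unfolding s_dual_norm_def
    proof (rule infsum_le_finite_sums)
      show "(\<lambda>n. cmod (T (unit_seq n)) / s_weight \<alpha> a n) summable_on UNIV"
        by (rule s_dual_summable[OF dual_s_space_coeffs[OF T] a])
      fix F :: "(nat ^ 'd) set" assume F: "finite F"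
      obtain u where u: "\<And>n. cmod (u n) * s_weight \<alpha> a n \<le> 1"
          "T u = complex_of_real (\<Sum>n\<in>F. cmod (T (unit_seq n)) / s_weight \<alpha> a n)"
        by (rule unit_ball_sum_le[OF lin F a]) blast
      have "(\<Sum>n\<in>F. cmod (T (unit_seq n)) / s_weight \<alpha> a n) \<le> cmod (T u)"
        unfolding u(2) norm_of_real by simp
      also have "\<dots> \<le> (SUP f\<in>B. cmod (T f))" using u(1) by (intro cSUP_upper bdd) (simp add: B_def)
      finally show "(\<Sum>n\<in>F. cmod (T (unit_seq n)) / s_weight \<alpha> a n) \<le> (SUP f\<in>B. cmod (T f))" .
    qed
    then show "p (\<lambda>n. T (unit_seq n)) \<le> 1 * (SUP f\<in>B. cmod (T f))" unfolding p by simp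
  qed simp
qed

section \<open>Laguerre functions of one variable\<close>

lemma LBINT_FTC_halfline:
  fixes f F :: "real \<Rightarrow> 'a::euclidean_space"
  assumes F: "\<And>t. a < t \<Longrightarrow> (F has_vector_derivative f t) (at t)"
    and f: "\<And>t. a < t \<Longrightarrow> isCont f t" "set_integrable lborel {a<..} f"
    and A: "(F \<longlongrightarrow> A) (at_right a)" and B: "(F \<longlongrightarrow> B) at_top"
  shows "(LBINT t:{a<..}. f t) = B - A"
proof -
  have "(LBINT t=ereal a..\<infinity>. f t) = B - A"
  proof (rule interval_integral_FTC_integrable)
    show "((F \<circ> real_of_ereal) \<longlongrightarrow> A) (at_right (ereal a))"
      unfolding comp_def at_right_ereal using A by (simp add: filterlim_filtermap)
    show "((F \<circ> real_of_ereal) \<longlongrightarrow> B) (at_left \<infinity>)"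
      unfolding comp_def at_left_PInf using B by (simp add: filterlim_filtermap)
    show "set_integrable lborel (einterval (ereal a) \<infinity>) f"
      using f(2) by (simp add: einterval_def greaterThan_def[symmetric])
  qed (use F f in auto)
  then show ?thesis
    by (simp add: interval_lebesgue_integral_def einterval_def greaterThan_def[symmetric])
qed

lemma set_integrable_power_exp: "set_integrable lborel {0<..} (\<lambda>t. t ^ k * exp (- t :: real))"
  and LBINT_power_exp: "(LBINT t:{0<..}. t ^ k * exp (- t :: real)) = fact k"
proof -
  have "(\<integral>\<^sup>+ t. ennreal (indicator {0<..} t * (t ^ k * exp (- t))) \<partial>lborel) =
      (\<integral>\<^sup>+ t. ennreal (t ^ k * exp (- t)) * indicator {0..} t \<partial>lborel)"
    by (intro nn_integral_cong_AE AE_I[where N = "{0}"]) (auto simp: indicator_def)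
  also have "\<dots> = ennreal (fact k)" using nn_intergal_power_times_exp_Ici[of k] by simp
  finally have *: "(\<integral>\<^sup>+ t. ennreal (indicator {0<..} t * (t ^ k * exp (- t))) \<partial>lborel) = ennreal (fact k)" .
  have nn: "0 \<le> indicator {0<..} t * (t ^ k * exp (- t))" for t :: real by (simp add: indicator_def)
  show "set_integrable lborel {0<..} (\<lambda>t. t ^ k * exp (- t :: real))"
    unfolding set_integrable_def real_scaleR_def using *
    by (intro integrableI_nonneg AE_I2 nn) auto
  show "(LBINT t:{0<..}. t ^ k * exp (- t :: real)) = fact k"
    unfolding set_lebesgue_integral_def real_scaleR_def using *
    by (intro has_bochner_integral_integral_eq has_bochner_integral_nn_integral AE_I2 nn) auto
qed

lemma real_poly_exp:
  assumes "real_polynomial_function (p :: real \<Rightarrow> real)"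
  shows "set_integrable lborel {0<..} (\<lambda>t. exp (- t) * p t)" "((\<lambda>t. exp (- t) * p t) \<longlongrightarrow> 0) at_top"
proof -
  obtain a n where p: "p = (\<lambda>x. \<Sum>i\<le>n. a i * x ^ i)"
    using assms unfolding real_polynomial_function_iff_sum by blast
  have eq: "(\<lambda>t. exp (- t) * p t) = (\<lambda>t. \<Sum>i\<le>n. a i * (t ^ i * exp (- t)))"
    unfolding p by (auto simp: sum_distrib_left algebra_simps)
  show "set_integrable lborel {0<..} (\<lambda>t. exp (- t) * p t)"
    unfolding eq set_integrable_def scaleR_sum_right
    by (intro Bochner_Integration.integrable_sum set_integrable_mult_right[unfolded set_integrable_def]
        set_integrable_power_exp[unfolded set_integrable_def])
  have "((\<lambda>t :: real. \<Sum>i\<le>n. a i * (t ^ i * exp (- t))) \<longlongrightarrow> (\<Sum>i\<le>n. a i * 0)) at_top"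
  proof (intro tendsto_intros)
    fix i
    show "((\<lambda>t :: real. t ^ i * exp (- t)) \<longlongrightarrow> 0) at_top"
      using tendsto_power_div_exp_0[of i] by (simp add: exp_minus field_simps)
  qed
  then show "((\<lambda>t. exp (- t) * p t) \<longlongrightarrow> 0) at_top" unfolding eq by simp
qed

section \<open>Associated Laguerre polynomials with parameter \<open>m\<close> and degree
  \<open>j\<close>\<close>

definition lag :: "nat \<Rightarrow> nat \<Rightarrow> real \<Rightarrow> real" where
  "lag m j t = (\<Sum>i\<le>j. (-1) ^ i * real ((j + m) choose (i + m)) / fact i * t ^ i)"

definition lag_deriv :: "nat \<Rightarrow> nat \<Rightarrow> real \<Rightarrow> real" where
  "lag_deriv m j t = (case j of 0 \<Rightarrow> 0 | Suc k \<Rightarrow> - lag (Suc m) k t)"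

lemma lag_0 [simp]: "lag m 0 t = 1"
  by (simp add: lag_def)

text \<open>The coefficient is \<open>j + m choose i + m\<close>, not the equal
  \<open>j + m choose j - i\<close>, because it vanishes for \<open>i > j\<close>; polynomials of
  different degrees can thus be summed over a common range.\<close>

lemma lag_extend: "j \<le> N \<Longrightarrow> lag m j t = (\<Sum>i\<le>N. (-1) ^ i * real ((j + m) choose (i + m)) / fact i * t ^ i)"
  unfolding lag_def by (rule sum.mono_neutral_left) (auto simp: binomial_eq_0)

text \<open>Pascal's rule, coefficient by coefficient. It trades a lower parameter for a difference
  of consecutive degrees.\<close>

lemma lag_Suc: "lag m (Suc j) t = lag (Suc m) (Suc j) t - lag (Suc m) j t"
proof -
  have "lag (Suc m) (Suc j) t - lag (Suc m) j t = (\<Sum>i\<le>Suc j.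
      (-1) ^ i * (real ((Suc j + Suc m) choose (i + Suc m)) - real ((j + Suc m) choose (i + Suc m))) / fact i * t ^ i)"
    unfolding lag_extend[of j "Suc j"  "Suc m", OF le_SucI[OF le_refl]] lag_extend[of "Suc j" "Suc j" "Suc m", OF le_refl]
      sum_subtractf[symmetric]
    by (intro sum.cong refl) (simp only: right_diff_distrib left_diff_distrib diff_divide_distrib)
  also have "\<dots> = lag m (Suc j) t"
    unfolding lag_def by (intro sum.cong refl) simp
  finally show ?thesis by simp
qed

lemma lag_Suc_param: "lag (Suc m) j t = (\<Sum>r\<le>j. lag m r t)"
proof (induction j)
  case (Suc j)
  then show ?case using lag_Suc[of m j t] by simp
qed simp

lemma lag_has_derivative: "(lag m j has_real_derivative lag_deriv m j t) (at t)"
proof (cases j)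
  case 0
  then show ?thesis by (simp add: lag_deriv_def lag_def[abs_def])
next
  case (Suc k)
  have "((\<lambda>t. \<Sum>i\<le>Suc k. (-1) ^ i * real ((Suc k + m) choose (i + m)) / fact i * t ^ i) has_real_derivative
      (\<Sum>i\<le>Suc k. (-1) ^ i * real ((Suc k + m) choose (i + m)) / fact i * (real i * t ^ (i - 1)))) (at t)"
    by (rule DERIV_sum, rule DERIV_cong[OF DERIV_cmult[OF DERIV_pow]]) simp
  moreover have "(\<Sum>i\<le>Suc k. (-1) ^ i * real ((Suc k + m) choose (i + m)) / fact i * (real i * t ^ (i - 1))) =
      - lag (Suc m) k t"
    unfolding sum.atMost_Suc_shift lag_def sum_negf[symmetric]
    by (simp, intro sum.cong refl) (simp add: divide_simps)
  ultimately show ?thesis unfolding Suc lag_deriv_def by (simp add: lag_def[abs_def])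
qed

lemma lag_deriv_Suc: "lag_deriv m (Suc j) t = lag_deriv (Suc m) (Suc j) t - lag_deriv (Suc m) j t"
  unfolding lag_deriv_def using lag_Suc[of "Suc m"] by (auto split: nat.split)

lemma t_times_lag_deriv: "t * lag_deriv m j t = (\<Sum>i\<le>j. real i * ((-1) ^ i * real ((j + m) choose (i + m)) / fact i) * t ^ i)"
proof -
  have "(lag m j has_real_derivative (\<Sum>i\<le>j. (-1) ^ i * real ((j + m) choose (i + m)) / fact i * (real i * t ^ (i - 1)))) (at t)"
    unfolding lag_def[abs_def]
    by (rule DERIV_sum, rule DERIV_cong[OF DERIV_cmult[OF DERIV_pow]]) simp
  then have eq: "lag_deriv m j t = (\<Sum>i\<le>j. (-1) ^ i * real ((j + m) choose (i + m)) / fact i * (real i * t ^ (i - 1)))"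
    using lag_has_derivative DERIV_unique by blast
  show ?thesis
    unfolding eq sum_distrib_left
  proof (intro sum.cong refl)
    fix i
    show "t * ((- 1) ^ i * real (j + m choose (i + m)) / fact i * (real i * t ^ (i - 1))) =
         real i * ((- 1) ^ i * real (j + m choose (i + m)) / fact i) * t ^ i"
      by (cases i) auto
  qed
qed

text \<open>Up to the factor \<open>exp (- t) * t ^ m\<close> the left side is the derivative of
  \<open>exp (- t) * t ^ Suc m * lag (Suc m) j t\<close>: differentiation lowers the parameter and
  raises the degree. The proof compares coefficients.\<close>

lemma lag_raise:
  "(real m + 1 - t) * lag (Suc m) j t + t * lag_deriv (Suc m) j t = real (Suc j) * lag m (Suc j) t"
proof -
  define c where "c i = (-1) ^ i * real ((j + Suc m) choose (i + Suc m)) / fact i" for i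
  have c0: "c (Suc j) = 0" by (simp add: c_def binomial_eq_0)
  have 1: "lag (Suc m) j t = (\<Sum>i\<le>Suc j. c i * t ^ i)" using c0 by (simp add: lag_def c_def)
  have 2: "t * lag_deriv (Suc m) j t = (\<Sum>i\<le>Suc j. real i * c i * t ^ i)"
    using c0 by (simp add: t_times_lag_deriv c_def)
  have 3: "t * lag (Suc m) j t = (\<Sum>i\<le>Suc j. (case i of 0 \<Rightarrow> 0 | Suc k \<Rightarrow> c k) * t ^ i)"
    unfolding sum.atMost_Suc_shift by (simp add: lag_def c_def sum_distrib_left algebra_simps)
  have "(real m + 1 - t) * lag (Suc m) j t + t * lag_deriv (Suc m) j t =
      (real m + 1) * (\<Sum>i\<le>Suc j. c i * t ^ i) - (\<Sum>i\<le>Suc j. (case i of 0 \<Rightarrow> 0 | Suc k \<Rightarrow> c k) * t ^ i) +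
      (\<Sum>i\<le>Suc j. real i * c i * t ^ i)"
    unfolding 2[symmetric] 3[symmetric] 1[symmetric] by (simp add: algebra_simps)
  also have "\<dots> = (\<Sum>i\<le>Suc j. ((real m + 1 + real i) * c i - (case i of 0 \<Rightarrow> 0 | Suc k \<Rightarrow> c k)) * t ^ i)"
    unfolding sum_distrib_left sum_subtractf[symmetric] sum.distrib[symmetric]
    by (intro sum.cong refl) (simp add: algebra_simps)
  also have "\<dots> = (\<Sum>i\<le>Suc j. real (Suc j) * ((-1) ^ i * real ((Suc j + m) choose (i + m)) / fact i * t ^ i))"
  proof (intro sum.cong refl)
    fix i assume "i \<in> {..Suc j}"
    then have i: "i \<le> Suc j" by simp
    \<comment> \<open>The absorption identity for binomial coefficients. It turns the coefficient of
      degree \<open>i\<close> coming from \<open>t\<close> times the derivative into the one of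
      \<open>lag m (Suc j)\<close>.\<close>
    have absorb: "real (Suc (i + m)) * real ((Suc j + m) choose Suc (i + m)) =
        (real (Suc j) - real i) * real ((Suc j + m) choose (i + m))"
    proof -
      have "(Suc (i + m)) * ((Suc j + m) choose Suc (i + m)) = (Suc j + m - (i + m)) * ((Suc j + m) choose (i + m))"
        by (metis binomial_absorption binomial_absorb_comp mult.commute add_Suc diff_Suc_1 binomial_Suc_Suc_eq_times Suc_times_binomial_add Suc_times_binomial_eq)
      then have "real (Suc (i + m)) * real ((Suc j + m) choose Suc (i + m)) = real (Suc j + m - (i + m)) * real ((Suc j + m) choose (i + m))"
        by (metis of_nat_mult)
      then show ?thesis using i by simp
    qed
    have "(real m + 1 + real i) * c i - (case i of 0 \<Rightarrow> 0 | Suc k \<Rightarrow> c k) =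
        real (Suc j) * ((-1) ^ i * real ((Suc j + m) choose (i + m)) / fact i)"
    proof (cases i)
      case 0
      then show ?thesis using absorb by (simp add: c_def algebra_simps)
    next
      case (Suc k)
      have "(case i of 0 \<Rightarrow> 0 | Suc k \<Rightarrow> c k) = - (real i * ((-1) ^ i * real ((Suc j + m) choose (i + m)) / fact i))"
        unfolding Suc by (simp add: c_def divide_simps)
      moreover have "(real m + 1 + real i) * c i = (-1) ^ i * (real (Suc (i + m)) * real ((Suc j + m) choose Suc (i + m))) / fact i"
        by (simp add: c_def algebra_simps)
      ultimately show ?thesis unfolding absorb by (simp add: algebra_simps diff_divide_distrib)
    qed
    then show "((real m + 1 + real i) * c i - (case i of 0 \<Rightarrow> 0 | Suc k \<Rightarrow> c k)) * t ^ i =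
        real (Suc j) * ((-1) ^ i * real ((Suc j + m) choose (i + m)) / fact i * t ^ i)"
      by (simp add: mult.assoc)
  qed
  also have "\<dots> = real (Suc j) * lag m (Suc j) t" unfolding lag_def sum_distrib_left ..
  finally show ?thesis .
qed

text \<open>Subtracting consecutive instances of \<open>lag_raise\<close> brings them to parameter 0
  by Pascal's rule; two such equations then eliminate the derivative. The result expresses
  multiplication by \<open>t\<close> through neighbouring degrees.\<close>

lemma lag_three_term:
  "t * lag 0 (Suc j) t = - (real j + 2) * lag 0 (Suc (Suc j)) t + (2 * real j + 3) * lag 0 (Suc j) t - (real j + 1) * lag 0 j t"
proof -
  have R1: "(real k + 2) * lag 0 (Suc (Suc k)) t = (real k + 2 - t) * lag 0 (Suc k) t + t * lag_deriv 0 (Suc k) t" for k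
  proof -
    have "(real k + 2) * lag 0 (Suc (Suc k)) t - (real k + 1) * lag 0 (Suc k) t =
        (1 - t) * (lag 1 (Suc k) t - lag 1 k t) + t * (lag_deriv 1 (Suc k) t - lag_deriv 1 k t)"
      using lag_raise[of 0 t "Suc k"] lag_raise[of 0 t k] by (simp add: algebra_simps)
    then show ?thesis
      unfolding One_nat_def lag_Suc[of 0 k t, symmetric] lag_deriv_Suc[of 0 k t, symmetric]
      by (simp add: algebra_simps)
  qed
  have R1': "(real j + 1) * lag 0 (Suc j) t = (real j + 1 - t) * lag 0 j t + t * lag_deriv 0 j t"
  proof (cases j)
    case 0
    then show ?thesis using lag_raise[of 0 t 0] by (simp add: lag_deriv_def algebra_simps)
  next
    case (Suc k)
    then show ?thesis using R1[of k] by (simp add: algebra_simps)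
  qed
  have "lag_deriv 0 (Suc j) t = lag_deriv 0 j t - lag 0 j t"
    unfolding lag_deriv_def using lag_Suc[of 0 _ t] by (auto split: nat.split)
  then have "t * lag_deriv 0 (Suc j) t = t * lag_deriv 0 j t - t * lag 0 j t"
    by (simp only: right_diff_distrib)
  then show ?thesis using R1[of j] R1' by (simp add: algebra_simps)
qed

lemma lag_three_term_0: "t * lag 0 0 t = - lag 0 1 t + lag 0 0 t"
  using lag_raise[of 0 t 0] by (simp add: lag_deriv_def)

lemma real_polynomial_function_id [intro]: "real_polynomial_function (\<lambda>t :: real. t)"
  by (rule real_polynomial_function.intros(1)) simp

lemma real_polynomial_function_lag [intro]: "real_polynomial_function (lag m j)"
  unfolding lag_def[abs_def] by (intro real_polynomial_function_sum real_polynomial_function.intros(4)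
      real_polynomial_function_power real_polynomial_function.intros(2) real_polynomial_function_id) auto

text \<open>One step of Rodrigues' formula. Orthogonality, the identification with
  \<open>laguerre_poly\<close> and the integration by parts against test functions all rest on
  it.\<close>

lemma exp_power_lag_deriv:
  "((\<lambda>t. exp (- t) * t ^ Suc m * lag (Suc m) j t) has_real_derivative
    real (Suc j) * (exp (- t) * t ^ m * lag m (Suc j) t)) (at t)"
proof -
  have "((\<lambda>t. exp (- t) * t ^ Suc m * lag (Suc m) j t) has_real_derivative
      (- exp (- t) * t ^ Suc m + exp (- t) * (real (Suc m) * t ^ m)) * lag (Suc m) j t +
      exp (- t) * t ^ Suc m * lag_deriv (Suc m) j t) (at t)"
    by (rule derivative_eq_intros lag_has_derivative refl | simp)+
  moreover have "(- exp (- t) * t ^ Suc m + exp (- t) * (real (Suc m) * t ^ m)) * lag (Suc m) j t +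
      exp (- t) * t ^ Suc m * lag_deriv (Suc m) j t =
      exp (- t) * t ^ m * ((real m + 1 - t) * lag (Suc m) j t + t * lag_deriv (Suc m) j t)"
    by (simp add: algebra_simps)
  ultimately show ?thesis unfolding lag_raise by (simp add: algebra_simps)
qed

lemma LBINT_deriv_poly_exp:
  assumes F: "\<And>t. ((\<lambda>t. exp (- t) * p t) has_real_derivative exp (- t) * q t) (at t)"
    and p: "real_polynomial_function p" and q: "real_polynomial_function q" and "p 0 = 0"
  shows "(LBINT t:{0<..}. exp (- t) * q t) = 0"
proof -
  have "continuous_on UNIV p" "continuous_on UNIV q"
    using p q continuous_on_polymonial_function real_polynomial_function_eq by blast+
  then have c: "isCont p t" "isCont q t" for t by (auto simp: continuous_on_eq_continuous_at)
  have "(LBINT t:{0<..}. exp (- t) * q t) = 0 - 0"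
  proof (rule LBINT_FTC_halfline[where F = "\<lambda>t. exp (- t) * p t"])
    show "((\<lambda>t. exp (- t) * p t) has_vector_derivative exp (- t) * q t) (at t)" for t
      using F[of t] by (simp add: has_real_derivative_iff_has_vector_derivative)
    have "((\<lambda>t. exp (- t) * p t) \<longlongrightarrow> exp (- 0) * p 0) (at_right 0)"
      using c(1)[of 0] by (intro tendsto_intros filterlim_mono[OF isContD order_refl at_le]) auto
    then show "((\<lambda>t. exp (- t) * p t) \<longlongrightarrow> 0) (at_right 0)" using \<open>p 0 = 0\<close> by simp
  qed (use c real_poly_exp[OF p] real_poly_exp[OF q] in \<open>auto intro!: continuous_intros\<close>)
  then show ?thesis by simp
qed

section \<open>Orthogonality and Rodrigues' formula\<close>

definition lag_ip :: "nat \<Rightarrow> nat \<Rightarrow> nat \<Rightarrow> real" where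
  "lag_ip m i j = (LBINT t:{0<..}. exp (- t) * (t ^ m * lag m i t * lag m j t))"

lemma lag_ip_integrable: "set_integrable lborel {0<..} (\<lambda>t. exp (- t) * (t ^ m * lag m i t * lag m j t))"
  by (intro real_poly_exp real_polynomial_function.intros(4) real_polynomial_function_power) auto

text \<open>Integration by parts, with \<open>exp_power_lag_deriv\<close> for one factor and the
  derivative of the other, lowers both degrees and raises the parameter. The recursion ends at
  degree 0, where one factor is constant.\<close>

lemma lag_ip_Suc_Suc: "real (Suc j) * lag_ip m (Suc i) (Suc j) = lag_ip (Suc m) i j"
proof -
  let ?q = "\<lambda>t. real (Suc j) * (t ^ m * lag m (Suc i) t * lag m (Suc j) t) - t ^ Suc m * lag (Suc m) i t * lag (Suc m) j t"
  have "(LBINT t:{0<..}. exp (- t) * ?q t) = 0"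
  proof (rule LBINT_deriv_poly_exp[where p = "\<lambda>t. t ^ Suc m * lag (Suc m) j t * lag m (Suc i) t"])
    fix t :: real
    have "((\<lambda>t. (exp (- t) * t ^ Suc m * lag (Suc m) j t) * lag m (Suc i) t) has_real_derivative
        real (Suc j) * (exp (- t) * t ^ m * lag m (Suc j) t) * lag m (Suc i) t +
        (exp (- t) * t ^ Suc m * lag (Suc m) j t) * lag_deriv m (Suc i) t) (at t)"
      by (rule DERIV_cong[OF DERIV_mult[OF exp_power_lag_deriv lag_has_derivative]]) simp
    then show "((\<lambda>t. exp (- t) * (t ^ Suc m * lag (Suc m) j t * lag m (Suc i) t)) has_real_derivative
        exp (- t) * ?q t) (at t)"
      by (simp add: lag_deriv_def algebra_simps)
  next
    show "real_polynomial_function (\<lambda>t. t ^ Suc m * lag (Suc m) j t * lag m (Suc i) t)"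
      by (intro real_polynomial_function.intros(4) real_polynomial_function_power) auto
    show "real_polynomial_function ?q"
      by (intro real_polynomial_function_diff real_polynomial_function.intros(4) real_polynomial_function_power) auto
  qed auto
  moreover have "(\<lambda>t. exp (- t) * ?q t) = (\<lambda>t. real (Suc j) * (exp (- t) * (t ^ m * lag m (Suc i) t * lag m (Suc j) t)) -
      exp (- t) * (t ^ Suc m * lag (Suc m) i t * lag (Suc m) j t))"
    by (auto simp: algebra_simps)
  ultimately show ?thesis
    unfolding lag_ip_def
    by (simp only: set_integral_diff set_integral_mult_right set_integrable_mult_right lag_ip_integrable)
qed

lemma lag_ip_0_Suc: "lag_ip m 0 (Suc j) = 0"
proof -
  have "(LBINT t:{0<..}. exp (- t) * (real (Suc j) * (t ^ m * lag m (Suc j) t))) = 0"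
  proof (rule LBINT_deriv_poly_exp[where p = "\<lambda>t. t ^ Suc m * lag (Suc m) j t"])
    show "((\<lambda>t. exp (- t) * (t ^ Suc m * lag (Suc m) j t)) has_real_derivative
        exp (- t) * (real (Suc j) * (t ^ m * lag m (Suc j) t))) (at t)" for t
      using exp_power_lag_deriv[of m j t] by (simp add: algebra_simps)
    show "real_polynomial_function (\<lambda>t. t ^ Suc m * lag (Suc m) j t)"
      "real_polynomial_function (\<lambda>t. real (Suc j) * (t ^ m * lag m (Suc j) t))"
      by (intro real_polynomial_function.intros(4) real_polynomial_function_power; auto)+
  qed auto
  moreover have "(\<lambda>t. exp (- t) * (real (Suc j) * (t ^ m * lag m (Suc j) t))) =
      (\<lambda>t. real (Suc j) * (exp (- t) * (t ^ m * lag m 0 t * lag m (Suc j) t)))"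
    by (auto simp: algebra_simps)
  ultimately have "real (Suc j) * lag_ip m 0 (Suc j) = 0"
    unfolding lag_ip_def by (simp only: set_integral_mult_right)
  then show ?thesis by simp
qed

lemma lag_ip_commute: "lag_ip m i j = lag_ip m j i"
  unfolding lag_ip_def by (simp add: mult.commute mult.left_commute)

lemma lag_ip_eq: "lag_ip m i j = (if i = j then fact (j + m) / fact j else 0)"
proof (induction j arbitrary: i m)
  case 0
  show ?case
  proof (cases i)
    case 0
    then show ?thesis using LBINT_power_exp[of m] by (simp add: lag_ip_def mult.commute)
  next
    case (Suc k)
    then show ?thesis using lag_ip_0_Suc lag_ip_commute by simp
  qed
next
  case (Suc j)
  show ?case
  proof (cases i)
    case 0
    then show ?thesis by (simp add: lag_ip_0_Suc)
  next
    case (Suc k)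
    have "lag_ip m (Suc k) (Suc j) = lag_ip (Suc m) k j / real (Suc j)"
      using lag_ip_Suc_Suc[of j m k] by (simp add: field_simps)
    then show ?thesis using Suc Suc.IH[of "Suc m" k] by simp
  qed
qed

text \<open>After \<open>r\<close> differentiations of \<open>exp (- s) * s ^ n\<close> the degree
  is \<open>r\<close> and the parameter \<open>n - r\<close>; at \<open>r = n\<close> parameter 0 is
  reached.\<close>

lemma laguerre_poly_eq: "laguerre_poly n t = lag 0 n t"
proof -
  have "(deriv ^^ r) (\<lambda>s. exp (- s) * s ^ n) = (\<lambda>s. fact r * (exp (- s) * s ^ (n - r) * lag (n - r) r s))"
    if "r \<le> n" for r
    using that
  proof (induction r)
    case (Suc r)
    obtain m where m: "n - r = Suc m" "n - Suc r = m" using Suc.prems by (metis Suc_diff_Suc Suc_le_lessD)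
    have "deriv (\<lambda>s. fact r * (exp (- s) * s ^ Suc m * lag (Suc m) r s)) s =
        fact (Suc r) * (exp (- s) * s ^ m * lag m (Suc r) s)" for s :: real
      by (rule DERIV_imp_deriv, rule DERIV_cong[OF DERIV_cmult[OF exp_power_lag_deriv]]) simp
    then show ?case using Suc m by simp
  qed simp
  from this[of n] show ?thesis by (simp add: laguerre_poly_def exp_minus)
qed

section \<open>Derivatives of Laguerre functions\<close>

fun dlag :: "nat \<Rightarrow> nat \<Rightarrow> nat \<Rightarrow> real \<Rightarrow> real" where
  "dlag 0 i j t = exp (- t / 2) * lag i j t"
| "dlag (Suc p) i 0 t = - dlag p (Suc i) 0 t / 2"
| "dlag (Suc p) i (Suc j) t = - (dlag p (Suc i) (Suc j) t + dlag p (Suc i) j t) / 2"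

text \<open>By \<open>lag_Suc\<close> the derivative of \<open>exp (- t / 2) * lag i j t\<close> is
  minus the average of the functions of degree \<open>j\<close> and \<open>j - 1\<close> with
  parameter \<open>i + 1\<close>. The recursion for \<open>dlag\<close> repeats this, so
  \<open>dlag p i j\<close> is a \<open>p\<close>-th derivative written in functions of parameter
  \<open>i + p\<close>, for which \<open>t ^ (i + p)\<close> is the natural weight.\<close>

lemma dlag_has_derivative: "(dlag p i j has_real_derivative dlag (Suc p) i j t) (at t)"
proof (induction p arbitrary: i j)
  case 0
  have "((\<lambda>t. exp (- t / 2) * lag i j t) has_real_derivative
      exp (- t / 2) * (- 1 / 2) * lag i j t + exp (- t / 2) * lag_deriv i j t) (at t)"
    by (rule derivative_eq_intros lag_has_derivative refl | simp)+
  moreover have "exp (- t / 2) * (- 1 / 2) * lag i j t + exp (- t / 2) * lag_deriv i j t = dlag 1 i j t"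
  proof (cases j)
    case (Suc k)
    then show ?thesis by (simp add: lag_deriv_def lag_Suc[of i k t] algebra_simps)
  qed (simp add: lag_deriv_def)
  moreover have "dlag 0 i j = (\<lambda>t. exp (- t / 2) * lag i j t)" by (simp add: fun_eq_iff)
  ultimately show ?case by simp
next
  case (Suc p)
  show ?case
  proof (cases j)
    case 0
    have "((\<lambda>t. - dlag p (Suc i) 0 t / 2) has_real_derivative - dlag (Suc p) (Suc i) 0 t / 2) (at t)"
      by (intro DERIV_cdivide DERIV_minus Suc.IH)
    moreover have "dlag (Suc p) i 0 = (\<lambda>t. - dlag p (Suc i) 0 t / 2)" by (simp add: fun_eq_iff)
    ultimately show ?thesis using 0 by simp
  next
    case j: (Suc k)
    have "((\<lambda>t. - (dlag p (Suc i) (Suc k) t + dlag p (Suc i) k t) / 2) has_real_derivative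
        - (dlag (Suc p) (Suc i) (Suc k) t + dlag (Suc p) (Suc i) k t) / 2) (at t)"
      by (intro DERIV_cdivide DERIV_minus DERIV_add Suc.IH)
    moreover have "dlag (Suc p) i (Suc k) = (\<lambda>t. - (dlag p (Suc i) (Suc k) t + dlag p (Suc i) k t) / 2)"
      by (simp add: fun_eq_iff)
    ultimately show ?thesis using j by simp
  qed
qed

declare dlag.simps [simp del]

lemma continuous_dlag: "isCont (dlag p i j) t"
  using dlag_has_derivative by (rule DERIV_isCont)

lemma continuous_on_dlag: "continuous_on S (dlag p i j)"
  by (intro continuous_at_imp_continuous_on ballI continuous_dlag)

lemma dlag_eq_exp_poly: "\<exists>P. real_polynomial_function P \<and> (\<forall>t. dlag p i j t = exp (- t / 2) * P t)"
proof (induction p i j rule: dlag.induct[of _ p i j "0::real" for p i j, case_names 0 Suc0 SucSuc])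
  case (0 i j t)
  then show ?case using real_polynomial_function_lag by (auto simp: dlag.simps)
next
  case (Suc0 p i t)
  then obtain P where P: "real_polynomial_function P" "\<forall>t. dlag p (Suc i) 0 t = exp (- t / 2) * P t" by blast
  then show ?case
    by (intro exI[of _ "\<lambda>t. (- 1 / 2) * P t"] conjI real_polynomial_function.intros(4) real_polynomial_function.intros(2))
      (auto simp: dlag.simps)
next
  case (SucSuc p i j t)
  then obtain P Q where P: "real_polynomial_function P" "\<forall>t. dlag p (Suc i) (Suc j) t = exp (- t / 2) * P t"
    and Q: "real_polynomial_function Q" "\<forall>t. dlag p (Suc i) j t = exp (- t / 2) * Q t" by blast
  then show ?case
    by (intro exI[of _ "\<lambda>t. (- 1 / 2) * (P t + Q t)"] conjI real_polynomial_function.intros(4)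
        real_polynomial_function.intros(2) real_polynomial_function.intros(3)) (auto simp: dlag.simps algebra_simps)
qed

lemma dlag_product_integrable:
  "set_integrable lborel {0<..} (\<lambda>t. t ^ q * (dlag p i j t * dlag p' i' j' t))"
proof -
  obtain P Q where P: "real_polynomial_function P" "\<And>t. dlag p i j t = exp (- t / 2) * P t"
    and Q: "real_polynomial_function Q" "\<And>t. dlag p' i' j' t = exp (- t / 2) * Q t"
    using dlag_eq_exp_poly by metis
  have "(\<lambda>t. t ^ q * (dlag p i j t * dlag p' i' j' t)) = (\<lambda>t. exp (- t) * (t ^ q * (P t * Q t)))"
  proof
    fix t :: real
    have "exp (- t) = exp (- t / 2) * exp (- t / 2)" by (simp flip: exp_add)
    then show "t ^ q * (dlag p i j t * dlag p' i' j' t) = exp (- t) * (t ^ q * (P t * Q t))"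
      by (simp add: P(2) Q(2))
  qed
  then show ?thesis
    using real_poly_exp(1)[of "\<lambda>t. t ^ q * (P t * Q t)"] P(1) Q(1)
    by (simp add: real_polynomial_function.intros(4) real_polynomial_function_power real_polynomial_function_id)
qed

lemma dlag_square_integrable: "set_integrable lborel {0<..} (\<lambda>t. t ^ q * (dlag p i j t)\<^sup>2)"
  using dlag_product_integrable[of q p i j p i j] by (simp add: power2_eq_square)

section \<open>Weighted square integrals\<close>

lemma LBINT_dlag_0_product:
  "(LBINT t:{0<..}. t ^ q * (dlag 0 q i t * dlag 0 q j t)) = (if i = j then fact (j + q) / fact j else 0)"
proof -
  have eq: "t ^ q * (dlag 0 q i t * dlag 0 q j t) = exp (- t) * (t ^ q * lag q i t * lag q j t)" for t
  proof -
    have "exp (- t) = exp (- t / 2) * exp (- t / 2)" by (simp flip: exp_add)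
    then show ?thesis by (simp add: dlag.simps)
  qed
  show ?thesis using lag_ip_eq[of q i j] unfolding lag_ip_def eq .
qed

lemma LBINT_square_combination:
  fixes x y :: "real \<Rightarrow> real"
  assumes x: "set_integrable lborel {0<..} (\<lambda>t. t ^ q * (x t)\<^sup>2)" "(LBINT t:{0<..}. t ^ q * (x t)\<^sup>2) \<le> M"
    and y: "set_integrable lborel {0<..} (\<lambda>t. t ^ q * (y t)\<^sup>2)" "(LBINT t:{0<..}. t ^ q * (y t)\<^sup>2) \<le> M"
    and z: "set_integrable lborel {0<..} (\<lambda>t. t ^ q * (z t)\<^sup>2)"
    and le: "\<And>t. (z t)\<^sup>2 \<le> c * ((x t)\<^sup>2 + (y t)\<^sup>2)" and c: "0 \<le> c"
  shows "(LBINT t:{0<..}. t ^ q * (z t)\<^sup>2) \<le> c * (M + M)"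
proof -
  have "(LBINT t:{0<..}. t ^ q * (z t)\<^sup>2) \<le> (LBINT t:{0<..}. c * (t ^ q * (x t)\<^sup>2 + t ^ q * (y t)\<^sup>2))"
  proof (rule set_integral_mono[OF z])
    show "set_integrable lborel {0<..} (\<lambda>t. c * (t ^ q * (x t)\<^sup>2 + t ^ q * (y t)\<^sup>2))"
      by (intro set_integrable_mult_right set_integral_add x y)
    fix t :: real assume "t \<in> {0<..}"
    then have "t ^ q * (z t)\<^sup>2 \<le> t ^ q * (c * ((x t)\<^sup>2 + (y t)\<^sup>2))" by (intro mult_left_mono le) simp
    then show "t ^ q * (z t)\<^sup>2 \<le> c * (t ^ q * (x t)\<^sup>2 + t ^ q * (y t)\<^sup>2)" by (simp add: algebra_simps)
  qed
  also have "\<dots> = c * ((LBINT t:{0<..}. t ^ q * (x t)\<^sup>2) + (LBINT t:{0<..}. t ^ q * (y t)\<^sup>2))"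
    by (simp add: set_integral_add(2)[OF x(1) y(1)])
  also have "\<dots> \<le> c * (M + M)" using x y c by (intro mult_left_mono) auto
  finally show ?thesis .
qed

lemma fact_div_fact_le_power: "fact (j + q) / fact j \<le> (real (j + q) ^ q :: real)"
proof -
  have "fact (j + q) div fact j \<le> (j + q) ^ q"
    using fact_div_fact_le_pow[of q "j + q"] by simp
  moreover have "fact (j + q) / fact j = real (fact (j + q) div fact j)"
    by (simp add: real_of_nat_div fact_dvd)
  ultimately show ?thesis by (metis of_nat_le_iff of_nat_power)
qed

text \<open>The exponent \<open>i + p\<close> matches the parameter produced by \<open>p\<close>
  derivatives, and each derivative, being an average of two functions, does not increase the bound.
  Each of the \<open>r\<close> surplus powers of \<open>t\<close> is matched by raising the
  parameter with \<open>lag_Suc\<close>; this is a difference of two functions and costs a factor 4.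
  With exponent and parameter equal to \<open>q\<close>, the integral is
  \<open>fact (j + q) / fact j\<close>.\<close>

lemma LBINT_dlag_square_le:
  "(LBINT t:{0<..}. t ^ (i + p + r) * (dlag p i j t)\<^sup>2) \<le> 4 ^ r * real (j + (i + p + r)) ^ (i + p + r)"
proof (induction p arbitrary: i j)
  case 0
  show ?case
  proof (induction r arbitrary: i j)
    case 0
    have "(LBINT t:{0<..}. t ^ i * (dlag 0 i j t)\<^sup>2) = fact (j + i) / fact j"
      using LBINT_dlag_0_product[of i j j] by (simp only: power2_eq_square simp_thms if_True)
    then show ?case using fact_div_fact_le_power[of j i] by simp
  next
    case (Suc r)
    let ?q = "i + 0 + Suc r"
    have e: "Suc i + 0 + r = ?q" by simp
    have IH: "(LBINT t:{0<..}. t ^ ?q * (dlag 0 (Suc i) k t)\<^sup>2) \<le> 4 ^ r * real (j + ?q) ^ ?q" if "k \<le> j" for k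
    proof -
      have "real (k + ?q) ^ ?q \<le> real (j + ?q) ^ ?q" using that by (intro power_mono) auto
      then show ?thesis
        using order_trans[OF Suc.IH[of "Suc i" k, unfolded e] mult_left_mono[of "real (k + ?q) ^ ?q" "real (j + ?q) ^ ?q" "4 ^ r"]]
        by simp
    qed
    show ?case
    proof (cases j)
      case 0
      have "4 ^ r * real (j + ?q) ^ ?q \<le> 4 ^ Suc r * real (j + ?q) ^ ?q" by (intro mult_right_mono) auto
      then have "(LBINT t:{0<..}. t ^ ?q * (dlag 0 (Suc i) 0 t)\<^sup>2) \<le> 4 ^ Suc r * real (j + ?q) ^ ?q"
        using IH[of 0] by linarith
      moreover have "dlag 0 i 0 t = dlag 0 (Suc i) 0 t" for t by (simp add: dlag.simps)
      ultimately show ?thesis using 0 by (simp only:)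
    next
      case j: (Suc k)
      have "(LBINT t:{0<..}. t ^ ?q * (dlag 0 i j t)\<^sup>2) \<le> 2 * (4 ^ r * real (j + ?q) ^ ?q + 4 ^ r * real (j + ?q) ^ ?q)"
      proof (rule LBINT_square_combination[where x = "dlag 0 (Suc i) j" and y = "dlag 0 (Suc i) k"])
        fix t
        have "dlag 0 i j t = dlag 0 (Suc i) j t - dlag 0 (Suc i) k t"
          using lag_Suc[of i k t] j by (simp add: dlag.simps right_diff_distrib)
        moreover have "(a - b)\<^sup>2 \<le> 2 * (a\<^sup>2 + b\<^sup>2)" for a b :: real
          using sum_squares_ge_zero[of "a + b" 0] by (simp add: power2_eq_square algebra_simps)
        ultimately show "(dlag 0 i j t)\<^sup>2 \<le> 2 * ((dlag 0 (Suc i) j t)\<^sup>2 + (dlag 0 (Suc i) k t)\<^sup>2)" by simp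
      qed (rule dlag_square_integrable IH | simp add: j)+
      then show ?thesis by simp
    qed
  qed
next
  case (Suc p)
  let ?q = "i + Suc p + r"
  have e: "Suc i + p + r = ?q" by simp
  have IH: "(LBINT t:{0<..}. t ^ ?q * (dlag p (Suc i) k t)\<^sup>2) \<le> 4 ^ r * real (j + ?q) ^ ?q" if "k \<le> j" for k
  proof -
    have "real (k + ?q) ^ ?q \<le> real (j + ?q) ^ ?q" using that by (intro power_mono) auto
    then show ?thesis
      using order_trans[OF Suc.IH[of "Suc i" k, unfolded e] mult_left_mono[of "real (k + ?q) ^ ?q" "real (j + ?q) ^ ?q" "4 ^ r"]]
      by simp
  qed
  show ?case
  proof (cases j)
    case 0
    have "(LBINT t:{0<..}. t ^ ?q * (dlag (Suc p) i j t)\<^sup>2) \<le> 1/2 * (4 ^ r * real (j + ?q) ^ ?q + 4 ^ r * real (j + ?q) ^ ?q)"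
      by (rule LBINT_square_combination[where x = "dlag p (Suc i) 0" and y = "dlag p (Suc i) 0"])
         (rule dlag_square_integrable IH | simp add: 0 dlag.simps power2_eq_square)+
    then show ?thesis by simp
  next
    case j: (Suc k)
    have "(LBINT t:{0<..}. t ^ ?q * (dlag (Suc p) i j t)\<^sup>2) \<le> 1/2 * (4 ^ r * real (j + ?q) ^ ?q + 4 ^ r * real (j + ?q) ^ ?q)"
    proof (rule LBINT_square_combination[where x = "dlag p (Suc i) j" and y = "dlag p (Suc i) k"])
      fix t
      have "(- (a + b) / 2)\<^sup>2 \<le> 1/2 * (a\<^sup>2 + b\<^sup>2)" for a b :: real
        using sum_squares_ge_zero[of "a - b" 0] by (simp add: power2_eq_square field_simps)
      then show "(dlag (Suc p) i j t)\<^sup>2 \<le> 1/2 * ((dlag p (Suc i) j t)\<^sup>2 + (dlag p (Suc i) k t)\<^sup>2)"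
        unfolding j dlag.simps by simp
    qed (rule dlag_square_integrable IH | simp add: j)+
    then show ?thesis by simp
  qed
qed

section \<open>Pointwise bounds with polynomial growth in the degree\<close>

lemma dlag_0_Suc_sum: "dlag 0 (Suc i) j t = (\<Sum>r\<le>j. dlag 0 i r t)"
  by (simp add: dlag.simps lag_Suc_param sum_distrib_left)

text \<open>Here the weight is 1 but the parameter is 1, so \<open>LBINT_dlag_0_product\<close> does
  not apply directly; the function is a sum of \<open>j + 1\<close> functions of norm 1.\<close>

lemma LBINT_dlag_0_1_square: "(LBINT t:{0<..}. (dlag 0 1 j t)\<^sup>2) \<le> (real j + 1)\<^sup>2"
proof -
  have int: "set_integrable lborel {0<..} (\<lambda>t. (dlag 0 i r t)\<^sup>2)" for i r
    using dlag_square_integrable[of 0 0 i r] by simp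
  have "(LBINT t:{0<..}. (dlag 0 1 j t)\<^sup>2) \<le> (LBINT t:{0<..}. (\<Sum>r\<le>j. (dlag 0 0 r t)\<^sup>2) * (real j + 1))"
  proof (rule set_integral_mono)
    show "(dlag 0 1 j t)\<^sup>2 \<le> (\<Sum>r\<le>j. (dlag 0 0 r t)\<^sup>2) * (real j + 1)" for t
      using sum_squared_le_sum_of_squares[of "\<lambda>r. dlag 0 0 r t" "{..j}"]
      unfolding One_nat_def dlag_0_Suc_sum by (simp add: add.commute)
    show "set_integrable lborel {0<..} (\<lambda>t. (\<Sum>r\<le>j. (dlag 0 0 r t)\<^sup>2) * (real j + 1))"
      unfolding set_integrable_def using int[unfolded set_integrable_def, of 0]
      by (simp only: scaleR_sum_right scaleR_left_distrib mult.assoc[symmetric] real_scaleR_def sum_distrib_left sum_distrib_right)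
         (intro Bochner_Integration.integrable_sum integrable_mult_left, simp)
  qed (rule int)
  also have "\<dots> = (LBINT t:{0<..}. (\<Sum>r\<le>j. (dlag 0 0 r t)\<^sup>2)) * (real j + 1)" by simp
  also have "(LBINT t:{0<..}. (\<Sum>r\<le>j. (dlag 0 0 r t)\<^sup>2)) = (\<Sum>r\<le>j. (LBINT t:{0<..}. (dlag 0 0 r t)\<^sup>2))"
    unfolding set_lebesgue_integral_def scaleR_sum_right
    by (intro Bochner_Integration.integral_sum int[unfolded set_integrable_def])
  also have "\<dots> = (\<Sum>r\<le>j. 1)"
  proof (intro sum.cong refl)
    fix r
    show "(LBINT t:{0<..}. (dlag 0 0 r t)\<^sup>2) = 1"
      using LBINT_dlag_0_product[of 0 r r] by (simp add: power2_eq_square)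
  qed
  finally show ?thesis by (simp add: power2_eq_square add.commute)
qed

text \<open>A Sobolev argument: the square at \<open>a\<close> is minus the integral of its
  derivative over \<open>{a<..}\<close>, hence at most the sum of the square integrals of the
  function and of its derivative, which is at most \<open>1 + (j + 1)\<^sup>2\<close>. Polynomial
  growth in \<open>j\<close> is harmless against the decay of the coefficients.\<close>

lemma abs_dlag_0_0_le:
  assumes "0 \<le> a"
  shows "\<bar>dlag 0 0 j a\<bar> \<le> real j + 2"
proof -
  have sq: "(LBINT t:{0<..}. (dlag 0 0 j t)\<^sup>2) = 1"
    using LBINT_dlag_0_product[of 0 j j] by (simp add: power2_eq_square)
  have int: "set_integrable lborel {0<..} (\<lambda>t. (dlag p i r t)\<^sup>2)" for p i r
    using dlag_square_integrable[of 0 p i r] by simp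
  have d: "(LBINT t:{0<..}. (dlag 1 0 j t)\<^sup>2) \<le> (real j + 1)\<^sup>2"
  proof -
    have b: "(LBINT t:{0<..}. t ^ 0 * (dlag 0 1 r t)\<^sup>2) \<le> (real j + 1)\<^sup>2" if "r \<le> j" for r
      using order_trans[OF LBINT_dlag_0_1_square[of r] power_mono[of "real r + 1" "real j + 1" 2]] that by simp
    have "(LBINT t:{0<..}. t ^ 0 * (dlag 1 0 j t)\<^sup>2) \<le> 1/2 * ((real j + 1)\<^sup>2 + (real j + 1)\<^sup>2)"
    proof (rule LBINT_square_combination[where x = "dlag 0 1 j" and y = "dlag 0 1 (j - 1)"])
      fix t
      have "(- (a + b) / 2)\<^sup>2 \<le> 1/2 * (a\<^sup>2 + b\<^sup>2)" for a b :: real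
        using sum_squares_ge_zero[of "a - b" 0] by (simp add: power2_eq_square field_simps)
      then show "(dlag 1 0 j t)\<^sup>2 \<le> 1/2 * ((dlag 0 1 j t)\<^sup>2 + (dlag 0 1 (j - 1) t)\<^sup>2)"
        by (cases j) (auto simp: dlag.simps power2_eq_square)
    qed (use b[of j] b[of "j - 1"] int in auto)
    then show ?thesis by simp
  qed
  have intp: "set_integrable lborel {0<..} (\<lambda>t. 2 * (dlag 0 0 j t * dlag 1 0 j t))"
    using dlag_product_integrable[of 0 0 0 j 1 0 j] by simp
  have sub: "set_integrable lborel {a<..} f" if "set_integrable lborel {0<..} f" for f :: "real \<Rightarrow> real"
    by (rule set_integrable_subset[OF that]) (use assms in auto)
  have "(LBINT t:{a<..}. 2 * (dlag 0 0 j t * dlag 1 0 j t)) = 0 - (dlag 0 0 j a)\<^sup>2"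
  proof (rule LBINT_FTC_halfline[where F = "\<lambda>t. (dlag 0 0 j t)\<^sup>2"])
    show "((\<lambda>t. (dlag 0 0 j t)\<^sup>2) has_vector_derivative 2 * (dlag 0 0 j t * dlag 1 0 j t)) (at t)" for t
      unfolding has_real_derivative_iff_has_vector_derivative[symmetric]
      by (rule DERIV_cong[OF DERIV_power[OF dlag_has_derivative]]) simp
    show "((\<lambda>t. (dlag 0 0 j t)\<^sup>2) \<longlongrightarrow> (dlag 0 0 j a)\<^sup>2) (at_right a)"
      by (intro tendsto_intros filterlim_mono[OF isContD[OF continuous_dlag] order_refl at_le]) auto
    have "(\<lambda>t. (dlag 0 0 j t)\<^sup>2) = (\<lambda>t. exp (- t) * (lag 0 j t * lag 0 j t))"
    proof
      fix t :: real
      have "exp (- t) = exp (- t / 2) * exp (- t / 2)" by (simp flip: exp_add)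
      then show "(dlag 0 0 j t)\<^sup>2 = exp (- t) * (lag 0 j t * lag 0 j t)" by (simp add: dlag.simps power2_eq_square)
    qed
    then show "((\<lambda>t. (dlag 0 0 j t)\<^sup>2) \<longlongrightarrow> 0) at_top"
      using real_poly_exp(2)[OF real_polynomial_function.intros(4)[OF real_polynomial_function_lag real_polynomial_function_lag]]
      by simp
  qed (use sub[OF intp] continuous_dlag in \<open>auto intro!: continuous_intros\<close>)
  then have "(dlag 0 0 j a)\<^sup>2 = - (LBINT t:{a<..}. 2 * (dlag 0 0 j t * dlag 1 0 j t))" by linarith
  also have "\<dots> = (LBINT t:{a<..}. - (2 * (dlag 0 0 j t * dlag 1 0 j t)))"
    unfolding set_lebesgue_integral_def scaleR_minus_right Bochner_Integration.integral_minus ..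
  also have "\<dots> \<le> (LBINT t:{a<..}. (dlag 0 0 j t)\<^sup>2 + (dlag 1 0 j t)\<^sup>2)"
  proof (rule set_integral_mono)
    show "set_integrable lborel {a<..} (\<lambda>t. - (2 * (dlag 0 0 j t * dlag 1 0 j t)))"
      using sub[OF intp] unfolding set_integrable_def by simp
    show "set_integrable lborel {a<..} (\<lambda>t. (dlag 0 0 j t)\<^sup>2 + (dlag 1 0 j t)\<^sup>2)"
      by (intro set_integral_add sub int)
    show "- (2 * (dlag 0 0 j t * dlag 1 0 j t)) \<le> (dlag 0 0 j t)\<^sup>2 + (dlag 1 0 j t)\<^sup>2" for t
      using sum_squares_ge_zero[of "dlag 0 0 j t + dlag 1 0 j t" 0] by (simp add: power2_eq_square algebra_simps)
  qed
  also have "\<dots> \<le> (LBINT t:{0<..}. (dlag 0 0 j t)\<^sup>2 + (dlag 1 0 j t)\<^sup>2)"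
  proof -
    have i: "set_integrable lborel {0<..} (\<lambda>t. (dlag 0 0 j t)\<^sup>2 + (dlag 1 0 j t)\<^sup>2)"
      by (intro set_integral_add int)
    show ?thesis
      unfolding set_lebesgue_integral_def
      by (rule integral_mono[OF sub[OF i, unfolded set_integrable_def] i[unfolded set_integrable_def]])
         (use assms in \<open>auto simp: indicator_def\<close>)
  qed
  also have "\<dots> = 1 + (LBINT t:{0<..}. (dlag 1 0 j t)\<^sup>2)"
    unfolding set_integral_add(2)[OF int int] sq ..
  also have "\<dots> \<le> (real j + 2)\<^sup>2" using d by (simp add: power2_eq_square algebra_simps)
  finally show ?thesis by (simp add: abs_le_square_iff[symmetric] flip: abs_le_square_iff)
qed

text \<open>By the three-term recurrence, multiplication by \<open>t\<close> is a combination of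
  neighbouring degrees with coefficients of total size at most \<open>4 * j + 4\<close>. Each power
  of \<open>t\<close> costs one such factor and may raise the degree by one, which explains
  \<open>j + k + 1\<close>.\<close>

lemma power_abs_dlag_0_0_le:
  assumes "0 \<le> t"
  shows "t ^ k * \<bar>dlag 0 0 j t\<bar> \<le> (4 * real (j + k + 1)) ^ (k + 1)"
proof (induction k arbitrary: j)
  case 0
  then show ?case using abs_dlag_0_0_le[OF assms, of j] by simp
next
  case (Suc k)
  let ?M = "(4 * real (j + Suc k + 1)) ^ (k + 1)"
  have IH: "t ^ k * \<bar>dlag 0 0 r t\<bar> \<le> ?M" if "r \<le> Suc j" for r
    using order_trans[OF Suc.IH[of r] power_mono[of "4 * real (r + k + 1)" "4 * real (j + Suc k + 1)" "k + 1"]] that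
    by simp
  have M: "0 \<le> ?M" by simp
  have "t ^ Suc k * \<bar>dlag 0 0 j t\<bar> \<le> (4 * real j + 4) * ?M"
  proof (cases j)
    case 0
    have "\<bar>t * dlag 0 0 j t\<bar> \<le> \<bar>dlag 0 0 1 t\<bar> + \<bar>dlag 0 0 0 t\<bar>"
    proof -
      have "t * dlag 0 0 j t = - dlag 0 0 1 t + dlag 0 0 0 t"
        using arg_cong[OF lag_three_term_0[of t], of "\<lambda>x. exp (- t / 2) * x"] 0
        by (simp add: dlag.simps algebra_simps)
      then show ?thesis by linarith
    qed
    then have "t ^ k * \<bar>t * dlag 0 0 j t\<bar> \<le> t ^ k * (\<bar>dlag 0 0 1 t\<bar> + \<bar>dlag 0 0 0 t\<bar>)"
      using assms by (intro mult_left_mono) auto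
    also have "\<dots> \<le> ?M + ?M" unfolding distrib_left by (intro add_mono IH) auto
    also have "\<dots> \<le> 4 * ?M" using M by linarith
    finally show ?thesis using assms 0 by (simp add: abs_mult mult_ac)
  next
    case j: (Suc i)
    have "t * dlag 0 0 j t = - (real i + 2) * dlag 0 0 (Suc j) t + (2 * real i + 3) * dlag 0 0 j t - (real i + 1) * dlag 0 0 i t"
      using arg_cong[OF lag_three_term[of t i], of "\<lambda>x. exp (- t / 2) * x"] unfolding j by (simp add: dlag.simps algebra_simps)
    then have "\<bar>t * dlag 0 0 j t\<bar> \<le> \<bar>(real i + 2) * dlag 0 0 (Suc j) t\<bar> + \<bar>(2 * real i + 3) * dlag 0 0 j t\<bar> + \<bar>(real i + 1) * dlag 0 0 i t\<bar>"
      by linarith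
    then have "t ^ k * \<bar>t * dlag 0 0 j t\<bar> \<le> t ^ k * (\<bar>(real i + 2) * dlag 0 0 (Suc j) t\<bar> + \<bar>(2 * real i + 3) * dlag 0 0 j t\<bar> + \<bar>(real i + 1) * dlag 0 0 i t\<bar>)"
      using assms by (intro mult_left_mono) auto
    also have "\<dots> = (real i + 2) * (t ^ k * \<bar>dlag 0 0 (Suc j) t\<bar>) + (2 * real i + 3) * (t ^ k * \<bar>dlag 0 0 j t\<bar>) + (real i + 1) * (t ^ k * \<bar>dlag 0 0 i t\<bar>)"
    proof -
      have "\<bar>c * x\<bar> = c * \<bar>x\<bar>" if "0 \<le> c" for c x :: real using that by (simp add: abs_mult)
      then have "\<bar>(real i + 2) * x\<bar> = (real i + 2) * \<bar>x\<bar>" "\<bar>(2 * real i + 3) * x\<bar> = (2 * real i + 3) * \<bar>x\<bar>"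
        "\<bar>(real i + 1) * x\<bar> = (real i + 1) * \<bar>x\<bar>" for x by auto
      then show ?thesis by (simp only: distrib_left mult.left_commute[of "t ^ k"])
    qed
    also have "\<dots> \<le> (real i + 2) * ?M + (2 * real i + 3) * ?M + (real i + 1) * ?M"
      by (intro add_mono mult_left_mono IH) (auto simp: j)
    also have "\<dots> \<le> (4 * real j + 4) * ?M" using M j by (simp add: algebra_simps)
    finally show ?thesis using assms by (simp add: abs_mult mult_ac)
  qed
  also have "\<dots> \<le> (4 * real (j + Suc k + 1)) * ?M" by (intro mult_right_mono M) auto
  finally show ?case by simp
qed

text \<open>Raising the parameter by one means summing \<open>j + 1\<close> functions. A derivative
  is an average of functions with parameter raised by one, so it costs one factor as well.\<close>

lemma power_abs_dlag_le:
  assumes "0 \<le> t"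
  shows "t ^ k * \<bar>dlag p i j t\<bar> \<le> (4 * real (j + k + 1)) ^ (k + 1 + i + p)"
proof (induction p arbitrary: i j)
  case 0
  show ?case
  proof (induction i arbitrary: j)
    case 0
    then show ?case using power_abs_dlag_0_0_le[OF assms, of k j] by simp
  next
    case (Suc i)
    let ?M = "(4 * real (j + k + 1)) ^ (k + 1 + i)"
    have IH: "t ^ k * \<bar>dlag 0 i r t\<bar> \<le> ?M" if "r \<le> j" for r
      using order_trans[OF Suc.IH[of r] power_mono[of "4 * real (r + k + 1)" "4 * real (j + k + 1)" "k + 1 + i + 0"]] that
      by simp
    have "t ^ k * \<bar>dlag 0 (Suc i) j t\<bar> \<le> t ^ k * (\<Sum>r\<le>j. \<bar>dlag 0 i r t\<bar>)"
      unfolding dlag_0_Suc_sum using assms by (intro mult_left_mono sum_abs) auto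
    also have "\<dots> \<le> (\<Sum>r\<le>j. ?M)" unfolding sum_distrib_left by (intro sum_mono IH) auto
    also have "\<dots> = (real j + 1) * ?M" by simp
    also have "\<dots> \<le> (4 * real (j + k + 1)) * ?M" by (intro mult_right_mono) auto
    finally show ?case by simp
  qed
next
  case (Suc p)
  let ?M = "(4 * real (j + k + 1)) ^ (k + 1 + i + Suc p)"
  have e: "k + 1 + Suc i + p = k + 1 + i + Suc p" by simp
  have IH: "t ^ k * \<bar>dlag p (Suc i) r t\<bar> \<le> ?M" if "r \<le> j" for r
    using order_trans[OF Suc.IH[of "Suc i" r, unfolded e] power_mono[of "4 * real (r + k + 1)" "4 * real (j + k + 1)" "k + 1 + i + Suc p"]] that
    by simp
  show ?case
  proof (cases j)
    case 0
    have "t ^ k * \<bar>dlag (Suc p) i j t\<bar> = t ^ k * \<bar>dlag p (Suc i) j t\<bar> / 2" unfolding 0 dlag.simps by simp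
    also have "\<dots> \<le> ?M / 2" using IH[of j] by (intro divide_right_mono) auto
    also have "\<dots> \<le> ?M" by simp
    finally show ?thesis .
  next
    case j: (Suc l)
    have "\<bar>dlag (Suc p) i j t\<bar> \<le> (\<bar>dlag p (Suc i) j t\<bar> + \<bar>dlag p (Suc i) l t\<bar>) / 2"
      using abs_triangle_ineq[of "dlag p (Suc i) j t" "dlag p (Suc i) l t"] unfolding j dlag.simps by simp
    then have "t ^ k * \<bar>dlag (Suc p) i j t\<bar> \<le> t ^ k * ((\<bar>dlag p (Suc i) j t\<bar> + \<bar>dlag p (Suc i) l t\<bar>) / 2)"
      using assms by (intro mult_left_mono) auto
    also have "\<dots> = (t ^ k * \<bar>dlag p (Suc i) j t\<bar> + t ^ k * \<bar>dlag p (Suc i) l t\<bar>) / 2" by (simp add: algebra_simps)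
    also have "\<dots> \<le> (?M + ?M) / 2" using IH[of j] IH[of l] j by (intro divide_right_mono add_mono) auto
    finally show ?thesis by simp
  qed
qed

text \<open>Rodrigues' formula has \<open>exp (- t)\<close> where \<open>dlag\<close> has
  \<open>exp (- t / 2)\<close>; the quotient \<open>exp (t / 2)\<close> contributes the term with
  1/2. In the integration by parts this term moves to the test function and makes the operator
  \<open>\<partial> + 1/2\<close>.\<close>

lemma power_dlag_has_derivative:
  "((\<lambda>t. t ^ Suc m * dlag 0 (Suc m) j t) has_real_derivative
    (1 / 2) * (t ^ Suc m * dlag 0 (Suc m) j t) + real (Suc j) * (t ^ m * dlag 0 m (Suc j) t)) (at t)"
proof -
  have "((\<lambda>t. exp (t / 2) * (exp (- t) * t ^ Suc m * lag (Suc m) j t)) has_real_derivative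
      (exp (t / 2) * (1 / 2)) * (exp (- t) * t ^ Suc m * lag (Suc m) j t) +
      exp (t / 2) * (real (Suc j) * (exp (- t) * t ^ m * lag m (Suc j) t))) (at t)"
    by (rule derivative_eq_intros exp_power_lag_deriv refl | simp)+
  moreover have e: "exp (s / 2) * (exp (- s) * a * b) = a * (exp (- s / 2) * b)" for s a b :: real
  proof -
    have "exp (- s / 2) = exp (s / 2) * exp (- s)" by (simp flip: exp_add)
    then show ?thesis by simp
  qed
  moreover have "exp (t / 2) * (real (Suc j) * (exp (- t) * a * b)) = real (Suc j) * (a * (exp (- t / 2) * b))" for a b
    unfolding e[symmetric] by simp
  ultimately show ?thesis
    by (simp only: dlag.simps e mult.assoc[of "exp (t / 2)" "1 / 2"] mult.left_commute[of "exp (t / 2)" "1 / 2"])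
qed

section \<open>Integration over the orthant\<close>

text \<open>\<open>lborel\<close> is the image of a product measure indexed by \<open>Basis\<close>;
  reindexing the basis by the coordinates makes the product theorems applicable.\<close>

lemma lborel_vec_prod:
  fixes f :: "'d::finite \<Rightarrow> real \<Rightarrow> real"
  assumes f: "\<And>l. integrable lborel (f l)"
  shows "integrable lborel (\<lambda>x :: real ^ 'd. \<Prod>l\<in>UNIV. f l (x $ l))"
    "(LINT x|lborel. (\<Prod>l\<in>UNIV. f l ((x :: real ^ 'd) $ l))) = (\<Prod>l\<in>UNIV. LINT t|lborel. f l t)"
proof -
  interpret product_sigma_finite "\<lambda>b :: real ^ 'd. lborel :: real measure" ..
  have B: "(Basis :: (real ^ 'd) set) = (\<lambda>l. axis l 1) ` UNIV" by (auto simp: Basis_vec_def)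
  have inj: "inj (\<lambda>l :: 'd. axis l (1 :: real))" by (auto simp: inj_on_def axis_eq_axis)
  have m[measurable]: "(\<lambda>x. \<Prod>l\<in>UNIV. f l ((x :: real ^ 'd) $ l)) \<in> borel_measurable borel"
    using borel_measurable_integrable[OF f] by measurable
  have g[measurable]: "(\<lambda>h. \<Sum>b\<in>Basis. h b *\<^sub>R b :: real ^ 'd) \<in> measurable (Pi\<^sub>M Basis (\<lambda>_. lborel)) borel"
    by measurable
  have eq: "(\<Prod>l\<in>UNIV. f l ((\<Sum>b\<in>Basis. h b *\<^sub>R b :: real ^ 'd) $ l)) = (\<Prod>b\<in>Basis. f (axis_index b) (h b))" for h
  proof -
    have "(\<Sum>b\<in>Basis. h b *\<^sub>R b :: real ^ 'd) $ l = h (axis l 1)" for l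
      by (simp add: cart_eq_inner_axis inner_sum_left_Basis axis_in_Basis_iff)
    then show ?thesis unfolding B by (subst prod.reindex[OF inj]) simp
  qed
  show "integrable lborel (\<lambda>x :: real ^ 'd. \<Prod>l\<in>UNIV. f l (x $ l))"
    unfolding lborel_eq[where 'a = "real ^ 'd"] by (subst integrable_distr_eq[OF g m]) (unfold eq, intro product_integrable_prod f, simp)
  have "(LINT x|lborel. (\<Prod>l\<in>UNIV. f l ((x :: real ^ 'd) $ l))) = (\<Prod>b\<in>Basis. LINT t|lborel. f (axis_index (b :: real ^ 'd)) t)"
    unfolding lborel_eq[where 'a = "real ^ 'd"]
    by (subst integral_distr[OF g m]) (unfold eq, intro product_integral_prod f, simp)
  then show "(LINT x|lborel. (\<Prod>l\<in>UNIV. f l ((x :: real ^ 'd) $ l))) = (\<Prod>l\<in>UNIV. LINT t|lborel. f l t)"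
    unfolding B by (subst (asm) prod.reindex[OF inj]) simp
qed

lemma indicator_orthant: "indicator orthant x = (\<Prod>l\<in>UNIV. indicator {0<..} (x $ l) :: real)"
proof (cases "x \<in> orthant")
  case False
  then obtain l where "\<not> 0 < x $ l" by (auto simp: orthant_def)
  then have "(\<Prod>l\<in>UNIV. indicator {0<..} (x $ l) :: real) = 0" by (intro prod_zero bexI[of _ l]) auto
  then show ?thesis using False by simp
qed (auto simp: orthant_def)

lemma orthant_prod:
  fixes f :: "'d::finite \<Rightarrow> real \<Rightarrow> real"
  assumes f: "\<And>l. set_integrable lborel {0<..} (f l)"
  shows "set_integrable lborel orthant (\<lambda>x :: real ^ 'd. \<Prod>l\<in>UNIV. f l (x $ l))"
    "(LINT x:orthant|lborel. (\<Prod>l\<in>UNIV. f l ((x :: real ^ 'd) $ l))) = (\<Prod>l\<in>UNIV. LBINT t:{0<..}. f l t)"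
  using lborel_vec_prod[of "\<lambda>l t. indicator {0<..} t * f l t"] f
  unfolding set_integrable_def set_lebesgue_integral_def real_scaleR_def indicator_orthant prod.distrib by simp_all

lemma open_orthant: "open (orthant :: (real ^ 'd::finite) set)"
proof -
  have "orthant = (\<Inter>l. {x :: real ^ 'd. 0 < x $ l})" by (auto simp: orthant_def)
  also have "open \<dots>" by (intro open_INT ballI open_Collect_less continuous_intros) auto
  finally show ?thesis .
qed

lemma closed_orthant_superset: "orthant \<subseteq> closed_orthant"
  unfolding orthant_def closed_orthant_def by (auto simp: less_imp_le)

lemma orthant_sets [measurable]: "orthant \<in> sets borel"
  by (intro borel_open open_orthant)

section \<open>Integrable majorants on the orthant\<close>

lemma set_integrable_inverse_square: "set_integrable lborel {a<..} (\<lambda>t :: real. 1 / (1 + (t - a))\<^sup>2)"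
proof -
  have "(\<integral>\<^sup>+x. ennreal (1 / (1 + (x - a))\<^sup>2) * indicator {a ..} x \<partial>lborel) = ennreal (0 - - 1 / (1 + (a - a)))"
  proof (rule nn_integral_FTC_atLeast[where F = "\<lambda>t. - 1 / (1 + (t - a))"])
    show "((\<lambda>t. - 1 / (1 + (t - a))) has_real_derivative 1 / (1 + (x - a))\<^sup>2) (at x)" if "a \<le> x" for x
      using that by (auto intro!: derivative_eq_intros simp: power2_eq_square)
    show "((\<lambda>t. - 1 / (1 + (t - a))) \<longlongrightarrow> 0) at_top"
      by (intro tendsto_divide_0[OF tendsto_const] filterlim_at_top_imp_at_infinity
          filterlim_tendsto_add_at_top[OF tendsto_const]
          filterlim_tendsto_add_at_top[of "\<lambda>_. - a" "-a" _ "\<lambda>t. t", simplified]) (auto intro: filterlim_ident)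
  qed auto
  moreover have "ennreal (1 / (1 + (x - a))\<^sup>2) * indicator {a ..} x = ennreal (indicator {a..} x * (1 / (1 + (x - a))\<^sup>2))" for x
    by (simp split: split_indicator)
  ultimately have "(\<integral>\<^sup>+x. ennreal (indicator {a..} x * (1 / (1 + (x - a))\<^sup>2)) \<partial>lborel) < \<infinity>" by simp
  then have "integrable lborel (\<lambda>x. indicator {a..} x * (1 / (1 + (x - a))\<^sup>2))"
    by (intro integrableI_nonneg AE_I2) auto
  then have "set_integrable lborel {a..} (\<lambda>t :: real. 1 / (1 + (t - a))\<^sup>2)"
    unfolding set_integrable_def by simp
  then show ?thesis by (rule set_integrable_subset) auto
qed

text \<open>A fixed integrable majorant. Being a product of functions at most 1 on the orthant, it
  also majorises along every line parallel to an axis.\<close>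

definition decay :: "real ^ 'd::finite \<Rightarrow> real" where
  "decay x = (\<Prod>l\<in>UNIV. 1 / (1 + x $ l)\<^sup>2)"

lemma decay_integrable: "set_integrable lborel orthant (decay :: real ^ 'd::finite \<Rightarrow> real)"
  unfolding decay_def[abs_def]
  by (rule orthant_prod(1)) (use set_integrable_inverse_square[of 0] in simp)

lemma decay_nonneg: "0 \<le> decay x"
  unfolding decay_def by (intro prod_nonneg) auto

lemma orthant_measurable:
  assumes "continuous_on orthant (g :: real ^ 'd::finite \<Rightarrow> 'b::{banach, second_countable_topology})"
  shows "(\<lambda>x. indicator orthant x *\<^sub>R g x) \<in> borel_measurable lborel"
  using borel_measurable_continuous_on_indicator[OF _ assms] by simp

lemma orthant_integrable_bound:
  fixes g :: "real ^ 'd::finite \<Rightarrow> 'b::{banach, second_countable_topology}"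
  assumes g: "continuous_on orthant g" and f: "set_integrable lborel orthant f"
    and le: "\<And>x. x \<in> orthant \<Longrightarrow> norm (g x) \<le> f x"
  shows "set_integrable lborel orthant g"
  unfolding set_integrable_def
proof (rule Bochner_Integration.integrable_bound[OF f[unfolded set_integrable_def] orthant_measurable[OF g]], rule AE_I2)
  fix x
  show "norm (indicat_real orthant x *\<^sub>R g x) \<le> norm (indicat_real orthant x *\<^sub>R f x)"
    using le[of x] by (cases "x \<in> orthant") auto
qed

lemma orthant_integrable_decay:
  fixes g :: "real ^ 'd::finite \<Rightarrow> 'b::{banach, second_countable_topology}"
  assumes "continuous_on orthant g" "\<And>x. x \<in> orthant \<Longrightarrow> norm (g x) \<le> C * decay x"
  shows "set_integrable lborel orthant g"
  by (rule orthant_integrable_bound[OF assms(1) set_integrable_mult_right[OF decay_integrable] assms(2)])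

section \<open>Integration along one coordinate\<close>

lemma lborel_integral_translation:
  fixes f :: "'a::euclidean_space \<Rightarrow> 'b::{banach, second_countable_topology}"
  shows "(LINT x|lborel. f (x + c)) = (LINT x|lborel. f x)"
proof (cases "f \<in> borel_measurable borel")
  case True
  have "(LINT x|lborel. f x) = (LINT x|distr lborel borel ((+) c). f x)" by (simp only: lborel_distr_plus)
  also have "\<dots> = (LINT x|lborel. f (c + x))" using True by (subst integral_distr) auto
  finally show ?thesis by (simp add: add.commute)
next
  case False
  have "\<not> integrable lborel f" using False by auto
  moreover have "\<not> integrable lborel (\<lambda>x. f (x + c))"
  proof
    assume "integrable lborel (\<lambda>x. f (x + c))"
    then have "(\<lambda>x. f (x + c)) \<in> borel_measurable borel" by auto
    then have "(\<lambda>x. f (x - c + c)) \<in> borel_measurable borel" by (rule measurable_compose[rotated]) auto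
    then show False using False by simp
  qed
  ultimately show ?thesis by (simp add: not_integrable_integral_eq)
qed

lemma lborel_integrable_translation:
  fixes f :: "'a::euclidean_space \<Rightarrow> 'b::{banach, second_countable_topology}"
  assumes "integrable lborel f"
  shows "integrable lborel (\<lambda>x. f (x + c))"
proof -
  have m: "f \<in> borel_measurable borel" using assms by auto
  have "integrable (distr lborel borel ((+) c)) f" using assms by (simp only: lborel_distr_plus)
  then have "integrable lborel (\<lambda>x. f (c + x))" using m by (subst (asm) integrable_distr_eq) auto
  then show ?thesis by (simp add: add.commute)
qed

text \<open>Fubini along one coordinate, without splitting the space: average the line integrals against
  a slab of width 1 and shear.\<close>

lemma lborel_line_integrals_zero:
  fixes F :: "real ^ 'd::finite \<Rightarrow> complex"
  assumes F: "integrable lborel F" and zero: "\<And>x. (LINT s|lborel. F (x + s *\<^sub>R axis l 1)) = 0"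
  shows "(LINT x|lborel. F x) = 0"
proof -
  define \<phi> where "\<phi> = (indicator {0..1} :: real \<Rightarrow> real)"
  have Fm[measurable]: "F \<in> borel_measurable borel" using F by auto
  have \<phi>m[measurable]: "\<phi> \<in> borel_measurable borel" unfolding \<phi>_def by simp
  have [measurable]: "(\<lambda>x :: real ^ 'd. x $ l) \<in> borel_measurable borel" by simp
  have pair: "borel_measurable (lborel \<Otimes>\<^sub>M lborel) = (borel_measurable (borel \<Otimes>\<^sub>M borel) :: ('x::euclidean_space \<times> 'y::euclidean_space \<Rightarrow> complex) set)"
    by (intro measurable_cong_sets sets_pair_measure_cong) auto
  have \<phi>i: "integrable lborel (\<lambda>s. \<phi> (c - s))" "(LINT s|lborel. \<phi> (c - s)) = 1" for c
  proof -
    have "\<phi> (c - s) = indicator {c - 1..c} s" for s unfolding \<phi>_def by (auto simp: indicator_def)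
    then show "integrable lborel (\<lambda>s. \<phi> (c - s))" "(LINT s|lborel. \<phi> (c - s)) = 1"
      by (simp_all add: integrable_indicator_iff)
  qed
  have \<phi>n: "\<bar>\<phi> s\<bar> = \<phi> s" for s unfolding \<phi>_def by simp
  let ?K = "\<lambda>s (x :: real ^ 'd). \<phi> (x $ l - s) *\<^sub>R F x"
  let ?H = "\<lambda>s (x :: real ^ 'd). \<phi> (x $ l) *\<^sub>R F (x + s *\<^sub>R axis l 1)"
  have K0: "integrable (lborel \<Otimes>\<^sub>M lborel) (\<lambda>(x, s). ?K s x)"
  proof (rule lborel_pair.Fubini_integrable)
    show "(\<lambda>(x, s). ?K s x) \<in> borel_measurable (lborel \<Otimes>\<^sub>M lborel)"
      unfolding pair by measurable
    show "integrable lborel (\<lambda>x. LINT y|lborel. norm (case (x, y) of (x, s) \<Rightarrow> ?K s x))"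
      using F by (simp add: \<phi>n \<phi>i(2))
    show "AE x in lborel. integrable lborel (\<lambda>y. case (x, y) of (x, s) \<Rightarrow> ?K s x)"
      by (intro AE_I2) (simp add: \<phi>i(1))
  qed
  have K: "integrable (lborel \<Otimes>\<^sub>M lborel) (\<lambda>(s, x). ?K s x)"
    using lborel_pair.integrable_product_swap[OF K0] by (simp add: case_prod_beta')
  have trans: "?K s (x + s *\<^sub>R axis l 1) = ?H s x" for s x by simp
  have Kint: "integrable lborel (?K s)" for s
  proof (rule Bochner_Integration.integrable_bound[OF F])
    show "AE x in lborel. norm (?K s x) \<le> norm (F x)" unfolding \<phi>_def by (intro AE_I2) (auto simp: indicator_def)
  qed measurable
  have H: "integrable (lborel \<Otimes>\<^sub>M lborel) (\<lambda>(s, x). ?H s x)"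
  proof (rule lborel_pair.Fubini_integrable)
    show "(\<lambda>(s, x). ?H s x) \<in> borel_measurable (lborel \<Otimes>\<^sub>M lborel)"
      unfolding pair by measurable
    have "(LINT x|lborel. norm (?H s x)) = (LINT x|lborel. norm (?K s x))" for s
      using lborel_integral_translation[of "\<lambda>x. norm (?K s x)" "s *\<^sub>R axis l 1"] by simp
    then show "integrable lborel (\<lambda>s. LINT x|lborel. norm (case (s, x) of (s, x) \<Rightarrow> ?H s x))"
      using lborel_pair.integrable_fst'[OF integrable_norm[OF K]] by simp
    show "AE s in lborel. integrable lborel (\<lambda>x. case (s, x) of (s, x) \<Rightarrow> ?H s x)"
    proof (intro AE_I2)
      fix s
      show "integrable lborel (\<lambda>x. case (s, x) of (s, x) \<Rightarrow> ?H s x)"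
        using lborel_integrable_translation[OF Kint[of s], where c = "s *\<^sub>R axis l 1"] unfolding trans by simp
    qed
  qed
  \<comment> \<open>The factor \<open>\<phi> (x $ l - s)\<close> has integral 1 in \<open>s\<close>.
    For fixed \<open>s\<close>, translation by \<open>s\<close> turns the moving slab into the fixed
    one, and what remains inside is the integral of \<open>F\<close> over a line.\<close>
  have "(LINT x|lborel. F x) = (LINT x|lborel. LINT s|lborel. ?K s x)"
    using \<phi>i by simp
  also have "\<dots> = (LINT s|lborel. LINT x|lborel. ?K s x)"
    by (rule lborel_pair.Fubini_integral[OF K])
  also have "\<dots> = (LINT s|lborel. LINT x|lborel. ?H s x)"
    using lborel_integral_translation[of "?K s" "s *\<^sub>R axis l 1" for s] unfolding trans by simp
  also have "\<dots> = (LINT x|lborel. LINT s|lborel. ?H s x)"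
    by (rule lborel_pair.Fubini_integral[OF H, symmetric])
  also have "\<dots> = 0" by (simp add: zero)
  finally show ?thesis .
qed

text \<open>On a line in direction \<open>l\<close> the integral of \<open>H'\<close> is a
  difference of limits of \<open>H\<close>. The bound \<open>x $ l / (1 + x $ l)\<^sup>2\<close>
  lets both limits vanish, at the wall of the orthant and at infinity. Lines that miss the orthant
  contribute 0.\<close>

lemma LINT_orthant_partial_zero:
  fixes H H' :: "real ^ 'd::finite \<Rightarrow> complex"
  assumes deriv: "\<And>x. x \<in> orthant \<Longrightarrow> ((\<lambda>s. H (x + s *\<^sub>R axis l 1)) has_vector_derivative H' x) (at 0)"
    and cont: "continuous_on orthant H'"
    and H': "\<And>x. x \<in> orthant \<Longrightarrow> norm (H' x) \<le> C * decay x"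
    and H: "\<And>x. x \<in> orthant \<Longrightarrow> norm (H x) \<le> C * (x $ l / (1 + x $ l)\<^sup>2)"
  shows "(LINT x:orthant|lborel. H' x) = 0"
  unfolding set_lebesgue_integral_def
proof (rule lborel_line_integrals_zero)
  show "integrable lborel (\<lambda>x. indicat_real orthant x *\<^sub>R H' x)"
    using orthant_integrable_decay[OF cont H'] unfolding set_integrable_def .
  fix x :: "real ^ 'd"
  let ?y = "\<lambda>s. x + s *\<^sub>R axis l 1"
  \<comment> \<open>The line enters the orthant at the parameter \<open>a\<close>.\<close>
  define a where "a = - x $ l"
  have comp: "?y s $ m = (if m = l then x $ l + s else x $ m)" for s m by (simp add: axis_def)
  show "(LINT s|lborel. indicat_real orthant (?y s) *\<^sub>R H' (?y s)) = 0"
  proof (cases "\<forall>m. m \<noteq> l \<longrightarrow> 0 < x $ m")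
    case False
    then have "?y s \<notin> orthant" for s unfolding orthant_def using comp by (metis mem_Collect_eq)
    then show ?thesis by simp
  next
    case True
    have orth: "?y s \<in> orthant \<longleftrightarrow> a < s" for s
      unfolding orthant_def a_def using True comp by (auto; smt (verit))
    have ind: "indicat_real orthant (?y s) = indicat_real {a<..} s" for s
      using orth by (simp add: indicator_def)
    have C: "0 \<le> C"
    proof -
      have "?y (a + 1) \<in> orthant" using orth by simp
      from order_trans[OF norm_ge_zero H[OF this]] show ?thesis by (simp add: comp a_def)
    qed
    have "(LBINT s:{a<..}. H' (?y s)) = 0 - 0"
    proof (rule LBINT_FTC_halfline[where F = "\<lambda>s. H (?y s)"])
      fix s assume s: "a < s"
      have "((\<lambda>r. H (?y s + r *\<^sub>R axis l 1)) has_vector_derivative H' (?y s)) (at (s - s))"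
        using deriv orth s by simp
      then have "((\<lambda>r. H (?y s + r *\<^sub>R axis l 1)) \<circ> (\<lambda>t. t - s) has_vector_derivative 1 *\<^sub>R H' (?y s)) (at s)"
        by (intro vector_diff_chain_at) (auto intro!: derivative_eq_intros)
      moreover have "(\<lambda>r. H (?y s + r *\<^sub>R axis l 1)) \<circ> (\<lambda>t. t - s) = (\<lambda>s. H (?y s))"
        by (auto simp: fun_eq_iff algebra_simps)
      ultimately show "((\<lambda>s. H (?y s)) has_vector_derivative H' (?y s)) (at s)" by simp
      have "isCont H' (?y s)" using cont orth s unfolding continuous_on_eq_continuous_at[OF open_orthant] by blast
      then show "isCont (\<lambda>s. H' (?y s)) s" by (rule isCont_o2[where g = H', rotated]) (intro continuous_intros)
    next
      have b1: "set_borel_measurable lborel {a<..} (\<lambda>s. H' (?y s))"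
      proof -
        have "(\<lambda>x. indicator orthant x *\<^sub>R H' x) \<in> borel_measurable borel" using orthant_measurable[OF cont] by simp
        then have "(\<lambda>s. indicator orthant (?y s) *\<^sub>R H' (?y s)) \<in> borel_measurable borel"
          by (rule measurable_compose[rotated]) measurable
        then show ?thesis unfolding set_borel_measurable_def ind by simp
      qed
      have b2: "norm (H' (?y s)) \<le> C * (1 / (1 + (s - a))\<^sup>2)" if s: "a < s" for s
      proof -
        have "decay (?y s) = 1 / (1 + ?y s $ l)\<^sup>2 * (\<Prod>m\<in>UNIV - {l}. 1 / (1 + ?y s $ m)\<^sup>2)"
          unfolding decay_def by (simp add: prod.remove[of UNIV l])
        also have "\<dots> \<le> 1 / (1 + ?y s $ l)\<^sup>2 * 1"
        proof (intro mult_left_mono prod_le_1 conjI)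
          fix m assume "m \<in> UNIV - {l}"
          then have "0 < ?y s $ m" using True comp by auto
          then show "1 / (1 + ?y s $ m)\<^sup>2 \<le> 1" by (simp add: divide_simps)
        qed auto
        finally have "decay (?y s) \<le> 1 / (1 + (s - a))\<^sup>2" by (simp add: comp a_def add.commute)
        then show ?thesis using order_trans[OF H' mult_left_mono] C orth s by blast
      qed
      have b3: "set_integrable lborel {a<..} (\<lambda>s. C * (1 / (1 + (s - a))\<^sup>2))"
        by (intro set_integrable_mult_right set_integrable_inverse_square)
      show "set_integrable lborel {a<..} (\<lambda>s. H' (?y s))"
      proof (rule set_integrable_bound[OF b3 b1], rule AE_I2, rule impI)
        fix s assume "s \<in> {a<..}"
        then show "norm (H' (?y s)) \<le> norm (C * (1 / (1 + (s - a))\<^sup>2))"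
          using order_trans[OF b2[of s] abs_ge_self] by simp
      qed
      have bd: "norm (H (?y s)) \<le> C * ((s - a) / (1 + (s - a))\<^sup>2)" if "a < s" for s
        using H[of "?y s"] orth[of s] that by (simp add: comp a_def add.commute)
      have e: "eventually (\<lambda>s. a < s) (at_right a)" "eventually (\<lambda>s. a < s) at_top"
        by (auto simp: eventually_at_right_less eventually_gt_at_top)
      have "((\<lambda>s. C * ((s - a) / (1 + (s - a))\<^sup>2)) \<longlongrightarrow> C * ((a - a) / (1 + (a - a))\<^sup>2)) (at_right a)"
        by (intro tendsto_intros) auto
      then have lim0: "((\<lambda>s. C * ((s - a) / (1 + (s - a))\<^sup>2)) \<longlongrightarrow> 0) (at_right a)" by simp
      show "((\<lambda>s. H (?y s)) \<longlongrightarrow> 0) (at_right a)"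
        by (rule Lim_null_comparison[OF eventually_mono[OF e(1) bd] lim0])
      have "((\<lambda>s. C * (1 / (1 + (s - a)))) \<longlongrightarrow> C * 0) at_top"
        by (intro tendsto_intros tendsto_divide_0[OF tendsto_const] filterlim_at_top_imp_at_infinity
          filterlim_tendsto_add_at_top[OF tendsto_const]
          filterlim_tendsto_add_at_top[of "\<lambda>_. - a" "-a" _ "\<lambda>t. t", simplified]) (auto intro: filterlim_ident)
      then have lim: "((\<lambda>s. C * (1 / (1 + (s - a)))) \<longlongrightarrow> 0) at_top" by simp
      have bd2: "norm (H (?y s)) \<le> C * (1 / (1 + (s - a)))" if s: "a < s" for s
      proof -
        have "(s - a) / (1 + (s - a))\<^sup>2 \<le> (1 + (s - a)) / (1 + (s - a))\<^sup>2" by (intro divide_right_mono) auto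
        also have "\<dots> = 1 / (1 + (s - a))" by (simp add: power2_eq_square)
        finally show ?thesis using bd[OF s] C by (meson mult_left_mono order_trans)
      qed
      show "((\<lambda>s. H (?y s)) \<longlongrightarrow> 0) at_top"
        by (rule Lim_null_comparison[OF eventually_mono[OF e(2) bd2] lim])
    qed
    then show ?thesis unfolding ind set_lebesgue_integral_def by simp
  qed
qed

section \<open>Square integrable functions on the orthant\<close>

definition square_integrable :: "(real ^ 'd::finite \<Rightarrow> complex) \<Rightarrow> bool" where
  "square_integrable f \<longleftrightarrow> continuous_on orthant f \<and> set_integrable lborel orthant (\<lambda>t. (cmod (f t))\<^sup>2)"

lemma L2_norm_orthant_nonneg: "0 \<le> L2_norm_orthant f"
  unfolding L2_norm_orthant_def set_lebesgue_integral_def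
  by (intro real_sqrt_ge_zero Bochner_Integration.integral_nonneg) (simp add: indicator_def)

lemma L2_norm_orthant_square: "(L2_norm_orthant f)\<^sup>2 = (LINT t:orthant|lborel. (cmod (f t))\<^sup>2)"
  unfolding L2_norm_orthant_def set_lebesgue_integral_def
  by (intro real_sqrt_pow2 Bochner_Integration.integral_nonneg) (simp add: indicator_def)

lemma L2_norm_orthant_scale: "L2_norm_orthant (\<lambda>t. c * f t) = cmod c * L2_norm_orthant f"
  unfolding L2_norm_orthant_def by (simp add: norm_mult power_mult_distrib real_sqrt_mult)

lemma square_integrable_scale: "square_integrable f \<Longrightarrow> square_integrable (\<lambda>t. c * f t)"
  unfolding square_integrable_def by (auto simp: norm_mult power_mult_distrib intro!: continuous_intros)

text \<open>Continuity, which is part of \<open>square_integrable\<close>, supplies measurability,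
  and the inequality is taken from the one for nonnegative integrals. The version with moduli inside
  the integral is the one from which the triangle inequality is obtained.\<close>

lemma orthant_Cauchy_Schwarz:
  fixes f g :: "real ^ 'd::finite \<Rightarrow> complex"
  assumes f: "square_integrable f" and g: "square_integrable g"
  shows "set_integrable lborel orthant (\<lambda>t. f t * g t)"
    "(LINT t:orthant|lborel. cmod (f t) * cmod (g t)) \<le> L2_norm_orthant f * L2_norm_orthant g"
    "cmod (LINT t:orthant|lborel. f t * g t) \<le> L2_norm_orthant f * L2_norm_orthant g"
proof -
  have cf: "continuous_on orthant f" and cg: "continuous_on orthant g"
    and sf: "set_integrable lborel orthant (\<lambda>t. (cmod (f t))\<^sup>2)" and sg: "set_integrable lborel orthant (\<lambda>t. (cmod (g t))\<^sup>2)"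
    using f g unfolding square_integrable_def by auto
  have am: "x * y \<le> x\<^sup>2 + y\<^sup>2" if "0 \<le> x" "0 \<le> y" for x y :: real
    using sum_squares_bound[of x y] mult_nonneg_nonneg[OF that] by linarith
  have bd: "norm (f t * g t) \<le> (cmod (f t))\<^sup>2 + (cmod (g t))\<^sup>2" for t
    using am by (simp add: norm_mult)
  show i1: "set_integrable lborel orthant (\<lambda>t. f t * g t)"
    by (rule orthant_integrable_bound[OF _ set_integral_add(1)[OF sf sg] bd]) (intro continuous_intros cf cg)
  have i2: "set_integrable lborel orthant (\<lambda>t. cmod (f t) * cmod (g t))"
    by (rule orthant_integrable_bound[OF _ set_integral_add(1)[OF sf sg]])
       (use bd in \<open>auto intro!: continuous_intros cf cg simp: norm_mult\<close>)
  let ?I = "LINT t:orthant|lborel. cmod (f t) * cmod (g t)"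
  have m: "(\<lambda>t. ennreal (indicator orthant t * cmod (f t))) \<in> borel_measurable lborel"
    "(\<lambda>t. ennreal (indicator orthant t * cmod (g t))) \<in> borel_measurable lborel"
    using orthant_measurable[of "\<lambda>t. cmod (f t)"] orthant_measurable[of "\<lambda>t. cmod (g t)"] cf cg
    by (auto intro!: continuous_intros measurable_compose[OF _ measurable_ennreal])
  have nn1: "(\<integral>\<^sup>+t. ennreal (indicator orthant t * cmod (f t)) * ennreal (indicator orthant t * cmod (g t)) \<partial>lborel) = ennreal ?I"
  proof -
    have "(\<integral>\<^sup>+t. ennreal (indicator orthant t * cmod (f t)) * ennreal (indicator orthant t * cmod (g t)) \<partial>lborel) =
        (\<integral>\<^sup>+t. ennreal (indicator orthant t * (cmod (f t) * cmod (g t))) \<partial>lborel)"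
      by (intro nn_integral_cong) (auto simp: indicator_def ennreal_mult)
    then show ?thesis
      unfolding set_lebesgue_integral_def real_scaleR_def
      by (simp add: nn_integral_eq_integral[OF i2[unfolded set_integrable_def real_scaleR_def]])
  qed
  have nn2: "(\<integral>\<^sup>+t. (ennreal (indicator orthant t * cmod (h t)))\<^sup>2 \<partial>lborel) = ennreal ((L2_norm_orthant h)\<^sup>2)"
    if "set_integrable lborel orthant (\<lambda>t. (cmod (h t))\<^sup>2)" for h :: "real ^ 'd \<Rightarrow> complex"
  proof -
    have "(\<integral>\<^sup>+t. (ennreal (indicator orthant t * cmod (h t)))\<^sup>2 \<partial>lborel) = (\<integral>\<^sup>+t. ennreal (indicator orthant t * (cmod (h t))\<^sup>2) \<partial>lborel)"
      by (intro nn_integral_cong) (auto simp: indicator_def ennreal_power)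
    then show ?thesis
      unfolding L2_norm_orthant_square set_lebesgue_integral_def real_scaleR_def
      by (simp add: nn_integral_eq_integral[OF that[unfolded set_integrable_def real_scaleR_def]])
  qed
  have I: "0 \<le> ?I"
    unfolding set_lebesgue_integral_def by (intro Bochner_Integration.integral_nonneg) (simp add: indicator_def)
  have "(ennreal ?I)\<^sup>2 \<le> ennreal ((L2_norm_orthant f)\<^sup>2) * ennreal ((L2_norm_orthant g)\<^sup>2)"
    using Cauchy_Schwarz_nn_integral[OF m] unfolding nn1 nn2[OF sf] nn2[OF sg] .
  then have "?I\<^sup>2 \<le> (L2_norm_orthant f * L2_norm_orthant g)\<^sup>2"
    using I by (simp add: ennreal_power power_mult_distrib flip: ennreal_mult)
  then show I2: "?I \<le> L2_norm_orthant f * L2_norm_orthant g"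
    by (rule power2_le_imp_le) (intro mult_nonneg_nonneg L2_norm_orthant_nonneg)
  have "cmod (LINT t:orthant|lborel. f t * g t) \<le> ?I"
    unfolding set_lebesgue_integral_def
    by (rule order_trans[OF integral_norm_bound]) (simp add: norm_mult)
  then show "cmod (LINT t:orthant|lborel. f t * g t) \<le> L2_norm_orthant f * L2_norm_orthant g" using I2 by linarith
qed

lemma L2_norm_orthant_triangle:
  fixes f g :: "real ^ 'd::finite \<Rightarrow> complex"
  assumes f: "square_integrable f" and g: "square_integrable g"
  shows "square_integrable (\<lambda>t. f t + g t)"
    "L2_norm_orthant (\<lambda>t. f t + g t) \<le> L2_norm_orthant f + L2_norm_orthant g"
proof -
  have cf: "continuous_on orthant f" and cg: "continuous_on orthant g"
    and sf: "set_integrable lborel orthant (\<lambda>t. (cmod (f t))\<^sup>2)" and sg: "set_integrable lborel orthant (\<lambda>t. (cmod (g t))\<^sup>2)"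
    using f g unfolding square_integrable_def by auto
  have sfg: "set_integrable lborel orthant (\<lambda>t. cmod (f t) * cmod (g t))"
    using orthant_Cauchy_Schwarz(1)[of "\<lambda>t. complex_of_real (cmod (f t))" "\<lambda>t. complex_of_real (cmod (g t))"]
      f g set_integrable_norm[of lborel orthant "\<lambda>t. complex_of_real (cmod (f t)) * complex_of_real (cmod (g t))"]
    unfolding square_integrable_def by (auto simp: norm_mult intro!: continuous_intros)
  have S: "set_integrable lborel orthant (\<lambda>t. (cmod (f t))\<^sup>2 + (cmod (g t))\<^sup>2 + 2 * (cmod (f t) * cmod (g t)))"
    by (intro set_integral_add set_integrable_mult_right sf sg sfg)
  have le: "(cmod (f t + g t))\<^sup>2 \<le> (cmod (f t))\<^sup>2 + (cmod (g t))\<^sup>2 + 2 * (cmod (f t) * cmod (g t))" for t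
    using power_mono[OF norm_triangle_ineq[of "f t" "g t"], of 2] by (simp add: power2_sum)
  have s: "set_integrable lborel orthant (\<lambda>t. (cmod (f t + g t))\<^sup>2)"
    by (rule orthant_integrable_bound[OF _ S]) (use le cf cg in \<open>auto intro!: continuous_intros\<close>)
  then show "square_integrable (\<lambda>t. f t + g t)"
    unfolding square_integrable_def using cf cg by (auto intro!: continuous_intros)
  have "(L2_norm_orthant (\<lambda>t. f t + g t))\<^sup>2 \<le>
      (LINT t:orthant|lborel. (cmod (f t))\<^sup>2 + (cmod (g t))\<^sup>2 + 2 * (cmod (f t) * cmod (g t)))"
    unfolding L2_norm_orthant_square by (rule set_integral_mono[OF s S le])
  also have "\<dots> = (L2_norm_orthant f)\<^sup>2 + (L2_norm_orthant g)\<^sup>2 + 2 * (LINT t:orthant|lborel. cmod (f t) * cmod (g t))"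
    unfolding L2_norm_orthant_square
    by (simp only: set_integral_add set_integral_mult_right set_integrable_mult_right sf sg sfg)
  also have "\<dots> \<le> (L2_norm_orthant f + L2_norm_orthant g)\<^sup>2"
    using orthant_Cauchy_Schwarz(2)[OF f g] by (simp add: power2_sum)
  finally show "L2_norm_orthant (\<lambda>t. f t + g t) \<le> L2_norm_orthant f + L2_norm_orthant g"
    by (rule power2_le_imp_le) (intro add_nonneg_nonneg L2_norm_orthant_nonneg)
qed

section \<open>The test function spaces\<close>

lemma eventually_line_in_orthant:
  assumes "x \<in> orthant"
  shows "eventually (\<lambda>s. x + s *\<^sub>R axis l 1 \<in> orthant) (nhds (0 :: real))"
proof -
  have "isCont (\<lambda>s. x + s *\<^sub>R axis l 1 :: real ^ 'a) 0" by (intro continuous_intros)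
  then have "((\<lambda>s. x + s *\<^sub>R axis l 1 :: real ^ 'a) \<longlongrightarrow> x + 0 *\<^sub>R axis l 1) (nhds (0 :: real))"
    unfolding isCont_def
    using tendsto_at_iff_tendsto_nhds[of "\<lambda>s. x + s *\<^sub>R axis l 1 :: real ^ 'a" "0 :: real"] by blast
  then have "((\<lambda>s. x + s *\<^sub>R axis l 1) \<longlongrightarrow> x) (nhds (0 :: real))" by simp
  then show ?thesis by (rule topological_tendstoD[OF _ open_orthant assms])
qed

lemma has_partial_cong:
  assumes "x \<in> orthant" "\<And>y. y \<in> orthant \<Longrightarrow> f y = g y"
  shows "((\<lambda>s. f (x + s *\<^sub>R axis l 1)) has_vector_derivative D) (at (0 :: real)) \<longleftrightarrow>
    ((\<lambda>s. g (x + s *\<^sub>R axis l 1)) has_vector_derivative D) (at 0)"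
proof (rule has_vector_derivative_cong_ev)
  show "\<forall>\<^sub>F s in nhds 0. s \<in> UNIV \<longrightarrow> f (x + s *\<^sub>R axis l 1) = g (x + s *\<^sub>R axis l 1)"
    using eventually_line_in_orthant[OF assms(1), of l] by eventually_elim (simp add: assms(2))
qed (use assms in auto)

text \<open>The orthant is open, so only values inside it matter. This is needed since functions are
  extended by 0 and formulas for their derivatives hold on the orthant only.\<close>

lemma partial_cong:
  assumes "x \<in> orthant" "\<And>y. y \<in> orthant \<Longrightarrow> f y = g y"
  shows "partial l f x = partial l g x" "has_partial_at f l x \<longleftrightarrow> has_partial_at g l x"
proof -
  have eq: "((\<lambda>s. f (x + s *\<^sub>R axis l 1)) has_vector_derivative D) (at (0 :: real)) \<longleftrightarrow>
    ((\<lambda>s. g (x + s *\<^sub>R axis l 1)) has_vector_derivative D) (at 0)" for D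
    by (rule has_partial_cong[OF assms])
  show "partial l f x = partial l g x" unfolding partial_def vector_derivative_def eq ..
  have "has_partial_at h l x \<longleftrightarrow> (\<exists>D. ((\<lambda>s. h (x + s *\<^sub>R axis l 1)) has_vector_derivative D) (at 0))" for h
    unfolding has_partial_at_def by (meson differentiableI_vector vector_derivative_works)
  then show "has_partial_at f l x \<longleftrightarrow> has_partial_at g l x" using eq by simp
qed

lemma has_partial_at_iff:
  "has_partial_at f l x \<longleftrightarrow> ((\<lambda>s. f (x + s *\<^sub>R axis l 1)) has_vector_derivative partial l f x) (at 0)"
  unfolding has_partial_at_def partial_def by (rule vector_derivative_works)

lemma partial_eqI:
  assumes "((\<lambda>s. f (x + s *\<^sub>R axis l 1)) has_vector_derivative D) (at 0)"
  shows "has_partial_at f l x" "partial l f x = D"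
  using assms unfolding has_partial_at_def partial_def
  by (auto intro: differentiableI_vector vector_derivative_at)

lemma partials_simps [simp]: "partials [] f = f" "partials (l # ls) f = partial l (partials ls f)"
  by (simp_all add: partials_def)

lemma smooth_onD:
  assumes "smooth_on S f"
  shows "continuous_on S (partials ls f)" "x \<in> S \<Longrightarrow> has_partial_at (partials ls f) l x"
  using assms unfolding smooth_on_def by blast+

lemma partials_linear:
  assumes f: "smooth_on orthant f" and g: "smooth_on orthant g"
  shows "\<forall>x\<in>orthant. partials ls (\<lambda>x. a * f x + b * g x) x = a * partials ls f x + b * partials ls g x \<and>
    has_partial_at (partials ls (\<lambda>x. a * f x + b * g x)) l x"
proof -
  have D: "((\<lambda>s. a * partials ls f (x + s *\<^sub>R axis l 1) + b * partials ls g (x + s *\<^sub>R axis l 1)) has_vector_derivative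
      a * partial l (partials ls f) x + b * partial l (partials ls g) x) (at 0)" if "x \<in> orthant" for x ls l
    using smooth_onD(2)[OF f that, of ls l] smooth_onD(2)[OF g that, of ls l] unfolding has_partial_at_iff
    by (intro has_vector_derivative_add bounded_linear.has_vector_derivative[OF bounded_linear_mult_right])
  have eq: "\<forall>x\<in>orthant. partials ls (\<lambda>x. a * f x + b * g x) x = a * partials ls f x + b * partials ls g x" for ls
  proof (induction ls)
    case (Cons l ls)
    show ?case
    proof
      fix x :: "real ^ 'a" assume x: "x \<in> orthant"
      have "partial l (partials ls (\<lambda>x. a * f x + b * g x)) x = partial l (\<lambda>x. a * partials ls f x + b * partials ls g x) x"
        using Cons.IH by (intro partial_cong[OF x]) auto
      also have "\<dots> = a * partial l (partials ls f) x + b * partial l (partials ls g) x"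
        by (rule partial_eqI(2)[OF D[OF x]])
      finally show "partials (l # ls) (\<lambda>x. a * f x + b * g x) x = a * partials (l # ls) f x + b * partials (l # ls) g x"
        by simp
    qed
  qed simp
  show ?thesis
  proof (intro ballI conjI)
    fix x :: "real ^ 'a" assume x: "x \<in> orthant"
    show "partials ls (\<lambda>x. a * f x + b * g x) x = a * partials ls f x + b * partials ls g x" using eq x by blast
    have "has_partial_at (\<lambda>x. a * partials ls f x + b * partials ls g x) l x" by (rule partial_eqI(1)[OF D[OF x]])
    then show "has_partial_at (partials ls (\<lambda>x. a * f x + b * g x)) l x"
      using partial_cong(2)[OF x, of "partials ls (\<lambda>x. a * f x + b * g x)" "\<lambda>x. a * partials ls f x + b * partials ls g x"] eq
      by blast
  qed
qed

lemma smooth_on_linear: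
  assumes f: "smooth_on orthant f" and g: "smooth_on orthant g"
  shows "smooth_on orthant (\<lambda>x. a * f x + b * g x)"
  unfolding smooth_on_def
proof (intro allI conjI ballI)
  fix ls
  have "continuous_on orthant (\<lambda>x. a * partials ls f x + b * partials ls g x)"
    by (intro continuous_intros smooth_onD f g)
  then show "continuous_on orthant (partials ls (\<lambda>x. a * f x + b * g x))"
    using partials_linear[OF f g] by (subst continuous_on_cong[OF refl, where g = "\<lambda>x. a * partials ls f x + b * partials ls g x"]) auto
qed (use partials_linear[OF f g] in blast)

lemma mi_deriv_linear:
  assumes "smooth_on orthant f" "smooth_on orthant g" "x \<in> orthant"
  shows "mi_deriv p (\<lambda>x. a * f x + b * g x) x = a * mi_deriv p f x + b * mi_deriv p g x"
  unfolding mi_deriv_def using partials_linear[OF assms(1,2)] assms(3) by blast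

section \<open>Rapidly decreasing functions\<close>

lemma schwartz_orthantD:
  assumes "f \<in> schwartz_orthant"
  shows "x \<notin> orthant \<Longrightarrow> f x = 0" "smooth_on orthant f"
    "\<exists>g. continuous_on closed_orthant g \<and> (\<forall>x\<in>orthant. g x = mi_deriv p f x)"
    "\<exists>C. \<forall>x\<in>orthant. mi_pow x k * cmod (mi_deriv p f x) \<le> C"
  using assms unfolding schwartz_orthant_def bdd_above_def by auto

lemma mi_pow_nonneg: "x \<in> orthant \<Longrightarrow> 0 \<le> mi_pow x k"
  unfolding mi_pow_def orthant_def by (intro prod_nonneg) (auto simp: less_imp_le)

lemma schwartz_orthant_linear:
  fixes f g :: "real ^ 'd::finite \<Rightarrow> complex"
  assumes f: "f \<in> schwartz_orthant" and g: "g \<in> schwartz_orthant"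
  shows "(\<lambda>x. a * f x + b * g x) \<in> schwartz_orthant"
proof -
  note sf = schwartz_orthantD(2)[OF f] and sg = schwartz_orthantD(2)[OF g]
  show ?thesis
    unfolding schwartz_orthant_def
  proof (intro CollectI conjI allI impI)
    fix p :: "nat ^ 'd"
    obtain F where F: "continuous_on closed_orthant F" "\<And>x. x \<in> orthant \<Longrightarrow> F x = mi_deriv p f x"
      using schwartz_orthantD(3)[OF f, of p] by blast
    obtain G where G: "continuous_on closed_orthant G" "\<And>x. x \<in> orthant \<Longrightarrow> G x = mi_deriv p g x"
      using schwartz_orthantD(3)[OF g, of p] by blast
    show "\<exists>h. continuous_on closed_orthant h \<and> (\<forall>x\<in>orthant. h x = mi_deriv p (\<lambda>x. a * f x + b * g x) x)"
      by (intro exI[of _ "\<lambda>x. a * F x + b * G x"])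
         (auto simp: F G mi_deriv_linear[OF sf sg] intro!: continuous_intros)
  next
    fix k p :: "nat ^ 'd"
    obtain C D where C: "\<And>x. x \<in> orthant \<Longrightarrow> mi_pow x k * cmod (mi_deriv p f x) \<le> C"
      and D: "\<And>x. x \<in> orthant \<Longrightarrow> mi_pow x k * cmod (mi_deriv p g x) \<le> D"
      using schwartz_orthantD(4)[OF f] schwartz_orthantD(4)[OF g] by meson
    have "mi_pow x k * cmod (mi_deriv p (\<lambda>x. a * f x + b * g x) x) \<le> cmod a * C + cmod b * D" if x: "x \<in> orthant" for x
    proof -
      have "mi_pow x k * cmod (mi_deriv p (\<lambda>x. a * f x + b * g x) x) \<le>
          mi_pow x k * (cmod a * cmod (mi_deriv p f x) + cmod b * cmod (mi_deriv p g x))"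
        unfolding mi_deriv_linear[OF sf sg x]
        by (intro mult_left_mono mi_pow_nonneg x) (metis norm_mult norm_triangle_ineq)
      also have "\<dots> = cmod a * (mi_pow x k * cmod (mi_deriv p f x)) + cmod b * (mi_pow x k * cmod (mi_deriv p g x))"
        by (simp add: algebra_simps)
      also have "\<dots> \<le> cmod a * C + cmod b * D" by (intro add_mono mult_left_mono C D x) auto
      finally show ?thesis .
    qed
    then show "bdd_above ((\<lambda>x. mi_pow x k * cmod (mi_deriv p (\<lambda>x. a * f x + b * g x) x)) ` orthant)"
      by (intro bdd_aboveI[of _ "cmod a * C + cmod b * D"]) auto
  qed (use schwartz_orthantD(1)[OF f] schwartz_orthantD(1)[OF g] smooth_on_linear[OF sf sg] in auto)
qed

text \<open>Every factor is at most that of the largest coordinate, and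
  \<open>(1 + y) ^ n \<le> 2 ^ n * (1 + y ^ n)\<close>. The product is thereby controlled by powers
  of single coordinates, which are among the weights in \<open>schwartz_orthant\<close>.\<close>

lemma prod_one_plus_power_le:
  fixes x :: "real ^ 'd::finite"
  assumes x: "x \<in> orthant"
  shows "(\<Prod>l\<in>UNIV. (1 + x $ l) ^ N) \<le> 2 ^ (N * CARD('d)) * (1 + (\<Sum>m\<in>UNIV. (x $ m) ^ (N * CARD('d))))"
proof -
  let ?M = "Max (range (($) x))" and ?n = "N * CARD('d)"
  have "?M \<in> range (($) x)" by (rule Max_in) auto
  then obtain m where m: "?M = x $ m" by (rule rangeE)
  have le: "x $ l \<le> x $ m" for l unfolding m[symmetric] by (intro Max_ge) auto
  have pos: "0 < x $ l" for l using x by (simp add: orthant_def)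
  have "(\<Prod>l\<in>UNIV. (1 + x $ l) ^ N) \<le> (\<Prod>l\<in>(UNIV :: 'd set). (1 + x $ m) ^ N)"
    using pos le by (intro prod_mono conjI power_mono) (auto simp: less_imp_le add_nonneg_nonneg)
  also have "\<dots> = (1 + x $ m) ^ ?n" by (simp add: power_mult)
  also have "\<dots> \<le> 2 ^ ?n * (1 + (x $ m) ^ ?n)"
  proof (cases "x $ m \<le> 1")
    case True
    then have "(1 + x $ m) ^ ?n \<le> 2 ^ ?n * 1" using pos[of m] by (simp add: power_mono)
    also have "\<dots> \<le> 2 ^ ?n * (1 + (x $ m) ^ ?n)" using pos[of m] by (intro mult_left_mono) (auto simp: less_imp_le)
    finally show ?thesis .
  next
    case False
    then have "(1 + x $ m) ^ ?n \<le> (2 * x $ m) ^ ?n" by (intro power_mono) auto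
    also have "\<dots> \<le> 2 ^ ?n * (1 + (x $ m) ^ ?n)" by (simp add: power_mult_distrib)
    finally show ?thesis .
  qed
  also have "\<dots> \<le> 2 ^ ?n * (1 + (\<Sum>m\<in>UNIV. (x $ m) ^ ?n))"
    using pos by (intro mult_left_mono add_left_mono member_le_sum) (auto simp: less_imp_le)
  finally show ?thesis .
qed

lemma schwartz_orthant_decay:
  fixes f :: "real ^ 'd::finite \<Rightarrow> complex"
  assumes f: "f \<in> schwartz_orthant"
  obtains C where "0 \<le> C" "\<And>x. x \<in> orthant \<Longrightarrow> cmod (mi_deriv p f x) * (\<Prod>l\<in>UNIV. (1 + x $ l) ^ N) \<le> C"
proof -
  let ?n = "N * CARD('d)"
  define k where "k m = (\<chi> l. if l = m then ?n else 0)" for m :: 'd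
  have k: "mi_pow x (k m) = (x $ m) ^ ?n" for x m
    unfolding mi_pow_def k_def by (simp add: if_distrib[of "\<lambda>n. _ ^ n"] prod.delta cong: if_cong)
  obtain B where B: "\<And>m x. x \<in> orthant \<Longrightarrow> mi_pow x (k m) * cmod (mi_deriv p f x) \<le> B m"
    using schwartz_orthantD(4)[OF f] by meson
  obtain B0 where B0: "\<And>x. x \<in> orthant \<Longrightarrow> mi_pow x 0 * cmod (mi_deriv p f x) \<le> B0"
    using schwartz_orthantD(4)[OF f] by meson
  let ?C = "2 ^ ?n * (B0 + (\<Sum>m\<in>UNIV. B m))"
  have le: "cmod (mi_deriv p f x) * (\<Prod>l\<in>UNIV. (1 + x $ l) ^ N) \<le> ?C" if x: "x \<in> orthant" for x
  proof -
    have "cmod (mi_deriv p f x) * (\<Prod>l\<in>UNIV. (1 + x $ l) ^ N) \<le>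
        cmod (mi_deriv p f x) * (2 ^ ?n * (1 + (\<Sum>m\<in>UNIV. (x $ m) ^ ?n)))"
      by (intro mult_left_mono prod_one_plus_power_le x) auto
    also have "\<dots> = 2 ^ ?n * (mi_pow x 0 * cmod (mi_deriv p f x) + (\<Sum>m\<in>UNIV. mi_pow x (k m) * cmod (mi_deriv p f x)))"
      unfolding k by (simp add: mi_pow_def sum_distrib_left sum_distrib_right algebra_simps)
    also have "\<dots> \<le> ?C" by (intro mult_left_mono add_mono sum_mono B B0 x) auto
    finally show ?thesis .
  qed
  have "0 \<le> cmod (mi_deriv p f 1) * (\<Prod>l\<in>UNIV. (1 + (1 :: real ^ 'd) $ l) ^ N)"
    by (intro mult_nonneg_nonneg prod_nonneg) auto
  also have "\<dots> \<le> ?C" by (rule le) (simp add: orthant_def)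
  finally show thesis using that le by blast
qed

lemma continuous_on_mi_deriv: "smooth_on orthant f \<Longrightarrow> continuous_on orthant (mi_deriv p f)"
  unfolding mi_deriv_def by (rule smooth_onD(1))

definition weighted_deriv :: "nat ^ 'd::finite \<Rightarrow> nat ^ 'd \<Rightarrow> (real ^ 'd \<Rightarrow> complex) \<Rightarrow> real ^ 'd \<Rightarrow> complex" where
  "weighted_deriv p k f t = complex_of_real (mi_powr t (\<chi> l. real ((p + k) $ l) / 2)) * mi_deriv p f t"

lemma mi_powr_half_square:
  assumes "t \<in> orthant"
  shows "(mi_powr t (\<chi> l. real (n $ l) / 2))\<^sup>2 = mi_pow t n"
proof -
  have "(t $ l powr (real (n $ l) / 2))\<^sup>2 = (t $ l) ^ (n $ l)" for l
    using assms by (simp add: orthant_def power2_eq_square powr_realpow flip: powr_add)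
  then show ?thesis unfolding mi_powr_def mi_pow_def by (simp add: prod_power_distrib)
qed

lemma weighted_deriv_square:
  assumes "t \<in> orthant"
  shows "(cmod (weighted_deriv p k f t))\<^sup>2 = mi_pow t (p + k) * (cmod (mi_deriv p f t))\<^sup>2"
  using mi_powr_half_square[OF assms, of "p + k"]
  by (simp add: weighted_deriv_def norm_mult power_mult_distrib)

lemma continuous_on_weighted_deriv:
  assumes "smooth_on orthant f"
  shows "continuous_on orthant (weighted_deriv p k f)"
  unfolding weighted_deriv_def[abs_def] mi_powr_def
  by (intro continuous_intros continuous_on_mi_deriv assms) (auto simp: orthant_def, metis less_irrefl)

lemma weighted_deriv_square_integrable:
  fixes f :: "real ^ 'd::finite \<Rightarrow> complex"
  assumes f: "f \<in> schwartz_orthant"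
  shows "square_integrable (weighted_deriv p k f)"
  unfolding square_integrable_def
proof
  show c: "continuous_on orthant (weighted_deriv p k f)"
    by (intro continuous_on_weighted_deriv schwartz_orthantD f)
  \<comment> \<open>Then \<open>2 * N \<ge> (p + k) $ l + 2\<close> in every coordinate: the weight
    is absorbed by \<open>((1 + x $ l) ^ N)\<^sup>2\<close> and the square needed for
    \<open>decay\<close> is left over.\<close>
  define N where "N = mi_abs (p + k) + 1"
  have N: "(p + k) $ l + 2 \<le> 2 * N" for l
    using member_le_sum[of l UNIV "($) (p + k)"] unfolding N_def mi_abs_def by simp
  obtain C where C: "0 \<le> C" "\<And>x. x \<in> orthant \<Longrightarrow> cmod (mi_deriv p f x) * (\<Prod>l\<in>UNIV. (1 + x $ l) ^ N) \<le> C"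
    using schwartz_orthant_decay[OF f] by blast
  show "set_integrable lborel orthant (\<lambda>t. (cmod (weighted_deriv p k f t))\<^sup>2)"
  proof (rule orthant_integrable_decay[where C = "C\<^sup>2"])
    show "continuous_on orthant (\<lambda>t. (cmod (weighted_deriv p k f t))\<^sup>2)" by (intro continuous_intros c)
    fix x :: "real ^ 'd" assume x: "x \<in> orthant"
    then have pos: "0 < x $ l" for l by (simp add: orthant_def)
    let ?P = "\<Prod>l\<in>UNIV. (1 + x $ l) ^ N"
    have P: "0 < ?P" using pos by (intro prod_pos) (simp add: add_pos_pos)
    have "mi_pow x (p + k) \<le> decay x * ?P\<^sup>2"
      unfolding mi_pow_def decay_def prod_power_distrib prod.distrib[symmetric]
    proof (intro prod_mono conjI)
      fix l
      show "0 \<le> (x $ l) ^ ((p + k) $ l)" using pos[of l] by simp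
      have "(x $ l) ^ ((p + k) $ l) * (1 + x $ l)\<^sup>2 \<le> (1 + x $ l) ^ ((p + k) $ l) * (1 + x $ l)\<^sup>2"
        using pos[of l] by (intro mult_right_mono power_mono) auto
      also have "\<dots> = (1 + x $ l) ^ ((p + k) $ l + 2)" by (simp add: power_add power2_eq_square)
      also have "\<dots> \<le> (1 + x $ l) ^ (2 * N)" using pos[of l] N by (intro power_increasing) auto
      finally have "(x $ l) ^ ((p + k) $ l) * (1 + x $ l)\<^sup>2 \<le> ((1 + x $ l) ^ N)\<^sup>2" by (simp add: power_mult[symmetric] mult.commute)
      then show "(x $ l) ^ ((p + k) $ l) \<le> 1 / (1 + x $ l)\<^sup>2 * ((1 + x $ l) ^ N)\<^sup>2"
        using pos[of l] by (simp add: pos_le_divide_eq)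
    qed
    then have "(cmod (weighted_deriv p k f x))\<^sup>2 \<le> (decay x * ?P\<^sup>2) * (cmod (mi_deriv p f x))\<^sup>2"
      unfolding weighted_deriv_square[OF x] by (intro mult_right_mono) auto
    also have "\<dots> = decay x * (cmod (mi_deriv p f x) * ?P)\<^sup>2" by (simp add: power_mult_distrib)
    also have "\<dots> \<le> decay x * C\<^sup>2" using P C(2)[OF x] by (intro mult_left_mono power_mono decay_nonneg) auto
    finally show "norm ((cmod (weighted_deriv p k f x))\<^sup>2) \<le> C\<^sup>2 * decay x" by (simp add: mult.commute)
  qed
qed

section \<open>The seminorms and steps of the test function space\<close>

definition G_denominator :: "real \<Rightarrow> real \<Rightarrow> nat ^ 'd::finite \<Rightarrow> nat ^ 'd \<Rightarrow> real" where
  "G_denominator \<alpha> A p k = A ^ mi_abs (p + k) * mi_self_powr (\<alpha> / 2) k * mi_self_powr (\<alpha> / 2) p"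

lemma G_quotient_eq: "G_quotient \<alpha> A f p k = L2_norm_orthant (weighted_deriv p k f) / G_denominator \<alpha> A p k"
  unfolding G_quotient_def G_denominator_def weighted_deriv_def[abs_def] ..

lemma mi_self_powr_pos: "0 < mi_self_powr \<beta> p"
  unfolding mi_self_powr_def by (intro prod_pos) auto

lemma G_denominator_pos: "0 < A \<Longrightarrow> 0 < G_denominator \<alpha> A p k"
  unfolding G_denominator_def by (simp add: mi_self_powr_pos)

lemma L2_norm_orthant_cong: "(\<And>t. t \<in> orthant \<Longrightarrow> f t = g t) \<Longrightarrow> L2_norm_orthant f = L2_norm_orthant g"
  unfolding L2_norm_orthant_def set_lebesgue_integral_def
  by (intro arg_cong[of _ _ sqrt] Bochner_Integration.integral_cong) (auto simp: indicator_def)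

text \<open>For \<open>c \<noteq> 0\<close> the lower bound in the homogeneity comes from the upper
  bound applied to \<open>inverse c\<close> and \<open>c * f\<close>, which lies in \<open>V\<close>
  again.\<close>

lemma seminorm_on_SUP_family:
  assumes "I \<noteq> {}" and q: "\<And>i. i \<in> I \<Longrightarrow> seminorm_on V (q i)"
    and bdd: "\<And>f. f \<in> V \<Longrightarrow> bdd_above ((\<lambda>i. q i f) ` I)" and V: "function_subspace V"
  shows "seminorm_on V (\<lambda>f. SUP i\<in>I. q i f)"
  unfolding seminorm_on_def
proof (intro conjI ballI allI)
  fix f assume f: "f \<in> V"
  obtain i where i: "i \<in> I" using assms by blast
  show "0 \<le> (SUP i\<in>I. q i f)"
    using cSUP_upper[OF i bdd[OF f]] seminorm_onD(1)[OF q[OF i] f] by linarith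
  show "(SUP i\<in>I. q i (\<lambda>x. f x + g x)) \<le> (SUP i\<in>I. q i f) + (SUP i\<in>I. q i g)" if g: "g \<in> V" for g
  proof (rule cSUP_least[OF assms(1)])
    fix i assume i: "i \<in> I"
    show "q i (\<lambda>x. f x + g x) \<le> (SUP i\<in>I. q i f) + (SUP i\<in>I. q i g)"
      using seminorm_onD(2)[OF q[OF i] f g] cSUP_upper[OF i bdd[OF f]] cSUP_upper[OF i bdd[OF g]] by linarith
  qed
  have le: "(SUP i\<in>I. q i (\<lambda>x. c * f x)) \<le> cmod c * (SUP i\<in>I. q i f)" if f: "f \<in> V" for c f
  proof (rule cSUP_least[OF assms(1)])
    fix i assume i: "i \<in> I"
    show "q i (\<lambda>x. c * f x) \<le> cmod c * (SUP i\<in>I. q i f)"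
      unfolding seminorm_onD(3)[OF q[OF i] f] by (intro mult_left_mono cSUP_upper[OF i bdd[OF f]]) auto
  qed
  fix c
  show "(SUP i\<in>I. q i (\<lambda>x. c * f x)) = cmod c * (SUP i\<in>I. q i f)"
  proof (cases "c = 0")
    case True
    have "q i (\<lambda>x. c * f x) = 0" if "i \<in> I" for i using seminorm_onD(3)[OF q[OF that] f, of c] True by simp
    then have "(SUP i\<in>I. q i (\<lambda>x. c * f x)) = (SUP i\<in>I. 0)" by (intro SUP_cong) auto
    then show ?thesis using True assms(1) by simp
  next
    case False
    have "(SUP i\<in>I. q i f) = (SUP i\<in>I. q i (\<lambda>x. inverse c * (c * f x)))" using False by (simp add: mult.assoc[symmetric])
    also have "\<dots> \<le> cmod (inverse c) * (SUP i\<in>I. q i (\<lambda>x. c * f x))" by (rule le[OF function_subspaceD(3)[OF V f]])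
    finally have "cmod c * (SUP i\<in>I. q i f) \<le> cmod c * (cmod (inverse c) * (SUP i\<in>I. q i (\<lambda>x. c * f x)))"
      by (intro mult_left_mono) auto
    also have "\<dots> = (SUP i\<in>I. q i (\<lambda>x. c * f x))" using False by (simp add: norm_inverse)
    finally show ?thesis using le[OF f, of c] by linarith
  qed
qed

lemma function_subspaceI:
  assumes "(\<lambda>_. 0) \<in> V" "\<And>f g a b. f \<in> V \<Longrightarrow> g \<in> V \<Longrightarrow> (\<lambda>x. a * f x + b * g x) \<in> V"
  shows "function_subspace V"
  unfolding function_subspace_def
proof (intro conjI ballI allI)
  fix f g c assume f: "f \<in> V"
  show "(\<lambda>x. c * f x) \<in> V" using assms(2)[OF f f, of c 0] by simp
  assume g: "g \<in> V"
  show "(\<lambda>x. f x + g x) \<in> V" using assms(2)[OF f g, of 1 1] by simp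
qed (rule assms(1))

lemma mi_deriv_zero: "x \<in> orthant \<Longrightarrow> mi_deriv p (\<lambda>_. 0) x = 0"
proof -
  have "partials ls (\<lambda>_. 0) = (\<lambda>_ :: real ^ 'a. 0)" for ls
    by (induction ls) (auto simp: partial_def fun_eq_iff)
  then show ?thesis unfolding mi_deriv_def by simp
qed

lemma zero_in_schwartz_orthant: "(\<lambda>_. 0) \<in> schwartz_orthant"
proof -
  have "partials ls (\<lambda>_. 0) = (\<lambda>_ :: real ^ 'a. 0)" for ls
    by (induction ls) (auto simp: partial_def fun_eq_iff)
  then have "smooth_on orthant (\<lambda>_ :: real ^ 'a. 0)" unfolding smooth_on_def has_partial_at_def by simp
  moreover have "\<exists>g. continuous_on closed_orthant g \<and> (\<forall>x\<in>orthant. g x = mi_deriv p (\<lambda>_ :: real ^ 'a. 0) x)" for p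
    by (intro exI[of _ "\<lambda>_. 0"]) (simp add: mi_deriv_zero)
  moreover have "bdd_above ((\<lambda>x. mi_pow x k * cmod (mi_deriv p (\<lambda>_ :: real ^ 'a. 0) x)) ` orthant)" for k p
    by (intro bdd_aboveI[of _ 0]) (auto simp: mi_deriv_zero)
  ultimately show ?thesis unfolding schwartz_orthant_def by blast
qed

lemma function_subspace_schwartz: "function_subspace schwartz_orthant"
  by (intro function_subspaceI zero_in_schwartz_orthant schwartz_orthant_linear)

lemma schwartz_mi_deriv_add_scale:
  assumes "f \<in> schwartz_orthant" "x \<in> orthant"
  shows "g \<in> schwartz_orthant \<Longrightarrow> mi_deriv p (\<lambda>x. f x + g x) x = mi_deriv p f x + mi_deriv p g x"
    "mi_deriv p (\<lambda>x. c * f x) x = c * mi_deriv p f x"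
  using mi_deriv_linear[OF schwartz_orthantD(2)[OF assms(1)] schwartz_orthantD(2) assms(2), of g p 1 1]
    mi_deriv_linear[OF schwartz_orthantD(2)[OF assms(1)] schwartz_orthantD(2)[OF assms(1)] assms(2), of p c 0]
  by simp_all

lemma seminorm_on_G_quotient:
  fixes p k :: "nat ^ 'd::finite"
  assumes "0 < A"
  shows "seminorm_on schwartz_orthant (\<lambda>f. G_quotient \<alpha> A f p k)"
  unfolding seminorm_on_def G_quotient_eq
proof (intro conjI ballI allI)
  note pos = G_denominator_pos[OF assms, of \<alpha> p k]
  fix f :: "real ^ 'd \<Rightarrow> complex" assume f: "f \<in> schwartz_orthant"
  show "0 \<le> L2_norm_orthant (weighted_deriv p k f) / G_denominator \<alpha> A p k"
    using pos by (simp add: L2_norm_orthant_nonneg)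
  show "L2_norm_orthant (weighted_deriv p k (\<lambda>x. f x + g x)) / G_denominator \<alpha> A p k \<le>
      L2_norm_orthant (weighted_deriv p k f) / G_denominator \<alpha> A p k +
      L2_norm_orthant (weighted_deriv p k g) / G_denominator \<alpha> A p k" if g: "g \<in> schwartz_orthant" for g
  proof -
    have "L2_norm_orthant (weighted_deriv p k (\<lambda>x. f x + g x)) =
        L2_norm_orthant (\<lambda>t. weighted_deriv p k f t + weighted_deriv p k g t)"
      by (intro L2_norm_orthant_cong) (simp add: weighted_deriv_def schwartz_mi_deriv_add_scale(1)[OF f _ g] distrib_left)
    also have "\<dots> \<le> L2_norm_orthant (weighted_deriv p k f) + L2_norm_orthant (weighted_deriv p k g)"
      by (intro L2_norm_orthant_triangle weighted_deriv_square_integrable f g)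
    finally show ?thesis using pos by (simp add: add_divide_distrib[symmetric] divide_right_mono)
  qed
  fix c
  have "L2_norm_orthant (weighted_deriv p k (\<lambda>x. c * f x)) = L2_norm_orthant (\<lambda>t. c * weighted_deriv p k f t)"
    by (intro L2_norm_orthant_cong) (simp add: weighted_deriv_def schwartz_mi_deriv_add_scale(2)[OF f])
  then show "L2_norm_orthant (weighted_deriv p k (\<lambda>x. c * f x)) / G_denominator \<alpha> A p k =
      cmod c * (L2_norm_orthant (weighted_deriv p k f) / G_denominator \<alpha> A p k)"
    by (simp add: L2_norm_orthant_scale)
qed

definition sup_seminorm :: "nat ^ 'd::finite \<Rightarrow> nat ^ 'd \<Rightarrow> (real ^ 'd \<Rightarrow> complex) \<Rightarrow> real" where
  "sup_seminorm p k f = (SUP t\<in>orthant. cmod (complex_of_real (mi_pow t k) * mi_deriv p f t))"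

lemma orthant_nonempty: "orthant \<noteq> {}"
proof -
  have "1 \<in> orthant" by (simp add: orthant_def)
  then show ?thesis by blast
qed

lemma seminorm_on_sup_seminorm:
  fixes p k :: "nat ^ 'd::finite"
  shows "seminorm_on schwartz_orthant (sup_seminorm p k)"
  unfolding sup_seminorm_def[abs_def]
proof (rule seminorm_on_SUP_family[OF orthant_nonempty _ _ function_subspace_schwartz])
  fix t :: "real ^ 'd" assume t: "t \<in> orthant"
  show "seminorm_on schwartz_orthant (\<lambda>f. cmod (complex_of_real (mi_pow t k) * mi_deriv p f t))"
    unfolding seminorm_on_def
    by (auto simp: schwartz_mi_deriv_add_scale[OF _ t] distrib_left norm_mult norm_triangle_ineq
        simp flip: distrib_left intro!: mult_left_mono)
next
  fix f :: "real ^ 'd \<Rightarrow> complex" assume f: "f \<in> schwartz_orthant"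
  obtain C where "\<And>x. x \<in> orthant \<Longrightarrow> mi_pow x k * cmod (mi_deriv p f x) \<le> C"
    using schwartz_orthantD(4)[OF f] by meson
  then show "bdd_above ((\<lambda>t. cmod (complex_of_real (mi_pow t k) * mi_deriv p f t)) ` orthant)"
    by (intro bdd_aboveI[of _ C]) (auto simp: norm_mult mi_pow_nonneg)
qed

lemma finite_pairs_mi_abs: "finite {(p :: nat ^ 'd::finite, k :: nat ^ 'd). mi_abs p \<le> j \<and> mi_abs k \<le> j}"
  by (rule finite_subset[of _ "{p. mi_abs p \<le> j} \<times> {k. mi_abs k \<le> j}"]) (auto simp: finite_mi_abs_le)

lemma G_seminorm_eq: "G_seminorm \<alpha> A j f = (SUP (p, k). G_quotient \<alpha> A f p k) +
    (SUP (p, k)\<in>{(p, k). mi_abs p \<le> j \<and> mi_abs k \<le> j}. sup_seminorm p k f)"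
  unfolding G_seminorm_def sup_seminorm_def ..

lemma function_subspace_G_step_space:
  assumes "0 < A"
  shows "function_subspace (G_step_space \<alpha> A :: (real ^ 'd::finite \<Rightarrow> complex) set)"
proof (rule function_subspaceI)
  note q = seminorm_onD[OF seminorm_on_G_quotient[OF assms, of \<alpha>]]
  have "G_quotient \<alpha> A (\<lambda>_. 0) p k = 0" for p k :: "nat ^ 'd"
    using seminorm_on_zero[OF function_subspace_schwartz seminorm_on_G_quotient[OF assms]] .
  then show "(\<lambda>_. 0) \<in> (G_step_space \<alpha> A :: (real ^ 'd \<Rightarrow> complex) set)"
    unfolding G_step_space_def using zero_in_schwartz_orthant by (auto intro!: bdd_aboveI[of _ 0])
  fix f g :: "real ^ 'd \<Rightarrow> complex" and a b assume fg: "f \<in> G_step_space \<alpha> A" "g \<in> G_step_space \<alpha> A"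
  then have S: "f \<in> schwartz_orthant" "g \<in> schwartz_orthant" unfolding G_step_space_def by auto
  obtain M N where M: "\<And>p k. G_quotient \<alpha> A f p k \<le> M" and N: "\<And>p k. G_quotient \<alpha> A g p k \<le> N"
    using fg unfolding G_step_space_def bdd_above_def by fastforce
  have "G_quotient \<alpha> A (\<lambda>x. a * f x + b * g x) p k \<le> cmod a * M + cmod b * N" for p k
  proof -
    have "G_quotient \<alpha> A (\<lambda>x. a * f x + b * g x) p k \<le> G_quotient \<alpha> A (\<lambda>x. a * f x) p k + G_quotient \<alpha> A (\<lambda>x. b * g x) p k"
      by (intro q function_subspaceD(3)[OF function_subspace_schwartz] S)
    also have "\<dots> = cmod a * G_quotient \<alpha> A f p k + cmod b * G_quotient \<alpha> A g p k"
      by (simp only: q(3)[OF S(1)] q(3)[OF S(2)])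
    also have "\<dots> \<le> cmod a * M + cmod b * N" by (intro add_mono mult_left_mono M N) auto
    finally show ?thesis .
  qed
  then show "(\<lambda>x. a * f x + b * g x) \<in> G_step_space \<alpha> A"
    unfolding G_step_space_def using schwartz_orthant_linear[OF S]
    by (auto intro!: bdd_aboveI[of _ "cmod a * M + cmod b * N"])
qed

lemma G_step_space_schwartz: "G_step_space \<alpha> A \<subseteq> schwartz_orthant"
  unfolding G_step_space_def by blast

lemma seminorm_on_add:
  assumes "seminorm_on V p" "seminorm_on V q"
  shows "seminorm_on V (\<lambda>f. p f + q f)"
  using seminorm_onD[OF assms(1)] seminorm_onD[OF assms(2)] unfolding seminorm_on_def
  by (auto simp: distrib_left) (smt (verit))

lemma sup_index_nonempty: "{(p :: nat ^ 'd::finite, k :: nat ^ 'd). mi_abs p \<le> j \<and> mi_abs k \<le> j} \<noteq> {}"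
proof -
  have "(0, 0) \<in> {(p :: nat ^ 'd::finite, k :: nat ^ 'd). mi_abs p \<le> j \<and> mi_abs k \<le> j}" by (simp add: mi_abs_def)
  then show ?thesis by blast
qed

lemma seminorm_on_G_SUPs:
  assumes A: "0 < A"
  shows "seminorm_on (G_step_space \<alpha> A :: (real ^ 'd::finite \<Rightarrow> complex) set) (\<lambda>f. SUP (p, k). G_quotient \<alpha> A f p k)"
    "seminorm_on (G_step_space \<alpha> A :: (real ^ 'd::finite \<Rightarrow> complex) set)
      (\<lambda>f. SUP (p, k)\<in>{(p, k). mi_abs p \<le> j \<and> mi_abs k \<le> j}. sup_seminorm p k f)"
proof -
  note V = function_subspace_G_step_space[OF A, of \<alpha>] and sub = G_step_space_schwartz[of \<alpha> A]
  show "seminorm_on (G_step_space \<alpha> A :: (real ^ 'd::finite \<Rightarrow> complex) set) (\<lambda>f. SUP (p, k). G_quotient \<alpha> A f p k)"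
    unfolding case_prod_beta
    by (rule seminorm_on_SUP_family[OF UNIV_not_empty seminorm_on_subset[OF seminorm_on_G_quotient[OF A] sub] _ V])
       (auto simp: G_step_space_def case_prod_beta)
  show "seminorm_on (G_step_space \<alpha> A :: (real ^ 'd::finite \<Rightarrow> complex) set)
      (\<lambda>f. SUP (p, k)\<in>{(p, k). mi_abs p \<le> j \<and> mi_abs k \<le> j}. sup_seminorm p k f)"
    unfolding case_prod_beta[of "\<lambda>p k. sup_seminorm p k _"]
    by (rule seminorm_on_SUP_family[OF sup_index_nonempty seminorm_on_subset[OF seminorm_on_sup_seminorm sub] _ V])
       (intro bdd_above_finite finite_imageI finite_pairs_mi_abs)
qed

lemma seminorm_family_G_step:
  assumes A: "0 < A"
  shows "seminorm_family (G_step_space \<alpha> A :: (real ^ 'd::finite \<Rightarrow> complex) set) (range (G_seminorm \<alpha> A))"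
  unfolding seminorm_family_def
  using function_subspace_G_step_space[OF A, of \<alpha>] seminorm_on_add[OF seminorm_on_G_SUPs[OF A]]
  by (auto simp: G_seminorm_eq[abs_def])

lemma G_quotient_le_SUP: "f \<in> G_step_space \<alpha> A \<Longrightarrow> G_quotient \<alpha> A f p k \<le> (SUP (p, k). G_quotient \<alpha> A f p k)"
  unfolding G_step_space_def
  using cSUP_upper[of "(p, k)" UNIV "\<lambda>(p, k). G_quotient \<alpha> A f p k"] by auto

lemma G_SUP_le_seminorm:
  assumes "0 < A" "f \<in> G_step_space \<alpha> A"
  shows "(SUP (p, k). G_quotient \<alpha> A f p k) \<le> G_seminorm \<alpha> A j f"
  unfolding G_seminorm_eq using seminorm_onD(1)[OF seminorm_on_G_SUPs(2)[OF assms(1)] assms(2)] by simp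

lemma G_step_space_mono:
  assumes "0 < A" "A \<le> B"
  shows "G_step_space \<alpha> A \<subseteq> G_step_space \<alpha> B"
proof
  fix f :: "real ^ 'a \<Rightarrow> complex" assume f: "f \<in> G_step_space \<alpha> A"
  have "G_quotient \<alpha> B f p k \<le> G_quotient \<alpha> A f p k" for p k
    unfolding G_quotient_eq G_denominator_def
    using assms mi_self_powr_pos[of "\<alpha> / 2" k] mi_self_powr_pos[of "\<alpha> / 2" p]
    by (intro divide_left_mono mult_right_mono power_mono mult_pos_pos L2_norm_orthant_nonneg) auto
  from order_trans[OF this G_quotient_le_SUP[OF f]]
  show "f \<in> G_step_space \<alpha> B"
    using f unfolding G_step_space_def by (auto intro!: bdd_aboveI)
qed

abbreviation G_union :: "real \<Rightarrow> (real ^ 'd::finite \<Rightarrow> complex) set" where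
  "G_union \<alpha> \<equiv> (\<Union>A\<in>{0<..}. G_step_space \<alpha> A)"

lemma function_subspace_G_union: "function_subspace (G_union \<alpha>)"
proof (rule function_subspace_UN_antimono)
  fix A B :: real assume "A \<in> {0<..}" "B \<in> {0<..}"
  then have "G_step_space \<alpha> A \<union> G_step_space \<alpha> B \<subseteq> G_step_space \<alpha> (max A B)" "max A B \<in> {0<..}"
    using G_step_space_mono[of A "max A B" \<alpha>] G_step_space_mono[of B "max A B" \<alpha>] by auto
  then show "\<exists>c\<in>{0<..}. G_step_space \<alpha> A \<union> G_step_space \<alpha> B \<subseteq> G_step_space \<alpha> c" by blast
qed (auto simp: function_subspace_G_step_space)

definition G_seminorms :: "real \<Rightarrow> ((real ^ 'd::finite \<Rightarrow> complex) \<Rightarrow> real) set" where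
  "G_seminorms \<alpha> = lc_seminorms {0<..} (G_step_space \<alpha>) (\<lambda>A. range (G_seminorm \<alpha> A))"

lemma G_space_eq: "G_space \<alpha> = seminorm_topology (G_union \<alpha>) (G_seminorms \<alpha>)"
  unfolding G_space_def G_seminorms_def
  by (subst lc_inductive_limit_seminorm_topology[symmetric])
     (simp_all add: seminorm_family_G_step G_step_def[abs_def])

lemma seminorm_family_G_space: "seminorm_family (G_union \<alpha>) (G_seminorms \<alpha>)"
  unfolding G_seminorms_def by (rule seminorm_family_lc_seminorms[OF function_subspace_G_union])

lemma topspace_G_space: "topspace (G_space \<alpha>) = G_union \<alpha>"
  unfolding G_space_eq by (rule seminorm_familyD(4)[OF seminorm_family_G_space])

section \<open>Laguerre series with rapidly decreasing coefficients\<close>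

definition self_powr :: "real \<Rightarrow> nat \<Rightarrow> real" where
  "self_powr \<beta> n = (if n = 0 then 1 else real n powr (\<beta> * real n))"

lemma self_powr_pos: "0 < self_powr \<beta> n"
  by (simp add: self_powr_def)

lemma mi_self_powr_eq: "mi_self_powr \<beta> p = (\<Prod>l\<in>UNIV. self_powr \<beta> (p $ l))"
  unfolding mi_self_powr_def self_powr_def ..

lemma self_powr_eq: "self_powr \<beta> n = (real n ^ n) powr \<beta>"
  by (cases "n = 0") (auto simp: self_powr_def powr_powr mult.commute simp flip: powr_realpow)

lemma self_powr_half_square: "(self_powr (\<alpha> / 2) n)\<^sup>2 = self_powr \<alpha> n"
  by (simp add: self_powr_def power2_eq_square flip: powr_add distrib_right)

text \<open>With \<open>n = p + k\<close>: the exponential series gives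
  \<open>n ^ n \<le> exp n * fact n\<close>, and \<open>fact n\<close> is
  \<open>fact p * fact k\<close> times a binomial coefficient of size at most \<open>2 ^ n\<close>.
  This separates \<open>p\<close> from \<open>k\<close>, as the denominators of
  \<open>G_quotient\<close> require.\<close>

lemma self_power_add_le: "real (p + k) ^ (p + k) \<le> (2 * exp 1) ^ (p + k) * (real p ^ p * real k ^ k)"
proof -
  let ?n = "p + k"
  have "real ?n ^ ?n / fact ?n \<le> exp (real ?n)"
  proof -
    have "(\<lambda>m. inverse (fact m) * real ?n ^ m) sums exp (real ?n)"
      using exp_converges[of "real ?n"] by (simp add: field_simps)
    then have "(\<Sum>m\<in>{?n}. inverse (fact m) * real ?n ^ m) \<le> exp (real ?n)"
      by (intro sum_le_suminf[of _ "{?n}", THEN order_trans]) (auto simp: sums_iff)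
    then show ?thesis by (simp add: field_simps)
  qed
  then have 1: "real ?n ^ ?n \<le> exp 1 ^ ?n * fact ?n"
    by (simp add: exp_of_nat_mult[symmetric] field_simps)
  have "fact ?n = fact p * fact k * real (?n choose p)"
    using binomial_fact_lemma[of p ?n] by (metis add_diff_cancel_left' le_add1 of_nat_fact of_nat_mult)
  also have "\<dots> \<le> (real p ^ p * real k ^ k) * 2 ^ ?n"
  proof (intro mult_mono)
    have "fact m \<le> real m ^ m" for m using fact_le_power[of m] by (metis of_nat_fact of_nat_le_iff of_nat_power order_refl fact_le_power)
    then show "fact p \<le> real p ^ p" "fact k \<le> real k ^ k" by blast+
    have "(?n choose p) \<le> 2 ^ ?n" by (rule binomial_le_pow2)
    then show "real (?n choose p) \<le> 2 ^ ?n" by (metis of_nat_le_iff of_nat_numeral of_nat_power)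
  qed auto
  finally have "exp 1 ^ ?n * fact ?n \<le> exp 1 ^ ?n * ((real p ^ p * real k ^ k) * 2 ^ ?n)"
    by (intro mult_left_mono) auto
  from order_trans[OF 1 this] show ?thesis by (simp only: power_mult_distrib mult_ac)
qed

lemma self_powr_add_le:
  assumes "0 \<le> \<alpha>"
  shows "self_powr \<alpha> (p + k) \<le> ((2 * exp 1) powr \<alpha>) ^ (p + k) * (self_powr \<alpha> p * self_powr \<alpha> k)"
proof -
  have "self_powr \<alpha> (p + k) \<le> ((2 * exp 1) ^ (p + k) * (real p ^ p * real k ^ k)) powr \<alpha>"
    unfolding self_powr_eq using assms by (intro powr_mono2 self_power_add_le) auto
  also have "\<dots> = ((2 * exp 1) powr \<alpha>) ^ (p + k) * (self_powr \<alpha> p * self_powr \<alpha> k)"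
  proof -
    have "(x ^ n) powr \<alpha> = (x powr \<alpha>) ^ n" if "0 < x" for x :: real and n
      using that by (simp add: powr_powr mult.commute flip: powr_realpow)
    from this[of "2 * exp 1" "p + k"] show ?thesis unfolding self_powr_eq by (simp add: powr_mult)
  qed
  finally show ?thesis .
qed

definition stretched_exp :: "real \<Rightarrow> real \<Rightarrow> nat \<Rightarrow> real" where
  "stretched_exp \<alpha> \<delta> j = exp (- \<delta> * real j powr (1 / \<alpha>))"

lemma stretched_exp_pos: "0 < stretched_exp \<alpha> \<delta> j"
  by (simp add: stretched_exp_def)

text \<open>The inequality \<open>z \<le> exp z\<close> at \<open>z = \<delta> * y / r\<close>,
  raised to the power \<open>r\<close>.\<close>

lemma powr_le_exp:
  assumes "0 < r" "0 < \<delta>" "0 \<le> (y :: real)"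
  shows "y powr r \<le> (r / \<delta>) powr r * exp (\<delta> * y)"
proof -
  have "(\<delta> * y / r) powr r \<le> exp (\<delta> * y / r) powr r"
  proof (intro powr_mono2)
    show "\<delta> * y / r \<le> exp (\<delta> * y / r)" using exp_ge_add_one_self[of "\<delta> * y / r"] by linarith
  qed (use assms in auto)
  also have "\<dots> = exp (\<delta> * y)" using assms by (simp add: powr_def)
  finally have "(r / \<delta>) powr r * (\<delta> * y / r) powr r \<le> (r / \<delta>) powr r * exp (\<delta> * y)"
    by (intro mult_left_mono) auto
  moreover have "(r / \<delta>) powr r * (\<delta> * y / r) powr r = y powr r"
    using assms by (subst powr_mult[symmetric]) auto
  ultimately show ?thesis by simp
qed

text \<open>Here the decay of coefficients is traded for the factorial powers of
  \<open>G_step\<close>. If \<open>j \<le> q\<close>, the trivial bound \<open>(2 * q) ^ q\<close>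
  suffices because \<open>\<alpha> \<ge> 1\<close>. If \<open>j > q\<close>, then
  \<open>j + q\<close> is at most \<open>2 * j\<close>, and \<open>powr_le_exp\<close> with
  \<open>y = j powr (1 / \<alpha>)\<close> and \<open>r = \<alpha> * q\<close> bounds
  \<open>j ^ q\<close> times the stretched exponential.\<close>

lemma power_stretched_exp_le:
  assumes \<alpha>: "1 \<le> \<alpha>" and \<delta>: "0 < \<delta>"
  obtains K where "1 \<le> K" "\<And>j q. real (j + q) ^ q * stretched_exp \<alpha> \<delta> j \<le> K ^ q * self_powr \<alpha> q"
proof -
  define K where "K = 2 * max 1 ((\<alpha> / \<delta>) powr \<alpha>)"
  have K: "1 \<le> K" unfolding K_def by auto
  have "real (j + q) ^ q * stretched_exp \<alpha> \<delta> j \<le> K ^ q * self_powr \<alpha> q" for j q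
  proof (cases "q = 0")
    case True
    then show ?thesis using \<delta> by (simp add: stretched_exp_def self_powr_def)
  next
    case q: False
    have sp: "self_powr \<alpha> q = real q powr (\<alpha> * real q)" using q by (simp add: self_powr_def)
    show ?thesis
    proof (cases "j \<le> q")
      case True
      have "real (j + q) ^ q * stretched_exp \<alpha> \<delta> j \<le> (2 * real q) ^ q * 1"
        using True \<delta> by (intro mult_mono power_mono) (auto simp: stretched_exp_def)
      also have "\<dots> = 2 ^ q * real q powr (1 * real q)" using q by (simp add: power_mult_distrib powr_realpow)
      also have "\<dots> \<le> K ^ q * real q powr (\<alpha> * real q)"
        using q \<alpha> by (intro mult_mono power_mono powr_mono mult_right_mono) (auto simp: K_def)
      finally show ?thesis using sp by simp
    next
      case False
      then have j: "0 < j" "q < j" by auto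
      have r: "0 < \<alpha> * real q" using q \<alpha> by simp
      have "real j ^ q = (real j powr (1 / \<alpha>)) powr (\<alpha> * real q)"
        using j \<alpha> by (simp add: powr_powr powr_realpow)
      also have "\<dots> \<le> (\<alpha> * real q / \<delta>) powr (\<alpha> * real q) * exp (\<delta> * real j powr (1 / \<alpha>))"
        by (rule powr_le_exp[OF r \<delta>]) simp
      finally have 1: "real j ^ q * stretched_exp \<alpha> \<delta> j \<le> (\<alpha> * real q / \<delta>) powr (\<alpha> * real q)"
        by (simp add: stretched_exp_def exp_minus field_simps)
      have "(\<alpha> * real q / \<delta>) powr (\<alpha> * real q) = ((\<alpha> / \<delta>) * real q) powr (\<alpha> * real q)" by simp
      also have "\<dots> = ((\<alpha> / \<delta>) powr \<alpha>) ^ q * self_powr \<alpha> q"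
        using \<alpha> \<delta> by (subst powr_mult) (auto simp: sp powr_powr simp flip: powr_realpow)
      finally have 2: "real j ^ q * stretched_exp \<alpha> \<delta> j \<le> ((\<alpha> / \<delta>) powr \<alpha>) ^ q * self_powr \<alpha> q" using 1 by simp
      have "real (j + q) ^ q * stretched_exp \<alpha> \<delta> j \<le> (2 * real j) ^ q * stretched_exp \<alpha> \<delta> j"
        using j by (intro mult_right_mono power_mono) (auto simp: less_imp_le stretched_exp_pos)
      also have "\<dots> = 2 ^ q * (real j ^ q * stretched_exp \<alpha> \<delta> j)" by (simp add: power_mult_distrib)
      also have "\<dots> \<le> 2 ^ q * (((\<alpha> / \<delta>) powr \<alpha>) ^ q * self_powr \<alpha> q)" by (intro mult_left_mono 2) auto
      also have "\<dots> = (2 * (\<alpha> / \<delta>) powr \<alpha>) ^ q * self_powr \<alpha> q" by (simp add: power_mult_distrib)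
      also have "\<dots> \<le> K ^ q * self_powr \<alpha> q"
        by (intro mult_right_mono power_mono less_imp_le[OF self_powr_pos]) (auto simp: K_def)
      finally show ?thesis .
    qed
  qed
  then show thesis using that K by blast
qed

lemma summable_stretched_exp_poly:
  assumes \<alpha>: "1 \<le> \<alpha>" and \<delta>: "0 < \<delta>"
  shows "summable (\<lambda>j. stretched_exp \<alpha> \<delta> j * (4 * real (j + k + 1)) ^ N)"
proof -
  obtain K where K: "1 \<le> K" "\<And>j q. real (j + q) ^ q * stretched_exp \<alpha> \<delta> j \<le> K ^ q * self_powr \<alpha> q"
    using power_stretched_exp_le[OF \<alpha> \<delta>] by blast
  \<comment> \<open>Two powers more than \<open>N\<close>, so that inverse squares remain to be
    summed.\<close>
  define q where "q = N + 2"
  define C where "C = (4 * real (k + 1)) ^ N * (K ^ q * self_powr \<alpha> q)"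
  have le: "stretched_exp \<alpha> \<delta> j * (4 * real (j + k + 1)) ^ N \<le> C * (1 / real (Suc j) ^ 2)" for j
  proof -
    have "4 * real (j + k + 1) \<le> 4 * real (k + 1) * real (Suc j)" by (simp add: algebra_simps)
    then have "(4 * real (j + k + 1)) ^ N \<le> (4 * real (k + 1) * real (Suc j)) ^ N" by (intro power_mono) auto
    then have "(stretched_exp \<alpha> \<delta> j * (4 * real (j + k + 1)) ^ N) * real (Suc j) ^ 2 \<le>
        (stretched_exp \<alpha> \<delta> j * (4 * real (k + 1) * real (Suc j)) ^ N) * real (Suc j) ^ 2"
      by (intro mult_right_mono mult_left_mono less_imp_le[OF stretched_exp_pos]) auto
    also have "\<dots> = (4 * real (k + 1)) ^ N * (real (Suc j) ^ q * stretched_exp \<alpha> \<delta> j)"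
      by (simp add: power_mult_distrib power_add q_def power2_eq_square)
    also have "\<dots> \<le> (4 * real (k + 1)) ^ N * (real (j + q) ^ q * stretched_exp \<alpha> \<delta> j)"
      by (intro mult_left_mono mult_right_mono power_mono less_imp_le[OF stretched_exp_pos]) (auto simp: q_def)
    also have "\<dots> \<le> C" unfolding C_def by (intro mult_left_mono K) auto
    finally show ?thesis by (simp add: pos_le_divide_eq)
  qed
  have "summable (\<lambda>j. C * (1 / real (Suc j) ^ 2))"
    using summable_Suc_iff[of "\<lambda>n. inverse (real n ^ 2)"] inverse_power_summable[of 2, where 'a = real]
    by (intro summable_mult) (simp add: inverse_eq_divide)
  then show ?thesis
    by (rule summable_comparison_test') (use le in \<open>auto simp: less_imp_le[OF stretched_exp_pos]\<close>)
qed

section \<open>Summation over multi-indices\<close>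

lemma sum_mi_prod_le:
  fixes c :: "'d::finite \<Rightarrow> nat \<Rightarrow> real"
  assumes c: "\<And>l j. 0 \<le> c l j" "\<And>l. summable (c l)" and F: "finite F"
  shows "(\<Sum>n\<in>F. \<Prod>l\<in>UNIV. c l (n $ l)) \<le> (\<Prod>l\<in>UNIV. suminf (c l))"
proof -
  \<comment> \<open>All entries of elements of \<open>F\<close> are at most \<open>N\<close>; over
    the resulting cube the sum of products is a product of sums.\<close>
  define N where "N = (\<Sum>n\<in>F. mi_abs n)"
  have N: "n $ l \<le> N" if "n \<in> F" for n l
  proof -
    have "n $ l \<le> mi_abs n" unfolding mi_abs_def by (intro member_le_sum) auto
    also have "\<dots> \<le> N" unfolding N_def by (intro member_le_sum that F) auto
    finally show ?thesis .
  qed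
  have inj: "inj_on vec_lambda (Pi\<^sub>E UNIV (\<lambda>_ :: 'd. {..N}))" by (intro inj_onI) (metis vec_lambda_inverse UNIV_I)
  have "F \<subseteq> vec_lambda ` (Pi\<^sub>E UNIV (\<lambda>_ :: 'd. {..N}))"
    by (auto intro!: image_eqI[of _ _ "($) _"] simp: N vec_nth_inverse)
  then have "(\<Sum>n\<in>F. \<Prod>l\<in>UNIV. c l (n $ l)) \<le> (\<Sum>n\<in>vec_lambda ` (Pi\<^sub>E UNIV (\<lambda>_ :: 'd. {..N})). \<Prod>l\<in>UNIV. c l (n $ l))"
    by (intro sum_mono2 finite_imageI finite_PiE) (auto intro!: prod_nonneg c)
  also have "\<dots> = (\<Sum>f\<in>Pi\<^sub>E UNIV (\<lambda>_ :: 'd. {..N}). \<Prod>l\<in>UNIV. c l (f l))"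
    by (subst sum.reindex[OF inj]) simp
  also have "\<dots> = (\<Prod>l\<in>UNIV. \<Sum>j\<le>N. c l j)" by (rule prod_sum_PiE[symmetric]) auto
  also have "\<dots> \<le> (\<Prod>l\<in>UNIV. suminf (c l))"
    by (intro prod_mono conjI sum_nonneg sum_le_suminf c) (auto intro: c)
  finally show ?thesis .
qed

lemma mi_prod_summable_on:
  fixes c :: "'d::finite \<Rightarrow> nat \<Rightarrow> real"
  assumes c: "\<And>l j. 0 \<le> c l j" "\<And>l. summable (c l)"
  shows "(\<lambda>n. \<Prod>l\<in>UNIV. c l (n $ l)) summable_on UNIV"
    "(\<Sum>\<^sub>\<infinity>n. \<Prod>l\<in>UNIV. c l (n $ l)) \<le> (\<Prod>l\<in>UNIV. suminf (c l))"
proof -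
  show s: "(\<lambda>n. \<Prod>l\<in>UNIV. c l (n $ l)) summable_on UNIV"
    by (rule nonneg_bdd_above_summable_on)
       (use sum_mi_prod_le[OF c] in \<open>auto intro!: prod_nonneg c bdd_aboveI[of _ "\<Prod>l\<in>UNIV. suminf (c l)"]\<close>)
  show "(\<Sum>\<^sub>\<infinity>n. \<Prod>l\<in>UNIV. c l (n $ l)) \<le> (\<Prod>l\<in>UNIV. suminf (c l))"
    by (rule infsum_le_finite_sums[OF s sum_mi_prod_le[OF c]])
qed

lemma infinite_mi: "infinite (UNIV :: (nat ^ 'd::finite) set)"
proof
  assume f: "finite (UNIV :: (nat ^ 'd) set)"
  have "inj (\<lambda>j :: nat. \<chi> l :: 'd. j)" by (auto simp: inj_on_def vec_eq_iff)
  from finite_imageD[OF finite_subset[OF subset_UNIV f] this] show False by simp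
qed

text \<open>An enumeration of the multi-indices. It turns unordered sums into series over
  \<open>nat\<close>, the form in which limits, derivatives and integrals are exchanged with sums
  below.\<close>

definition mi_enum :: "nat \<Rightarrow> nat ^ 'd::finite" where
  "mi_enum = from_nat_into UNIV"

lemma bij_mi_enum: "bij_betw mi_enum UNIV (UNIV :: (nat ^ 'd::finite) set)"
  unfolding mi_enum_def by (intro bij_betw_from_nat_into infinite_mi) auto

lemma infsum_mi_enum:
  fixes f :: "nat ^ 'd::finite \<Rightarrow> 'b::banach"
  assumes "(\<lambda>n. norm (f n)) summable_on UNIV"
  shows "summable (\<lambda>i. norm (f (mi_enum i)))" "(\<lambda>i. f (mi_enum i)) sums (\<Sum>\<^sub>\<infinity>n. f n)"
proof -
  have s: "(\<lambda>i. norm (f (mi_enum i))) summable_on UNIV"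
    using summable_on_reindex_bij_betw[OF bij_mi_enum, of "\<lambda>n. norm (f n)"] assms by simp
  then show "summable (\<lambda>i. norm (f (mi_enum i)))" by (rule summable_on_imp_summable)
  have "((\<lambda>i. f (mi_enum i)) has_sum (\<Sum>\<^sub>\<infinity>n. f n)) UNIV"
    using has_sum_infsum[OF abs_summable_summable[OF s]] infsum_reindex_bij_betw[OF bij_mi_enum, of f] by simp
  then show "(\<lambda>i. f (mi_enum i)) sums (\<Sum>\<^sub>\<infinity>n. f n)" by (rule has_sum_imp_sums)
qed

text \<open>The root \<open>t \<mapsto> t powr (1/\<alpha>)\<close> is monotone, so the weight in \<open>|n|\<close> splits into weights in the
  single indices at the price of a factor \<open>1/d\<close> in the exponent.\<close>

lemma s_carrier_stretched_exp:
  fixes u :: "nat ^ 'd::finite \<Rightarrow> complex"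
  assumes \<alpha>: "0 < \<alpha>" and a: "1 < a" and u: "u \<in> s_carrier \<alpha> a"
  shows "cmod (u n) \<le> s_norm \<alpha> a u * (\<Prod>l\<in>UNIV. stretched_exp \<alpha> (ln a / CARD('d)) (n $ l))"
proof -
  have "(\<Sum>l\<in>UNIV. real (n $ l) powr (1 / \<alpha>)) \<le> (\<Sum>l\<in>(UNIV :: 'd set). real (mi_abs n) powr (1 / \<alpha>))"
  proof (intro sum_mono powr_mono2)
    fix l show "real (n $ l) \<le> real (mi_abs n)"
      using member_le_sum[of l UNIV "($) n"] unfolding mi_abs_def of_nat_le_iff by simp
  qed (use \<alpha> in auto)
  then have "(ln a / CARD('d)) * (\<Sum>l\<in>UNIV. real (n $ l) powr (1 / \<alpha>)) \<le>
      (ln a / CARD('d)) * (real CARD('d) * real (mi_abs n) powr (1 / \<alpha>))"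
    using a by (intro mult_left_mono) auto
  then have "(ln a / CARD('d)) * (\<Sum>l\<in>UNIV. real (n $ l) powr (1 / \<alpha>)) \<le> ln a * real (mi_abs n) powr (1 / \<alpha>)"
    by simp
  then have "exp (- (ln a * real (mi_abs n) powr (1 / \<alpha>))) \<le> exp (- ((ln a / CARD('d)) * (\<Sum>l\<in>UNIV. real (n $ l) powr (1 / \<alpha>))))"
    by simp
  also have "\<dots> = (\<Prod>l\<in>UNIV. stretched_exp \<alpha> (ln a / CARD('d)) (n $ l))"
    unfolding stretched_exp_def exp_sum[OF finite, symmetric] by (simp add: sum_distrib_left sum_negf)
  finally have "1 / s_weight \<alpha> a n \<le> (\<Prod>l\<in>UNIV. stretched_exp \<alpha> (ln a / CARD('d)) (n $ l))"
    using a by (simp add: s_weight_def powr_def exp_minus field_simps)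
  from mult_left_mono[OF this s_norm_nonneg[OF a u]] s_norm_bound[OF u a, of n] show ?thesis by simp
qed

section \<open>Laguerre series and their derivatives\<close>

definition lag_prod :: "('d::finite \<Rightarrow> nat) \<Rightarrow> nat ^ 'd \<Rightarrow> real ^ 'd \<Rightarrow> real" where
  "lag_prod p n x = (\<Prod>l\<in>UNIV. dlag (p l) 0 (n $ l) (x $ l))"

lemma laguerre_fun_eq: "laguerre_fun n t = (if t \<in> orthant then complex_of_real (lag_prod (\<lambda>_. 0) n t) else 0)"
  unfolding laguerre_fun_def lag_prod_def by (simp add: laguerre_poly_eq dlag.simps mult.commute)

lemma continuous_on_lag_prod: "continuous_on S (lag_prod p n)"
  unfolding lag_prod_def[abs_def]
  by (intro continuous_on_prod continuous_on_compose2[OF continuous_on_dlag[of UNIV]] continuous_intros) auto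

definition lag_bound :: "('d::finite \<Rightarrow> nat) \<Rightarrow> nat ^ 'd \<Rightarrow> nat ^ 'd \<Rightarrow> real" where
  "lag_bound p k n = (\<Prod>l\<in>UNIV. (4 * real (n $ l + k $ l + 1)) ^ (k $ l + 1 + p l))"

lemma lag_prod_bound:
  assumes "x \<in> closed_orthant"
  shows "mi_pow x k * \<bar>lag_prod p n x\<bar> \<le> lag_bound p k n"
  unfolding mi_pow_def lag_prod_def lag_bound_def abs_prod prod.distrib[symmetric]
proof (intro prod_mono conjI)
  fix l
  have x: "0 \<le> x $ l" using assms by (simp add: closed_orthant_def)
  then show "0 \<le> x $ l ^ k $ l * \<bar>dlag (p l) 0 (n $ l) (x $ l)\<bar>" by simp
  show "x $ l ^ k $ l * \<bar>dlag (p l) 0 (n $ l) (x $ l)\<bar> \<le> (4 * real (n $ l + k $ l + 1)) ^ (k $ l + 1 + p l)"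
    using power_abs_dlag_le[OF x, of "k $ l" "p l" 0 "n $ l"] by simp
qed

lemma abs_lag_prod_le: "x \<in> closed_orthant \<Longrightarrow> \<bar>lag_prod p n x\<bar> \<le> lag_bound p 0 n"
  using lag_prod_bound[of x 0 p n] by (simp add: mi_pow_def)

lemma lag_bound_nonneg: "0 \<le> lag_bound p k n"
  unfolding lag_bound_def by (intro prod_nonneg) auto

definition lag_bound_sum :: "real \<Rightarrow> real \<Rightarrow> ('d::finite \<Rightarrow> nat) \<Rightarrow> nat ^ 'd \<Rightarrow> real" where
  "lag_bound_sum \<alpha> a p k =
    (\<Prod>l\<in>UNIV. \<Sum>j. stretched_exp \<alpha> (ln a / CARD('d)) j * (4 * real (j + k $ l + 1)) ^ (k $ l + 1 + p l))"

lemma s_carrier_lag_bound_summable: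
  fixes u :: "nat ^ 'd::finite \<Rightarrow> complex"
  assumes \<alpha>: "1 \<le> \<alpha>" and a: "1 < a" and u: "u \<in> s_carrier \<alpha> a"
  shows "(\<lambda>n. cmod (u n) * lag_bound p k n) summable_on UNIV"
    "(\<Sum>\<^sub>\<infinity>n. cmod (u n) * lag_bound p k n) \<le> s_norm \<alpha> a u * lag_bound_sum \<alpha> a p k"
proof -
  define c where "c l j = stretched_exp \<alpha> (ln a / CARD('d)) j * (4 * real (j + k $ l + 1)) ^ (k $ l + 1 + p l)" for l j
  have \<delta>: "0 < ln a / CARD('d)" using a by simp
  have c: "0 \<le> c l j" "summable (c l)" for l j
    unfolding c_def[abs_def] using stretched_exp_pos[of \<alpha> "ln a / CARD('d)" j]
    by - (simp, rule summable_stretched_exp_poly[OF \<alpha> \<delta>])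
  have le: "cmod (u n) * lag_bound p k n \<le> s_norm \<alpha> a u * (\<Prod>l\<in>UNIV. c l (n $ l))" for n
  proof -
    have "cmod (u n) * lag_bound p k n \<le>
        (s_norm \<alpha> a u * (\<Prod>l\<in>UNIV. stretched_exp \<alpha> (ln a / CARD('d)) (n $ l))) * lag_bound p k n"
      using \<alpha> a u by (intro mult_right_mono s_carrier_stretched_exp lag_bound_nonneg) auto
    then show ?thesis unfolding c_def lag_bound_def by (simp add: prod.distrib mult.assoc)
  qed
  note sc = summable_on_cmult_right[OF mi_prod_summable_on(1)[OF c], of "s_norm \<alpha> a u"]
  show s: "(\<lambda>n. cmod (u n) * lag_bound p k n) summable_on UNIV"
    by (rule summable_on_comparison_test[OF sc]) (use le in \<open>auto simp: lag_bound_nonneg\<close>)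
  have "(\<Sum>\<^sub>\<infinity>n. cmod (u n) * lag_bound p k n) \<le> (\<Sum>\<^sub>\<infinity>n. s_norm \<alpha> a u * (\<Prod>l\<in>UNIV. c l (n $ l)))"
    by (rule infsum_mono[OF s sc le])
  also have "\<dots> = s_norm \<alpha> a u * (\<Sum>\<^sub>\<infinity>n. \<Prod>l\<in>UNIV. c l (n $ l))" by (rule infsum_cmult_right')
  also have "\<dots> \<le> s_norm \<alpha> a u * (\<Prod>l\<in>UNIV. suminf (c l))"
    by (intro mult_left_mono mi_prod_summable_on c s_norm_nonneg a u)
  finally show "(\<Sum>\<^sub>\<infinity>n. cmod (u n) * lag_bound p k n) \<le> s_norm \<alpha> a u * lag_bound_sum \<alpha> a p k"
    unfolding lag_bound_sum_def c_def .
qed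

definition lag_series :: "('d::finite \<Rightarrow> nat) \<Rightarrow> (nat ^ 'd \<Rightarrow> complex) \<Rightarrow> real ^ 'd \<Rightarrow> complex" where
  "lag_series p u x = (\<Sum>\<^sub>\<infinity>n. u n * complex_of_real (lag_prod p n x))"

definition lag_synthesis :: "(nat ^ 'd::finite \<Rightarrow> complex) \<Rightarrow> real ^ 'd \<Rightarrow> complex" where
  "lag_synthesis u x = (if x \<in> orthant then lag_series (\<lambda>_. 0) u x else 0)"

lemma lag_series_term_le:
  "x \<in> closed_orthant \<Longrightarrow> cmod (u n * complex_of_real (lag_prod p n x)) \<le> cmod (u n) * lag_bound p 0 n"
  by (simp add: norm_mult mult_left_mono abs_lag_prod_le)

context
  fixes \<alpha> a :: real and u :: "nat ^ 'd::finite \<Rightarrow> complex"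
  assumes \<alpha>: "1 \<le> \<alpha>" and a: "1 < a" and u: "u \<in> s_carrier \<alpha> a"
begin

lemma lag_series_abs_summable:
  assumes "x \<in> closed_orthant"
  shows "(\<lambda>n. cmod (u n * complex_of_real (lag_prod p n x))) summable_on UNIV"
  by (rule summable_on_comparison_test[OF s_carrier_lag_bound_summable(1)[OF \<alpha> a u, of p 0]])
     (use lag_series_term_le[OF assms] in auto)

text \<open>Uniform convergence by the M-test, on the closed orthant: the boundary is included since
  derivatives of elements of \<open>schwartz_orthant\<close> must extend continuously to it.\<close>

lemma continuous_on_lag_series: "continuous_on closed_orthant (lag_series p u)"
proof (rule uniform_limit_theorem)
  show "uniform_limit closed_orthant (\<lambda>X x. \<Sum>n\<in>X. u n * complex_of_real (lag_prod p n x)) (lag_series p u)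
      (finite_subsets_at_top UNIV)"
    unfolding lag_series_def[abs_def]
    by (rule Weierstrass_m_test_general[OF lag_series_term_le[where u = u and p = p] s_carrier_lag_bound_summable(1)[OF \<alpha> a u]])
  show "\<forall>\<^sub>F X in finite_subsets_at_top UNIV. continuous_on closed_orthant (\<lambda>x. \<Sum>n\<in>X. u n * complex_of_real (lag_prod p n x))"
    by (intro always_eventually allI continuous_intros continuous_on_lag_prod)
qed auto

lemma cmod_lag_series_le:
  assumes x: "x \<in> closed_orthant"
  shows "mi_pow x k * cmod (lag_series p u x) \<le> s_norm \<alpha> a u * lag_bound_sum \<alpha> a p k"
proof -
  have pos: "0 \<le> mi_pow x k" using x unfolding mi_pow_def closed_orthant_def by (auto intro: prod_nonneg)
  have "mi_pow x k * cmod (lag_series p u x) \<le> mi_pow x k * (\<Sum>\<^sub>\<infinity>n. cmod (u n * complex_of_real (lag_prod p n x)))"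
    unfolding lag_series_def by (intro mult_left_mono norm_infsum_bound lag_series_abs_summable x pos)
  also have "\<dots> = (\<Sum>\<^sub>\<infinity>n. mi_pow x k * cmod (u n * complex_of_real (lag_prod p n x)))"
    by (rule infsum_cmult_right'[symmetric])
  also have "\<dots> \<le> (\<Sum>\<^sub>\<infinity>n. cmod (u n) * lag_bound p k n)"
  proof (rule infsum_mono)
    show "(\<lambda>n. mi_pow x k * cmod (u n * complex_of_real (lag_prod p n x))) summable_on UNIV"
      by (intro summable_on_cmult_right lag_series_abs_summable x)
    fix n
    show "mi_pow x k * cmod (u n * complex_of_real (lag_prod p n x)) \<le> cmod (u n) * lag_bound p k n"
      using mult_left_mono[OF lag_prod_bound[OF x, of k p n] norm_ge_zero[of "u n"]] by (simp add: norm_mult mult_ac)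
  qed (rule s_carrier_lag_bound_summable(1)[OF \<alpha> a u])
  also have "\<dots> \<le> s_norm \<alpha> a u * lag_bound_sum \<alpha> a p k" by (rule s_carrier_lag_bound_summable(2)[OF \<alpha> a u])
  finally show ?thesis .
qed

end

text \<open>The orders of differentiation form a function, not a vector: a derivative in direction
  \<open>l\<close> is then a function update, and \<open>count_list ls\<close> is directly an
  admissible argument.\<close>

lemma lag_prod_line_deriv:
  "((\<lambda>s. lag_prod p n (x + s *\<^sub>R axis l 1)) has_real_derivative lag_prod (p(l := Suc (p l))) n (x + r *\<^sub>R axis l 1)) (at r)"
proof -
  have line: "lag_prod q n (x + s *\<^sub>R axis l 1) =
      dlag (q l) 0 (n $ l) (x $ l + s) * (\<Prod>m\<in>UNIV - {l}. dlag (q m) 0 (n $ m) (x $ m))" for q s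
    unfolding lag_prod_def by (simp add: prod.remove[of UNIV l] axis_def)
  have "((\<lambda>s. dlag (p l) 0 (n $ l) (x $ l + s)) has_real_derivative dlag (Suc (p l)) 0 (n $ l) (x $ l + r)) (at r)"
    using DERIV_shift[of "dlag (p l) 0 (n $ l)" "dlag (Suc (p l)) 0 (n $ l) (x $ l + r)" r "x $ l"]
      dlag_has_derivative[of "p l" 0 "n $ l" "x $ l + r"] by (simp add: add.commute)
  from DERIV_cmult_right[OF this, of "\<Prod>m\<in>UNIV - {l}. dlag (p m) 0 (n $ m) (x $ m)"]
  show ?thesis unfolding line by simp
qed

text \<open>The mean value inequality on a segment that stays in the orthant. It majorises the
  difference quotients uniformly in \<open>s\<close>.\<close>

lemma lag_prod_line_lipschitz:
  assumes x: "x \<in> orthant" and s: "x + s *\<^sub>R axis l 1 \<in> orthant"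
  shows "\<bar>lag_prod p n (x + s *\<^sub>R axis l 1) - lag_prod p n x\<bar> \<le> lag_bound (p(l := Suc (p l))) 0 n * \<bar>s\<bar>"
proof -
  have "norm (lag_prod p n (x + s *\<^sub>R axis l 1) - lag_prod p n (x + 0 *\<^sub>R axis l 1)) \<le>
      lag_bound (p(l := Suc (p l))) 0 n * norm (s - 0)"
  proof (rule field_differentiable_bound[where S = "closed_segment 0 s" and f = "\<lambda>s. lag_prod p n (x + s *\<^sub>R axis l 1)"])
    fix r assume r: "r \<in> closed_segment 0 s"
    show "((\<lambda>s. lag_prod p n (x + s *\<^sub>R axis l 1)) has_field_derivative
        lag_prod (p(l := Suc (p l))) n (x + r *\<^sub>R axis l 1)) (at r within closed_segment 0 s)"
      by (rule has_field_derivative_at_within[OF lag_prod_line_deriv])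
    have "x + r *\<^sub>R axis l 1 \<in> closed_orthant"
      unfolding closed_orthant_def
    proof (intro CollectI allI)
      fix m
      have "0 < x $ m" "0 < (x + s *\<^sub>R axis l 1) $ m" using x s unfolding orthant_def by blast+
      then show "0 \<le> (x + r *\<^sub>R axis l 1) $ m"
        using r by (auto simp: axis_def closed_segment_eq_real_ivl split: if_splits)
    qed
    then show "norm (lag_prod (p(l := Suc (p l))) n (x + r *\<^sub>R axis l 1)) \<le> lag_bound (p(l := Suc (p l))) 0 n"
      using abs_lag_prod_le by simp
  qed auto
  then show ?thesis by simp
qed

text \<open>Difference quotients converge termwise, and by the Lipschitz bound they have the
  summable majorant \<open>M\<close>; Tannery's theorem exchanges the limit with the sum.\<close>

lemma lag_series_line_deriv:
  fixes u :: "nat ^ 'd::finite \<Rightarrow> complex"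
  assumes \<alpha>: "1 \<le> \<alpha>" and a: "1 < a" and u: "u \<in> s_carrier \<alpha> a" and x: "x \<in> orthant"
  shows "((\<lambda>s. lag_series p u (x + s *\<^sub>R axis l 1)) has_vector_derivative lag_series (p(l := Suc (p l))) u x) (at 0)"
proof -
  let ?p' = "p(l := Suc (p l))" and ?y = "\<lambda>s. x + s *\<^sub>R axis l 1"
  have xc: "x \<in> closed_orthant" using x closed_orthant_superset by blast
  define A where "A i s = u (mi_enum i) * complex_of_real ((lag_prod p (mi_enum i) (?y s) - lag_prod p (mi_enum i) x) / s)" for i s
  define b where "b i = u (mi_enum i) * complex_of_real (lag_prod ?p' (mi_enum i) x)" for i
  define M where "M i = cmod (u (mi_enum i)) * lag_bound ?p' 0 (mi_enum i)" for i
  have ev: "eventually (\<lambda>s. ?y s \<in> orthant \<and> s \<noteq> 0) (at 0)"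
    using eventually_line_in_orthant[OF x, of l] unfolding eventually_at_filter by eventually_elim auto
  have sums: "(\<lambda>i. u (mi_enum i) * complex_of_real (lag_prod q (mi_enum i) z)) sums lag_series q u z" if "z \<in> closed_orthant" for q z
    unfolding lag_series_def
    by (rule infsum_mi_enum(2)[OF lag_series_abs_summable[OF \<alpha> a u that]])
  have "eventually (\<lambda>s. summable (\<lambda>i. norm (A i s))) (at 0) \<and> summable (\<lambda>i. norm (b i)) \<and>
      ((\<lambda>s. \<Sum>i. A i s) \<longlongrightarrow> suminf b) (at 0)"
  proof (rule tannerys_theorem)
    fix i
    have "((\<lambda>s. (lag_prod p (mi_enum i) (?y s) - lag_prod p (mi_enum i) x) / s) \<longlongrightarrow> lag_prod ?p' (mi_enum i) x) (at 0)"
      using lag_prod_line_deriv[of p "mi_enum i" x l 0] unfolding DERIV_def by simp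
    then show "((\<lambda>s. A i s) \<longlongrightarrow> b i) (at 0)" unfolding A_def b_def by (intro tendsto_intros)
  next
    have "eventually (\<lambda>i :: nat. True) at_top" by simp
    moreover have "norm (A i s) \<le> M i" if "?y s \<in> orthant \<and> s \<noteq> 0" for i s
      unfolding A_def M_def norm_mult norm_of_real abs_divide
      using lag_prod_line_lipschitz[OF x conjunct1[OF that], of p "mi_enum i"] that
      by (intro mult_left_mono) (simp_all add: divide_le_eq)
    ultimately show "eventually (\<lambda>(i, s). norm (A i s) \<le> M i) (at_top \<times>\<^sub>F at 0)"
      unfolding eventually_prod_filter using ev by (intro exI[of _ "\<lambda>_. True"] exI[of _ "\<lambda>s. ?y s \<in> orthant \<and> s \<noteq> 0"]) auto
    have "(\<lambda>n. norm (cmod (u n) * lag_bound ?p' 0 n)) summable_on UNIV"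
      using s_carrier_lag_bound_summable(1)[OF \<alpha> a u, of ?p' 0] by (simp add: abs_of_nonneg lag_bound_nonneg)
    from sums_summable[OF infsum_mi_enum(2)[OF this]] show "summable M" unfolding M_def[abs_def] .
  qed simp
  then have lim: "((\<lambda>s. \<Sum>i. A i s) \<longlongrightarrow> lag_series ?p' u x) (at 0)"
    using sums[OF xc, of ?p'] unfolding b_def by (simp add: sums_iff)
  have eq: "(\<Sum>i. A i s) = (lag_series p u (?y s) - lag_series p u x) /\<^sub>R s" if "?y s \<in> orthant \<and> s \<noteq> 0" for s
  proof -
    have "?y s \<in> closed_orthant" using that closed_orthant_superset by blast
    then have "(\<lambda>i. (u (mi_enum i) * complex_of_real (lag_prod p (mi_enum i) (?y s)) - u (mi_enum i) * complex_of_real (lag_prod p (mi_enum i) x)) /\<^sub>R s)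
        sums ((lag_series p u (?y s) - lag_series p u x) /\<^sub>R s)"
      by (intro sums_scaleR_right sums_diff sums xc)
    moreover have "(u (mi_enum i) * complex_of_real (lag_prod p (mi_enum i) (?y s)) - u (mi_enum i) * complex_of_real (lag_prod p (mi_enum i) x)) /\<^sub>R s = A i s" for i
      by (simp add: A_def scaleR_conv_of_real field_simps)
    ultimately show ?thesis by (simp add: sums_iff)
  qed
  have lim2: "((\<lambda>s. (lag_series p u (?y s) - lag_series p u x) /\<^sub>R s) \<longlongrightarrow> lag_series ?p' u x) (at 0)"
    by (rule Lim_transform_eventually[OF lim]) (use ev eq in \<open>auto elim: eventually_mono\<close>)
  show ?thesis
    unfolding has_vector_derivative_def has_derivative_iff_norm
  proof (intro conjI bounded_linear_scaleR_left)
    have "((\<lambda>s. norm ((lag_series p u (?y s) - lag_series p u x) /\<^sub>R s - lag_series ?p' u x)) \<longlongrightarrow> 0) (at 0)"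
      using lim2 by (simp add: LIM_zero tendsto_norm_zero)
    then show "((\<lambda>s. norm (lag_series p u (?y s) - lag_series p u (?y 0) - (s - 0) *\<^sub>R lag_series ?p' u x) / norm (s - 0)) \<longlongrightarrow> 0) (at 0)"
    proof (rule Lim_transform_eventually)
      show "\<forall>\<^sub>F s in at 0. norm ((lag_series p u (?y s) - lag_series p u x) /\<^sub>R s - lag_series ?p' u x) =
          norm (lag_series p u (?y s) - lag_series p u (?y 0) - (s - 0) *\<^sub>R lag_series ?p' u x) / norm (s - 0)"
      proof (rule eventually_mono[OF ev])
        fix s assume "?y s \<in> orthant \<and> s \<noteq> 0"
        then have "(lag_series p u (?y s) - lag_series p u x) /\<^sub>R s - lag_series ?p' u x =
            (lag_series p u (?y s) - lag_series p u (?y 0) - (s - 0) *\<^sub>R lag_series ?p' u x) /\<^sub>R s"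
          by (simp add: algebra_simps)
        then show "norm ((lag_series p u (?y s) - lag_series p u x) /\<^sub>R s - lag_series ?p' u x) =
          norm (lag_series p u (?y s) - lag_series p u (?y 0) - (s - 0) *\<^sub>R lag_series ?p' u x) / norm (s - 0)"
          by (simp only: norm_scaleR) (simp add: divide_inverse_commute abs_inverse)
      qed
    qed
  qed
qed

text \<open>It gives the choice in \<open>mi_deriv\<close> a meaning: some order of differentiation
  with the prescribed multiplicities exists.\<close>

lemma ex_list_with_counts: "\<exists>ls. \<forall>l. count_list ls l = (p :: nat ^ 'd::finite) $ l"
proof -
  obtain ls where ls: "mset ls = (\<Sum>l\<in>UNIV. replicate_mset (p $ l) l)" using ex_mset by blast
  have "count_list ls l = p $ l" for l
  proof -
    have "count_list ls l = count (mset ls) l" by (simp add: count_mset)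
    then show ?thesis unfolding ls by (simp add: count_sum sum.delta if_distrib cong: if_cong)
  qed
  then show ?thesis by blast
qed

context
  fixes \<alpha> a :: real and u :: "nat ^ 'd::finite \<Rightarrow> complex"
  assumes \<alpha>: "1 \<le> \<alpha>" and a: "1 < a" and u: "u \<in> s_carrier \<alpha> a"
begin

text \<open>The right side depends on the multiplicities alone, so it is the same for whatever order
  of differentiation \<open>mi_deriv\<close> selects.\<close>

lemma partials_lag_synthesis:
  "\<forall>x\<in>orthant. partials ls (lag_synthesis u) x = lag_series (count_list ls) u x"
proof (induction ls)
  case Nil
  then show ?case by (simp add: lag_synthesis_def)
next
  case (Cons l ls)
  show ?case
  proof
    fix x :: "real ^ 'd" assume x: "x \<in> orthant"
    have "partial l (partials ls (lag_synthesis u)) x = partial l (lag_series (count_list ls) u) x"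
      using Cons.IH by (intro partial_cong[OF x]) auto
    also have "\<dots> = lag_series ((count_list ls)(l := Suc (count_list ls l))) u x"
      by (rule partial_eqI(2)[OF lag_series_line_deriv[OF \<alpha> a u x]])
    also have "(count_list ls)(l := Suc (count_list ls l)) = count_list (l # ls)" by (simp add: fun_eq_iff)
    finally show "partials (l # ls) (lag_synthesis u) x = lag_series (count_list (l # ls)) u x"
      unfolding partials_simps .
  qed
qed

lemma smooth_on_lag_synthesis: "smooth_on orthant (lag_synthesis u)"
  unfolding smooth_on_def
proof (intro allI conjI ballI)
  fix ls
  have "continuous_on orthant (lag_series (count_list ls) u)"
    by (rule continuous_on_subset[OF continuous_on_lag_series[OF \<alpha> a u] closed_orthant_superset])
  then show "continuous_on orthant (partials ls (lag_synthesis u))"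
    using partials_lag_synthesis by (subst continuous_on_cong[OF refl, where g = "lag_series (count_list ls) u"]) auto
  fix l and x :: "real ^ 'd" assume x: "x \<in> orthant"
  have "has_partial_at (lag_series (count_list ls) u) l x"
    by (rule partial_eqI(1)[OF lag_series_line_deriv[OF \<alpha> a u x]])
  then show "has_partial_at (partials ls (lag_synthesis u)) l x"
    using partial_cong(2)[OF x, of "partials ls (lag_synthesis u)" "lag_series (count_list ls) u"] partials_lag_synthesis
    by blast
qed

lemma mi_deriv_lag_synthesis:
  assumes "x \<in> orthant"
  shows "mi_deriv p (lag_synthesis u) x = lag_series (($) p) u x"
proof -
  have "count_list (SOME ls. \<forall>l. count_list ls l = p $ l) = ($) p"
    using someI_ex[OF ex_list_with_counts[of p]] by auto
  then show ?thesis unfolding mi_deriv_def using partials_lag_synthesis assms by simp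
qed

lemma lag_synthesis_schwartz: "lag_synthesis u \<in> schwartz_orthant"
  unfolding schwartz_orthant_def
proof (intro CollectI conjI allI impI smooth_on_lag_synthesis)
  show "lag_synthesis u x = 0" if "x \<notin> orthant" for x using that by (simp add: lag_synthesis_def)
  show "\<exists>g. continuous_on closed_orthant g \<and> (\<forall>x\<in>orthant. g x = mi_deriv p (lag_synthesis u) x)" for p
    using continuous_on_lag_series[OF \<alpha> a u, of "($) p"] mi_deriv_lag_synthesis by (intro exI[of _ "lag_series (($) p) u"]) auto
  show "bdd_above ((\<lambda>x. mi_pow x k * cmod (mi_deriv p (lag_synthesis u) x)) ` orthant)" for k p
    using cmod_lag_series_le[OF \<alpha> a u, of _ k "($) p"] closed_orthant_superset
    by (intro bdd_aboveI[of _ "s_norm \<alpha> a u * lag_bound_sum \<alpha> a (($) p) k"]) (auto simp: mi_deriv_lag_synthesis)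
qed

lemma sup_seminorm_lag_synthesis:
  "sup_seminorm p k (lag_synthesis u) \<le> s_norm \<alpha> a u * lag_bound_sum \<alpha> a (($) p) k"
  unfolding sup_seminorm_def
proof (rule cSUP_least[OF orthant_nonempty])
  fix x :: "real ^ 'd" assume x: "x \<in> orthant"
  then show "cmod (complex_of_real (mi_pow x k) * mi_deriv p (lag_synthesis u) x) \<le> s_norm \<alpha> a u * lag_bound_sum \<alpha> a (($) p) k"
    using cmod_lag_series_le[OF \<alpha> a u, of x k "($) p"] closed_orthant_superset
    by (auto simp: mi_deriv_lag_synthesis norm_mult mi_pow_nonneg)
qed

end

section \<open>Square norms of Laguerre series\<close>

lemma suminf_Cauchy_Schwarz:
  fixes v h :: "nat \<Rightarrow> real"
  assumes v: "\<And>i. 0 \<le> v i" "summable v" and vh: "summable (\<lambda>i. v i * \<bar>h i\<bar>)" and vh2: "summable (\<lambda>i. v i * (h i)\<^sup>2)"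
  shows "(\<Sum>i. v i * \<bar>h i\<bar>)\<^sup>2 \<le> suminf v * (\<Sum>i. v i * (h i)\<^sup>2)"
proof (rule LIMSEQ_le_const2)
  show "(\<lambda>n. (\<Sum>i<n. v i * \<bar>h i\<bar>)\<^sup>2) \<longlonglongrightarrow> (\<Sum>i. v i * \<bar>h i\<bar>)\<^sup>2"
    by (intro tendsto_power summable_LIMSEQ vh)
  have "(\<Sum>i<n. v i * \<bar>h i\<bar>)\<^sup>2 \<le> suminf v * (\<Sum>i. v i * (h i)\<^sup>2)" for n
  proof -
    have "(\<Sum>i<n. v i * \<bar>h i\<bar>)\<^sup>2 = (\<Sum>i<n. sqrt (v i) * (sqrt (v i) * \<bar>h i\<bar>))\<^sup>2"
      using v(1) by (simp add: mult.assoc[symmetric])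
    also have "\<dots> \<le> (\<Sum>i<n. (sqrt (v i))\<^sup>2) * (\<Sum>i<n. (sqrt (v i) * \<bar>h i\<bar>)\<^sup>2)"
      by (rule Cauchy_Schwarz_ineq_sum)
    also have "\<dots> = (\<Sum>i<n. v i) * (\<Sum>i<n. v i * (h i)\<^sup>2)"
      using v(1) by (simp add: power_mult_distrib)
    also have "\<dots> \<le> suminf v * (\<Sum>i. v i * (h i)\<^sup>2)"
      by (intro mult_mono sum_le_suminf v vh2 sum_nonneg suminf_nonneg) (auto simp: v)
    finally show ?thesis .
  qed
  then show "\<exists>N. \<forall>n\<ge>N. (\<Sum>i<n. v i * \<bar>h i\<bar>)\<^sup>2 \<le> suminf v * (\<Sum>i. v i * (h i)\<^sup>2)" by blast
qed

lemma lag_prod_square_integral: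
  fixes p k n :: "nat ^ 'd::finite"
  shows "set_integrable lborel orthant (\<lambda>x. mi_pow x (p + k) * (lag_prod (($) p) n x)\<^sup>2)"
    "(LINT x:orthant|lborel. mi_pow x (p + k) * (lag_prod (($) p) n x)\<^sup>2) \<le>
      (\<Prod>l\<in>UNIV. 4 ^ (k $ l) * real (n $ l + (p + k) $ l) ^ ((p + k) $ l))"
proof -
  have eq: "mi_pow x (p + k) * (lag_prod (($) p) n x)\<^sup>2 =
      (\<Prod>l\<in>UNIV. (x $ l) ^ ((p + k) $ l) * (dlag (p $ l) 0 (n $ l) (x $ l))\<^sup>2)" for x
    unfolding mi_pow_def lag_prod_def prod_power_distrib prod.distrib[symmetric] ..
  note int = dlag_square_integrable[of "(p + k) $ l" "p $ l" 0 "n $ l" for l]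
  show "set_integrable lborel orthant (\<lambda>x. mi_pow x (p + k) * (lag_prod (($) p) n x)\<^sup>2)"
    unfolding eq by (rule orthant_prod(1)[OF int])
  have "(LINT x:orthant|lborel. mi_pow x (p + k) * (lag_prod (($) p) n x)\<^sup>2) =
      (\<Prod>l\<in>UNIV. LBINT t:{0<..}. t ^ ((p + k) $ l) * (dlag (p $ l) 0 (n $ l) t)\<^sup>2)"
    unfolding eq by (rule orthant_prod(2)[OF int])
  also have "\<dots> \<le> (\<Prod>l\<in>UNIV. 4 ^ (k $ l) * real (n $ l + (p + k) $ l) ^ ((p + k) $ l))"
  proof (intro prod_mono conjI)
    fix l
    show "0 \<le> (LBINT t:{0<..}. t ^ ((p + k) $ l) * (dlag (p $ l) 0 (n $ l) t)\<^sup>2)"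
      unfolding set_lebesgue_integral_def by (intro Bochner_Integration.integral_nonneg) (simp add: indicator_def)
    show "(LBINT t:{0<..}. t ^ ((p + k) $ l) * (dlag (p $ l) 0 (n $ l) t)\<^sup>2) \<le>
        4 ^ (k $ l) * real (n $ l + (p + k) $ l) ^ ((p + k) $ l)"
      using LBINT_dlag_square_le[of 0 "p $ l" "k $ l" "n $ l"] by simp
  qed
  finally show "(LINT x:orthant|lborel. mi_pow x (p + k) * (lag_prod (($) p) n x)\<^sup>2) \<le>
      (\<Prod>l\<in>UNIV. 4 ^ (k $ l) * real (n $ l + (p + k) $ l) ^ ((p + k) $ l))" .
qed

text \<open>Squares of bounds are bounds of the same form with other orders, so
  \<open>s_carrier_lag_bound_summable\<close> covers the summability of squares too.\<close>

lemma lag_bound_square: "(lag_bound p 0 n)\<^sup>2 = lag_bound (\<lambda>l. 1 + 2 * p l) 0 n"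
  unfolding lag_bound_def prod_power_distrib by (intro prod.cong refl, subst power_mult[symmetric], rule arg_cong2[where f = power]) auto

text \<open>The decay rate is split into two halves: one pays for the powers through
  \<open>K\<close>, the other makes the sum over \<open>n\<close> converge.\<close>

lemma s_carrier_power_summable:
  fixes u :: "nat ^ 'd::finite \<Rightarrow> complex" and q :: "nat ^ 'd"
  assumes \<alpha>: "1 \<le> \<alpha>" and a: "1 < a" and u: "u \<in> s_carrier \<alpha> a"
    and K: "\<And>j q. real (j + q) ^ q * stretched_exp \<alpha> (ln a / (2 * CARD('d))) j \<le> K ^ q * self_powr \<alpha> q" and K1: "1 \<le> K"
  defines "w \<equiv> \<lambda>n. cmod (u n) * (\<Prod>l\<in>UNIV. real (n $ l + q $ l) ^ (q $ l))"
  shows "w summable_on UNIV"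
    "(\<Sum>\<^sub>\<infinity>n. w n) \<le> s_norm \<alpha> a u * (suminf (stretched_exp \<alpha> (ln a / (2 * CARD('d)))) ^ CARD('d)) * (\<Prod>l\<in>UNIV. K ^ (q $ l) * self_powr \<alpha> (q $ l))"
proof -
  let ?\<delta> = "ln a / CARD('d)" and ?\<eta> = "ln a / (2 * CARD('d))"
  have \<eta>: "0 < ?\<eta>" using a by simp
  have half: "stretched_exp \<alpha> ?\<delta> j = stretched_exp \<alpha> ?\<eta> j * stretched_exp \<alpha> ?\<eta> j" for j
    unfolding stretched_exp_def by (simp add: field_simps flip: exp_add)
  define D where "D = (\<Prod>l\<in>UNIV. K ^ (q $ l) * self_powr \<alpha> (q $ l))"
  have D: "0 \<le> D" unfolding D_def using K1 self_powr_pos by (intro prod_nonneg) (auto simp: less_imp_le)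
  have N: "0 \<le> s_norm \<alpha> a u" by (rule s_norm_nonneg[OF a u])
  have le: "w n \<le> s_norm \<alpha> a u * D * (\<Prod>l\<in>UNIV. stretched_exp \<alpha> ?\<eta> (n $ l))" for n
  proof -
    have "w n \<le> (s_norm \<alpha> a u * (\<Prod>l\<in>UNIV. stretched_exp \<alpha> ?\<delta> (n $ l))) * (\<Prod>l\<in>UNIV. real (n $ l + q $ l) ^ (q $ l))"
      unfolding w_def using \<alpha> a u by (intro mult_right_mono s_carrier_stretched_exp prod_nonneg) auto
    also have "\<dots> = s_norm \<alpha> a u * ((\<Prod>l\<in>UNIV. real (n $ l + q $ l) ^ (q $ l) * stretched_exp \<alpha> ?\<eta> (n $ l)) * (\<Prod>l\<in>UNIV. stretched_exp \<alpha> ?\<eta> (n $ l)))"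
      unfolding half by (simp add: prod.distrib mult_ac)
    also have "\<dots> \<le> s_norm \<alpha> a u * (D * (\<Prod>l\<in>UNIV. stretched_exp \<alpha> ?\<eta> (n $ l)))"
      unfolding D_def using K N
      by (intro mult_left_mono mult_right_mono prod_mono conjI prod_nonneg mult_nonneg_nonneg)
         (auto simp: less_imp_le[OF stretched_exp_pos])
    finally show ?thesis by (simp add: mult.assoc)
  qed
  have c: "0 \<le> stretched_exp \<alpha> ?\<eta> j" "summable (stretched_exp \<alpha> ?\<eta>)" for j
    using summable_stretched_exp_poly[OF \<alpha> \<eta>, of 0 0] stretched_exp_pos[of \<alpha> ?\<eta> j] by (auto simp: less_imp_le)
  note mi = mi_prod_summable_on[where c = "\<lambda>_ :: 'd. stretched_exp \<alpha> ?\<eta>", OF c]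
  have s: "(\<lambda>n. s_norm \<alpha> a u * D * (\<Prod>l\<in>(UNIV :: 'd set). stretched_exp \<alpha> ?\<eta> (n $ l))) summable_on UNIV"
    by (intro summable_on_cmult_right mi)
  have w0: "0 \<le> w n" for n unfolding w_def by (intro mult_nonneg_nonneg prod_nonneg) auto
  show sw: "w summable_on UNIV"
    by (rule summable_on_comparison_test[OF s]) (use le w0 in auto)
  have "(\<Sum>\<^sub>\<infinity>n. w n) \<le> (\<Sum>\<^sub>\<infinity>n. s_norm \<alpha> a u * D * (\<Prod>l\<in>(UNIV :: 'd set). stretched_exp \<alpha> ?\<eta> (n $ l)))"
    by (rule infsum_mono[OF sw s le])
  also have "\<dots> = s_norm \<alpha> a u * D * (\<Sum>\<^sub>\<infinity>n. \<Prod>l\<in>(UNIV :: 'd set). stretched_exp \<alpha> ?\<eta> (n $ l))" by (rule infsum_cmult_right')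
  also have "\<dots> \<le> s_norm \<alpha> a u * D * (\<Prod>l\<in>(UNIV :: 'd set). suminf (stretched_exp \<alpha> ?\<eta>))"
    by (intro mult_left_mono mi mult_nonneg_nonneg N D)
  finally show "(\<Sum>\<^sub>\<infinity>n. w n) \<le> s_norm \<alpha> a u * (suminf (stretched_exp \<alpha> ?\<eta>) ^ CARD('d)) * (\<Prod>l\<in>UNIV. K ^ (q $ l) * self_powr \<alpha> (q $ l))"
    unfolding D_def by (simp add: mult_ac)
qed

text \<open>Cauchy-Schwarz with weights \<open>cmod (u n)\<close> bounds the square of the series
  pointwise by the sum of the weights times the weighted series of squares. The latter is integrated
  term by term with \<open>lag_prod_square_integral\<close>, and only this factor produces powers of
  \<open>K\<close> and factorial powers.\<close>

lemma L2_norm_lag_synthesis: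
  fixes u :: "nat ^ 'd::finite \<Rightarrow> complex" and p k :: "nat ^ 'd"
  assumes \<alpha>: "1 \<le> \<alpha>" and a: "1 < a" and u: "u \<in> s_carrier \<alpha> a"
    and K: "\<And>j q. real (j + q) ^ q * stretched_exp \<alpha> (ln a / (2 * CARD('d))) j \<le> K ^ q * self_powr \<alpha> q" and K1: "1 \<le> K"
  defines "S \<equiv> suminf (stretched_exp \<alpha> (ln a / (2 * CARD('d)))) ^ CARD('d)"
  shows "(L2_norm_orthant (weighted_deriv p k (lag_synthesis u)))\<^sup>2 \<le>
    (s_norm \<alpha> a u * S)\<^sup>2 * (\<Prod>l\<in>UNIV. 4 ^ (k $ l) * (K ^ ((p + k) $ l) * self_powr \<alpha> ((p + k) $ l)))"
proof -
  note sch = lag_synthesis_schwartz[OF \<alpha> a u]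
  define v where "v i = cmod (u (mi_enum i))" for i
  define h where "h i x = lag_prod (($) p) (mi_enum i :: nat ^ 'd) x" for i x
  define W where "W = (\<Prod>l\<in>UNIV. K ^ ((p + k) $ l) * self_powr \<alpha> ((p + k) $ l))"
  note ps0 = s_carrier_power_summable[OF \<alpha> a u K K1, of 0, folded S_def]
  note ps = s_carrier_power_summable[OF \<alpha> a u K K1, of "p + k", folded S_def W_def]
  have v0: "0 \<le> v i" for i by (simp add: v_def)
  have sv: "summable v" "suminf v \<le> s_norm \<alpha> a u * S"
  proof -
    have "(\<lambda>n. norm (cmod (u n))) summable_on UNIV" "(\<Sum>\<^sub>\<infinity>n. cmod (u n)) \<le> s_norm \<alpha> a u * S"
      using ps0 by (simp_all add: self_powr_def)
    then show "summable v" "suminf v \<le> s_norm \<alpha> a u * S"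
      using infsum_mi_enum(2)[of "\<lambda>n. cmod (u n)"] unfolding v_def by (auto simp: sums_iff)
  qed
  define I where "I i = (LINT x:orthant|lborel. mi_pow x (p + k) * (h i x)\<^sup>2)" for i
  have I0: "0 \<le> I i" for i
    unfolding I_def set_lebesgue_integral_def
    by (intro Bochner_Integration.integral_nonneg) (auto simp: indicator_def mi_pow_nonneg)
  let ?E = "\<Prod>l\<in>(UNIV :: 'd set). (4 :: real) ^ (k $ l)"
  have E: "0 \<le> ?E" by (intro prod_nonneg) auto
  define w where "w n = cmod (u n) * (\<Prod>l\<in>UNIV. real (n $ l + (p + k) $ l) ^ ((p + k) $ l))" for n
  have sw: "summable (\<lambda>i. w (mi_enum i))" "(\<Sum>i. w (mi_enum i)) \<le> s_norm \<alpha> a u * S * W"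
  proof -
    have w0: "norm (w n) = w n" for n unfolding w_def by (simp add: prod_nonneg)
    have "(\<lambda>n. norm (w n)) summable_on UNIV" "(\<Sum>\<^sub>\<infinity>n. w n) \<le> s_norm \<alpha> a u * S * W"
      unfolding w0 using ps unfolding w_def by simp_all
    then show "summable (\<lambda>i. w (mi_enum i))" "(\<Sum>i. w (mi_enum i)) \<le> s_norm \<alpha> a u * S * W"
      using infsum_mi_enum(2)[of w] by (auto simp: sums_iff)
  qed
  have vI: "v i * I i \<le> ?E * w (mi_enum i)" for i
  proof -
    have "v i * I i \<le> v i * (\<Prod>l\<in>UNIV. 4 ^ (k $ l) * real (mi_enum i $ l + (p + k) $ l) ^ ((p + k) $ l))"
      unfolding I_def h_def by (intro mult_left_mono lag_prod_square_integral v0)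
    then show ?thesis unfolding w_def v_def by (simp add: prod.distrib mult_ac)
  qed
  have svI: "summable (\<lambda>i. v i * I i)"
    by (rule summable_comparison_test'[OF summable_mult[OF sw(1), of ?E]]) (use vI v0 I0 in auto)
  have vI_le: "(\<Sum>i. v i * I i) \<le> ?E * (s_norm \<alpha> a u * S * W)"
  proof -
    have "(\<Sum>i. v i * I i) \<le> (\<Sum>i. ?E * w (mi_enum i))" by (intro suminf_le vI svI summable_mult sw)
    also have "\<dots> = ?E * (\<Sum>i. w (mi_enum i))" by (rule suminf_mult[OF sw(1)])
    also have "\<dots> \<le> ?E * (s_norm \<alpha> a u * S * W)" by (intro mult_left_mono sw E)
    finally show ?thesis .
  qed
  define f where "f i x = indicat_real orthant x *\<^sub>R (mi_pow x (p + k) * (h i x)\<^sup>2) * v i" for i x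
  have fi: "integrable lborel (f i)" for i
    unfolding f_def using lag_prod_square_integral(1)[of p k "mi_enum i"] unfolding set_integrable_def h_def
    by (intro integrable_mult_left) simp
  have fI: "(LINT x|lborel. f i x) = v i * I i" for i
    unfolding f_def I_def set_lebesgue_integral_def by simp
  have f0: "0 \<le> f i x" for i x unfolding f_def by (auto simp: indicator_def mi_pow_nonneg v0)
  have ptw: "summable (\<lambda>i. v i * (h i x)\<^sup>2)" "summable (\<lambda>i. v i * \<bar>h i x\<bar>)"
    "cmod (lag_series (($) p) u x) \<le> (\<Sum>i. v i * \<bar>h i x\<bar>)" if x: "x \<in> orthant" for x
  proof -
    have xc: "x \<in> closed_orthant" using x closed_orthant_superset by blast
    have s: "summable (\<lambda>i. v i * lag_bound q 0 (mi_enum i))" for q :: "'d \<Rightarrow> nat"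
      using infsum_mi_enum(2)[of "\<lambda>n. cmod (u n) * lag_bound q 0 n"] s_carrier_lag_bound_summable(1)[OF \<alpha> a u, of q 0]
      unfolding v_def by (auto simp: sums_iff abs_of_nonneg lag_bound_nonneg)
    show "summable (\<lambda>i. v i * (h i x)\<^sup>2)"
    proof (rule summable_comparison_test'[OF s[of "\<lambda>l. 1 + 2 * p $ l"]])
      fix i
      have "\<bar>h i x\<bar>\<^sup>2 \<le> (lag_bound (($) p) 0 (mi_enum i))\<^sup>2" unfolding h_def by (intro power_mono abs_lag_prod_le xc) auto
      then show "norm (v i * (h i x)\<^sup>2) \<le> v i * lag_bound (\<lambda>l. 1 + 2 * p $ l) 0 (mi_enum i)"
        unfolding lag_bound_square using v0[of i] by (simp add: mult_left_mono)
    qed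
    show sh: "summable (\<lambda>i. v i * \<bar>h i x\<bar>)"
      by (rule summable_comparison_test'[OF s[of "($) p"]]) (use v0 xc in \<open>auto simp: h_def intro!: mult_left_mono abs_lag_prod_le\<close>)
    have sums: "(\<lambda>i. u (mi_enum i) * complex_of_real (h i x)) sums lag_series (($) p) u x"
      unfolding lag_series_def h_def by (rule infsum_mi_enum(2)[OF lag_series_abs_summable[OF \<alpha> a u xc]])
    have nrm: "norm (u (mi_enum i) * complex_of_real (h i x)) = v i * \<bar>h i x\<bar>" for i by (simp add: norm_mult v_def)
    show "cmod (lag_series (($) p) u x) \<le> (\<Sum>i. v i * \<bar>h i x\<bar>)"
      using summable_norm[of "\<lambda>i. u (mi_enum i) * complex_of_real (h i x)"] sh sums unfolding nrm by (simp add: sums_iff)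
  qed
  have AEs: "AE x in lborel. summable (\<lambda>i. norm (f i x))"
  proof (rule AE_I2)
    fix x
    show "summable (\<lambda>i. norm (f i x))"
    proof (cases "x \<in> orthant")
      case True
      then show ?thesis
        using summable_mult[OF ptw(1)[OF True], of "mi_pow x (p + k)"] v0
        by (simp add: f_def abs_mult mi_pow_nonneg mult_ac)
    qed (simp add: f_def)
  qed
  have ns: "summable (\<lambda>i. LINT x|lborel. norm (f i x))" using svI f0 fI by simp
  have pw: "indicat_real orthant x *\<^sub>R (cmod (weighted_deriv p k (lag_synthesis u) x))\<^sup>2 \<le> suminf v * (\<Sum>i. f i x)" for x
  proof (cases "x \<in> orthant")
    case x: True
    have "(cmod (weighted_deriv p k (lag_synthesis u) x))\<^sup>2 = mi_pow x (p + k) * (cmod (lag_series (($) p) u x))\<^sup>2"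
      by (simp add: weighted_deriv_square[OF x] mi_deriv_lag_synthesis[OF \<alpha> a u x])
    also have "\<dots> \<le> mi_pow x (p + k) * (\<Sum>i. v i * \<bar>h i x\<bar>)\<^sup>2"
      by (intro mult_left_mono power_mono ptw(3) x mi_pow_nonneg) auto
    also have "\<dots> \<le> mi_pow x (p + k) * (suminf v * (\<Sum>i. v i * (h i x)\<^sup>2))"
      by (intro mult_left_mono suminf_Cauchy_Schwarz v0 sv ptw x mi_pow_nonneg)
    also have "\<dots> = suminf v * (\<Sum>i. mi_pow x (p + k) * (v i * (h i x)\<^sup>2))"
      by (simp add: suminf_mult[OF ptw(1)[OF x]])
    also have "(\<lambda>i. mi_pow x (p + k) * (v i * (h i x)\<^sup>2)) = (\<lambda>i. f i x)" using x by (auto simp: f_def)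
    finally show ?thesis using x by simp
  qed (simp add: f_def)
  have "(L2_norm_orthant (weighted_deriv p k (lag_synthesis u)))\<^sup>2 \<le> (LINT x|lborel. suminf v * (\<Sum>i. f i x))"
    unfolding L2_norm_orthant_square set_lebesgue_integral_def
  proof (rule integral_mono)
    show "integrable lborel (\<lambda>x. indicat_real orthant x *\<^sub>R (cmod (weighted_deriv p k (lag_synthesis u) x))\<^sup>2)"
      using weighted_deriv_square_integrable[OF sch] unfolding square_integrable_def set_integrable_def by blast
    show "integrable lborel (\<lambda>x. suminf v * (\<Sum>i. f i x))"
      by (intro integrable_mult_right integrable_suminf fi AEs ns)
  qed (rule pw)
  also have "\<dots> = suminf v * (\<Sum>i. v i * I i)"
    by (simp add: integral_suminf[OF fi AEs ns] fI)
  also have "\<dots> \<le> (s_norm \<alpha> a u * S) * (?E * (s_norm \<alpha> a u * S * W))"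
    using sv vI_le suminf_nonneg[OF sv(1) v0] suminf_nonneg[OF svI] v0 I0
    by (intro mult_mono) auto
  also have "\<dots> = (s_norm \<alpha> a u * S)\<^sup>2 * (\<Prod>l\<in>UNIV. 4 ^ (k $ l) * (K ^ ((p + k) $ l) * self_powr \<alpha> ((p + k) $ l)))"
    unfolding W_def by (simp add: prod.distrib power2_eq_square mult_ac)
  finally show ?thesis .
qed

lemma lag_synthesis_G_step:
  assumes \<alpha>: "1 \<le> \<alpha>" and a: "1 < a"
  obtains A C where "0 < A" "\<And>j. 0 \<le> C j"
    "\<And>u :: nat ^ 'd::finite \<Rightarrow> complex. u \<in> s_carrier \<alpha> a \<Longrightarrow> lag_synthesis u \<in> G_step_space \<alpha> A"
    "\<And>(u :: nat ^ 'd \<Rightarrow> complex) j. u \<in> s_carrier \<alpha> a \<Longrightarrow> G_seminorm \<alpha> A j (lag_synthesis u) \<le> C j * s_norm \<alpha> a u"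
proof -
  have "0 < ln a / (2 * CARD('d))" using a by simp
  then obtain K where K1: "1 \<le> K" and
    K: "\<And>j q. real (j + q) ^ q * stretched_exp \<alpha> (ln a / (2 * CARD('d))) j \<le> K ^ q * self_powr \<alpha> q"
    using power_stretched_exp_le[OF \<alpha>] by blast
  define S where "S = suminf (stretched_exp \<alpha> (ln a / (2 * CARD('d)))) ^ CARD('d)"
  define L where "L = ((2 * exp 1) powr \<alpha> :: real)"
  have "(1 :: real) \<le> exp 1" by simp
  then have "(1 :: real) \<le> 2 * exp 1" by linarith
  then have L1: "1 \<le> L" unfolding L_def using \<alpha> by (intro ge_one_powr_ge_zero) auto
  \<comment> \<open>The factor 4 comes from the surplus powers of \<open>t\<close>, \<open>K\<close>
    from the summation over \<open>n\<close>, and \<open>L\<close> from separating \<open>p\<close>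
    and \<open>k\<close>.\<close>
  define A where "A = 4 * K * L"
  have "1 * 1 \<le> K * L" using K1 L1 by (intro mult_mono) auto
  then have A1: "1 \<le> A" unfolding A_def by simp
  have S0: "0 \<le> S"
    unfolding S_def using summable_stretched_exp_poly[OF \<alpha> \<open>0 < ln a / (2 * CARD('d))\<close>, of 0 0]
    by (intro zero_le_power suminf_nonneg) (auto simp: less_imp_le[OF stretched_exp_pos])
  have quot: "G_quotient \<alpha> A (lag_synthesis u) p k \<le> s_norm \<alpha> a u * S"
    if u: "u \<in> s_carrier \<alpha> a" for u :: "nat ^ 'd \<Rightarrow> complex" and p k
  proof -
    let ?q = "p + k" and ?den = "G_denominator \<alpha> A p k"
    have den: "0 < ?den" using A1 by (intro G_denominator_pos) simp
    have "(\<Prod>l\<in>UNIV. 4 ^ (k $ l) * (K ^ (?q $ l) * self_powr \<alpha> (?q $ l))) \<le>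
        (\<Prod>l\<in>UNIV. (A ^ (?q $ l))\<^sup>2 * (self_powr \<alpha> (k $ l) * self_powr \<alpha> (p $ l)))"
    proof (intro prod_mono conjI)
      fix l
      show "0 \<le> 4 ^ (k $ l) * (K ^ (?q $ l) * self_powr \<alpha> (?q $ l))"
        using K1 self_powr_pos[of \<alpha> "?q $ l"] by (simp add: less_imp_le)
      have sp: "0 \<le> self_powr \<alpha> (p $ l) * self_powr \<alpha> (k $ l)" by (simp add: less_imp_le self_powr_pos)
      have "4 ^ (k $ l) * (K ^ (?q $ l) * self_powr \<alpha> (?q $ l)) \<le>
          4 ^ (?q $ l) * (K ^ (?q $ l) * (L ^ (?q $ l) * (self_powr \<alpha> (p $ l) * self_powr \<alpha> (k $ l))))"
        using K1 \<alpha> self_powr_add_le[of \<alpha> "p $ l" "k $ l"] unfolding L_def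
        by (intro mult_mono power_increasing mult_nonneg_nonneg) (auto simp: less_imp_le self_powr_pos)
      also have "\<dots> = A ^ (?q $ l) * (self_powr \<alpha> (p $ l) * self_powr \<alpha> (k $ l))"
        unfolding A_def by (simp add: power_mult_distrib)
      \<comment> \<open>The denominator enters squared; since \<open>A \<ge> 1\<close>, its power
        may be squared as well.\<close>
      also have "\<dots> \<le> (A ^ (?q $ l))\<^sup>2 * (self_powr \<alpha> (p $ l) * self_powr \<alpha> (k $ l))"
        using one_le_power[OF A1, of "?q $ l"] by (intro mult_right_mono sp) (simp add: power2_eq_square)
      finally show "4 ^ (k $ l) * (K ^ (?q $ l) * self_powr \<alpha> (?q $ l)) \<le>
          (A ^ (?q $ l))\<^sup>2 * (self_powr \<alpha> (k $ l) * self_powr \<alpha> (p $ l))" by (simp add: mult.commute)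
    qed
    also have "\<dots> = ?den\<^sup>2"
      unfolding G_denominator_def mi_self_powr_eq mi_abs_def
      by (simp add: prod.distrib power_mult_distrib prod_power_distrib self_powr_half_square power_sum)
    finally have le: "(\<Prod>l\<in>UNIV. 4 ^ (k $ l) * (K ^ (?q $ l) * self_powr \<alpha> (?q $ l))) \<le> ?den\<^sup>2" .
    have "(L2_norm_orthant (weighted_deriv p k (lag_synthesis u)))\<^sup>2 \<le> (s_norm \<alpha> a u * S)\<^sup>2 * ?den\<^sup>2"
      by (rule order_trans[OF L2_norm_lag_synthesis[OF \<alpha> a u K K1, of p k, folded S_def] mult_left_mono[OF le]]) simp
    then have "(L2_norm_orthant (weighted_deriv p k (lag_synthesis u)))\<^sup>2 \<le> (s_norm \<alpha> a u * S * ?den)\<^sup>2"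
      by (simp add: power_mult_distrib)
    then have "L2_norm_orthant (weighted_deriv p k (lag_synthesis u)) \<le> s_norm \<alpha> a u * S * ?den"
      by (rule power2_le_imp_le) (use s_norm_nonneg[OF a u] S0 den in simp)
    then show ?thesis unfolding G_quotient_eq using den by (simp add: pos_divide_le_eq)
  qed
  define C where "C j = S + (\<Sum>(p, k)\<in>{(p :: nat ^ 'd, k). mi_abs p \<le> j \<and> mi_abs k \<le> j}. \<bar>lag_bound_sum \<alpha> a (($) p) k\<bar>)" for j
  show thesis
  proof (rule that[of A C])
    show "0 < A" using A1 by simp
    show "0 \<le> C j" for j unfolding C_def using S0 by (auto intro!: add_nonneg_nonneg sum_nonneg)
    fix u :: "nat ^ 'd \<Rightarrow> complex" assume u: "u \<in> s_carrier \<alpha> a"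
    show "lag_synthesis u \<in> G_step_space \<alpha> A"
      unfolding G_step_space_def using lag_synthesis_schwartz[OF \<alpha> a u] quot[OF u]
      by (auto intro!: bdd_aboveI[of _ "s_norm \<alpha> a u * S"])
    fix j
    let ?I = "{(p :: nat ^ 'd, k :: nat ^ 'd). mi_abs p \<le> j \<and> mi_abs k \<le> j}"
    have "(SUP (p, k). G_quotient \<alpha> A (lag_synthesis u) p k) \<le> s_norm \<alpha> a u * S"
      by (rule cSUP_least) (auto intro: quot[OF u])
    moreover have "(SUP (p, k)\<in>?I. sup_seminorm p k (lag_synthesis u)) \<le> s_norm \<alpha> a u * (\<Sum>(p, k)\<in>?I. \<bar>lag_bound_sum \<alpha> a (($) p) k\<bar>)"
    proof (rule cSUP_least[OF sup_index_nonempty])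
      fix pk assume pk: "pk \<in> ?I"
      obtain p k where e: "pk = (p, k)" by (cases pk)
      have "sup_seminorm p k (lag_synthesis u) \<le> s_norm \<alpha> a u * lag_bound_sum \<alpha> a (($) p) k"
        by (rule sup_seminorm_lag_synthesis[OF \<alpha> a u])
      also have "\<dots> \<le> s_norm \<alpha> a u * (\<Sum>(p, k)\<in>?I. \<bar>lag_bound_sum \<alpha> a (($) p) k\<bar>)"
      proof (intro mult_left_mono s_norm_nonneg[OF a u])
        have "(case pk of (p, k) \<Rightarrow> \<bar>lag_bound_sum \<alpha> a (($) p) k\<bar>) \<le> (\<Sum>(p, k)\<in>?I. \<bar>lag_bound_sum \<alpha> a (($) p) k\<bar>)"
          by (rule member_le_sum[OF pk _ finite_pairs_mi_abs]) auto
        then show "lag_bound_sum \<alpha> a (($) p) k \<le> (\<Sum>(p, k)\<in>?I. \<bar>lag_bound_sum \<alpha> a (($) p) k\<bar>)"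
          unfolding e by simp
      qed
      finally show "(case pk of (p, k) \<Rightarrow> sup_seminorm p k (lag_synthesis u)) \<le>
          s_norm \<alpha> a u * (\<Sum>(p, k)\<in>?I. \<bar>lag_bound_sum \<alpha> a (($) p) k\<bar>)" using e by simp
    qed
    ultimately show "G_seminorm \<alpha> A j (lag_synthesis u) \<le> C j * s_norm \<alpha> a u"
      unfolding G_seminorm_eq C_def by (simp add: algebra_simps)
  qed
qed

section \<open>Decay of Laguerre coefficients\<close>

definition lag_coeff :: "(real ^ 'd::finite \<Rightarrow> complex) \<Rightarrow> nat ^ 'd \<Rightarrow> complex" where
  "lag_coeff f n = (LINT t:orthant|lborel. laguerre_fun n t * f t)"

section \<open>Derivatives in a single direction\<close>

definition unit_mi :: "'d::finite \<Rightarrow> nat \<Rightarrow> nat ^ 'd" where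
  "unit_mi l r = (\<chi> m. if m = l then r else 0)"

text \<open>For a multi-index supported at one coordinate only one list has the right counts, so the
  choice in \<open>mi_deriv\<close> is determined.\<close>

lemma list_eq_replicate_if_counts:
  assumes "\<forall>m. count_list ls m = unit_mi l r $ m"
  shows "ls = replicate r l"
proof -
  have "m = l" if "m \<in> set ls" for m
  proof (rule ccontr)
    assume "m \<noteq> l"
    then have "count_list ls m = 0" using assms by (simp add: unit_mi_def)
    then show False using that by (simp add: count_list_0_iff)
  qed
  then have eq: "ls = replicate (length ls) l" by (intro replicate_eqI) auto
  have "count_list (replicate k l) l = k" for k by (induction k) auto
  from this[of "length ls"] have "count_list ls l = length ls" unfolding eq[symmetric] .
  then have "length ls = r" using assms by (simp add: unit_mi_def)
  then show ?thesis using eq by simp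
qed

lemma mi_deriv_unit_mi: "mi_deriv (unit_mi l r) f = partials (replicate r l) f"
proof -
  have "(SOME ls. \<forall>m. count_list ls m = unit_mi l r $ m) = replicate r l"
    using someI_ex[OF ex_list_with_counts[of "unit_mi l r"]] by (rule list_eq_replicate_if_counts)
  then show ?thesis unfolding mi_deriv_def by simp
qed

lemma square_integrable_cong:
  assumes "\<And>t. t \<in> orthant \<Longrightarrow> g t = h t"
  shows "square_integrable g \<longleftrightarrow> square_integrable h"
  unfolding square_integrable_def using assms
  by (intro conj_cong continuous_on_cong set_integrable_cong refl) auto

lemma mi_abs_unit_mi: "r \<le> m \<Longrightarrow> mi_abs (unit_mi l r + unit_mi l (m - r)) = m"
  unfolding mi_abs_def unit_mi_def by (simp add: sum.distrib sum.delta)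

lemma mi_self_powr_unit_mi: "mi_self_powr \<beta> (unit_mi l r) = self_powr \<beta> r"
proof -
  have "mi_self_powr \<beta> (unit_mi l r) = (\<Prod>m\<in>UNIV. if m = l then self_powr \<beta> r else 1)"
    unfolding mi_self_powr_eq by (intro prod.cong refl) (auto simp: unit_mi_def self_powr_def)
  then show ?thesis by (simp add: prod.delta)
qed

text \<open>Both bases are replaced by \<open>m\<close>. The denominators belonging to
  \<open>p = r\<close> and \<open>k = m - r\<close> are thereby merged into a bound that depends on
  \<open>m\<close> alone.\<close>

lemma self_powr_mult_le:
  assumes "r \<le> m" "0 \<le> \<beta>"
  shows "self_powr \<beta> (m - r) * self_powr \<beta> r \<le> self_powr \<beta> m"
proof -
  have "real (m - r) ^ (m - r) * real r ^ r \<le> real m ^ (m - r) * real m ^ r"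
    using assms by (intro mult_mono power_mono) auto
  also have "\<dots> = real m ^ m" using assms by (simp flip: power_add)
  finally have "(real (m - r) ^ (m - r) * real r ^ r) powr \<beta> \<le> (real m ^ m) powr \<beta>"
    using assms by (intro powr_mono2) auto
  then show ?thesis unfolding self_powr_eq by (simp add: powr_mult)
qed

text \<open>The second bound concerns parameter \<open>i + 1\<close> with only \<open>t ^ i\<close>.
  It is what is left of the factor \<open>t ^ Suc i * dlag 0 (Suc i) j t\<close> after splitting off
  one \<open>t\<close>, and shows that this factor vanishes both at 0 and at infinity.\<close>

lemma lag_weight_bounds:
  obtains B where "0 \<le> B" "\<And>t. 0 \<le> t \<Longrightarrow> \<bar>t ^ i * dlag 0 i j t\<bar> \<le> B"
    "\<And>t. 0 \<le> t \<Longrightarrow> \<bar>t ^ i * dlag 0 (Suc i) j t\<bar> \<le> B / (1 + t)\<^sup>2"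
proof -
  define b where "b k i' = (4 * real (j + k + 1)) ^ (k + 1 + i' + 0)" for k i'
  have b: "t ^ k * \<bar>dlag 0 i' j t\<bar> \<le> b k i'" "0 \<le> b k i'" if "0 \<le> t" for t k i'
    using power_abs_dlag_le[OF that, of k 0 i' j] unfolding b_def by auto
  \<comment> \<open>The last three terms come from expanding \<open>(1 + t)\<^sup>2\<close>.\<close>
  define B where "B = b i i + (b i (Suc i) + 2 * b (Suc i) (Suc i) + b (Suc (Suc i)) (Suc i))"
  show thesis
  proof (rule that[of B])
    show "0 \<le> B" unfolding B_def using b(2)[of 0] by auto
    fix t :: real assume t: "0 \<le> t"
    have "\<bar>t ^ i * dlag 0 i j t\<bar> = t ^ i * \<bar>dlag 0 i j t\<bar>" using t by (simp add: abs_mult)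
    also have "\<dots> \<le> b i i" by (rule b(1)[OF t])
    also have "\<dots> \<le> B" unfolding B_def using b(2)[of 0] by auto
    finally show "\<bar>t ^ i * dlag 0 i j t\<bar> \<le> B" .
    have "\<bar>t ^ i * dlag 0 (Suc i) j t\<bar> * (1 + t)\<^sup>2 =
        t ^ i * \<bar>dlag 0 (Suc i) j t\<bar> + 2 * (t ^ Suc i * \<bar>dlag 0 (Suc i) j t\<bar>) + t ^ Suc (Suc i) * \<bar>dlag 0 (Suc i) j t\<bar>"
      using t by (simp add: abs_mult power2_eq_square algebra_simps)
    also have "\<dots> \<le> B"
      using b(1)[OF t, of i "Suc i"] b(1)[OF t, of "Suc i" "Suc i"] b(1)[OF t, of "Suc (Suc i)" "Suc i"] b(2)[of 0 i i]
      unfolding B_def by linarith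
    finally show "\<bar>t ^ i * dlag 0 (Suc i) j t\<bar> \<le> B / (1 + t)\<^sup>2" using t by (simp add: pos_le_divide_eq)
  qed
qed

section \<open>Repeated integration by parts in one coordinate\<close>

definition lag_rest :: "'d::finite \<Rightarrow> nat ^ 'd \<Rightarrow> real ^ 'd \<Rightarrow> real" where
  "lag_rest l n x = (\<Prod>m\<in>UNIV - {l}. dlag 0 0 (n $ m) (x $ m))"

lemma lag_rest_bounded:
  fixes l :: "'d::finite"
  obtains B where "0 \<le> B" "\<And>x. x \<in> orthant \<Longrightarrow> \<bar>lag_rest l n x\<bar> \<le> B"
proof
  show "0 \<le> (\<Prod>m\<in>UNIV - {l}. real (n $ m) + 2)" by (intro prod_nonneg) auto
  fix x :: "real ^ 'd" assume "x \<in> orthant"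
  then show "\<bar>lag_rest l n x\<bar> \<le> (\<Prod>m\<in>UNIV - {l}. real (n $ m) + 2)"
    unfolding lag_rest_def abs_prod by (intro prod_mono conjI abs_dlag_0_0_le) (auto simp: orthant_def less_imp_le)
qed

lemma continuous_on_lag_rest: "continuous_on S (lag_rest l n)"
  unfolding lag_rest_def[abs_def]
  by (intro continuous_on_prod continuous_on_compose2[OF continuous_on_dlag[of UNIV]] continuous_intros) auto

lemma continuous_on_dlag_coord: "continuous_on S (\<lambda>x :: real ^ 'd::finite. dlag p i j (x $ l))"
  by (intro continuous_on_compose2[OF continuous_on_dlag[of UNIV]] continuous_intros) auto

text \<open>\<open>half_shift_deriv f l i r\<close> is \<open>\<partial>^r (\<partial> + 1/2)^i f\<close>, with \<open>\<partial>\<close> the derivative in the direction \<open>l\<close>.\<close>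

primrec half_shift_deriv :: "(real ^ 'd::finite \<Rightarrow> complex) \<Rightarrow> 'd \<Rightarrow> nat \<Rightarrow> nat \<Rightarrow> real ^ 'd \<Rightarrow> complex" where
  "half_shift_deriv f l 0 r t = mi_deriv (unit_mi l r) f t"
| "half_shift_deriv f l (Suc i) r t = half_shift_deriv f l i (Suc r) t + 1 / 2 * half_shift_deriv f l i r t"

context
  fixes f :: "real ^ 'd::finite \<Rightarrow> complex" and l :: 'd
  assumes f: "f \<in> schwartz_orthant"
begin

lemma half_shift_deriv_continuous: "continuous_on orthant (half_shift_deriv f l i r)"
proof (induction i arbitrary: r)
  case 0
  have "half_shift_deriv f l 0 r = mi_deriv (unit_mi l r) f" by (simp add: fun_eq_iff)
  then show ?case using continuous_on_mi_deriv[OF schwartz_orthantD(2)[OF f]] by simp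
next
  case (Suc i)
  have "half_shift_deriv f l (Suc i) r = (\<lambda>t. half_shift_deriv f l i (Suc r) t + 1 / 2 * half_shift_deriv f l i r t)"
    by (simp add: fun_eq_iff)
  then show ?case by (simp only:) (intro continuous_intros Suc.IH)
qed

lemma half_shift_deriv_deriv:
  assumes x: "x \<in> orthant"
  shows "((\<lambda>s. half_shift_deriv f l i r (x + s *\<^sub>R axis l 1)) has_vector_derivative half_shift_deriv f l i (Suc r) x) (at 0)"
proof (induction i arbitrary: r)
  case 0
  then show ?case
    using smooth_onD(2)[OF schwartz_orthantD(2)[OF f] x, of "replicate r l" l]
    by (simp add: mi_deriv_unit_mi has_partial_at_iff)
next
  case (Suc i)
  show ?case
    unfolding half_shift_deriv.simps
    by (intro has_vector_derivative_add bounded_linear.has_vector_derivative[OF bounded_linear_mult_right] Suc.IH)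
qed

lemma half_shift_deriv_decay:
  obtains C where "0 \<le> C" "\<And>x. x \<in> orthant \<Longrightarrow> cmod (half_shift_deriv f l i r x) \<le> C * decay x"
proof -
  have "\<exists>C\<ge>0. \<forall>x\<in>orthant. cmod (half_shift_deriv f l i r x) \<le> C * decay x"
  proof (induction i arbitrary: r)
    case 0
    obtain C where C: "0 \<le> C" "\<And>x. x \<in> orthant \<Longrightarrow> cmod (mi_deriv (unit_mi l r) f x) * (\<Prod>l\<in>UNIV. (1 + x $ l) ^ 2) \<le> C"
      using schwartz_orthant_decay[OF f] by blast
    have "cmod (mi_deriv (unit_mi l r) f x) \<le> C * decay x" if x: "x \<in> orthant" for x
    proof -
      have "0 < 1 + x $ m" for m using x by (simp add: orthant_def add_pos_pos)
      then have "0 < (\<Prod>l\<in>UNIV. (1 + x $ l) ^ 2)" by (intro prod_pos zero_less_power)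
      moreover have "decay x = 1 / (\<Prod>l\<in>UNIV. (1 + x $ l) ^ 2)" unfolding decay_def by (simp add: prod_dividef)
      ultimately show ?thesis using C(2)[OF x] by (simp add: field_simps)
    qed
    then show ?case using C(1) by auto
  next
    case (Suc i)
    obtain C D where C: "0 \<le> C" "\<And>x. x \<in> orthant \<Longrightarrow> cmod (half_shift_deriv f l i (Suc r) x) \<le> C * decay x"
      and D: "0 \<le> D" "\<And>x. x \<in> orthant \<Longrightarrow> cmod (half_shift_deriv f l i r x) \<le> D * decay x"
      using Suc.IH by meson
    have "cmod (half_shift_deriv f l (Suc i) r x) \<le> (C + D) * decay x" if x: "x \<in> orthant" for x
    proof -
      have "cmod (half_shift_deriv f l (Suc i) r x) \<le> cmod (half_shift_deriv f l i (Suc r) x) + 1 / 2 * cmod (half_shift_deriv f l i r x)"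
        unfolding half_shift_deriv.simps by (rule order_trans[OF norm_triangle_ineq]) (simp add: norm_mult)
      also have "\<dots> \<le> C * decay x + D * decay x"
        using C(2)[OF x] D(2)[OF x] norm_ge_zero[of "half_shift_deriv f l i r x"] by linarith
      finally show ?thesis by (simp add: distrib_right)
    qed
    then show ?case using C(1) D(1) by (intro exI[of _ "C + D"]) auto
  qed
  then show thesis using that by blast
qed

definition weighted_half_shift :: "nat \<Rightarrow> nat \<Rightarrow> nat \<Rightarrow> real ^ 'd \<Rightarrow> complex" where
  "weighted_half_shift m i r t = complex_of_real ((t $ l) powr (real m / 2)) * half_shift_deriv f l i r t"

lemma weighted_half_shift_0:
  assumes "r \<le> m" "t \<in> orthant"
  shows "weighted_half_shift m 0 r t = weighted_deriv (unit_mi l r) (unit_mi l (m - r)) f t"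
proof -
  have "mi_powr t (\<chi> k. real ((unit_mi l r + unit_mi l (m - r)) $ k) / 2) =
      (\<Prod>k\<in>UNIV. if k = l then (t $ l) powr (real m / 2) else 1)"
    unfolding mi_powr_def using assms by (intro prod.cong refl) (auto simp: unit_mi_def orthant_def, metis less_irrefl)
  then show ?thesis unfolding weighted_half_shift_def weighted_deriv_def by (simp add: prod.delta)
qed

text \<open>Each factor \<open>\<partial> + 1/2\<close> costs at most \<open>1 + 1/2\<close>. The
  weight stays at \<open>t_l^(m/2)\<close> throughout while derivatives of all orders
  \<open>r\<close> from 0 to \<open>m\<close> occur; \<open>G_quotient\<close> with
  \<open>p = r\<close> and \<open>k = m - r\<close> in coordinate \<open>l\<close> has precisely
  this weight.\<close>

lemma weighted_half_shift_bound:
  assumes A: "0 < A" and \<alpha>: "0 \<le> \<alpha>" and Q: "\<And>p k. G_quotient \<alpha> A f p k \<le> Q" and m: "i + r \<le> m"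
  shows "square_integrable (weighted_half_shift m i r) \<and>
    L2_norm_orthant (weighted_half_shift m i r) \<le> (3 / 2) ^ i * (Q * A ^ m * self_powr (\<alpha> / 2) m)"
  using m
proof (induction i arbitrary: r)
  case 0
  then have r: "r \<le> m" by simp
  let ?p = "unit_mi l r" and ?k = "unit_mi l (m - r)"
  have den: "0 < G_denominator \<alpha> A ?p ?k" by (rule G_denominator_pos[OF A])
  have "0 \<le> G_quotient \<alpha> A f ?p ?k" unfolding G_quotient_eq using den by (simp add: L2_norm_orthant_nonneg)
  then have Q0: "0 \<le> Q" using Q[of ?p ?k] by linarith
  have "L2_norm_orthant (weighted_deriv ?p ?k f) \<le> Q * G_denominator \<alpha> A ?p ?k"
    using Q[of ?p ?k] den unfolding G_quotient_eq by (simp add: pos_divide_le_eq)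
  also have "\<dots> \<le> Q * (A ^ m * self_powr (\<alpha> / 2) m)"
    unfolding G_denominator_def mi_abs_unit_mi[OF r] mi_self_powr_unit_mi mult.assoc
    using self_powr_mult_le[OF r, of "\<alpha> / 2"] \<alpha> Q0 A by (intro mult_left_mono) auto
  finally have "L2_norm_orthant (weighted_deriv ?p ?k f) \<le> Q * A ^ m * self_powr (\<alpha> / 2) m" by (simp add: mult.assoc)
  then show ?case
    using L2_norm_orthant_cong[of "weighted_half_shift m 0 r", OF weighted_half_shift_0[OF r]]
      square_integrable_cong[of "weighted_half_shift m 0 r", OF weighted_half_shift_0[OF r]]
      weighted_deriv_square_integrable[OF f] by simp
next
  case (Suc i)
  let ?B = "Q * A ^ m * self_powr (\<alpha> / 2) m"
  have eq: "weighted_half_shift m (Suc i) r = (\<lambda>t. weighted_half_shift m i (Suc r) t + 1 / 2 * weighted_half_shift m i r t)"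
    by (auto simp: weighted_half_shift_def algebra_simps)
  have 1: "square_integrable (weighted_half_shift m i (Suc r))" "L2_norm_orthant (weighted_half_shift m i (Suc r)) \<le> (3 / 2) ^ i * ?B"
    and 2: "square_integrable (weighted_half_shift m i r)" "L2_norm_orthant (weighted_half_shift m i r) \<le> (3 / 2) ^ i * ?B"
    using Suc.IH[of "Suc r"] Suc.IH[of r] Suc.prems by auto
  note sc = square_integrable_scale[OF 2(1), of "1 / 2"]
  have "L2_norm_orthant (\<lambda>t. weighted_half_shift m i (Suc r) t + 1 / 2 * weighted_half_shift m i r t) \<le>
      L2_norm_orthant (weighted_half_shift m i (Suc r)) + 1 / 2 * L2_norm_orthant (weighted_half_shift m i r)"
    using L2_norm_orthant_triangle(2)[OF 1(1) sc] L2_norm_orthant_scale[of "1 / 2" "weighted_half_shift m i r"] by simp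
  also have "\<dots> \<le> (3 / 2) ^ i * ?B + 1 / 2 * ((3 / 2) ^ i * ?B)" using 1(2) 2(2) by linarith
  also have "\<dots> = (3 / 2) ^ Suc i * ?B" by simp
  finally show ?case unfolding eq using L2_norm_orthant_triangle(1)[OF 1(1) sc] by blast
qed

text \<open>The integrand reached after \<open>i\<close> integrations by parts: weight exponent and
  parameter in coordinate \<open>l\<close> have gone up by \<open>i\<close>, the degree down by
  \<open>i\<close>.\<close>

definition lag_pairing :: "nat ^ 'd \<Rightarrow> nat \<Rightarrow> real ^ 'd \<Rightarrow> complex" where
  "lag_pairing n i x = half_shift_deriv f l i 0 x *
    complex_of_real ((x $ l) ^ i * dlag 0 i (n $ l - i) (x $ l) * lag_rest l n x)"

lemma lag_pairing_integrable: "set_integrable lborel orthant (lag_pairing n i)"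
proof -
  obtain C where C: "0 \<le> C" "\<And>x. x \<in> orthant \<Longrightarrow> cmod (half_shift_deriv f l i 0 x) \<le> C * decay x"
    using half_shift_deriv_decay[of i 0] by blast
  obtain B where B: "0 \<le> B" "\<And>t. 0 \<le> t \<Longrightarrow> \<bar>t ^ i * dlag 0 i (n $ l - i) t\<bar> \<le> B"
    using lag_weight_bounds by metis
  obtain D where D: "0 \<le> D" "\<And>x. x \<in> orthant \<Longrightarrow> \<bar>lag_rest l n x\<bar> \<le> D" using lag_rest_bounded by blast
  show ?thesis
  proof (rule orthant_integrable_decay[where C = "C * (B * D)"])
    show "continuous_on orthant (lag_pairing n i)"
      unfolding lag_pairing_def[abs_def]
      by (intro continuous_intros half_shift_deriv_continuous continuous_on_dlag_coord continuous_on_lag_rest)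
    fix x :: "real ^ 'd" assume x: "x \<in> orthant"
    then have xl: "0 \<le> x $ l" by (simp add: orthant_def less_imp_le)
    have "norm (lag_pairing n i x) \<le> (C * decay x) * (B * D)"
      unfolding lag_pairing_def norm_mult norm_of_real abs_mult[of _ "lag_rest l n x"]
      by (intro mult_mono C B D x xl mult_nonneg_nonneg decay_nonneg) auto
    then show "norm (lag_pairing n i x) \<le> C * (B * D) * decay x" by (simp add: mult_ac)
  qed
qed

text \<open>The product \<open>H\<close> of \<open>half_shift_deriv f l i 0\<close> with the
  weighted function \<open>W\<close> vanishes at both ends of each line, so its derivative
  \<open>H'\<close> has integral 0. The derivative of \<open>W\<close> contains
  \<open>W / 2\<close>, which joins the derivative of the other factor to form
  \<open>half_shift_deriv f l (Suc i) 0\<close>.\<close>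

lemma lag_pairing_step:
  assumes i: "Suc i \<le> n $ l"
  shows "(LINT x:orthant|lborel. lag_pairing n (Suc i) x) = - complex_of_real (real (n $ l - i)) * (LINT x:orthant|lborel. lag_pairing n i x)"
proof -
  define j where "j = n $ l - Suc i"
  have j: "n $ l - i = Suc j" "n $ l - Suc i = j" using i by (auto simp: j_def)
  define W where "W t = t ^ Suc i * dlag 0 (Suc i) j t" for t
  define W' where "W' t = 1 / 2 * W t + real (Suc j) * (t ^ i * dlag 0 i (Suc j) t)" for t
  define H where "H x = half_shift_deriv f l i 0 x * complex_of_real (W (x $ l) * lag_rest l n x)" for x
  define H' where "H' x = lag_pairing n (Suc i) x + complex_of_real (real (Suc j)) * lag_pairing n i x" for x
  have H'eq: "H' x = half_shift_deriv f l i 0 x * complex_of_real (W' (x $ l) * lag_rest l n x) +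
      half_shift_deriv f l i 1 x * complex_of_real (W (x $ l) * lag_rest l n x)" for x
    unfolding H'_def lag_pairing_def W'_def W_def j half_shift_deriv.simps One_nat_def
    by (simp add: algebra_simps)
  have rest: "lag_rest l n (x + s *\<^sub>R axis l 1) = lag_rest l n x" for x s
    unfolding lag_rest_def by (intro prod.cong refl) (simp add: axis_def)
  obtain B1 where B1: "0 \<le> B1" "\<And>t. 0 \<le> t \<Longrightarrow> \<bar>t ^ Suc i * dlag 0 (Suc i) j t\<bar> \<le> B1"
    using lag_weight_bounds by metis
  obtain B2 where B2: "0 \<le> B2" "\<And>t. 0 \<le> t \<Longrightarrow> \<bar>t ^ i * dlag 0 (Suc i) j t\<bar> \<le> B2 / (1 + t)\<^sup>2"
    using lag_weight_bounds by metis
  obtain B3 where B3: "0 \<le> B3" "\<And>t. 0 \<le> t \<Longrightarrow> \<bar>t ^ i * dlag 0 i (Suc j) t\<bar> \<le> B3"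
    using lag_weight_bounds by metis
  obtain D where D: "0 \<le> D" "\<And>x. x \<in> orthant \<Longrightarrow> \<bar>lag_rest l n x\<bar> \<le> D" using lag_rest_bounded by blast
  obtain C0 where C0: "0 \<le> C0" "\<And>x. x \<in> orthant \<Longrightarrow> cmod (half_shift_deriv f l i 0 x) \<le> C0 * decay x"
    using half_shift_deriv_decay[of i 0] by blast
  obtain C1 where C1: "0 \<le> C1" "\<And>x. x \<in> orthant \<Longrightarrow> cmod (half_shift_deriv f l i 1 x) \<le> C1 * decay x"
    using half_shift_deriv_decay[of i 1] by blast
  define B' where "B' = 1 / 2 * B1 + real (Suc j) * B3"
  have B': "0 \<le> B'" unfolding B'_def using B1 B3 by simp
  have W'b: "\<bar>W' t\<bar> \<le> B'" if t: "0 \<le> t" for t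
  proof -
    have "\<bar>W' t\<bar> \<le> \<bar>1 / 2 * W t\<bar> + \<bar>real (Suc j) * (t ^ i * dlag 0 i (Suc j) t)\<bar>" unfolding W'_def by (rule abs_triangle_ineq)
    also have "\<dots> = 1 / 2 * \<bar>W t\<bar> + real (Suc j) * \<bar>t ^ i * dlag 0 i (Suc j) t\<bar>" by (simp add: abs_mult)
    also have "\<dots> \<le> B'" unfolding B'_def W_def by (intro add_mono mult_left_mono B1 B3 t) auto
    finally show ?thesis .
  qed
  \<comment> \<open>One constant for both estimates that are required, of \<open>H'\<close> and of
    \<open>H\<close>.\<close>
  define C where "C = C0 * (B' * D) + C1 * (B1 * D) + C0 * (B2 * D)"
  have C_ge: "C0 * (B' * D) + C1 * (B1 * D) \<le> C" "C0 * (B2 * D) \<le> C"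
    unfolding C_def using C0 C1 B' B1 B2 D by auto
  have "(LINT x:orthant|lborel. H' x) = 0"
  proof (rule LINT_orthant_partial_zero[where H = H and l = l and C = C])
    fix x :: "real ^ 'd" assume x: "x \<in> orthant"
    then have xl: "0 \<le> x $ l" "0 < x $ l" by (auto simp: orthant_def less_imp_le)
    have dW: "((\<lambda>s. W (x $ l + s)) has_real_derivative W' (x $ l)) (at 0)"
    proof -
      have "((\<lambda>t. W t) has_real_derivative W' (x $ l + 0)) (at (0 + x $ l))"
        using power_dlag_has_derivative[of i j "x $ l"] unfolding W_def W'_def by simp
      then show ?thesis using DERIV_shift[of W "W' (x $ l)" 0 "x $ l"] by (simp add: add.commute)
    qed
    then have "((\<lambda>s. complex_of_real (W (x $ l + s) * lag_rest l n x)) has_vector_derivative complex_of_real (W' (x $ l) * lag_rest l n x)) (at 0)"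
      by (intro has_vector_derivative_of_real) (rule DERIV_cmult_right)
    from has_vector_derivative_mult[OF half_shift_deriv_deriv[OF x, of i 0] this]
    show "((\<lambda>s. H (x + s *\<^sub>R axis l 1)) has_vector_derivative H' x) (at 0)"
      unfolding H_def H'eq rest by (simp add: axis_def)
    have "norm (H' x) \<le> (C0 * decay x) * (B' * D) + (C1 * decay x) * (B1 * D)"
      unfolding H'eq
      by (rule order_trans[OF norm_triangle_ineq])
         (unfold norm_mult norm_of_real abs_mult[of _ "lag_rest l n x"] W_def,
          intro add_mono mult_mono C0 C1 D x xl W'b B1 mult_nonneg_nonneg decay_nonneg B'; simp)
    also have "\<dots> = (C0 * (B' * D) + C1 * (B1 * D)) * decay x" by (simp add: algebra_simps)
    also have "\<dots> \<le> C * decay x" by (intro mult_right_mono C_ge decay_nonneg)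
    finally show "norm (H' x) \<le> C * decay x" .
    have "decay x \<le> 1" unfolding decay_def using x
      by (intro prod_le_1 conjI) (auto simp: orthant_def less_imp_le divide_simps one_le_power)
    then have F1: "cmod (half_shift_deriv f l i 0 x) \<le> C0" using C0(2)[OF x] C0(1) by (meson mult_left_le order_trans)
    have W1: "\<bar>W (x $ l)\<bar> \<le> x $ l * (B2 / (1 + x $ l)\<^sup>2)"
      using mult_left_mono[OF B2(2)[OF xl(1)] xl(1)] xl unfolding W_def by (simp add: abs_mult mult_ac)
    have "norm (H x) \<le> C0 * ((x $ l * (B2 / (1 + x $ l)\<^sup>2)) * D)"
      unfolding H_def norm_mult norm_of_real abs_mult[of _ "lag_rest l n x"]
      using C0 B2 xl by (intro mult_mono F1 W1 D x) auto
    also have "\<dots> = C0 * (B2 * D) * (x $ l / (1 + x $ l)\<^sup>2)" by (simp add: mult_ac)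
    also have "\<dots> \<le> C * (x $ l / (1 + x $ l)\<^sup>2)" using xl by (intro mult_right_mono C_ge) auto
    finally show "norm (H x) \<le> C * (x $ l / (1 + x $ l)\<^sup>2)" .
  next
    show "continuous_on orthant H'"
      unfolding H'_def[abs_def] lag_pairing_def[abs_def]
      by (intro continuous_intros half_shift_deriv_continuous continuous_on_dlag_coord continuous_on_lag_rest)
  qed
  moreover have "(LINT x:orthant|lborel. H' x) = (LINT x:orthant|lborel. lag_pairing n (Suc i) x) +
      complex_of_real (real (Suc j)) * (LINT x:orthant|lborel. lag_pairing n i x)"
    unfolding H'_def by (simp only: set_integral_add set_integral_mult_right set_integrable_mult_right lag_pairing_integrable)
  ultimately have "(LINT x:orthant|lborel. lag_pairing n (Suc i) x) +
      complex_of_real (real (Suc j)) * (LINT x:orthant|lborel. lag_pairing n i x) = 0" by simp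
  then show ?thesis unfolding j by (simp only: eq_neg_iff_add_eq_0 mult_minus_left)
qed

lemma lag_pairing_0: "(LINT x:orthant|lborel. lag_pairing n 0 x) = lag_coeff f n"
  unfolding lag_coeff_def
proof (rule set_lebesgue_integral_cong)
  have "lag_prod (\<lambda>_. 0) n x = dlag 0 0 (n $ l) (x $ l) * lag_rest l n x" for x
    unfolding lag_prod_def lag_rest_def by (simp add: prod.remove[of UNIV l])
  then show "\<forall>x. x \<in> orthant \<longrightarrow> lag_pairing n 0 x = laguerre_fun n x * f x"
    by (simp add: lag_pairing_def laguerre_fun_eq mi_deriv_unit_mi mult.commute)
qed simp

lemma lag_pairing_iterate:
  assumes "m \<le> n $ l"
  shows "cmod (LINT x:orthant|lborel. lag_pairing n m x) = fact (n $ l) / fact (n $ l - m) * cmod (lag_coeff f n)"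
  using assms
proof (induction m)
  case 0
  then show ?case by (simp add: lag_pairing_0)
next
  case (Suc m)
  then have "fact (n $ l - m) = real (n $ l - m) * (fact (n $ l - Suc m) :: real)"
    by (metis Suc_diff_Suc Suc_le_lessD fact_Suc)
  moreover have "real (n $ l - m) \<noteq> 0" using Suc.prems by simp
  ultimately have e: "real (n $ l - m) * (fact (n $ l) / fact (n $ l - m)) = (fact (n $ l) / fact (n $ l - Suc m) :: real)"
    by simp
  have "cmod (LINT x:orthant|lborel. lag_pairing n (Suc m) x) = real (n $ l - m) * cmod (LINT x:orthant|lborel. lag_pairing n m x)"
    unfolding lag_pairing_step[OF Suc.prems] by (simp only: norm_mult norm_minus_cancel norm_of_real abs_of_nat)
  also have "\<dots> = real (n $ l - m) * (fact (n $ l) / fact (n $ l - m)) * cmod (lag_coeff f n)"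
    using Suc by (simp only: Suc_leD mult.assoc)
  finally show ?case unfolding e .
qed

text \<open>With \<open>N = n $ l\<close>, the \<open>m\<close> integrations by parts multiply the
  coefficient by \<open>fact N / fact (N - m)\<close>. The same number is the squared norm of the
  weighted Laguerre function \<open>g\<close> that appears in the Cauchy-Schwarz inequality, so one
  power of this norm remains as a gain.\<close>

lemma cmod_lag_coeff_le:
  assumes A: "0 < A" and \<alpha>: "0 \<le> \<alpha>" and Q: "\<And>p k. G_quotient \<alpha> A f p k \<le> Q" and m: "m \<le> n $ l"
  shows "cmod (lag_coeff f n) \<le>
    sqrt (fact (n $ l - m) / fact (n $ l)) * ((3 / 2) ^ m * (Q * A ^ m * self_powr (\<alpha> / 2) m))"
proof -
  let ?B = "(3 / 2) ^ m * (Q * A ^ m * self_powr (\<alpha> / 2) m)"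
  define g where "g x = complex_of_real ((x $ l) powr (real m / 2) * (dlag 0 m (n $ l - m) (x $ l) * lag_rest l n x))" for x :: "real ^ 'd"
  \<comment> \<open>Weight exponent and parameter, and below the degree, coordinate by coordinate;
    the norm of \<open>g\<close> becomes a product of integrals in one variable.\<close>
  define q where "q k = (if k = l then m else 0)" for k
  define j where "j k = (if k = l then n $ l - m else n $ k)" for k
  have gsq: "(cmod (g x))\<^sup>2 = (\<Prod>k\<in>UNIV. (x $ k) ^ q k * (dlag 0 (q k) (j k) (x $ k))\<^sup>2)" if x: "x \<in> orthant" for x
  proof -
    have "((x $ l) powr (real m / 2))\<^sup>2 = (x $ l) ^ m"
      using x by (simp add: orthant_def power2_eq_square powr_realpow flip: powr_add)
    moreover have "(lag_rest l n x)\<^sup>2 = (\<Prod>k\<in>UNIV - {l}. (x $ k) ^ q k * (dlag 0 (q k) (j k) (x $ k))\<^sup>2)"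
      unfolding lag_rest_def prod_power_distrib by (intro prod.cong refl) (auto simp: q_def j_def)
    ultimately show ?thesis
      unfolding g_def norm_of_real by (simp add: power_mult_distrib prod.remove[of UNIV l] q_def j_def)
  qed
  note int = dlag_square_integrable[of "q k" 0 "q k" "j k" for k]
  have gint: "set_integrable lborel orthant (\<lambda>x. (cmod (g x))\<^sup>2)"
  proof -
    have "set_integrable lborel orthant (\<lambda>x. (cmod (g x))\<^sup>2) \<longleftrightarrow>
        set_integrable lborel orthant (\<lambda>x. \<Prod>k\<in>UNIV. (x $ k) ^ q k * (dlag 0 (q k) (j k) (x $ k))\<^sup>2)"
      by (intro set_integrable_cong refl gsq)
    then show ?thesis using orthant_prod(1)[OF int] by simp
  qed
  have gs: "square_integrable g"
    unfolding square_integrable_def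
  proof
    show "continuous_on orthant g"
      unfolding g_def
      by (intro continuous_intros continuous_on_dlag_coord continuous_on_lag_rest) (auto simp: orthant_def, metis less_irrefl)
  qed (rule gint)
  have gL2: "(L2_norm_orthant g)\<^sup>2 = fact (n $ l) / fact (n $ l - m)"
  proof -
    have "(L2_norm_orthant g)\<^sup>2 = (LINT x:orthant|lborel. \<Prod>k\<in>UNIV. (x $ k) ^ q k * (dlag 0 (q k) (j k) (x $ k))\<^sup>2)"
      unfolding L2_norm_orthant_square by (rule set_lebesgue_integral_cong) (auto simp: gsq)
    also have "\<dots> = (\<Prod>k\<in>UNIV. LBINT t:{0<..}. t ^ q k * (dlag 0 (q k) (j k) t)\<^sup>2)"
      by (rule orthant_prod(2)[OF int])
    also have "\<dots> = (\<Prod>k\<in>UNIV. if k = l then fact (n $ l) / fact (n $ l - m) else 1)"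
    proof (intro prod.cong refl)
      fix k
      have "(LBINT t:{0<..}. t ^ q k * (dlag 0 (q k) (j k) t)\<^sup>2) = fact (j k + q k) / fact (j k)"
        using LBINT_dlag_0_product[of "q k" "j k" "j k"] by (simp only: power2_eq_square simp_thms if_True)
      also have "\<dots> = (if k = l then fact (n $ l) / fact (n $ l - m) else 1)" using m by (simp add: q_def j_def)
      finally show "(LBINT t:{0<..}. t ^ q k * (dlag 0 (q k) (j k) t)\<^sup>2) = (if k = l then fact (n $ l) / fact (n $ l - m) else 1)" .
    qed
    finally show ?thesis by (simp add: prod.delta)
  qed
  have ws: "square_integrable (weighted_half_shift m m 0)" "L2_norm_orthant (weighted_half_shift m m 0) \<le> ?B"
    using weighted_half_shift_bound[OF A \<alpha> Q, of m 0 m] by auto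
  have "(LINT x:orthant|lborel. lag_pairing n m x) = (LINT x:orthant|lborel. weighted_half_shift m m 0 x * g x)"
  proof (rule set_lebesgue_integral_cong)
    show "\<forall>x. x \<in> orthant \<longrightarrow> lag_pairing n m x = weighted_half_shift m m 0 x * g x"
    proof (intro allI impI)
      fix x :: "real ^ 'd" assume "x \<in> orthant"
      then have "(x $ l) ^ m = (x $ l) powr (real m / 2) * (x $ l) powr (real m / 2)"
        by (simp add: orthant_def powr_realpow flip: powr_add)
      then show "lag_pairing n m x = weighted_half_shift m m 0 x * g x"
        unfolding lag_pairing_def weighted_half_shift_def g_def by (simp add: mult_ac)
    qed
  qed simp
  then have "cmod (LINT x:orthant|lborel. lag_pairing n m x) \<le> L2_norm_orthant (weighted_half_shift m m 0) * L2_norm_orthant g"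
    using orthant_Cauchy_Schwarz(3)[OF ws(1) gs] by simp
  also have "\<dots> \<le> ?B * L2_norm_orthant g" by (intro mult_right_mono ws L2_norm_orthant_nonneg)
  finally have "fact (n $ l) / fact (n $ l - m) * cmod (lag_coeff f n) \<le> ?B * L2_norm_orthant g"
    unfolding lag_pairing_iterate[OF m] .
  then have "(L2_norm_orthant g)\<^sup>2 * cmod (lag_coeff f n) \<le> ?B * L2_norm_orthant g" unfolding gL2 .
  moreover have g0: "0 < L2_norm_orthant g"
    using gL2 L2_norm_orthant_nonneg[of g] by (cases "L2_norm_orthant g = 0") (auto simp: field_simps)
  ultimately have "L2_norm_orthant g * (L2_norm_orthant g * cmod (lag_coeff f n)) \<le> L2_norm_orthant g * ?B"
    by (simp add: power2_eq_square mult_ac)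
  then have "L2_norm_orthant g * cmod (lag_coeff f n) \<le> ?B" using g0 by (simp only: mult_le_cancel_left_pos)
  then have "cmod (lag_coeff f n) \<le> ?B / L2_norm_orthant g" using g0 by (simp add: pos_le_divide_eq mult.commute)
  also have "L2_norm_orthant g = sqrt (fact (n $ l) / fact (n $ l - m))"
    using gL2 L2_norm_orthant_nonneg[of g] by (metis real_sqrt_unique)
  also have "?B / sqrt (fact (n $ l) / fact (n $ l - m)) = sqrt (fact (n $ l - m) / fact (n $ l)) * ?B"
    by (simp add: real_sqrt_divide)
  finally show ?thesis .
qed

end

text \<open>The \<open>m\<close> factors that remain in the denominator are at least
  \<open>N / 2\<close>.\<close>

lemma fact_quotient_le:
  assumes "2 * m \<le> N" "0 < N"
  shows "fact (N - m) / fact N \<le> (2 / real N) ^ m"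
  using assms(1)
proof (induction m)
  case (Suc m)
  have f: "fact (N - m) = real (N - m) * (fact (N - Suc m) :: real)"
    using Suc.prems by (metis Suc_diff_Suc Suc_le_lessD fact_Suc le_trans mult_2 le_add1)
  have pos: "real N / 2 \<le> real (N - m)" "0 < real (N - m)" using Suc.prems assms(2) by auto
  have "fact (N - Suc m) / fact N = fact (N - m) / fact N * (1 / real (N - m))"
    unfolding f using pos by simp
  also have "\<dots> \<le> (2 / real N) ^ m * (2 / real N)"
  proof (intro mult_mono)
    show "fact (N - m) / fact N \<le> (2 / real N) ^ m" using Suc by simp
    have "1 / real (N - m) \<le> 1 / (real N / 2)" using pos assms(2) by (intro divide_left_mono) auto
    then show "1 / real (N - m) \<le> 2 / real N" by simp
  qed auto
  finally show ?case by (simp add: mult.commute)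
qed simp

text \<open>The bounds of all orders \<open>m\<close> are combined by choosing \<open>m\<close> close to \<open>c N powr (1/\<alpha>)\<close>, with \<open>c\<close> so small
  that the \<open>m\<close>-th bound is at most \<open>exp (-m)\<close>.\<close>

lemma optimise_order:
  assumes \<alpha>: "1 \<le> \<alpha>" and A: "0 < A"
  obtains c where "0 < c"
    "\<And>N Q x. 0 \<le> Q \<Longrightarrow>
      (\<And>m. m \<le> N \<Longrightarrow> x \<le> sqrt (fact (N - m) / fact N) * ((3 / 2) ^ m * (Q * A ^ m * self_powr (\<alpha> / 2) m))) \<Longrightarrow>
      x \<le> exp 1 * Q * exp (- c * real N powr (1 / \<alpha>))"
proof -
  \<comment> \<open>Chosen so that \<open>sqrt (2 / N) * (3 / 2 * A * (b * sqrt N))\<close> equals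
    \<open>exp (- 1)\<close>; this is the number whose \<open>m\<close>-th power will be
    taken.\<close>
  define b where "b = sqrt 2 / (3 * A * exp 1)"
  have b: "0 < b" using A by (simp add: b_def)
  \<comment> \<open>The bound 1/2 gives \<open>2 * m \<le> N\<close>, as
    \<open>fact_quotient_le\<close> requires, and the other one gives
    \<open>c powr (\<alpha> / 2) \<le> b\<close>.\<close>
  define c where "c = min (1 / 2) (b powr (2 / \<alpha>))"
  have c: "0 < c" "c \<le> 1 / 2" using b by (auto simp: c_def)
  have "c powr (\<alpha> / 2) \<le> (b powr (2 / \<alpha>)) powr (\<alpha> / 2)" using c \<alpha> by (intro powr_mono2) (auto simp: c_def)
  also have "\<dots> = b" using b \<alpha> by (simp add: powr_powr)
  finally have cb: "c powr (\<alpha> / 2) \<le> b" .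
  have "x \<le> exp 1 * Q * exp (- c * real N powr (1 / \<alpha>))"
    if Q: "0 \<le> Q" and x: "\<And>m. m \<le> N \<Longrightarrow> x \<le> sqrt (fact (N - m) / fact N) * ((3 / 2) ^ m * (Q * A ^ m * self_powr (\<alpha> / 2) m))"
    for N Q x
  proof (cases "N = 0")
    case True
    have "x \<le> Q" using x[of 0] True by (simp add: self_powr_def)
    also have "\<dots> \<le> exp 1 * Q" using Q exp_ge_add_one_self[of "1 :: real"] mult_right_mono[of 1 "exp 1" Q] by simp
    finally show ?thesis using True by simp
  next
    case False
    then have N: "1 \<le> real N" by simp
    define y where "y = real N powr (1 / \<alpha>)"
    have y: "0 \<le> y" "y \<le> real N"
    proof -
      have "y \<le> real N powr 1" unfolding y_def using N \<alpha> by (intro powr_mono) auto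
      then show "0 \<le> y" "y \<le> real N" using N by (auto simp: y_def)
    qed
    define m where "m = nat \<lfloor>c * y\<rfloor>"
    have cy: "0 \<le> c * y" using c y by simp
    have m: "real m \<le> c * y" "c * y < real m + 1" unfolding m_def using cy by linarith+
    have "2 * real m \<le> 2 * (c * y)" using m by simp
    also have "\<dots> = (2 * c) * y" by simp
    also have "\<dots> \<le> 1 * y" using c y by (intro mult_right_mono) auto
    finally have m2: "2 * m \<le> N" using y by linarith
    have "x \<le> Q * exp (- real m)"
    proof (cases "m = 0")
      case True
      then show ?thesis using x[of 0] by (simp add: self_powr_def)
    next
      case m0: False
      define s where "s = real m powr (\<alpha> / 2)"
      have s0: "0 \<le> s" by (simp add: s_def)
      have sp: "self_powr (\<alpha> / 2) m = s ^ m"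
        using m0 by (simp add: self_powr_def s_def powr_powr flip: powr_realpow)
      have "s \<le> (c * y) powr (\<alpha> / 2)" unfolding s_def using m \<alpha> by (intro powr_mono2) auto
      also have "\<dots> = c powr (\<alpha> / 2) * y powr (\<alpha> / 2)" using c y by (simp add: powr_mult)
      also have "y powr (\<alpha> / 2) = sqrt (real N)"
        unfolding y_def using \<alpha> N by (simp add: powr_powr powr_half_sqrt)
      also have "c powr (\<alpha> / 2) * sqrt (real N) \<le> b * sqrt (real N)" using cb by (intro mult_right_mono) auto
      finally have s: "s \<le> b * sqrt (real N)" .
      have "sqrt (2 / real N) * (3 / 2 * A * s) \<le> sqrt (2 / real N) * (3 / 2 * A * (b * sqrt (real N)))"
        using s A N by (intro mult_left_mono) auto
      also have "\<dots> = exp (- 1)"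
        using N A by (simp add: b_def real_sqrt_divide exp_minus field_simps)
      finally have base: "sqrt (2 / real N) * (3 / 2 * A * s) \<le> exp (- 1)" .
      have "x \<le> sqrt (fact (N - m) / fact N) * ((3 / 2) ^ m * (Q * A ^ m * s ^ m))"
        using x[of m] m2 unfolding sp by simp
      also have "\<dots> \<le> sqrt ((2 / real N) ^ m) * ((3 / 2) ^ m * (Q * A ^ m * s ^ m))"
        using fact_quotient_le[OF m2] N Q A s0 by (intro mult_right_mono) auto
      also have "\<dots> = Q * (sqrt (2 / real N) * (3 / 2 * A * s)) ^ m"
        by (simp only: real_sqrt_power power_mult_distrib mult_ac)
      also have "\<dots> \<le> Q * exp (- 1) ^ m"
        using base A s0 Q by (intro mult_left_mono power_mono) auto
      also have "exp (- 1) ^ m = exp (- real m)" by (simp flip: exp_of_nat_mult)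
      finally show ?thesis .
    qed
    \<comment> \<open>Rounding \<open>c * y\<close> down to the integer \<open>m\<close> loses at
      most the factor \<open>exp 1\<close>.\<close>
    also have "\<dots> \<le> Q * exp (1 - c * y)" using m Q by (intro mult_left_mono) auto
    also have "\<dots> = exp 1 * Q * exp (- c * y)" by (simp add: exp_diff exp_minus field_simps)
    finally show ?thesis unfolding y_def .
  qed
  then show thesis using that c(1) by blast
qed

lemma lag_coeff_bound:
  assumes \<alpha>: "1 \<le> \<alpha>" and A: "0 < A"
  obtains a C where "1 < a" "0 \<le> C"
    "\<And>(f :: real ^ 'd::finite \<Rightarrow> complex) n. f \<in> G_step_space \<alpha> A \<Longrightarrow>
      cmod (lag_coeff f n) * s_weight \<alpha> a n \<le> C * (SUP (p, k). G_quotient \<alpha> A f p k)"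
proof -
  obtain c where c: "0 < c" and opt: "\<And>N Q x. 0 \<le> Q \<Longrightarrow>
      (\<And>m. m \<le> N \<Longrightarrow> x \<le> sqrt (fact (N - m) / fact N) * ((3 / 2) ^ m * (Q * A ^ m * self_powr (\<alpha> / 2) m))) \<Longrightarrow>
      x \<le> exp 1 * Q * exp (- c * real N powr (1 / \<alpha>))"
    by (rule optimise_order[OF \<alpha> A]) blast
  \<comment> \<open>The division pays for \<open>mi_abs n \<le> CARD('d) * n $ l\<close> at a
    maximal coordinate, since \<open>CARD('d) powr (1 / \<alpha>) \<le> CARD('d)\<close>.\<close>
  define a where "a = exp (c / CARD('d))"
  show thesis
  proof (rule that[of a "exp 1"])
    show "1 < a" using c by (simp add: a_def)
    fix f :: "real ^ 'd \<Rightarrow> complex" and n :: "nat ^ 'd" assume f: "f \<in> G_step_space \<alpha> A"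
    have fs: "f \<in> schwartz_orthant" using f G_step_space_schwartz by blast
    define Q where "Q = (SUP (p, k). G_quotient \<alpha> A f p k)"
    have Q: "0 \<le> Q" unfolding Q_def by (rule seminorm_onD(1)[OF seminorm_on_G_SUPs(1)[OF A] f])
    have "Max (range (($) n)) \<in> range (($) n)" by (rule Max_in) auto
    then obtain l where l: "Max (range (($) n)) = n $ l" by (rule rangeE)
    have nl: "n $ m \<le> n $ l" for m unfolding l[symmetric] by (intro Max_ge) auto
    have le: "cmod (lag_coeff f n) \<le> exp 1 * Q * exp (- c * real (n $ l) powr (1 / \<alpha>))"
    proof (rule opt[OF Q])
      fix m assume m: "m \<le> n $ l"
      show "cmod (lag_coeff f n) \<le>
          sqrt (fact (n $ l - m) / fact (n $ l)) * ((3 / 2) ^ m * (Q * A ^ m * self_powr (\<alpha> / 2) m))"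
        using \<alpha> by (intro cmod_lag_coeff_le[OF fs A _ _ m]) (auto simp: Q_def intro: G_quotient_le_SUP[OF f])
    qed
    have "mi_abs n \<le> (\<Sum>m\<in>(UNIV :: 'd set). n $ l)" unfolding mi_abs_def by (intro sum_mono nl)
    then have "real (mi_abs n) \<le> real (CARD('d) * n $ l)" unfolding of_nat_le_iff by simp
    then have "real (mi_abs n) powr (1 / \<alpha>) \<le> (real CARD('d) * real (n $ l)) powr (1 / \<alpha>)"
      using \<alpha> by (intro powr_mono2) auto
    also have "\<dots> = real CARD('d) powr (1 / \<alpha>) * real (n $ l) powr (1 / \<alpha>)" by (simp add: powr_mult)
    also have "\<dots> \<le> real CARD('d) powr 1 * real (n $ l) powr (1 / \<alpha>)"
      using \<alpha> by (intro mult_right_mono powr_mono) (auto simp: Suc_le_eq)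
    finally have "real (mi_abs n) powr (1 / \<alpha>) \<le> real CARD('d) * real (n $ l) powr (1 / \<alpha>)" by simp
    then have "c / CARD('d) * real (mi_abs n) powr (1 / \<alpha>) \<le> c / CARD('d) * (real CARD('d) * real (n $ l) powr (1 / \<alpha>))"
      using c by (intro mult_left_mono) auto
    then have w: "s_weight \<alpha> a n \<le> exp (c * real (n $ l) powr (1 / \<alpha>))"
      unfolding s_weight_def a_def by (simp add: exp_powr_real mult.commute)
    have "cmod (lag_coeff f n) * s_weight \<alpha> a n \<le>
        (exp 1 * Q * exp (- c * real (n $ l) powr (1 / \<alpha>))) * exp (c * real (n $ l) powr (1 / \<alpha>))"
      using Q by (intro mult_mono le w) (auto simp: s_weight_nonneg)
    also have "\<dots> = exp 1 * Q" by (simp add: mult.assoc flip: exp_add)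
    finally show "cmod (lag_coeff f n) * s_weight \<alpha> a n \<le> exp 1 * (SUP (p, k). G_quotient \<alpha> A f p k)" unfolding Q_def .
  qed simp
qed

section \<open>Completeness of the Laguerre functions\<close>

lemma lag_synthesis_unit_seq: "lag_synthesis (unit_seq n) = laguerre_fun n"
proof
  fix x
  have "(\<Sum>\<^sub>\<infinity>m. unit_seq n m * complex_of_real (lag_prod (\<lambda>_. 0) m x)) =
      (\<Sum>\<^sub>\<infinity>m\<in>{n}. unit_seq n m * complex_of_real (lag_prod (\<lambda>_. 0) m x))"
    by (rule infsum_cong_neutral) (auto simp: unit_seq_def)
  then show "lag_synthesis (unit_seq n) x = laguerre_fun n x"
    unfolding lag_synthesis_def lag_series_def laguerre_fun_eq by (simp add: unit_seq_def)
qed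

text \<open>A Laguerre function is the series of a unit sequence, which lies in every step; 1 and 2
  are just admissible parameters.\<close>

lemma laguerre_fun_schwartz: "laguerre_fun n \<in> schwartz_orthant"
  using lag_synthesis_schwartz[of 1 2 "unit_seq n", OF _ _ unit_seq_in_s_carrier] by (simp add: lag_synthesis_unit_seq)

lemma schwartz_orthant_integrable:
  fixes f :: "real ^ 'd::finite \<Rightarrow> complex"
  assumes f: "f \<in> schwartz_orthant"
  shows "continuous_on orthant f" "set_integrable lborel orthant f"
proof -
  have "partials [] f = f" by simp
  then show c: "continuous_on orthant f" using smooth_onD(1)[OF schwartz_orthantD(2)[OF f], of "[]"] by simp
  obtain C where C: "\<And>x. x \<in> orthant \<Longrightarrow> cmod (half_shift_deriv f undefined 0 0 x) \<le> C * decay x"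
    using half_shift_deriv_decay[OF f] by blast
  show "set_integrable lborel orthant f"
    by (rule orthant_integrable_decay[OF c]) (use C in \<open>simp add: mi_deriv_unit_mi\<close>)
qed

lemma integrable_lag_prod: "set_integrable lborel orthant (\<lambda>x. \<bar>lag_prod (\<lambda>_. 0) n x\<bar>)"
proof -
  have "set_integrable lborel orthant (\<lambda>x. norm (laguerre_fun n x))"
    by (intro set_integrable_norm schwartz_orthant_integrable(2) laguerre_fun_schwartz)
  then show ?thesis
    by (subst (asm) set_integrable_cong[OF refl refl, where f' = "\<lambda>x. \<bar>lag_prod (\<lambda>_. 0) n x\<bar>"]) (auto simp: laguerre_fun_eq)
qed

lemma lag_prod_bounded_0: "x \<in> orthant \<Longrightarrow> \<bar>lag_prod (\<lambda>_. 0) n x\<bar> \<le> lag_bound (\<lambda>_. 0) 0 n"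
  using abs_lag_prod_le closed_orthant_superset by blast

lemma lag_prod_orthonormal:
  "(LINT x:orthant|lborel. lag_prod (\<lambda>_. 0) n x * lag_prod (\<lambda>_. 0) m x) = (if n = m then 1 else 0)"
proof -
  have int: "set_integrable lborel {0<..} (\<lambda>t. dlag 0 0 (n $ l) t * dlag 0 0 (m $ l) t)" for l
    using dlag_product_integrable[of 0 0 0 "n $ l" 0 0 "m $ l"] by simp
  have "(LINT x:orthant|lborel. lag_prod (\<lambda>_. 0) n x * lag_prod (\<lambda>_. 0) m x) =
      (\<Prod>l\<in>UNIV. LBINT t:{0<..}. dlag 0 0 (n $ l) t * dlag 0 0 (m $ l) t)"
    unfolding lag_prod_def prod.distrib[symmetric] by (rule orthant_prod(2)[OF int])
  also have "\<dots> = (\<Prod>l\<in>UNIV. if n $ l = m $ l then 1 else 0)"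
  proof (intro prod.cong refl)
    fix l
    show "(LBINT t:{0<..}. dlag 0 0 (n $ l) t * dlag 0 0 (m $ l) t) = (if n $ l = m $ l then 1 else 0)"
      using LBINT_dlag_0_product[of 0 "n $ l" "m $ l"] by simp
  qed
  also have "\<dots> = (if n = m then 1 else 0)"
  proof (cases "n = m")
    case False
    then obtain l where "n $ l \<noteq> m $ l" by (auto simp: vec_eq_iff)
    then have "(\<Prod>l\<in>UNIV. if n $ l = m $ l then 1 else (0 :: real)) = 0" by (intro prod_zero bexI[of _ l]) auto
    then show ?thesis using False by simp
  qed simp
  finally show ?thesis .
qed

text \<open>A majorant in the form of a product \<open>v i * K x\<close> gives the absolute
  convergence at every point and that of the integrals at the same time.\<close>

lemma integral_suminf_dominated:
  fixes g :: "nat \<Rightarrow> 'a \<Rightarrow> 'b::{banach, second_countable_topology}"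
  assumes K: "integrable M K" and g: "\<And>i. g i \<in> borel_measurable M"
    and le: "\<And>i x. norm (g i x) \<le> v i * K x" and v: "summable v"
  shows "integral\<^sup>L M (\<lambda>x. suminf (\<lambda>i. g i x)) = suminf (\<lambda>i. integral\<^sup>L M (g i))"
proof -
  have gi: "integrable M (g i)" for i
    by (rule Bochner_Integration.integrable_bound[OF integrable_mult_right[OF K, of "v i"] g], rule AE_I2)
       (use order_trans[OF le abs_ge_self] in simp)
  have "AE x in M. summable (\<lambda>i. norm (g i x))"
    by (intro AE_I2 summable_comparison_test'[OF summable_mult2[OF v]]) (use le in simp)
  moreover have "summable (\<lambda>i. LINT x|M. norm (g i x))"
  proof (rule summable_comparison_test'[OF summable_mult2[OF v, of "LINT x|M. K x"]])
    fix i
    have "(LINT x|M. norm (g i x)) \<le> (LINT x|M. v i * K x)"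
      by (intro integral_mono integrable_norm gi integrable_mult_right K le)
    then show "norm (LINT x|M. norm (g i x)) \<le> v i * (LINT x|M. K x)" by simp
  qed
  ultimately show ?thesis by (rule integral_suminf[OF gi])
qed

lemma lag_coeff_lag_synthesis:
  fixes u :: "nat ^ 'd::finite \<Rightarrow> complex"
  assumes \<alpha>: "1 \<le> \<alpha>" and a: "1 < a" and u: "u \<in> s_carrier \<alpha> a"
  shows "lag_coeff (lag_synthesis u) n = u n"
proof -
  let ?L = "\<lambda>m x. lag_prod (\<lambda>_. 0) m x"
  define g where "g i x = indicat_real orthant x *\<^sub>R (u (mi_enum i) * complex_of_real (?L n x * ?L (mi_enum i) x))" for i x
  define v where "v i = cmod (u (mi_enum i)) * lag_bound (\<lambda>_. 0) 0 (mi_enum i :: nat ^ 'd)" for i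
  have sv: "summable v"
    using infsum_mi_enum(2)[of "\<lambda>n. cmod (u n) * lag_bound (\<lambda>_. 0) 0 n"] s_carrier_lag_bound_summable(1)[OF \<alpha> a u, of "\<lambda>_. 0" 0]
    unfolding v_def by (auto simp: sums_iff abs_of_nonneg lag_bound_nonneg)
  have gb: "norm (g i x) \<le> v i * (indicat_real orthant x *\<^sub>R \<bar>?L n x\<bar>)" for i x
  proof (cases "x \<in> orthant")
    case True
    then have "\<bar>?L (mi_enum i) x\<bar> \<le> lag_bound (\<lambda>_. 0) 0 (mi_enum i :: nat ^ 'd)" by (rule lag_prod_bounded_0)
    then have "cmod (u (mi_enum i)) * (\<bar>?L n x\<bar> * \<bar>?L (mi_enum i) x\<bar>)
        \<le> cmod (u (mi_enum i)) * (\<bar>?L n x\<bar> * lag_bound (\<lambda>_. 0) 0 (mi_enum i :: nat ^ 'd))"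
      by (intro mult_left_mono) auto
    then show ?thesis using True by (simp add: g_def v_def norm_mult abs_mult mult_ac)
  qed (simp add: g_def)
  have gm: "g i \<in> borel_measurable lborel" for i
    unfolding g_def by (intro orthant_measurable continuous_intros continuous_on_lag_prod)
  have Li: "integrable lborel (\<lambda>x. indicat_real orthant x *\<^sub>R \<bar>?L n x\<bar>)" using integrable_lag_prod unfolding set_integrable_def .
  have gI: "(LINT x|lborel. g i x) = (if mi_enum i = n then u (mi_enum i) else 0)" for i
  proof -
    have "(LINT x|lborel. g i x) = (LINT x|lborel. u (mi_enum i) * complex_of_real (indicat_real orthant x *\<^sub>R (?L n x * ?L (mi_enum i) x)))"
      unfolding g_def by (intro Bochner_Integration.integral_cong refl) (simp add: scaleR_conv_of_real)
    also have "\<dots> = u (mi_enum i) * complex_of_real (LINT x:orthant|lborel. ?L n x * ?L (mi_enum i) x)"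
      unfolding set_lebesgue_integral_def by (simp only: integral_mult_right_zero integral_complex_of_real)
    finally show ?thesis unfolding lag_prod_orthonormal by (auto split: if_splits)
  qed
  have sums: "(\<lambda>i. u (mi_enum i) * complex_of_real (?L (mi_enum i) x)) sums lag_series (\<lambda>_. 0) u x" if "x \<in> orthant" for x
    unfolding lag_series_def
    by (rule infsum_mi_enum(2)[OF lag_series_abs_summable[OF \<alpha> a u subsetD[OF closed_orthant_superset that]]])
  have pw: "indicat_real orthant x *\<^sub>R (laguerre_fun n x * lag_synthesis u x) = (\<Sum>i. g i x)" for x
  proof (cases "x \<in> orthant")
    case True
    from sums_mult[OF sums[OF True], of "complex_of_real (?L n x)"]
    have "(\<lambda>i. g i x) sums (complex_of_real (?L n x) * lag_series (\<lambda>_. 0) u x)"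
      using True by (simp add: g_def mult_ac)
    then show ?thesis using True by (simp add: sums_iff laguerre_fun_eq lag_synthesis_def)
  qed (simp add: g_def)
  obtain j where j: "mi_enum j = n" using bij_mi_enum[where 'd = 'd] by (metis UNIV_I bij_betw_imp_surj_on imageE)
  have jj: "mi_enum i = n \<longleftrightarrow> i = j" for i
    using bij_betw_imp_inj_on[OF bij_mi_enum[where 'd = 'd]] j by (auto dest: injD)
  have "lag_coeff (lag_synthesis u) n = (LINT x|lborel. (\<Sum>i. g i x))"
    unfolding lag_coeff_def set_lebesgue_integral_def pw ..
  also have "\<dots> = (\<Sum>i. LINT x|lborel. g i x)" by (rule integral_suminf_dominated[OF Li gm gb sv])
  also have "\<dots> = (\<Sum>i. if i = j then u n else 0)" unfolding gI jj by (simp add: j cong: if_cong)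
  also have "\<dots> = u n" using sums_unique[OF sums_single[of j "\<lambda>_. u n"]] by simp
  finally show ?thesis .
qed

section \<open>Exponentials as series of Laguerre functions\<close>

lemma summable_power_poly:
  assumes "\<bar>r\<bar> < (1 :: real)"
  shows "summable (\<lambda>j. \<bar>r\<bar> ^ j * (4 * real (j + k + 1)) ^ N)"
proof -
  \<comment> \<open>The midpoint of \<open>\<bar>r\<bar>\<close> and 1 is positive also for
    \<open>r = 0\<close>, so its powers are stretched exponentials with
    \<open>\<alpha> = 1\<close>.\<close>
  define \<rho> where "\<rho> = (\<bar>r\<bar> + 1) / 2"
  have \<rho>: "0 < \<rho>" "\<rho> < 1" "\<bar>r\<bar> \<le> \<rho>" using assms by (auto simp: \<rho>_def)
  have "stretched_exp 1 (- ln \<rho>) j = \<rho> ^ j" for j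
    using \<rho> by (cases "j = 0") (auto simp: stretched_exp_def exp_of_nat_mult mult.commute[of "ln \<rho>"])
  then have "summable (\<lambda>j. \<rho> ^ j * (4 * real (j + k + 1)) ^ N)"
    using summable_stretched_exp_poly[of 1 "- ln \<rho>" k N] \<rho> by simp
  then show ?thesis
    by (rule summable_comparison_test') (use \<rho> in \<open>auto intro!: mult_right_mono power_mono\<close>)
qed

text \<open>Term by term, the generating function \<open>G\<close> satisfies \<open>G' = - (1 + r) / (2 (1 - r)) G\<close> and \<open>G 0 = 1 / (1 - r)\<close>.\<close>

lemma laguerre_generating_function:
  assumes r: "\<bar>r\<bar> < 1" and t: "0 \<le> t"
  shows "(\<lambda>j. r ^ j * dlag 0 0 j t) sums (exp (- ((1 + r) / (2 * (1 - r))) * t) / (1 - r))"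
proof -
  let ?\<kappa> = "(1 + r) / (2 * (1 - r))"
  define G where "G t = (\<Sum>j. r ^ j * dlag 0 0 j t)" for t
  have bd: "norm (r ^ j * dlag p i j t) \<le> \<bar>r\<bar> ^ j * (4 * real (j + 0 + 1)) ^ (0 + 1 + i + p)" if "0 \<le> t" for p i j t
    using power_abs_dlag_le[OF that, of 0 p i j] by (simp add: abs_mult power_abs mult_left_mono)
  have sm: "summable (\<lambda>j. r ^ j * dlag p i j t)" if "0 \<le> t" for p i t
    by (rule summable_comparison_test'[OF summable_power_poly[OF r]]) (rule bd[OF that])
  have r1: "1 - r \<noteq> 0" using r by auto
  have deriv_sum: "(\<Sum>j. r ^ j * dlag 1 0 j t) = - ?\<kappa> * G t" if t: "0 \<le> t" for t
  proof -
    \<comment> \<open>\<open>B\<close> is the generating series at parameter 1, and \<open>b\<close>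
      shifts its terms by one degree, which multiplies the sum by \<open>r\<close>. The series
      \<open>G\<close> and the differentiated series are the multiples \<open>1 - r\<close> and
      \<open>- (1 + r) / 2\<close> of \<open>B\<close>.\<close>
    define B where "B = (\<Sum>j. r ^ j * dlag 0 1 j t)"
    define b where "b j = (case j of 0 \<Rightarrow> 0 | Suc k \<Rightarrow> dlag 0 1 k t)" for j
    have sB: "(\<lambda>j. r ^ j * dlag 0 1 j t) sums B" unfolding B_def by (rule summable_sums[OF sm[OF t]])
    have "(\<lambda>j. r ^ Suc j * b (Suc j)) sums (r * B)" using sums_mult[OF sB, of r] by (simp add: b_def mult.assoc)
    then have sb: "(\<lambda>j. r ^ j * b j) sums (r * B)" by (subst (asm) sums_Suc_iff) (simp add: b_def)
    have "dlag 0 1 j t - b j = dlag 0 0 j t" for j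
    proof (cases j)
      case (Suc k)
      then show ?thesis using lag_Suc[of 0 k t] by (simp add: b_def dlag.simps right_diff_distrib)
    qed (simp add: b_def dlag.simps)
    then have "(\<lambda>j. r ^ j * dlag 0 0 j t) sums (B - r * B)"
      using sums_diff[OF sB sb] by (simp add: right_diff_distrib[symmetric])
    then have G: "G t = (1 - r) * B" unfolding G_def by (simp add: sums_iff algebra_simps)
    have "dlag 1 0 j t = - (1 / 2) * (dlag 0 1 j t + b j)" for j
      by (cases j) (simp_all add: b_def dlag.simps field_simps)
    then have "r ^ j * dlag 1 0 j t = - (1 / 2) * (r ^ j * dlag 0 1 j t + r ^ j * b j)" for j
      by (simp only: distrib_left mult.left_commute)
    then have "(\<lambda>j. r ^ j * dlag 1 0 j t) sums (- (1 / 2) * (B + r * B))"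
      using sums_mult[OF sums_add[OF sB sb], of "- (1 / 2)"] by simp
    then have "(\<Sum>j. r ^ j * dlag 1 0 j t) = - (1 / 2) * (B + r * B)" by (simp add: sums_iff)
    also have "\<dots> = - ?\<kappa> * G t" unfolding G using r1 by (simp add: field_simps)
    finally show ?thesis .
  qed
  have Gd: "(G has_real_derivative - ?\<kappa> * G s) (at s)" if s: "0 < s" for s
  proof -
    have "((\<lambda>t. \<Sum>j. r ^ j * dlag 0 0 j t) has_field_derivative (\<Sum>j. r ^ j * dlag 1 0 j s)) (at s)"
    proof (rule has_field_derivative_series'(2)[where S = "{0..}"])
      show "((\<lambda>t. r ^ n * dlag 0 0 n t) has_field_derivative r ^ n * dlag 1 0 n x) (at x within {0..})" for n x
        using has_field_derivative_at_within[OF DERIV_cmult[OF dlag_has_derivative[of 0 0 n x]]] by simp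
      show "uniformly_convergent_on {0..} (\<lambda>n x. \<Sum>i<n. r ^ i * dlag 1 0 i x)"
        by (rule Weierstrass_m_test'[OF _ summable_power_poly[OF r]]) (rule bd, simp)
      show "summable (\<lambda>n. r ^ n * dlag 0 0 n s)" by (rule sm) (use s in simp)
    qed (use s in \<open>auto simp: interior_real_atLeast\<close>)
    then show ?thesis unfolding G_def[abs_def, symmetric] using deriv_sum[of s] s by simp
  qed
  have Gc: "continuous_on {0..} G"
    unfolding G_def
  proof (rule uniform_limit_theorem)
    show "uniform_limit {0..} (\<lambda>n t. \<Sum>j<n. r ^ j * dlag 0 0 j t) (\<lambda>t. \<Sum>j. r ^ j * dlag 0 0 j t) sequentially"
      by (rule Weierstrass_m_test[OF _ summable_power_poly[OF r]]) (rule bd, simp)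
    show "\<forall>\<^sub>F n in sequentially. continuous_on {0..} (\<lambda>t. \<Sum>j<n. r ^ j * dlag 0 0 j t)"
      by (intro always_eventually allI continuous_intros continuous_on_dlag)
  qed simp
  have G0: "G 0 = 1 / (1 - r)"
  proof -
    have "lag 0 j 0 = 1" for j
      unfolding lag_def by (subst sum.remove[of _ 0]) (auto intro!: sum.neutral)
    then have "G 0 = (\<Sum>j. r ^ j)" unfolding G_def by (simp add: dlag.simps)
    then show ?thesis using suminf_geometric[of r] r by simp
  qed
  have "G t * exp (?\<kappa> * t) = G 0 * exp (?\<kappa> * 0)"
  proof (cases "t = 0")
    case False
    then have "0 < t" using t by simp
    then show ?thesis
    proof (rule DERIV_isconst2[where x = t and f = "\<lambda>t. G t * exp (?\<kappa> * t)"])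
      show "continuous_on {0..t} (\<lambda>t. G t * exp (?\<kappa> * t))"
        by (intro continuous_intros continuous_on_subset[OF Gc]) auto
      fix x assume "0 < x" "x < t"
      have "((\<lambda>t. G t * exp (?\<kappa> * t)) has_real_derivative (- ?\<kappa> * G x) * exp (?\<kappa> * x) + (exp (?\<kappa> * x) * ?\<kappa>) * G x) (at x)"
        by (intro DERIV_mult Gd \<open>0 < x\<close>) (use r1 in \<open>auto intro!: derivative_eq_intros\<close>)
      then show "((\<lambda>t. G t * exp (?\<kappa> * t)) has_real_derivative 0) (at x)" by (simp add: algebra_simps)
    qed (use t in auto)
  qed simp
  then have e: "G t * exp (?\<kappa> * t) = 1 / (1 - r)" unfolding G0 by simp
  have "G t = G t * exp (?\<kappa> * t) * exp (- ?\<kappa> * t)" by (simp add: exp_minus)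
  then have "G t = exp (- ?\<kappa> * t) / (1 - r)" unfolding e by simp
  then show ?thesis using sm[OF t, of 0 0] unfolding G_def by (simp add: sums_iff)
qed

text \<open>The number \<open>r\<close> solves \<open>(1 + r) / (2 * (1 - r)) = \<sigma>\<close>, so
  the generating function at \<open>r\<close> is a multiple of
  \<open>exp (- \<sigma> * t)\<close>.\<close>

lemma exp_laguerre_series:
  assumes "1 \<le> \<sigma>" "0 \<le> t"
  defines "r \<equiv> (2 * \<sigma> - 1) / (2 * \<sigma> + 1)"
  shows "\<bar>r\<bar> < 1" "(\<lambda>j. (1 - r) * r ^ j * dlag 0 0 j t) sums exp (- \<sigma> * t)"
proof -
  show r: "\<bar>r\<bar> < 1" using assms(1) by (simp add: r_def abs_if divide_simps)
  have e: "1 + r = 4 * \<sigma> / (2 * \<sigma> + 1)" "1 - r = 2 / (2 * \<sigma> + 1)" using assms(1) by (simp_all add: r_def field_simps)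
  have k: "(1 + r) / (2 * (1 - r)) = \<sigma>" unfolding e using assms(1) by simp
  have "1 - r \<noteq> 0" using r by auto
  then show "(\<lambda>j. (1 - r) * r ^ j * dlag 0 0 j t) sums exp (- \<sigma> * t)"
    using sums_mult[OF laguerre_generating_function[OF r assms(2)], of "1 - r"] unfolding k by (simp add: mult.assoc)
qed

section \<open>Moments in exponential coordinates, on the compact unit cube\<close>

definition exp_coord :: "real ^ 'd::finite \<Rightarrow> real ^ 'd" where
  "exp_coord x = (\<chi> l. exp (- (x $ l)))"

definition exp_moment :: "(real ^ 'd::finite \<Rightarrow> complex) \<Rightarrow> (real ^ 'd \<Rightarrow> real) \<Rightarrow> complex" where
  "exp_moment g q = (LINT x:orthant|lborel. g x * complex_of_real (q (exp_coord x)))"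

lemma exp_coord_in_box: "x \<in> orthant \<Longrightarrow> exp_coord x \<in> box 0 1"
  by (simp add: exp_coord_def orthant_def mem_box_cart)

lemma exp_coord_in_cbox: "x \<in> orthant \<Longrightarrow> exp_coord x \<in> cbox 0 1"
  using exp_coord_in_box box_subset_cbox by blast

lemma continuous_on_exp_coord: "continuous_on S exp_coord"
  unfolding exp_coord_def[abs_def] by (intro continuous_intros)

lemma continuous_on_mi_pow: "continuous_on S (\<lambda>y :: real ^ 'd::finite. mi_pow y m)"
  unfolding mi_pow_def by (intro continuous_intros)

lemma exp_moment_mult: "exp_moment g (\<lambda>y. c * q y) = complex_of_real c * exp_moment g q"
proof -
  have "exp_moment g (\<lambda>y. c * q y) = (LINT x:orthant|lborel. complex_of_real c * (g x * complex_of_real (q (exp_coord x))))"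
    unfolding exp_moment_def by (simp add: mult_ac)
  then show ?thesis unfolding exp_moment_def by (simp only: set_integral_mult_right)
qed

context
  fixes g :: "real ^ 'd::finite \<Rightarrow> complex"
  assumes g: "continuous_on orthant g" "set_integrable lborel orthant g"
begin

lemma exp_moment_integrable:
  assumes q: "continuous_on (cbox 0 1) q"
  shows "continuous_on orthant (\<lambda>x. g x * complex_of_real (q (exp_coord x)))"
    "set_integrable lborel orthant (\<lambda>x. g x * complex_of_real (q (exp_coord x)))"
proof -
  have "continuous_on orthant (\<lambda>x. q (exp_coord x))"
    by (rule continuous_on_compose2[OF q continuous_on_exp_coord]) (use exp_coord_in_cbox in blast)
  then show c: "continuous_on orthant (\<lambda>x. g x * complex_of_real (q (exp_coord x)))"
    by (intro continuous_intros g)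
  have "bounded (q ` cbox 0 1)" by (intro compact_imp_bounded compact_continuous_image q compact_cbox)
  then obtain B where B: "\<And>y. y \<in> cbox 0 1 \<Longrightarrow> \<bar>q y\<bar> \<le> B" unfolding bounded_iff by auto
  show "set_integrable lborel orthant (\<lambda>x. g x * complex_of_real (q (exp_coord x)))"
  proof (rule orthant_integrable_bound[OF c set_integrable_mult_right[OF set_integrable_norm[OF g(2)], of B]])
    fix x :: "real ^ 'd" assume "x \<in> orthant"
    then show "cmod (g x * complex_of_real (q (exp_coord x))) \<le> B * cmod (g x)"
      using mult_left_mono[OF B[OF exp_coord_in_cbox] norm_ge_zero[of "g x"]] by (simp add: norm_mult mult.commute)
  qed
qed

lemma exp_moment_add:
  assumes "continuous_on (cbox 0 1) p" "continuous_on (cbox 0 1) q"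
  shows "exp_moment g (\<lambda>y. p y + q y) = exp_moment g p + exp_moment g q"
  unfolding exp_moment_def of_real_add distrib_left
  by (rule set_integral_add(2)[OF exp_moment_integrable(2)[OF assms(1)] exp_moment_integrable(2)[OF assms(2)]])

lemma cmod_exp_moment_le:
  assumes q: "continuous_on (cbox 0 1) q" and B: "\<And>y. y \<in> cbox 0 1 \<Longrightarrow> \<bar>q y\<bar> \<le> B"
  shows "cmod (exp_moment g q) \<le> B * (LINT x:orthant|lborel. cmod (g x))"
proof -
  have "cmod (exp_moment g q) \<le> (LINT x:orthant|lborel. cmod (g x * complex_of_real (q (exp_coord x))))"
    unfolding exp_moment_def by (rule set_integral_norm_bound[OF exp_moment_integrable(2)[OF q]])
  also have "\<dots> \<le> (LINT x:orthant|lborel. B * cmod (g x))"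
  proof (rule set_integral_mono[OF set_integrable_norm[OF exp_moment_integrable(2)[OF q]] set_integrable_mult_right[OF set_integrable_norm[OF g(2)]]])
    fix x :: "real ^ 'd" assume "x \<in> orthant"
    then show "cmod (g x * complex_of_real (q (exp_coord x))) \<le> B * cmod (g x)"
      using mult_left_mono[OF B[OF exp_coord_in_cbox] norm_ge_zero[of "g x"]] by (simp add: norm_mult mult.commute)
  qed
  finally show ?thesis by simp
qed

context
  assumes zero: "\<And>n. lag_coeff g n = 0"
begin

text \<open>The Laguerre functions are replaced by exponentials one coordinate at a time, by expanding
  each exponential into Laguerre functions of one variable.\<close>

lemma mixed_moment_zero:
  assumes \<sigma>: "\<And>l. 1 \<le> \<sigma> l" and "finite S"
  shows "(LINT x:orthant|lborel. g x *
    complex_of_real (\<Prod>l\<in>UNIV. if l \<in> S then exp (- \<sigma> l * (x $ l)) else dlag 0 0 (n $ l) (x $ l))) = 0"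
  using \<open>finite S\<close>
proof (induction S arbitrary: n)
  case empty
  have "(LINT x:orthant|lborel. g x * complex_of_real (\<Prod>l\<in>UNIV. dlag 0 0 (n $ l) (x $ l))) = lag_coeff g n"
    unfolding lag_coeff_def by (rule set_lebesgue_integral_cong) (auto simp: laguerre_fun_eq lag_prod_def)
  then show ?case using zero by simp
next
  case (insert l S)
  define F where "F S n x = (\<Prod>l\<in>UNIV. if l \<in> S then exp (- \<sigma> l * (x $ l)) else dlag 0 0 (n $ l) (x $ l))"
    for S and n :: "nat ^ 'd" and x :: "real ^ 'd"
  define R where "R x = (\<Prod>k\<in>UNIV - {l}. if k \<in> S then exp (- \<sigma> k * (x $ k)) else dlag 0 0 (n $ k) (x $ k))" for x :: "real ^ 'd"
  define m where "m j = (\<chi> k. if k = l then j else n $ k)" for j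
  define r where "r = (2 * \<sigma> l - 1) / (2 * \<sigma> l + 1)"
  have r: "\<bar>r\<bar> < 1" and ser: "\<And>t. 0 \<le> t \<Longrightarrow> (\<lambda>j. (1 - r) * r ^ j * dlag 0 0 j t) sums exp (- \<sigma> l * t)"
    unfolding r_def using exp_laguerre_series[OF \<sigma>] by auto
  have F1: "F (insert l S) n x = exp (- \<sigma> l * (x $ l)) * R x" for x
    unfolding F_def R_def by (subst prod.remove[of _ l]) (auto intro!: prod.cong)
  have F2: "F S (m j) x = dlag 0 0 j (x $ l) * R x" for j x
    unfolding F_def R_def using insert.hyps
    by (subst prod.remove[of _ l], simp, simp, intro arg_cong2[of _ _ _ _ "(*)"] prod.cong) (auto simp: m_def)
  define B where "B = (\<Prod>k\<in>UNIV - {l}. real (n $ k) + 2)"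
  have B: "\<bar>R x\<bar> \<le> B" if x: "x \<in> orthant" for x
    unfolding R_def B_def abs_prod
  proof (rule prod_mono, rule conjI)
    fix k
    have x0: "0 \<le> x $ k" using x by (simp add: orthant_def less_imp_le)
    have "0 \<le> \<sigma> k * x $ k" using \<sigma>[of k] x0 by simp
    then have "exp (- \<sigma> k * x $ k) \<le> 1" by simp
    then show "\<bar>if k \<in> S then exp (- \<sigma> k * x $ k) else dlag 0 0 (n $ k) (x $ k)\<bar> \<le> real (n $ k) + 2"
      using abs_dlag_0_0_le[OF x0, of "n $ k"] by (simp del: exp_le_one_iff)
  qed simp
  define G where "G j x = indicat_real orthant x *\<^sub>R (g x * complex_of_real ((1 - r) * r ^ j * F S (m j) x))" for j x
  define v where "v j = \<bar>1 - r\<bar> * B * (\<bar>r\<bar> ^ j * (4 * real (j + 0 + 1)) ^ 1)" for j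
  have sv: "summable v" unfolding v_def by (intro summable_mult summable_power_poly r)
  have K: "integrable lborel (\<lambda>x. indicat_real orthant x *\<^sub>R cmod (g x))"
    using set_integrable_norm[OF g(2)] unfolding set_integrable_def .
  have cF: "continuous_on orthant (F T k)" for T k
    unfolding F_def[abs_def]
  proof (intro continuous_on_prod)
    fix i
    show "continuous_on orthant (\<lambda>x. if i \<in> T then exp (- \<sigma> i * x $ i) else dlag 0 0 (k $ i) (x $ i))"
      by (cases "i \<in> T") (auto intro!: continuous_intros continuous_on_compose2[OF continuous_on_dlag[of UNIV]])
  qed
  have GM: "G j \<in> borel_measurable lborel" for j
    unfolding G_def by (intro orthant_measurable continuous_intros g cF)
  have GB: "norm (G j x) \<le> v j * (indicat_real orthant x *\<^sub>R cmod (g x))" for j x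
  proof (cases "x \<in> orthant")
    case True
    then have x0: "0 \<le> x $ l" by (simp add: orthant_def less_imp_le)
    have "\<bar>dlag 0 0 j (x $ l)\<bar> * \<bar>R x\<bar> \<le> (4 * real (j + 0 + 1)) * B"
      by (rule mult_mono[OF order_trans[OF abs_dlag_0_0_le[OF x0]] B[OF True]]) auto
    then have "cmod (g x) * (\<bar>1 - r\<bar> * \<bar>r\<bar> ^ j) * (\<bar>dlag 0 0 j (x $ l)\<bar> * \<bar>R x\<bar>)
        \<le> cmod (g x) * (\<bar>1 - r\<bar> * \<bar>r\<bar> ^ j) * ((4 * real (j + 0 + 1)) * B)"
      by (intro mult_left_mono) auto
    moreover have "norm (G j x) = cmod (g x) * (\<bar>1 - r\<bar> * \<bar>r\<bar> ^ j) * (\<bar>dlag 0 0 j (x $ l)\<bar> * \<bar>R x\<bar>)"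
      unfolding G_def F2 using True by (simp only: norm_scaleR norm_mult norm_of_real abs_mult power_abs) (simp add: mult.assoc)
    ultimately show ?thesis using True by (simp add: v_def mult_ac)
  qed (simp add: G_def)
  have pw: "indicat_real orthant x *\<^sub>R (g x * complex_of_real (F (insert l S) n x)) = (\<Sum>j. G j x)" for x
  proof (cases "x \<in> orthant")
    case True
    then have "0 \<le> x $ l" by (simp add: orthant_def less_imp_le)
    from sums_mult2[OF ser[OF this], of "R x"]
    have "(\<lambda>j. (1 - r) * r ^ j * F S (m j) x) sums F (insert l S) n x" by (simp add: F1 F2 mult.assoc)
    from sums_mult[OF sums_of_real[OF this], of "g x"] show ?thesis using True by (simp add: G_def sums_iff)
  qed (simp add: G_def)
  have G0: "(LINT x|lborel. G j x) = 0" for j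
  proof -
    have "(LINT x|lborel. G j x) = (LINT x:orthant|lborel. complex_of_real ((1 - r) * r ^ j) * (g x * complex_of_real (F S (m j) x)))"
      unfolding G_def set_lebesgue_integral_def by (simp add: mult_ac)
    also have "\<dots> = complex_of_real ((1 - r) * r ^ j) * (LINT x:orthant|lborel. g x * complex_of_real (F S (m j) x))"
      by (rule set_integral_mult_right)
    also have "(LINT x:orthant|lborel. g x * complex_of_real (F S (m j) x)) = 0"
      unfolding F_def by (rule insert.IH)
    finally show ?thesis by simp
  qed
  have "(LINT x:orthant|lborel. g x * complex_of_real (F (insert l S) n x)) = (LINT x|lborel. (\<Sum>j. G j x))"
    unfolding set_lebesgue_integral_def pw ..
  also have "\<dots> = (\<Sum>j. LINT x|lborel. G j x)" by (rule integral_suminf_dominated[OF K GM GB sv])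
  finally show ?case unfolding G0 F_def by simp
qed

lemma exp_moment_mi_pow_zero:
  assumes "\<And>l. 1 \<le> m $ l"
  shows "exp_moment g (\<lambda>y. mi_pow y m) = 0"
proof -
  have "exp (- real (m $ l) * t) = exp (- t) ^ (m $ l)" for l t
    by (simp add: exp_of_nat_mult[symmetric])
  then have "exp_moment g (\<lambda>y. mi_pow y m) = (LINT x:orthant|lborel. g x *
      complex_of_real (\<Prod>l\<in>UNIV. if l \<in> UNIV then exp (- real (m $ l) * (x $ l)) else dlag 0 0 (0 $ l) (x $ l)))"
    unfolding exp_moment_def mi_pow_def exp_coord_def by simp
  also have "\<dots> = 0" by (rule mixed_moment_zero) (use assms in auto)
  finally show ?thesis .
qed

text \<open>Only monomials with all exponents at least 1 are known to have vanishing moments, hence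
  the prefactor \<open>mi_pow y 1\<close>. It is positive on the image of the orthant and does not
  hide any zero of the remaining factor.\<close>

lemma exp_moment_polynomial_zero:
  assumes "real_polynomial_function p"
  shows "exp_moment g (\<lambda>y. mi_pow y 1 * p y) = 0"
proof -
  define Z where "Z = {q. continuous_on (cbox 0 1) q \<and>
    (\<forall>m. (\<forall>l. 1 \<le> m $ l) \<longrightarrow> exp_moment g (\<lambda>y :: real ^ 'd. mi_pow y m * q y) = 0)}"
  have Zadd: "(\<lambda>y. q y + q' y) \<in> Z" if "q \<in> Z" "q' \<in> Z" for q q'
    using that unfolding Z_def
    by (auto simp: distrib_left exp_moment_add continuous_on_mult continuous_on_mi_pow intro!: continuous_intros)
  have Zmult: "(\<lambda>y. c * q y) \<in> Z" if "q \<in> Z" for c q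
    using that exp_moment_mult[of g c] unfolding Z_def
    by (auto simp: mult.left_commute intro!: continuous_intros)
  have Zsum: "(\<lambda>y. \<Sum>i\<in>I. q i y) \<in> Z" if "finite I" "\<And>i. i \<in> I \<Longrightarrow> q i \<in> Z" for I :: "'d set" and q
    using that
  proof (induction I rule: finite_induct)
    case empty
    have "exp_moment g (\<lambda>y. 0) = 0" by (simp add: exp_moment_def)
    then show ?case by (simp add: Z_def)
  qed (simp add: Zadd)
  have Zcoord: "(\<lambda>y. y $ i * q y) \<in> Z" if q: "q \<in> Z" for i q
    unfolding Z_def
  proof (intro CollectI conjI allI impI)
    show "continuous_on (cbox 0 1) (\<lambda>y. y $ i * q y)" using q unfolding Z_def by (auto intro!: continuous_intros)
    fix m :: "nat ^ 'd" assume m: "\<forall>l. 1 \<le> m $ l"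
    have "mi_pow y m * (y $ i * q y) = mi_pow y (\<chi> l. if l = i then Suc (m $ l) else m $ l) * q y" for y
      unfolding mi_pow_def by (subst (1 2) prod.remove[of _ i]) (auto simp: mult_ac intro!: prod.cong)
    moreover have "exp_moment g (\<lambda>y. mi_pow y (\<chi> l. if l = i then Suc (m $ l) else m $ l) * q y) = 0"
      using q m unfolding Z_def by auto
    ultimately show "exp_moment g (\<lambda>y. mi_pow y m * (y $ i * q y)) = 0" by (simp only:)
  qed
  have "\<forall>q\<in>Z. (\<lambda>y. p y * q y) \<in> Z"
    using assms
  proof (induction rule: real_polynomial_function.induct)
    case (linear f)
    show ?case
    proof
      fix q assume q: "q \<in> Z"
      interpret f: bounded_linear f by fact
      have f_eq: "f y = (\<Sum>i\<in>UNIV. f (axis i 1) * y $ i)" for y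
      proof -
        have "y = (\<Sum>i\<in>UNIV. y $ i *\<^sub>R axis i 1)" using basis_expansion[of y] by (simp add: scalar_mult_eq_scaleR)
        then have "f y = f (\<Sum>i\<in>UNIV. y $ i *\<^sub>R axis i 1)" by simp
        also have "\<dots> = (\<Sum>i\<in>UNIV. f (axis i 1) * y $ i)" by (simp add: f.sum f.scaleR mult.commute)
        finally show ?thesis .
      qed
      have "(\<lambda>y. f y * q y) = (\<lambda>y. \<Sum>i\<in>UNIV. f (axis i 1) * (y $ i * q y))"
        by (rule ext, subst f_eq) (simp add: sum_distrib_right mult.assoc)
      also have "\<dots> \<in> Z" by (intro Zsum Zmult Zcoord q finite)
      finally show "(\<lambda>y. f y * q y) \<in> Z" .
    qed
  next
    case (add f h)
    then show ?case by (simp add: distrib_right Zadd)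
  qed (simp_all add: Zmult mult.assoc)
  moreover have "(\<lambda>y. 1) \<in> Z" unfolding Z_def using exp_moment_mi_pow_zero by simp
  ultimately have "(\<lambda>y. p y * 1) \<in> Z" by (rule bspec)
  then show ?thesis unfolding Z_def by simp
qed

lemma exp_moment_continuous_zero:
  assumes \<psi>: "continuous_on (cbox 0 1) \<psi>"
  shows "exp_moment g (\<lambda>y. mi_pow y 1 * \<psi> y) = 0"
proof -
  define J where "J = (LINT x:orthant|lborel. cmod (g x))"
  have J: "0 \<le> J" unfolding J_def set_lebesgue_integral_def by (intro Bochner_Integration.integral_nonneg) (auto simp: indicator_def)
  have "cmod (exp_moment g (\<lambda>y. mi_pow y 1 * \<psi> y)) \<le> e" if e: "0 < e" for e
  proof -
    \<comment> \<open>One is added so that the quotient makes sense when the integral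
      \<open>J\<close> vanishes.\<close>
    have "0 < e / (J + 1)" using e J by simp
    then obtain p where p: "real_polynomial_function p" "\<And>x. x \<in> cbox 0 1 \<Longrightarrow> \<bar>\<psi> x - p x\<bar> < e / (J + 1)"
      using Stone_Weierstrass_real_polynomial_function[OF compact_cbox \<psi>] by blast
    have cp: "continuous_on (cbox 0 1) p" using p(1) by (simp add: continuous_on_polymonial_function real_polynomial_function_eq)
    have "exp_moment g (\<lambda>y. mi_pow y 1 * \<psi> y) =
        exp_moment g (\<lambda>y. mi_pow y 1 * (\<psi> y - p y)) + exp_moment g (\<lambda>y. mi_pow y 1 * p y)"
      by (subst exp_moment_add[symmetric]) (auto simp: algebra_simps intro!: continuous_intros continuous_on_mi_pow \<psi> cp)
    then have "exp_moment g (\<lambda>y. mi_pow y 1 * \<psi> y) = exp_moment g (\<lambda>y. mi_pow y 1 * (\<psi> y - p y))"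
      using exp_moment_polynomial_zero[OF p(1)] by simp
    also have "cmod \<dots> \<le> e / (J + 1) * J"
      unfolding J_def[symmetric]
    proof (rule cmod_exp_moment_le[folded J_def])
      show "continuous_on (cbox 0 1) (\<lambda>y. mi_pow y 1 * (\<psi> y - p y))"
        by (intro continuous_intros continuous_on_mi_pow \<psi> cp)
      fix y :: "real ^ 'd" assume y: "y \<in> cbox 0 1"
      have "\<bar>mi_pow y 1\<bar> \<le> 1"
        unfolding mi_pow_def abs_prod using y by (intro prod_le_1) (auto simp: mem_box_cart)
      then have "\<bar>mi_pow y 1\<bar> * \<bar>\<psi> y - p y\<bar> \<le> 1 * (e / (J + 1))"
        by (rule mult_mono) (use p(2)[OF y] in auto)
      then show "\<bar>mi_pow y 1 * (\<psi> y - p y)\<bar> \<le> e / (J + 1)" by (simp add: abs_mult)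
    qed
    also have "\<dots> \<le> e" using e J by (simp add: field_simps)
    finally show ?thesis .
  qed
  then have "cmod (exp_moment g (\<lambda>y. mi_pow y 1 * \<psi> y)) \<le> 0" by (rule field_le_epsilon) simp
  then show ?thesis by simp
qed

text \<open>If \<open>g t0 \<noteq> 0\<close>, the real part of \<open>cnj (g t0) * g\<close> is
  positive near \<open>t0\<close>. Testing against a hat function supported where this holds gives a
  nonnegative integrand with integral 0 that is positive on an open set around \<open>t0\<close>,
  which is impossible.\<close>

lemma zero_if_lag_coeff_zero:
  assumes t0: "t0 \<in> orthant"
  shows "g t0 = 0"
proof (rule ccontr)
  assume nz: "g t0 \<noteq> 0"
  define z where "z = cnj (g t0)"
  \<comment> \<open>The real part is transported to the cube, so that the neighbourhood can be
    chosen as a ball there and the hat function depends on \<open>exp_coord x\<close> alone.\<close>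
  define h where "h y = Re (z * g (\<chi> l. - ln (y $ l)))" for y
  have hE: "h (exp_coord x) = Re (z * g x)" for x
    unfolding h_def exp_coord_def by simp
  have c: "continuous_on (box 0 1) h"
  proof -
    have "continuous_on (box 0 1) (\<lambda>y :: real ^ 'd. - ln (y $ l))" for l
    proof (intro continuous_on_minus continuous_on_ln continuous_intros ballI)
      fix x :: "real ^ 'd" assume "x \<in> box 0 1"
      then have "0 < x $ l" by (simp add: mem_box_cart)
      then show "x $ l \<noteq> 0" by simp
    qed
    then have "continuous_on (box 0 1) (\<lambda>y :: real ^ 'd. \<chi> l. - ln (y $ l))" by (rule continuous_on_vec_lambda)
    moreover have "(\<lambda>y. \<chi> l. - ln (y $ l)) ` box 0 1 \<subseteq> (orthant :: (real ^ 'd) set)"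
      by (auto simp: orthant_def mem_box_cart)
    ultimately have "continuous_on (box 0 1) (\<lambda>y :: real ^ 'd. g (\<chi> l. - ln (y $ l)))"
      by (rule continuous_on_compose2[OF g(1)])
    then show ?thesis unfolding h_def by (intro continuous_on_Re continuous_on_mult continuous_on_const)
  qed
  have "0 < h (exp_coord t0)"
  proof -
    have "z * g t0 = complex_of_real ((cmod (g t0))\<^sup>2)"
      unfolding z_def by (subst mult.commute) (simp only: complex_norm_square)
    then show ?thesis using nz unfolding hE by simp
  qed
  moreover have "open (box 0 1 \<inter> h -` {0<..})" by (rule continuous_open_preimage[OF c open_box open_greaterThan])
  ultimately obtain \<delta> where \<delta>: "0 < \<delta>" "ball (exp_coord t0) \<delta> \<subseteq> box 0 1 \<inter> h -` {0<..}"
    using exp_coord_in_box[OF t0] open_contains_ball by (metis IntI greaterThan_iff vimageI)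
  \<comment> \<open>A hat function that vanishes exactly outside the ball on which \<open>h\<close>
    is positive.\<close>
  define \<psi> where "\<psi> y = max 0 (\<delta> - dist (exp_coord t0) y)" for y
  have \<psi>: "continuous_on (cbox 0 1) \<psi>" unfolding \<psi>_def by (intro continuous_intros)
  have c': "continuous_on (cbox 0 1) (\<lambda>y. mi_pow y 1 * \<psi> y)" by (intro continuous_intros continuous_on_mi_pow \<psi>)
  define q where "q x = mi_pow (exp_coord x) 1 * \<psi> (exp_coord x)" for x
  define k where "k x = indicat_real orthant x *\<^sub>R Re (z * (g x * complex_of_real (q x)))" for x
  have int: "set_integrable lborel orthant (\<lambda>x. z * (g x * complex_of_real (q x)))"
    using set_integrable_mult_right[OF exp_moment_integrable(2)[OF c'], of z] unfolding q_def by simp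
  have kk: "k x = Re (indicat_real orthant x *\<^sub>R (z * (g x * complex_of_real (q x))))" for x
    unfolding k_def by simp
  have ki: "integrable lborel k"
    unfolding kk[abs_def] by (intro integrable_Re int[unfolded set_integrable_def])
  have "(LINT x|lborel. k x) = Re (LINT x:orthant|lborel. z * (g x * complex_of_real (q x)))"
    unfolding kk[abs_def] set_lebesgue_integral_def by (rule integral_Re[OF int[unfolded set_integrable_def]])
  also have "\<dots> = Re (z * exp_moment g (\<lambda>y. mi_pow y 1 * \<psi> y))"
    unfolding exp_moment_def q_def by (simp only: set_integral_mult_right)
  finally have k0: "(LINT x|lborel. k x) = 0" using exp_moment_continuous_zero[OF \<psi>] by simp
  have mp: "0 < mi_pow (exp_coord x) 1" for x :: "real ^ 'd"
    unfolding mi_pow_def exp_coord_def by (intro prod_pos) simp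
  have k_eq: "k x = h (exp_coord x) * (mi_pow (exp_coord x) 1 * \<psi> (exp_coord x))" if "x \<in> orthant" for x
    unfolding hE using that by (simp add: k_def q_def mult.assoc[symmetric])
  have pos: "0 < h (exp_coord x)" if "dist (exp_coord t0) (exp_coord x) < \<delta>" for x
    using \<delta>(2) that by (auto simp: subset_eq)
  have kn: "0 \<le> k x" for x
  proof (cases "x \<in> orthant \<and> dist (exp_coord t0) (exp_coord x) < \<delta>")
    case True
    then show ?thesis using k_eq[of x] pos[of x] mp[of x] by (simp add: \<psi>_def)
  next
    case False
    show ?thesis
    proof (cases "x \<in> orthant")
      case True
      then have "\<psi> (exp_coord x) = 0" using False by (auto simp: \<psi>_def)
      then show ?thesis using k_eq[OF True] by simp
    qed (simp add: k_def)
  qed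
  define U where "U = {x \<in> orthant. dist (exp_coord t0) (exp_coord x) < \<delta>}"
  have "open (orthant \<inter> (\<lambda>x. dist (exp_coord t0) (exp_coord x)) -` {..<\<delta>})"
    by (rule continuous_open_preimage[OF _ open_orthant open_lessThan]) (intro continuous_intros continuous_on_exp_coord)
  then have U: "open U" unfolding U_def by (simp add: Int_def vimage_def)
  have "AE x in lborel. k x = 0" using integral_nonneg_eq_0_iff_AE[OF ki AE_I2] kn k0 by simp
  moreover have "k x \<noteq> 0" if "x \<in> U" for x
    using that k_eq[of x] pos[of x] mp[of x] by (auto simp: U_def \<psi>_def)
  ultimately have "AE x in lborel. x \<notin> U" by (auto elim!: eventually_mono)
  then have "U \<in> null_sets lborel" using U by (subst AE_iff_null_sets) auto
  then have "negligible U" unfolding negligible_iff_null_sets by (rule null_sets_completionI)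
  moreover have "t0 \<in> U" using t0 \<delta>(1) by (simp add: U_def)
  ultimately show False using open_not_negligible[OF U] by blast
qed

end

end

section \<open>Recovery of a test function from its coefficients\<close>

lemma laguerre_fun_mult_integrable:
  fixes h :: "real ^ 'd::finite \<Rightarrow> complex"
  assumes h: "h \<in> schwartz_orthant"
  shows "set_integrable lborel orthant (\<lambda>t. laguerre_fun n t * h t)"
proof (rule orthant_integrable_bound)
  show "continuous_on orthant (\<lambda>t. laguerre_fun n t * h t)"
    by (intro continuous_intros schwartz_orthant_integrable(1) laguerre_fun_schwartz h)
  show "set_integrable lborel orthant (\<lambda>t. lag_bound (\<lambda>_. 0) 0 n * norm (h t))"
    by (intro set_integrable_mult_right set_integrable_norm schwartz_orthant_integrable(2) h)
  fix x :: "real ^ 'd" assume x: "x \<in> orthant"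
  then show "norm (laguerre_fun n x * h x) \<le> lag_bound (\<lambda>_. 0) 0 n * norm (h x)"
    using lag_prod_bounded_0[OF x, of n] by (simp add: laguerre_fun_eq norm_mult mult_right_mono)
qed

lemma lag_synthesis_lag_coeff:
  fixes f :: "real ^ 'd::finite \<Rightarrow> complex"
  assumes \<alpha>: "1 \<le> \<alpha>" and a: "1 < a" and f: "f \<in> schwartz_orthant" and u: "lag_coeff f \<in> s_carrier \<alpha> a"
  shows "lag_synthesis (lag_coeff f) = f"
proof
  let ?F = "lag_synthesis (lag_coeff f)"
  have F: "?F \<in> schwartz_orthant" by (rule lag_synthesis_schwartz[OF \<alpha> a u])
  fix t
  show "?F t = f t"
  proof (cases "t \<in> orthant")
    case True
    note cF = schwartz_orthant_integrable[OF F] and cf = schwartz_orthant_integrable[OF f]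
    have "lag_coeff (\<lambda>t. f t - ?F t) n = 0" for n
    proof -
      have "lag_coeff (\<lambda>t. f t - ?F t) n = lag_coeff f n - lag_coeff ?F n"
        unfolding lag_coeff_def[of _ n] right_diff_distrib by (rule set_integral_diff(2)[OF laguerre_fun_mult_integrable[OF f] laguerre_fun_mult_integrable[OF F]])
      then show ?thesis using lag_coeff_lag_synthesis[OF \<alpha> a u, of n] by simp
    qed
    then have "f t - ?F t = 0"
      by (intro zero_if_lag_coeff_zero[OF continuous_on_diff[OF cf(1) cF(1)] set_integral_diff(1)[OF cf(2) cF(2)]] True)
    then show ?thesis by simp
  next
    case False
    then show ?thesis using schwartz_orthantD(1)[OF f] schwartz_orthantD(1)[OF F] by simp
  qed
qed

section \<open>The isomorphism of the duals\<close>

lemma linear_map_on_inverse: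
  assumes V: "function_subspace V" and h: "linear_map_on V h" "h \<in> V \<rightarrow> W" and k: "k \<in> W \<rightarrow> V"
    and kh: "\<And>f. f \<in> V \<Longrightarrow> k (h f) = f" and hk: "\<And>g. g \<in> W \<Longrightarrow> h (k g) = g"
  shows "linear_map_on W k"
  unfolding linear_map_on_def
proof (intro conjI ballI allI)
  fix u assume u: "u \<in> W"
  then have ku: "k u \<in> V" using k by blast
  show "k (\<lambda>x. u x + v x) = (\<lambda>y. k u y + k v y)" if v: "v \<in> W" for v
  proof -
    have kv: "k v \<in> V" using k v by blast
    have "h (\<lambda>y. k u y + k v y) = (\<lambda>x. u x + v x)"
      using linear_map_onD(1)[OF h(1) ku kv] hk[OF u] hk[OF v] by simp
    then show ?thesis using kh[OF function_subspaceD(2)[OF V ku kv]] by simp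
  qed
  show "k (\<lambda>x. c * u x) = (\<lambda>y. c * k u y)" for c
  proof -
    have "h (\<lambda>y. c * k u y) = (\<lambda>x. c * u x)" using linear_map_onD(2)[OF h(1) ku] hk[OF u] by simp
    then show ?thesis using kh[OF function_subspaceD(3)[OF V ku, of c]] by simp
  qed
qed

section \<open>The isomorphism of test functions and sequences\<close>

lemma linear_map_on_lag_coeff:
  "linear_map_on (schwartz_orthant :: (real ^ 'd::finite \<Rightarrow> complex) set) lag_coeff"
  unfolding linear_map_on_def
proof (intro conjI ballI allI ext)
  fix f n assume f: "f \<in> (schwartz_orthant :: (real ^ 'd \<Rightarrow> complex) set)"
  show "lag_coeff (\<lambda>x. f x + g x) n = lag_coeff f n + lag_coeff g n" if g: "g \<in> schwartz_orthant" for g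
    unfolding lag_coeff_def distrib_left
    by (rule set_integral_add(2)[OF laguerre_fun_mult_integrable[OF f] laguerre_fun_mult_integrable[OF g]])
  show "lag_coeff (\<lambda>x. c * f x) n = c * lag_coeff f n" for c
    unfolding lag_coeff_def by (simp only: mult.left_commute[of _ c] set_integral_mult_right)
qed

lemma G_union_schwartz: "f \<in> G_union \<alpha> \<Longrightarrow> f \<in> schwartz_orthant"
  using G_step_space_schwartz by blast

lemma linear_map_on_lag_coeff_G: "linear_map_on (G_union \<alpha>) (lag_coeff :: (real ^ 'd::finite \<Rightarrow> complex) \<Rightarrow> _)"
  using linear_map_on_lag_coeff[where 'd = 'd] G_union_schwartz[of _ \<alpha>] unfolding linear_map_on_def by blast

lemma lag_coeff_step:
  assumes \<alpha>: "1 \<le> \<alpha>" and A: "0 < A"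
  obtains a C where "1 < a" "0 \<le> C"
    "\<And>f :: real ^ 'd::finite \<Rightarrow> complex. f \<in> G_step_space \<alpha> A \<Longrightarrow> lag_coeff f \<in> s_carrier \<alpha> a"
    "\<And>f :: real ^ 'd \<Rightarrow> complex. f \<in> G_step_space \<alpha> A \<Longrightarrow> s_norm \<alpha> a (lag_coeff f) \<le> C * G_seminorm \<alpha> A 0 f"
proof -
  obtain a C where a: "1 < a" "0 \<le> C" and le: "\<And>(f :: real ^ 'd \<Rightarrow> complex) n. f \<in> G_step_space \<alpha> A \<Longrightarrow>
      cmod (lag_coeff f n) * s_weight \<alpha> a n \<le> C * (SUP (p, k). G_quotient \<alpha> A f p k)"
    by (rule lag_coeff_bound[OF \<alpha> A]) blast
  have le': "cmod (lag_coeff f n) * s_weight \<alpha> a n \<le> C * G_seminorm \<alpha> A 0 f"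
    if f: "f \<in> G_step_space \<alpha> A" for f :: "real ^ 'd \<Rightarrow> complex" and n
    by (rule order_trans[OF le[OF f] mult_left_mono[OF G_SUP_le_seminorm[OF A f] a(2)]])
  show thesis
    by (rule that[OF a s_carrierI[OF le'] s_norm_least[OF le']])
qed

lemma lag_coeff_in_s_union: "1 \<le> \<alpha> \<Longrightarrow> f \<in> G_union \<alpha> \<Longrightarrow> lag_coeff f \<in> s_union \<alpha>"
  for f :: "real ^ 'd::finite \<Rightarrow> complex"
  using lag_coeff_step[of \<alpha>, where 'd = 'd] by (metis UN_iff greaterThan_iff)

lemma lag_synthesis_in_G_union: "1 \<le> \<alpha> \<Longrightarrow> u \<in> s_union \<alpha> \<Longrightarrow> lag_synthesis u \<in> G_union \<alpha>"
  for u :: "nat ^ 'd::finite \<Rightarrow> complex"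
  using lag_synthesis_G_step[of \<alpha>, where 'd = 'd] by (metis UN_iff greaterThan_iff)

lemma seminorm_lag_coeff:
  fixes q :: "(nat ^ 'd::finite \<Rightarrow> complex) \<Rightarrow> real"
  assumes \<alpha>: "1 \<le> \<alpha>" and q: "q \<in> s_seminorms \<alpha>"
  shows "(\<lambda>f. q (lag_coeff f)) \<in> G_seminorms \<alpha>"
  unfolding G_seminorms_def lc_seminorms_def
proof (intro CollectI conjI ballI)
  show "seminorm_on (G_union \<alpha>) (\<lambda>f. q (lag_coeff f))"
    by (rule seminorm_on_compose[OF linear_map_on_lag_coeff_G seminorm_familyD(2)[OF seminorm_family_s_space q]])
       (use lag_coeff_in_s_union[OF \<alpha>] in blast)
  fix A :: real assume "A \<in> {0<..}"
  then have A: "0 < A" by simp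
  obtain a C where a: "1 < a" "0 \<le> C"
    "\<And>f :: real ^ 'd \<Rightarrow> complex. f \<in> G_step_space \<alpha> A \<Longrightarrow> lag_coeff f \<in> s_carrier \<alpha> a"
    "\<And>f :: real ^ 'd \<Rightarrow> complex. f \<in> G_step_space \<alpha> A \<Longrightarrow> s_norm \<alpha> a (lag_coeff f) \<le> C * G_seminorm \<alpha> A 0 f"
    by (rule lag_coeff_step[OF \<alpha> A]) blast
  have "dominated_on (s_carrier \<alpha> a) {s_norm \<alpha> a} q"
    using q a(1) unfolding s_seminorms_def lc_seminorms_def by blast
  then obtain D where D: "0 \<le> D" "\<And>u. u \<in> s_carrier \<alpha> a \<Longrightarrow> q u \<le> D * s_norm \<alpha> a u"
    by (rule s_dominatedD[OF _ a(1)]) blast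
  show "dominated_on (G_step_space \<alpha> A) (range (G_seminorm \<alpha> A)) (\<lambda>f. q (lag_coeff f))"
  proof (rule dominated_onI)
    show "G_seminorm \<alpha> A 0 \<in> range (G_seminorm \<alpha> A)" by blast
    show "0 \<le> D * C" using D(1) a(2) by simp
    fix f :: "real ^ 'd \<Rightarrow> complex" assume f: "f \<in> G_step_space \<alpha> A"
    show "q (lag_coeff f) \<le> D * C * G_seminorm \<alpha> A 0 f"
      using order_trans[OF D(2)[OF a(3)[OF f]] mult_left_mono[OF a(4)[OF f] D(1)]] by (simp add: mult.assoc)
  qed
qed

lemma lag_synthesis_lag_coeff_G: "1 \<le> \<alpha> \<Longrightarrow> f \<in> G_union \<alpha> \<Longrightarrow> lag_synthesis (lag_coeff f) = f"
  for f :: "real ^ 'd::finite \<Rightarrow> complex"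
  using lag_coeff_in_s_union[of \<alpha> f] lag_synthesis_lag_coeff[of \<alpha> _ f] G_union_schwartz[of f \<alpha>] by auto

lemma lag_coeff_lag_synthesis_s: "1 \<le> \<alpha> \<Longrightarrow> u \<in> s_union \<alpha> \<Longrightarrow> lag_coeff (lag_synthesis u) = u"
  for u :: "nat ^ 'd::finite \<Rightarrow> complex"
  using lag_coeff_lag_synthesis[of \<alpha> _ u] by (auto simp: fun_eq_iff)

text \<open>Linearity of the summation is inherited from the coefficient map, whose inverse it
  is.\<close>

lemma linear_map_on_lag_synthesis:
  assumes \<alpha>: "1 \<le> \<alpha>"
  shows "linear_map_on (s_union \<alpha>) (lag_synthesis :: (nat ^ 'd::finite \<Rightarrow> complex) \<Rightarrow> _)"
  by (rule linear_map_on_inverse[OF function_subspace_G_union linear_map_on_lag_coeff_G])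
     (use lag_coeff_in_s_union[OF \<alpha>] lag_synthesis_in_G_union[OF \<alpha>] lag_synthesis_lag_coeff_G[OF \<alpha>]
       lag_coeff_lag_synthesis_s[OF \<alpha>] in blast)+

lemma seminorm_lag_synthesis:
  fixes p :: "(real ^ 'd::finite \<Rightarrow> complex) \<Rightarrow> real"
  assumes \<alpha>: "1 \<le> \<alpha>" and p: "p \<in> G_seminorms \<alpha>"
  shows "(\<lambda>u. p (lag_synthesis u)) \<in> s_seminorms \<alpha>"
  unfolding s_seminorms_def lc_seminorms_def
proof (intro CollectI conjI ballI)
  show "seminorm_on (s_union \<alpha>) (\<lambda>u. p (lag_synthesis u))"
    by (rule seminorm_on_compose[OF linear_map_on_lag_synthesis[OF \<alpha>] seminorm_familyD(2)[OF seminorm_family_G_space p]])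
       (use lag_synthesis_in_G_union[OF \<alpha>] in blast)
  fix a :: real assume "a \<in> {1<..}"
  then have a: "1 < a" by simp
  obtain A C where A: "0 < A" "\<And>j. 0 \<le> C j"
    "\<And>u :: nat ^ 'd \<Rightarrow> complex. u \<in> s_carrier \<alpha> a \<Longrightarrow> lag_synthesis u \<in> G_step_space \<alpha> A"
    "\<And>(u :: nat ^ 'd \<Rightarrow> complex) j. u \<in> s_carrier \<alpha> a \<Longrightarrow> G_seminorm \<alpha> A j (lag_synthesis u) \<le> C j * s_norm \<alpha> a u"
    by (rule lag_synthesis_G_step[OF \<alpha> a, where 'd = 'd]) blast
  have "dominated_on (G_step_space \<alpha> A) (range (G_seminorm \<alpha> A)) p"
    using p A(1) unfolding G_seminorms_def lc_seminorms_def by blast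
  then obtain F D where F: "finite F" "F \<subseteq> range (G_seminorm \<alpha> A)" "0 \<le> D"
      "\<And>f. f \<in> G_step_space \<alpha> A \<Longrightarrow> p f \<le> D * (\<Sum>q\<in>F. q f)"
    unfolding dominated_on_def by blast
  have "\<forall>q\<in>F. \<exists>j. q = G_seminorm \<alpha> A j" using F(2) by blast
  then obtain c where c: "\<forall>q\<in>F. q = G_seminorm \<alpha> A (c q)" by (rule bchoice[THEN exE])
  show "dominated_on (s_carrier \<alpha> a) {s_norm \<alpha> a} (\<lambda>u. p (lag_synthesis u))"
  proof (rule s_dominatedI)
    show "0 \<le> D * (\<Sum>q\<in>F. C (c q))" by (intro mult_nonneg_nonneg F(3) sum_nonneg A(2))
    fix u :: "nat ^ 'd \<Rightarrow> complex" assume u: "u \<in> s_carrier \<alpha> a"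
    have "q (lag_synthesis u) \<le> C (c q) * s_norm \<alpha> a u" if "q \<in> F" for q
      using A(4)[OF u, of "c q"] bspec[OF c that, symmetric] by simp
    then have "(\<Sum>q\<in>F. q (lag_synthesis u)) \<le> (\<Sum>q\<in>F. C (c q)) * s_norm \<alpha> a u"
      unfolding sum_distrib_right by (intro sum_mono) auto
    from order_trans[OF F(4)[OF A(3)[OF u]] mult_left_mono[OF this F(3)]]
    show "p (lag_synthesis u) \<le> D * (\<Sum>q\<in>F. C (c q)) * s_norm \<alpha> a u" by (simp add: mult.assoc)
  qed
qed

lemma homeomorphic_maps_lag_coeff:
  assumes \<alpha>: "1 \<le> \<alpha>"
  shows "homeomorphic_maps (G_space \<alpha> :: (real ^ 'd::finite \<Rightarrow> complex) topology) (s_space \<alpha>) lag_coeff lag_synthesis"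
  unfolding homeomorphic_maps_def topspace_G_space topspace_s_space
proof (intro conjI ballI)
  show "continuous_map (G_space \<alpha> :: (real ^ 'd \<Rightarrow> complex) topology) (s_space \<alpha>) lag_coeff"
    unfolding G_space_eq s_space_eq
  proof (rule continuous_map_linear[OF seminorm_family_G_space seminorm_family_s_space linear_map_on_lag_coeff_G])
    show "dominated_on (G_union \<alpha>) (G_seminorms \<alpha>) (\<lambda>f. q (lag_coeff f))"
      if "q \<in> s_seminorms \<alpha>" for q :: "(nat ^ 'd \<Rightarrow> complex) \<Rightarrow> real"
      by (rule dominated_onI[OF seminorm_lag_coeff[OF \<alpha> that], of 1]) auto
  qed (use lag_coeff_in_s_union[OF \<alpha>] in blast)
  show "continuous_map (s_space \<alpha>) (G_space \<alpha> :: (real ^ 'd \<Rightarrow> complex) topology) lag_synthesis"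
    unfolding G_space_eq s_space_eq
  proof (rule continuous_map_linear[OF seminorm_family_s_space seminorm_family_G_space linear_map_on_lag_synthesis[OF \<alpha>]])
    show "dominated_on (s_union \<alpha>) (s_seminorms \<alpha>) (\<lambda>u. p (lag_synthesis u))"
      if "p \<in> G_seminorms \<alpha>" for p :: "(real ^ 'd \<Rightarrow> complex) \<Rightarrow> real"
      by (rule dominated_onI[OF seminorm_lag_synthesis[OF \<alpha> that], of 1]) auto
  qed (use lag_synthesis_in_G_union[OF \<alpha>] in blast)
qed (use lag_synthesis_lag_coeff_G[OF \<alpha>] lag_coeff_lag_synthesis_s[OF \<alpha>] in blast)+

section \<open>The isomorphism of the duals\<close>

lemma transpose_lag_synthesis:
  fixes T :: "(real ^ 'd::finite \<Rightarrow> complex) \<Rightarrow> complex"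
  assumes \<alpha>: "1 \<le> \<alpha>" and T: "T \<in> dual_space (G_space \<alpha>)"
  shows "laguerre_coeffs T \<in> s_dual_carrier \<alpha>"
    "transpose_map (s_space \<alpha>) lag_synthesis T = s_pairing \<alpha> (laguerre_coeffs T)"
proof -
  have "continuous_map (s_space \<alpha>) (G_space \<alpha> :: (real ^ 'd \<Rightarrow> complex) topology) lag_synthesis"
    using homeomorphic_maps_lag_coeff[OF \<alpha>, where 'd = 'd] unfolding homeomorphic_maps_def by blast
  then have S: "transpose_map (s_space \<alpha>) lag_synthesis T \<in> dual_space (s_space \<alpha>)"
    by (rule transpose_map_in_dual_space[OF T])
       (simp_all only: topspace_s_space function_subspace_s_union linear_map_on_lag_synthesis[OF \<alpha>])
  have "unit_seq n \<in> s_union \<alpha>" for n :: "nat ^ 'd"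
    using unit_seq_in_s_carrier[of n \<alpha> 2] by (auto intro!: bexI[of _ 2])
  \<comment> \<open>The transposed functional takes on \<open>unit_seq n\<close> the value of
    \<open>T\<close> at the Laguerre function, so the sequence that represents it is that of the
    Laguerre coefficients.\<close>
  then have eq: "(\<lambda>n. transpose_map (s_space \<alpha>) lag_synthesis T (unit_seq n)) = laguerre_coeffs T"
    unfolding transpose_map_def topspace_s_space laguerre_coeffs_def lag_synthesis_unit_seq by simp
  show "laguerre_coeffs T \<in> s_dual_carrier \<alpha>" using dual_s_space_coeffs[OF S] unfolding eq .
  show "transpose_map (s_space \<alpha>) lag_synthesis T = s_pairing \<alpha> (laguerre_coeffs T)"
    using dual_s_space_eq_s_pairing[OF _ S] \<alpha> unfolding eq by simp
qed

lemma topspace_strong_dual: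
  assumes "function_subspace (topspace X)"
  shows "topspace (strong_dual X) = dual_space X"
  unfolding strong_dual_eq by (rule seminorm_familyD(4)[OF seminorm_family_strong_dual[OF assms]])

lemma topspace_strong_dual_G: "topspace (strong_dual (G_space \<alpha>)) = dual_space (G_space \<alpha>)"
  by (rule topspace_strong_dual) (simp only: topspace_G_space function_subspace_G_union)

lemma topological_isomorphism_laguerre_pairing:
  assumes \<alpha>: "1 \<le> \<alpha>"
  shows "topological_isomorphism (strong_dual (G_space \<alpha> :: (real ^ 'd::finite \<Rightarrow> complex) topology))
    (strong_dual (s_space \<alpha>)) (\<lambda>T. s_pairing \<alpha> (laguerre_coeffs T))"
proof -
  let ?X = "strong_dual (G_space \<alpha> :: (real ^ 'd \<Rightarrow> complex) topology)"
  let ?t = "transpose_map (s_space \<alpha>) (lag_synthesis :: _ \<Rightarrow> real ^ 'd \<Rightarrow> complex)"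
  have iso: "topological_isomorphism ?X (strong_dual (s_space \<alpha>)) ?t"
    by (rule topological_isomorphism_transpose[OF _ _ homeomorphic_maps_lag_coeff[OF \<alpha>]])
       (simp_all only: topspace_s_space topspace_G_space function_subspace_s_union function_subspace_G_union
         linear_map_on_lag_synthesis[OF \<alpha>] linear_map_on_lag_coeff_G)
  have t: "?t T = s_pairing \<alpha> (laguerre_coeffs T)" if "T \<in> topspace ?X" for T
    using transpose_lag_synthesis(2)[OF \<alpha>] that unfolding topspace_strong_dual_G by blast
  have sub: "function_subspace (topspace ?X)"
    unfolding topspace_strong_dual_G by (rule function_subspace_dual_space)
  show ?thesis
    unfolding topological_isomorphism_def
  proof (intro conjI ballI allI)
    have "homeomorphic_map ?X (strong_dual (s_space \<alpha>)) ?t"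
      using iso unfolding topological_isomorphism_def by blast
    then show "homeomorphic_map ?X (strong_dual (s_space \<alpha>)) (\<lambda>T. s_pairing \<alpha> (laguerre_coeffs T))"
      by (rule homeomorphic_map_eq) (rule t)
    fix S T assume S: "S \<in> topspace ?X" and T: "T \<in> topspace ?X"
    then have "?t (\<lambda>f. S f + T f) = (\<lambda>u. ?t S u + ?t T u)"
      using iso unfolding topological_isomorphism_def by blast
    then show "s_pairing \<alpha> (laguerre_coeffs (\<lambda>f. S f + T f)) =
        (\<lambda>u. s_pairing \<alpha> (laguerre_coeffs S) u + s_pairing \<alpha> (laguerre_coeffs T) u)"
      unfolding t[OF S] t[OF T] t[OF function_subspaceD(2)[OF sub S T]] .
  next
    fix c T assume T: "T \<in> topspace ?X"
    then have "?t (\<lambda>f. c * T f) = (\<lambda>u. c * ?t T u)"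
      using iso unfolding topological_isomorphism_def by blast
    then show "s_pairing \<alpha> (laguerre_coeffs (\<lambda>f. c * T f)) = (\<lambda>u. c * s_pairing \<alpha> (laguerre_coeffs T) u)"
      unfolding t[OF T] t[OF function_subspaceD(3)[OF sub T]] .
  qed
qed

text \<open>It yields the homeomorphism onto the sequence space \<open>s_dual\<close> from the one
  onto the strong dual of \<open>s_space\<close>, by cancelling the pairing.\<close>

lemma homeomorphic_map_cancel_left:
  assumes P: "homeomorphic_map Y Z P" and PL: "homeomorphic_map X Z (\<lambda>x. P (L x))"
    and L: "L \<in> topspace X \<rightarrow> topspace Y"
  shows "homeomorphic_map X Y L"
proof -
  obtain Q where Q: "homeomorphic_maps Y Z P Q" using P unfolding homeomorphic_map_maps by blast
  then have "homeomorphic_map X Y (Q \<circ> (\<lambda>x. P (L x)))"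
    unfolding homeomorphic_maps_map by (intro homeomorphic_map_compose[OF PL]) blast
  moreover have "(Q \<circ> (\<lambda>x. P (L x))) x = L x" if "x \<in> topspace X" for x
    using Q L that unfolding homeomorphic_maps_def by auto
  ultimately show ?thesis by (rule homeomorphic_map_eq)
qed

lemma topological_isomorphism_laguerre_coeffs:
  assumes \<alpha>: "1 \<le> \<alpha>"
  shows "topological_isomorphism (strong_dual (G_space \<alpha> :: (real ^ 'd::finite \<Rightarrow> complex) topology))
    (s_dual \<alpha>) laguerre_coeffs"
proof -
  let ?X = "strong_dual (G_space \<alpha> :: (real ^ 'd \<Rightarrow> complex) topology)"
  have "homeomorphic_map ?X (s_dual \<alpha>) laguerre_coeffs"
  proof (rule homeomorphic_map_cancel_left)
    show "homeomorphic_map (s_dual \<alpha>) (strong_dual (s_space \<alpha>)) (s_pairing \<alpha> :: _ \<Rightarrow> (nat ^ 'd \<Rightarrow> complex) \<Rightarrow> complex)"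
      using topological_isomorphism_s_pairing[of \<alpha>, where 'd = 'd] \<alpha> unfolding topological_isomorphism_def by simp
    show "homeomorphic_map ?X (strong_dual (s_space \<alpha>)) (\<lambda>T. s_pairing \<alpha> (laguerre_coeffs T))"
      using topological_isomorphism_laguerre_pairing[OF \<alpha>, where 'd = 'd] unfolding topological_isomorphism_def by blast
    show "laguerre_coeffs \<in> topspace ?X \<rightarrow> topspace (s_dual \<alpha>)"
      unfolding topspace_strong_dual_G s_dual_eq seminorm_familyD(4)[OF seminorm_family_s_dual]
      using transpose_lag_synthesis(1)[OF \<alpha>] by blast
  qed
  then show ?thesis
    unfolding topological_isomorphism_def laguerre_coeffs_def[abs_def] by simp
qed

section \<open>Convergence of the Laguerre series of a functional\<close>

lemma s_dual_truncation_limit: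
  fixes b :: "nat ^ 'd::finite \<Rightarrow> complex"
  assumes b: "b \<in> s_dual_carrier \<alpha>"
  shows "limitin (s_dual \<alpha>) (\<lambda>F n. if n \<in> F then b n else 0) b (finite_subsets_at_top UNIV)"
    "(\<lambda>n. if n \<in> F then b n else 0) \<in> s_dual_carrier \<alpha>"
proof -
  show tr: "(\<lambda>n. if n \<in> F then b n else 0) \<in> s_dual_carrier \<alpha>" for F
    unfolding s_dual_carrier_def
  proof (intro CollectI allI impI)
    fix a :: real assume a: "1 < a"
    show "(\<lambda>n. cmod (if n \<in> F then b n else 0) / s_weight \<alpha> a n) summable_on UNIV"
      by (rule summable_on_comparison_test[OF s_dual_summable[OF b a]]) (auto simp: s_weight_nonneg)
  qed
  show "limitin (s_dual \<alpha>) (\<lambda>F n. if n \<in> F then b n else 0) b (finite_subsets_at_top UNIV)"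
    unfolding s_dual_eq
  proof (rule limitin_seminorm_topology[OF seminorm_family_s_dual b])
    show "\<forall>\<^sub>F F in finite_subsets_at_top UNIV. (\<lambda>n. if n \<in> F then b n else 0) \<in> s_dual_carrier \<alpha>"
      using tr by simp
    fix p :: "(nat ^ 'd \<Rightarrow> complex) \<Rightarrow> real" assume "p \<in> s_dual_seminorms \<alpha>"
    then obtain a where a: "1 < a" and p: "p = s_dual_norm \<alpha> a" unfolding s_dual_seminorms_def by blast
    define c where "c n = cmod (b n) / s_weight \<alpha> a n" for n
    have c: "c summable_on UNIV" unfolding c_def by (rule s_dual_summable[OF b a])
    have "p (\<lambda>n. (if n \<in> F then b n else 0) - b n) = infsum c UNIV - sum c F" if F: "finite F" for F
    proof -
      have "p (\<lambda>n. (if n \<in> F then b n else 0) - b n) = infsum c (UNIV - F)"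
        unfolding p s_dual_norm_def by (rule infsum_cong_neutral) (auto simp: c_def)
      also have "\<dots> = infsum c UNIV - infsum c F"
        by (rule infsum_Diff[OF c]) (use F in auto)
      finally show ?thesis using F by simp
    qed
    then have ev: "\<forall>\<^sub>F F in finite_subsets_at_top UNIV.
        infsum c UNIV - sum c F = p (\<lambda>n. (if n \<in> F then b n else 0) - b n)"
      by (intro eventually_finite_subsets_at_top_weakI) simp
    have "((\<lambda>F. infsum c UNIV - sum c F) \<longlongrightarrow> infsum c UNIV - infsum c UNIV) (finite_subsets_at_top UNIV)"
      by (intro tendsto_diff tendsto_const infsum_tendsto c)
    then show "((\<lambda>F. p (\<lambda>n. (if n \<in> F then b n else 0) - b n)) \<longlongrightarrow> 0) (finite_subsets_at_top UNIV)"
      using Lim_transform_eventually[OF _ ev] by simp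
  qed
qed

text \<open>The partial sum is the transpose, along the coefficient map, of the pairing with the
  truncated sequence. Its continuity follows from this, and its coefficients are read off since the
  coefficient map sends Laguerre functions to unit sequences.\<close>

lemma laguerre_partial_sum:
  fixes b :: "nat ^ 'd::finite \<Rightarrow> complex" and F
  assumes \<alpha>: "1 \<le> \<alpha>" and F: "finite F" and b: "b \<in> s_dual_carrier \<alpha>"
  defines "S \<equiv> \<lambda>f. \<Sum>n\<in>F. b n * laguerre_functional \<alpha> n f"
  shows "S \<in> dual_space (G_space \<alpha>)" "laguerre_coeffs S = (\<lambda>n. if n \<in> F then b n else 0)"
proof -
  let ?b = "\<lambda>n. if n \<in> F then b n else 0"
  have S: "S = transpose_map (G_space \<alpha>) lag_coeff (s_pairing \<alpha> ?b)"
  proof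
    fix f :: "real ^ 'd \<Rightarrow> complex"
    show "S f = transpose_map (G_space \<alpha>) lag_coeff (s_pairing \<alpha> ?b) f"
    proof (cases "f \<in> G_union \<alpha>")
      case True
      have "(\<Sum>\<^sub>\<infinity>n. lag_coeff f n * ?b n) = (\<Sum>\<^sub>\<infinity>n\<in>F. lag_coeff f n * b n)"
        by (rule infsum_cong_neutral) auto
      then show ?thesis
        unfolding S_def transpose_map_def s_pairing_eq laguerre_functional_def topspace_G_space lag_coeff_def[symmetric]
        using True lag_coeff_in_s_union[OF \<alpha> True] F by (simp add: mult.commute)
    next
      case False
      then show ?thesis unfolding S_def transpose_map_def laguerre_functional_def topspace_G_space by simp
    qed
  qed
  have "continuous_map (G_space \<alpha> :: (real ^ 'd \<Rightarrow> complex) topology) (s_space \<alpha>) lag_coeff"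
    using homeomorphic_maps_lag_coeff[OF \<alpha>, where 'd = 'd] unfolding homeomorphic_maps_def by blast
  then show "S \<in> dual_space (G_space \<alpha>)"
    unfolding S
    by (rule transpose_map_in_dual_space[OF s_pairing_in_dual_space[OF s_dual_truncation_limit(2)[OF b]]])
       (simp_all only: topspace_G_space function_subspace_G_union linear_map_on_lag_coeff_G)
  show "laguerre_coeffs S = ?b"
  proof
    fix n :: "nat ^ 'd"
    have u: "unit_seq n \<in> s_union \<alpha>"
      using unit_seq_in_s_carrier[of n \<alpha> 2] by (auto intro!: bexI[of _ 2])
    have "laguerre_fun n \<in> G_union \<alpha>" "lag_coeff (laguerre_fun n) = unit_seq n"
      using lag_synthesis_in_G_union[OF \<alpha> u] lag_coeff_lag_synthesis_s[OF \<alpha> u] unfolding lag_synthesis_unit_seq by auto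
    then show "laguerre_coeffs S n = ?b n"
      unfolding S laguerre_coeffs_def transpose_map_def topspace_G_space by (simp add: s_pairing_unit_seq)
  qed
qed

theorem theorem6p2:
  fixes \<alpha> :: real
  assumes "1 \<le> \<alpha>"
  shows "topological_isomorphism
           (strong_dual (G_space \<alpha> :: (real ^ 'd::finite \<Rightarrow> complex) topology))
           (s_dual \<alpha>) laguerre_coeffs
       \<and> topological_isomorphism
           (strong_dual (G_space \<alpha> :: (real ^ 'd \<Rightarrow> complex) topology))
           (strong_dual (s_space \<alpha>)) (\<lambda>T. s_pairing \<alpha> (laguerre_coeffs T))
       \<and> (\<forall>T \<in> topspace (strong_dual (G_space \<alpha> :: (real ^ 'd \<Rightarrow> complex) topology)).
           limitin (strong_dual (G_space \<alpha>))
             (\<lambda>F f. \<Sum>n\<in>F. laguerre_coeffs T n * laguerre_functional \<alpha> n f) T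
             (finite_subsets_at_top UNIV))"
proof (intro conjI ballI)
  let ?X = "strong_dual (G_space \<alpha> :: (real ^ 'd \<Rightarrow> complex) topology)"
  show iso: "topological_isomorphism ?X (s_dual \<alpha>) laguerre_coeffs"
    by (rule topological_isomorphism_laguerre_coeffs[OF assms])
  show "topological_isomorphism ?X (strong_dual (s_space \<alpha>)) (\<lambda>T. s_pairing \<alpha> (laguerre_coeffs T))"
    by (rule topological_isomorphism_laguerre_pairing[OF assms])
  fix T assume T: "T \<in> topspace ?X"
  let ?b = "laguerre_coeffs T"
  let ?S = "\<lambda>F f. \<Sum>n\<in>F. ?b n * laguerre_functional \<alpha> n f"
  have b: "?b \<in> s_dual_carrier \<alpha>"
    using transpose_lag_synthesis(1)[OF assms] T unfolding topspace_strong_dual_G by blast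
  obtain Q where Q: "homeomorphic_maps ?X (s_dual \<alpha>) laguerre_coeffs Q"
    using iso unfolding topological_isomorphism_def homeomorphic_map_maps by blast
  then have QL: "Q (laguerre_coeffs R) = R" if "R \<in> topspace ?X" for R
    using that unfolding homeomorphic_maps_def by blast
  have "Q (\<lambda>n. if n \<in> F then ?b n else 0) = ?S F" if F: "finite F" for F
    using QL[of "?S F"] laguerre_partial_sum[OF assms F b] unfolding topspace_strong_dual_G by simp
  \<comment> \<open>For infinite \<open>F\<close> the sum is 0 by convention and the equation may
    fail; the filter sees finite sets only.\<close>
  then have ev: "\<forall>\<^sub>F F in finite_subsets_at_top UNIV. (Q \<circ> (\<lambda>F n. if n \<in> F then ?b n else 0)) F = ?S F"
    by (intro eventually_finite_subsets_at_top_weakI) simp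
  have "continuous_map (s_dual \<alpha>) ?X Q" using Q unfolding homeomorphic_maps_def by blast
  from continuous_map_limit[OF this s_dual_truncation_limit(1)[OF b]]
  show "limitin ?X ?S T (finite_subsets_at_top UNIV)"
    unfolding QL[OF T] by (rule limitin_transform_eventually[OF ev])
qed

end
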